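(* Let $\kappa$ be an infinite regular cardinal, $\mathcal{L}$ a $\kappa$-small 2-category, and $\mathscr{C}\in\mathcal{P}s_{\mathrm{colax}}(\mathcal{L},\mathcal{L}\mathit{ex}_\kappa)$, with co-dextrification $\widehat{\mathscr{C}}\in\mathcal{P}s^{\mathrm{adj}}(\mathcal{L}^{\mathsf{coop}},\mathcal{L}\mathit{ex}_\kappa)$ and canonical map $\mathsf{L}:U\widehat{\mathscr{C}}\to\mathscr{C}$. Then for any $\mathscr{D}\in\mathcal{P}s^{\mathrm{adj}}(\mathcal{L}^{\mathsf{coop}},\mathcal{L}\mathit{ex}_\kappa)$, the functor $$\mathcal{P}s^{\mathrm{adj}}(\mathcal{L}^{\mathsf{coop}},\mathcal{L}\mathit{ex}_\kappa)(\mathscr{D},\widehat{\mathscr{C}})\xrightarrow{\ \mathsf{L}\circ U(-)\ }\mathcal{P}s_{\mathrm{colax}}(\mathcal{L},\mathcal{L}\mathit{ex}_\kappa)(U\mathscr{D},\mathscr{C})$$ is an equivalence of categories. Thus $\mathscr{C}\mapsto\widehat{\mathscr{C}}$ is bicategorically right adjoint to the forgetful 2-functor $U:\mathcal{P}s^{\mathrm{adj}}(\mathcal{L}^{\mathsf{coop}},\mathcal{L}\mathit{ex}_\kappa)\to\mathcal{P}s_{\mathrm{colax}}(\mathcal{L},\mathcal{L}\mathit{ex}_\kappa)$.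
   Context: **2-categories.** $\mathcal{L}\mathit{ex}_\kappa$ is the 2-category of categories with $\kappa$-small limits, functors preserving them, and natural transformations. $\mathcal{P}s_{\mathrm{colax}}(\mathcal{L},\mathcal{L}\mathit{ex}_\kappa)$ is the 2-category of pseudofunctors $\mathcal{L}\to\mathcal{L}\mathit{ex}_\kappa$, colax natural transformations, and modifications; a colax transformation $F:\mathscr{C}\to\mathscr{D}$ has components $F_p:\mathscr{C}_p\to\mathscr{D}_p$ in $\mathcal{L}\mathit{ex}_\kappa$ and 2-cells $F_\mu:F_q\circ\mathscr{C}_\mu\Rightarrow\mathscr{D}_\mu\circ F_p$ for $\mu:p\to q$, satisfying functoriality and naturality. $(-)^{\mathsf{coop}}$ reverses 1-cells and 2-cells. $\mathcal{P}s^{\mathrm{adj}}(\mathcal{L}^{\mathsf{coop}},\mathcal{L}\mathit{ex}_\kappa)$ is the 2-category of pseudofunctors $\mathscr{D}:\mathcal{L}^{\mathsf{coop}}\to\mathcal{L}\mathit{ex}_\kappa$ (actions written $\mathscr{D}^\mu:\mathscr{D}_q\to\mathscr{D}_p$ for $\mu:p\to q$, and $\mathscr{D}^\alpha$) such that each $\mathscr{D}^\mu$ has a right adjoint $\mathscr{D}_\mu$ in $\mathcal{L}\mathit{ex}_\kappa$, pseudonatural transformations between pseudofunctors $\mathcal{L}^{\mathsf{coop}}\to\mathcal{L}\mathit{ex}_\kappa$, and modifications. The 2-functor $U$ sends $\mathscr{D}$ to the pseudofunctor $\mathcal{L}\to\mathcal{L}\mathit{ex}_\kappa$ given by the right adjoints,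 $\mu\mapsto\mathscr{D}_\mu$, and sends a pseudonatural $F$ to the colax transformation with the same components whose 2-cells $F_q\circ\mathscr{C}_\mu\Rightarrow\mathscr{D}_\mu\circ F_p$ are the mates of the isomorphisms $\mathscr{D}^\mu\circ F_q\cong F_p\circ\mathscr{C}^\mu$. **Co-dextrification.** In a 2-category $\circ$ denotes composition of morphisms and vertical composition of 2-cells; $\mu\triangleleft\beta:\mu\circ\nu\Rightarrow\mu\circ\nu'$ (for $\beta:\nu\Rightarrow\nu'$) and $\alpha\triangleright\nu:\mu\circ\nu\Rightarrow\mu'\circ\nu$ (for $\alpha:\mu\Rightarrow\mu'$) denote whiskering; coherence isomorphisms are suppressed. For $r\in\mathcal{L}$, an object $\Gamma$ of $\widehat{\mathscr{C}}_r$ consists of an object $\Gamma^\mu\in\mathscr{C}_p$ for each $\mu:p\to r$, and for each $\varrho:p\to q$, $\nu:q\to r$ and $\alpha:\mu\Rightarrow\nu\circ\varrho$ a morphism $\Gamma^\alpha:\Gamma^\nu\to\mathscr{C}_\varrho(\Gamma^\mu)$ in $\mathscr{C}_q$ (depending also on the decomposition $\nu\circ\varrho$), such that: $\Gamma^{1_\mu}=1$ for $1_\mu:\mu\Rightarrow\mu\circ1_p$; for $\alpha:\mu\Rightarrow\nu\circ\varrho$ and $\beta:\nu\Rightarrow\varpi\circ\sigma$, $\mathscr{C}_\sigma(\Gamma^\alpha)\circ\Gamma^\beta=\Gamma^{(\beta\triangleright\varrho)\circ\alpha}$; for $\alpha:\mu\Rightarrow\nu\circ\varrho$ and $\beta:\varrho\Rightarrow\sigma$,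 $\mathscr{C}_\beta(\Gamma^\mu)\circ\Gamma^\alpha=\Gamma^{(\nu\triangleleft\beta)\circ\alpha}$. A morphism $\theta:\Gamma\to\Delta$ consists of $\theta^\mu:\Gamma^\mu\to\Delta^\mu$ for each $\mu:p\to r$ with $\mathscr{C}_\varrho(\theta^\mu)\circ\Gamma^\alpha=\Delta^\alpha\circ\theta^\nu$ for each $\alpha:\mu\Rightarrow\nu\circ\varrho$. For $\mu:p\to q$, $\widehat{\mathscr{C}}^\mu:\widehat{\mathscr{C}}_q\to\widehat{\mathscr{C}}_p$ is $(\widehat{\mathscr{C}}^\mu\Gamma)^\nu=\Gamma^{\mu\circ\nu}$, and for $\beta:\mu\Rightarrow\mu'$, $\widehat{\mathscr{C}}^\beta:\widehat{\mathscr{C}}^{\mu'}\to\widehat{\mathscr{C}}^{\mu}$ has components $(\widehat{\mathscr{C}}^\beta\Gamma)^\varrho=\Gamma^{\beta\triangleright\varrho}$. Each $\widehat{\mathscr{C}}^\mu$ preserves $\kappa$-small limits and has a right adjoint $\widehat{\mathscr{C}}_\mu$. The map $\mathsf{L}:U\widehat{\mathscr{C}}\to\mathscr{C}$ has components $\mathsf{L}^p:\widehat{\mathscr{C}}_p\to\mathscr{C}_p$, $\Gamma\mapsto\Gamma^{1_p}$, and is in fact pseudonatural, with isomorphisms $(\widehat{\mathscr{C}}_\mu\Gamma)^{1_q}\cong\mathscr{C}_\mu(\Gamma^{1_p})$. *)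

theory Defs
  imports Main "HOL-Library.FuncSet"
begin

unbundle cardinal_syntax

section \<open>Categories, functors, natural transformations\<close>

record ('o, 'm) cat =
  Ob :: "'o set"
  Ar :: "'m set"
  Src :: "'m \<Rightarrow> 'o"
  Tgt :: "'m \<Rightarrow> 'o"
  Idn :: "'o \<Rightarrow> 'm"
  Cmp :: "'m \<Rightarrow> 'm \<Rightarrow> 'm"  (infixr "\<cdot>\<index>" 70)

definition hom :: "('o, 'm) cat \<Rightarrow> 'o \<Rightarrow> 'o \<Rightarrow> 'm set" where
  "hom C a b = {f \<in> Ar C. Src C f = a \<and> Tgt C f = b}"

definition category :: "('o, 'm) cat \<Rightarrow> bool" where
  "category C \<longleftrightarrow>
     (\<forall>f \<in> Ar C. Src C f \<in> Ob C \<and> Tgt C f \<in> Ob C) \<and>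
     (\<forall>a \<in> Ob C. Idn C a \<in> hom C a a) \<and>
     (\<forall>f \<in> Ar C. \<forall>g \<in> Ar C. Src C g = Tgt C f \<longrightarrow> g \<cdot>\<^bsub>C\<^esub> f \<in> hom C (Src C f) (Tgt C g)) \<and>
     (\<forall>f \<in> Ar C. f \<cdot>\<^bsub>C\<^esub> Idn C (Src C f) = f \<and> Idn C (Tgt C f) \<cdot>\<^bsub>C\<^esub> f = f) \<and>
     (\<forall>f \<in> Ar C. \<forall>g \<in> Ar C. \<forall>h \<in> Ar C. Src C g = Tgt C f \<longrightarrow> Src C h = Tgt C g \<longrightarrow>
        (h \<cdot>\<^bsub>C\<^esub> g) \<cdot>\<^bsub>C\<^esub> f = h \<cdot>\<^bsub>C\<^esub> (g \<cdot>\<^bsub>C\<^esub> f))"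

text \<open>Functors and natural transformations carry their source and target, and their underlying
  functions are required to be extensional (undefined off the carrier), so that equality of
  HOL values is equality of functors and of natural transformations.\<close>

record ('o1, 'm1, 'o2, 'm2) ftr =
  FDom :: "('o1, 'm1) cat"
  FCod :: "('o2, 'm2) cat"
  FO :: "'o1 \<Rightarrow> 'o2"
  FA :: "'m1 \<Rightarrow> 'm2"

definition is_functor :: "('o1, 'm1, 'o2, 'm2) ftr \<Rightarrow> bool" where
  "is_functor F \<longleftrightarrow> (let C = FDom F; D = FCod F in
     category C \<and> category D \<and>
     FO F \<in> Ob C \<rightarrow>\<^sub>E Ob D \<and> FA F \<in> Ar C \<rightarrow>\<^sub>E Ar D \<and>
     (\<forall>f \<in> Ar C. Src D (FA F f) = FO F (Src C f) \<and> Tgt D (FA F f) = FO F (Tgt C f)) \<and>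
     (\<forall>a \<in> Ob C. FA F (Idn C a) = Idn D (FO F a)) \<and>
     (\<forall>f \<in> Ar C. \<forall>g \<in> Ar C. Src C g = Tgt C f \<longrightarrow>
        FA F (g \<cdot>\<^bsub>C\<^esub> f) = FA F g \<cdot>\<^bsub>D\<^esub> FA F f))"

definition id_ftr :: "('o, 'm) cat \<Rightarrow> ('o, 'm, 'o, 'm) ftr" where
  "id_ftr C = \<lparr>FDom = C, FCod = C, FO = (\<lambda>a \<in> Ob C. a), FA = (\<lambda>f \<in> Ar C. f)\<rparr>"

definition comp_ftr ::
  "('o2, 'm2, 'o3, 'm3) ftr \<Rightarrow> ('o1, 'm1, 'o2, 'm2) ftr \<Rightarrow> ('o1, 'm1, 'o3, 'm3) ftr"
  (infixr "\<odot>" 75) where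
  "G \<odot> F = \<lparr>FDom = FDom F, FCod = FCod G,
     FO = (\<lambda>a \<in> Ob (FDom F). FO G (FO F a)), FA = (\<lambda>f \<in> Ar (FDom F). FA G (FA F f))\<rparr>"

record ('o1, 'm1, 'o2, 'm2) ntr =
  NDom :: "('o1, 'm1, 'o2, 'm2) ftr"
  NCod :: "('o1, 'm1, 'o2, 'm2) ftr"
  NC :: "'o1 \<Rightarrow> 'm2"

definition nattrans :: "('o1, 'm1, 'o2, 'm2) ntr \<Rightarrow> bool" where
  "nattrans \<tau> \<longleftrightarrow> (let F = NDom \<tau>; G = NCod \<tau>; C = FDom F; D = FCod F in
     is_functor F \<and> is_functor G \<and> FDom G = C \<and> FCod G = D \<and>
     NC \<tau> \<in> extensional (Ob C) \<and>
     (\<forall>a \<in> Ob C. NC \<tau> a \<in> hom D (FO F a) (FO G a)) \<and>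
     (\<forall>f \<in> Ar C. FA G f \<cdot>\<^bsub>D\<^esub> NC \<tau> (Src C f) = NC \<tau> (Tgt C f) \<cdot>\<^bsub>D\<^esub> FA F f))"

definition nats ::
  "('o1, 'm1, 'o2, 'm2) ftr \<Rightarrow> ('o1, 'm1, 'o2, 'm2) ftr \<Rightarrow> ('o1, 'm1, 'o2, 'm2) ntr set" where
  "nats F G = {\<tau>. nattrans \<tau> \<and> NDom \<tau> = F \<and> NCod \<tau> = G}"

definition id_ntr :: "('o1, 'm1, 'o2, 'm2) ftr \<Rightarrow> ('o1, 'm1, 'o2, 'm2) ntr" where
  "id_ntr F = \<lparr>NDom = F, NCod = F, NC = (\<lambda>a \<in> Ob (FDom F). Idn (FCod F) (FO F a))\<rparr>"

definition vcomp_ntr ::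
  "('o1, 'm1, 'o2, 'm2) ntr \<Rightarrow> ('o1, 'm1, 'o2, 'm2) ntr \<Rightarrow> ('o1, 'm1, 'o2, 'm2) ntr"
  (infixr "\<bullet>\<^sub>N" 60) where
  "\<tau> \<bullet>\<^sub>N \<sigma> = \<lparr>NDom = NDom \<sigma>, NCod = NCod \<tau>,
     NC = (\<lambda>a \<in> Ob (FDom (NDom \<sigma>)). NC \<tau> a \<cdot>\<^bsub>FCod (NDom \<sigma>)\<^esub> NC \<sigma> a)\<rparr>"

definition lwh_ntr ::
  "('o2, 'm2, 'o3, 'm3) ftr \<Rightarrow> ('o1, 'm1, 'o2, 'm2) ntr \<Rightarrow> ('o1, 'm1, 'o3, 'm3) ntr"
  (infixr "\<triangleleft>\<^sub>N" 65) where
  "G \<triangleleft>\<^sub>N \<tau> = \<lparr>NDom = G \<odot> NDom \<tau>, NCod = G \<odot> NCod \<tau>,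
     NC = (\<lambda>a \<in> Ob (FDom (NDom \<tau>)). FA G (NC \<tau> a))\<rparr>"

definition rwh_ntr ::
  "('o2, 'm2, 'o3, 'm3) ntr \<Rightarrow> ('o1, 'm1, 'o2, 'm2) ftr \<Rightarrow> ('o1, 'm1, 'o3, 'm3) ntr"
  (infixl "\<triangleright>\<^sub>N" 66) where
  "\<tau> \<triangleright>\<^sub>N F = \<lparr>NDom = NDom \<tau> \<odot> F, NCod = NCod \<tau> \<odot> F,
     NC = (\<lambda>a \<in> Ob (FDom F). NC \<tau> (FO F a))\<rparr>"

definition inverse_ntr ::
  "('o1, 'm1, 'o2, 'm2) ntr \<Rightarrow> ('o1, 'm1, 'o2, 'm2) ntr \<Rightarrow> bool" where
  "inverse_ntr \<tau> \<sigma> \<longleftrightarrow> \<sigma> \<in> nats (NCod \<tau>) (NDom \<tau>) \<and>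
     \<sigma> \<bullet>\<^sub>N \<tau> = id_ntr (NDom \<tau>) \<and> \<tau> \<bullet>\<^sub>N \<sigma> = id_ntr (NCod \<tau>)"

definition iso_ntr :: "('o1, 'm1, 'o2, 'm2) ntr \<Rightarrow> bool" where
  "iso_ntr \<tau> \<longleftrightarrow> nattrans \<tau> \<and> (\<exists>\<sigma>. inverse_ntr \<tau> \<sigma>)"

definition inv_ntr :: "('o1, 'm1, 'o2, 'm2) ntr \<Rightarrow> ('o1, 'm1, 'o2, 'm2) ntr" where
  "inv_ntr \<tau> = (THE \<sigma>. inverse_ntr \<tau> \<sigma>)"

definition equivalence :: "('o1, 'm1, 'o2, 'm2) ftr \<Rightarrow> bool" where
  "equivalence F \<longleftrightarrow> is_functor F \<and>
     (\<exists>G \<eta> \<epsilon>. is_functor G \<and> FDom G = FCod F \<and> FCod G = FDom F \<and>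
        \<eta> \<in> nats (id_ftr (FDom F)) (G \<odot> F) \<and> iso_ntr \<eta> \<and>
        \<epsilon> \<in> nats (F \<odot> G) (id_ftr (FCod F)) \<and> iso_ntr \<epsilon>)"


section \<open>Limits\<close>

definition cone :: "('j, 'i, 'o, 'm) ftr \<Rightarrow> 'o \<Rightarrow> ('j \<Rightarrow> 'm) \<Rightarrow> bool" where
  "cone G c l \<longleftrightarrow> (let J = FDom G; C = FCod G in
     c \<in> Ob C \<and> (\<forall>j \<in> Ob J. l j \<in> hom C c (FO G j)) \<and>
     (\<forall>u \<in> Ar J. FA G u \<cdot>\<^bsub>C\<^esub> l (Src J u) = l (Tgt J u)))"

definition limit_cone :: "('j, 'i, 'o, 'm) ftr \<Rightarrow> 'o \<Rightarrow> ('j \<Rightarrow> 'm) \<Rightarrow> bool" where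
  "limit_cone G c l \<longleftrightarrow> cone G c l \<and>
     (\<forall>c' l'. cone G c' l' \<longrightarrow>
        (\<exists>!h. h \<in> hom (FCod G) c' c \<and> (\<forall>j \<in> Ob (FDom G). l j \<cdot>\<^bsub>FCod G\<^esub> h = l' j)))"

text \<open>A cardinal is a relation \<open>\<kappa> :: 'k rel\<close> with \<open>Card_order \<kappa>\<close>. Every category with fewer
  than \<open>\<kappa>\<close> objects and arrows is isomorphic to one whose objects and arrows are elements of
  \<^typ>\<open>'k\<close>, so it suffices to take the index categories of \<open>\<kappa>\<close>-small diagrams in that type.\<close>

definition small_diagram :: "'k rel \<Rightarrow> ('k, 'k, 'o, 'm) ftr \<Rightarrow> bool" where
  "small_diagram \<kappa> G \<longleftrightarrow> is_functor G \<and> |Ob (FDom G)| <o \<kappa> \<and> |Ar (FDom G)| <o \<kappa>"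

definition has_small_limits :: "'k rel \<Rightarrow> ('o, 'm) cat \<Rightarrow> bool" where
  "has_small_limits \<kappa> C \<longleftrightarrow> category C \<and>
     (\<forall>G :: ('k, 'k, 'o, 'm) ftr. small_diagram \<kappa> G \<longrightarrow> FCod G = C \<longrightarrow> (\<exists>c l. limit_cone G c l))"

definition preserves_small_limits :: "'k rel \<Rightarrow> ('o1, 'm1, 'o2, 'm2) ftr \<Rightarrow> bool" where
  "preserves_small_limits \<kappa> F \<longleftrightarrow>
     (\<forall>(G :: ('k, 'k, 'o1, 'm1) ftr) c l. small_diagram \<kappa> G \<longrightarrow> FCod G = FDom F \<longrightarrow>
        limit_cone G c l \<longrightarrow> limit_cone (F \<odot> G) (FO F c) (\<lambda>j. FA F (l j)))"

definition lex_ftr :: "'k rel \<Rightarrow> ('o1, 'm1, 'o2, 'm2) ftr \<Rightarrow> bool" where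
  "lex_ftr \<kappa> F \<longleftrightarrow> is_functor F \<and> has_small_limits \<kappa> (FDom F) \<and> has_small_limits \<kappa> (FCod F) \<and>
     preserves_small_limits \<kappa> F"


section \<open>2-categories and pseudofunctors\<close>

text \<open>2-categories are strict, presented by vertical composition \<open>\<bullet>\<close> of 2-cells and whiskering
  \<open>f \<triangleleft> \<alpha>\<close>, \<open>\<alpha> \<triangleright> f\<close>.\<close>

record ('p, 'f, 'a) twocat =
  Cell0 :: "'p set"
  Cell1 :: "'f set"
  Cell2 :: "'a set"
  src1 :: "'f \<Rightarrow> 'p"
  tgt1 :: "'f \<Rightarrow> 'p"
  id1 :: "'p \<Rightarrow> 'f"
  cmp1 :: "'f \<Rightarrow> 'f \<Rightarrow> 'f"  (infixr "\<star>\<index>" 75)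
  src2 :: "'a \<Rightarrow> 'f"
  tgt2 :: "'a \<Rightarrow> 'f"
  id2 :: "'f \<Rightarrow> 'a"
  vcmp :: "'a \<Rightarrow> 'a \<Rightarrow> 'a"  (infixr "\<bullet>\<index>" 60)
  lwh :: "'f \<Rightarrow> 'a \<Rightarrow> 'a"  (infixr "\<triangleleft>\<index>" 65)
  rwh :: "'a \<Rightarrow> 'f \<Rightarrow> 'a"  (infixl "\<triangleright>\<index>" 66)

definition hom2 :: "('p, 'f, 'a) twocat \<Rightarrow> 'f \<Rightarrow> 'f \<Rightarrow> 'a set" where
  "hom2 K f g = {\<alpha> \<in> Cell2 K. src2 K \<alpha> = f \<and> tgt2 K \<alpha> = g}"

definition two_category :: "('p, 'f, 'a) twocat \<Rightarrow> bool" where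
  "two_category K \<longleftrightarrow>
     category \<lparr>Ob = Cell0 K, Ar = Cell1 K, Src = src1 K, Tgt = tgt1 K, Idn = id1 K, Cmp = cmp1 K\<rparr> \<and>
     category \<lparr>Ob = Cell1 K, Ar = Cell2 K, Src = src2 K, Tgt = tgt2 K, Idn = id2 K, Cmp = vcmp K\<rparr> \<and>
     (\<forall>\<alpha> \<in> Cell2 K. src1 K (src2 K \<alpha>) = src1 K (tgt2 K \<alpha>) \<and>
        tgt1 K (src2 K \<alpha>) = tgt1 K (tgt2 K \<alpha>)) \<and>
     (\<forall>f \<in> Cell1 K. \<forall>\<alpha> \<in> Cell2 K. src1 K f = tgt1 K (src2 K \<alpha>) \<longrightarrow>
        f \<triangleleft>\<^bsub>K\<^esub> \<alpha> \<in> hom2 K (f \<star>\<^bsub>K\<^esub> src2 K \<alpha>) (f \<star>\<^bsub>K\<^esub> tgt2 K \<alpha>)) \<and>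
     (\<forall>f \<in> Cell1 K. \<forall>\<alpha> \<in> Cell2 K. tgt1 K f = src1 K (src2 K \<alpha>) \<longrightarrow>
        \<alpha> \<triangleright>\<^bsub>K\<^esub> f \<in> hom2 K (src2 K \<alpha> \<star>\<^bsub>K\<^esub> f) (tgt2 K \<alpha> \<star>\<^bsub>K\<^esub> f)) \<and>
     (\<forall>f \<in> Cell1 K. \<forall>g \<in> Cell1 K. src1 K g = tgt1 K f \<longrightarrow>
        g \<triangleleft>\<^bsub>K\<^esub> id2 K f = id2 K (g \<star>\<^bsub>K\<^esub> f) \<and> id2 K g \<triangleright>\<^bsub>K\<^esub> f = id2 K (g \<star>\<^bsub>K\<^esub> f)) \<and>
     (\<forall>\<alpha> \<in> Cell2 K. \<forall>\<beta> \<in> Cell2 K. src2 K \<beta> = tgt2 K \<alpha> \<longrightarrow>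
        (\<forall>f \<in> Cell1 K. src1 K f = tgt1 K (src2 K \<alpha>) \<longrightarrow>
           f \<triangleleft>\<^bsub>K\<^esub> (\<beta> \<bullet>\<^bsub>K\<^esub> \<alpha>) = (f \<triangleleft>\<^bsub>K\<^esub> \<beta>) \<bullet>\<^bsub>K\<^esub> (f \<triangleleft>\<^bsub>K\<^esub> \<alpha>)) \<and>
        (\<forall>f \<in> Cell1 K. tgt1 K f = src1 K (src2 K \<alpha>) \<longrightarrow>
           (\<beta> \<bullet>\<^bsub>K\<^esub> \<alpha>) \<triangleright>\<^bsub>K\<^esub> f = (\<beta> \<triangleright>\<^bsub>K\<^esub> f) \<bullet>\<^bsub>K\<^esub> (\<alpha> \<triangleright>\<^bsub>K\<^esub> f))) \<and>
     (\<forall>\<alpha> \<in> Cell2 K. id1 K (tgt1 K (src2 K \<alpha>)) \<triangleleft>\<^bsub>K\<^esub> \<alpha> = \<alpha> \<and>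
        \<alpha> \<triangleright>\<^bsub>K\<^esub> id1 K (src1 K (src2 K \<alpha>)) = \<alpha>) \<and>
     (\<forall>\<alpha> \<in> Cell2 K. \<forall>f \<in> Cell1 K. \<forall>g \<in> Cell1 K.
        (src1 K f = tgt1 K (src2 K \<alpha>) \<longrightarrow> src1 K g = tgt1 K f \<longrightarrow>
           (g \<star>\<^bsub>K\<^esub> f) \<triangleleft>\<^bsub>K\<^esub> \<alpha> = g \<triangleleft>\<^bsub>K\<^esub> (f \<triangleleft>\<^bsub>K\<^esub> \<alpha>)) \<and>
        (src1 K (src2 K \<alpha>) = tgt1 K g \<longrightarrow> src1 K g = tgt1 K f \<longrightarrow>
           \<alpha> \<triangleright>\<^bsub>K\<^esub> (g \<star>\<^bsub>K\<^esub> f) = (\<alpha> \<triangleright>\<^bsub>K\<^esub> g) \<triangleright>\<^bsub>K\<^esub> f) \<and>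
        (src1 K g = tgt1 K (src2 K \<alpha>) \<longrightarrow> tgt1 K f = src1 K (src2 K \<alpha>) \<longrightarrow>
           g \<triangleleft>\<^bsub>K\<^esub> (\<alpha> \<triangleright>\<^bsub>K\<^esub> f) = (g \<triangleleft>\<^bsub>K\<^esub> \<alpha>) \<triangleright>\<^bsub>K\<^esub> f)) \<and>
     (\<forall>\<alpha> \<in> Cell2 K. \<forall>\<beta> \<in> Cell2 K. src1 K (src2 K \<beta>) = tgt1 K (src2 K \<alpha>) \<longrightarrow>
        (\<beta> \<triangleright>\<^bsub>K\<^esub> tgt2 K \<alpha>) \<bullet>\<^bsub>K\<^esub> (src2 K \<beta> \<triangleleft>\<^bsub>K\<^esub> \<alpha>) = (tgt2 K \<beta> \<triangleleft>\<^bsub>K\<^esub> \<alpha>) \<bullet>\<^bsub>K\<^esub> (\<beta> \<triangleright>\<^bsub>K\<^esub> src2 K \<alpha>))"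

definition small_twocat :: "'k rel \<Rightarrow> ('p, 'f, 'a) twocat \<Rightarrow> bool" where
  "small_twocat \<kappa> K \<longleftrightarrow> |Cell0 K| <o \<kappa> \<and> |Cell1 K| <o \<kappa> \<and> |Cell2 K| <o \<kappa>"

definition coop :: "('p, 'f, 'a) twocat \<Rightarrow> ('p, 'f, 'a) twocat" where
  "coop K = \<lparr>Cell0 = Cell0 K, Cell1 = Cell1 K, Cell2 = Cell2 K,
     src1 = tgt1 K, tgt1 = src1 K, id1 = id1 K, cmp1 = (\<lambda>g f. f \<star>\<^bsub>K\<^esub> g),
     src2 = tgt2 K, tgt2 = src2 K, id2 = id2 K, vcmp = (\<lambda>\<beta> \<alpha>. \<alpha> \<bullet>\<^bsub>K\<^esub> \<beta>),
     lwh = (\<lambda>f \<alpha>. \<alpha> \<triangleright>\<^bsub>K\<^esub> f), rwh = (\<lambda>\<alpha> f. f \<triangleleft>\<^bsub>K\<^esub> \<alpha>)\<rparr>"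

definition invertible2 :: "('p, 'f, 'a) twocat \<Rightarrow> 'a \<Rightarrow> bool" where
  "invertible2 K \<alpha> \<longleftrightarrow> \<alpha> \<in> Cell2 K \<and>
     (\<exists>\<beta> \<in> hom2 K (tgt2 K \<alpha>) (src2 K \<alpha>).
        \<beta> \<bullet>\<^bsub>K\<^esub> \<alpha> = id2 K (src2 K \<alpha>) \<and> \<alpha> \<bullet>\<^bsub>K\<^esub> \<beta> = id2 K (tgt2 K \<alpha>))"

text \<open>\<open>PC P g f : P1 P g \<circ> P1 P f \<Rightarrow> P1 P (g \<circ> f)\<close> and \<open>PU P p : 1 \<Rightarrow> P1 P 1\<^sub>p\<close> are the coherence
  isomorphisms.\<close>

record ('p, 'f, 'a, 'x, 'y, 'z) pfun =
  P0 :: "'p \<Rightarrow> 'x"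
  P1 :: "'f \<Rightarrow> 'y"
  P2 :: "'a \<Rightarrow> 'z"
  PC :: "'f \<Rightarrow> 'f \<Rightarrow> 'z"
  PU :: "'p \<Rightarrow> 'z"

definition pseudofunctor ::
  "('p, 'f, 'a) twocat \<Rightarrow> ('x, 'y, 'z) twocat \<Rightarrow> ('p, 'f, 'a, 'x, 'y, 'z) pfun \<Rightarrow> bool" where
  "pseudofunctor K M P \<longleftrightarrow>
     (\<forall>p \<in> Cell0 K. P0 P p \<in> Cell0 M) \<and>
     (\<forall>f \<in> Cell1 K. P1 P f \<in> Cell1 M \<and>
        src1 M (P1 P f) = P0 P (src1 K f) \<and> tgt1 M (P1 P f) = P0 P (tgt1 K f)) \<and>
     (\<forall>\<alpha> \<in> Cell2 K. P2 P \<alpha> \<in> hom2 M (P1 P (src2 K \<alpha>)) (P1 P (tgt2 K \<alpha>))) \<and>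
     (\<forall>f \<in> Cell1 K. P2 P (id2 K f) = id2 M (P1 P f)) \<and>
     (\<forall>\<alpha> \<in> Cell2 K. \<forall>\<beta> \<in> Cell2 K. src2 K \<beta> = tgt2 K \<alpha> \<longrightarrow>
        P2 P (\<beta> \<bullet>\<^bsub>K\<^esub> \<alpha>) = P2 P \<beta> \<bullet>\<^bsub>M\<^esub> P2 P \<alpha>) \<and>
     (\<forall>p \<in> Cell0 K. PU P p \<in> hom2 M (id1 M (P0 P p)) (P1 P (id1 K p)) \<and> invertible2 M (PU P p)) \<and>
     (\<forall>f \<in> Cell1 K. \<forall>g \<in> Cell1 K. src1 K g = tgt1 K f \<longrightarrow>
        PC P g f \<in> hom2 M (P1 P g \<star>\<^bsub>M\<^esub> P1 P f) (P1 P (g \<star>\<^bsub>K\<^esub> f)) \<and> invertible2 M (PC P g f)) \<and>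
     (\<forall>f \<in> Cell1 K. \<forall>\<beta> \<in> Cell2 K. src1 K (src2 K \<beta>) = tgt1 K f \<longrightarrow>
        P2 P (\<beta> \<triangleright>\<^bsub>K\<^esub> f) \<bullet>\<^bsub>M\<^esub> PC P (src2 K \<beta>) f = PC P (tgt2 K \<beta>) f \<bullet>\<^bsub>M\<^esub> (P2 P \<beta> \<triangleright>\<^bsub>M\<^esub> P1 P f)) \<and>
     (\<forall>g \<in> Cell1 K. \<forall>\<alpha> \<in> Cell2 K. src1 K g = tgt1 K (src2 K \<alpha>) \<longrightarrow>
        P2 P (g \<triangleleft>\<^bsub>K\<^esub> \<alpha>) \<bullet>\<^bsub>M\<^esub> PC P g (src2 K \<alpha>) = PC P g (tgt2 K \<alpha>) \<bullet>\<^bsub>M\<^esub> (P1 P g \<triangleleft>\<^bsub>M\<^esub> P2 P \<alpha>)) \<and>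
     (\<forall>f \<in> Cell1 K. \<forall>g \<in> Cell1 K. \<forall>h \<in> Cell1 K. src1 K g = tgt1 K f \<longrightarrow> src1 K h = tgt1 K g \<longrightarrow>
        PC P (h \<star>\<^bsub>K\<^esub> g) f \<bullet>\<^bsub>M\<^esub> (PC P h g \<triangleright>\<^bsub>M\<^esub> P1 P f) =
        PC P h (g \<star>\<^bsub>K\<^esub> f) \<bullet>\<^bsub>M\<^esub> (P1 P h \<triangleleft>\<^bsub>M\<^esub> PC P g f)) \<and>
     (\<forall>f \<in> Cell1 K.
        PC P f (id1 K (src1 K f)) \<bullet>\<^bsub>M\<^esub> (P1 P f \<triangleleft>\<^bsub>M\<^esub> PU P (src1 K f)) = id2 M (P1 P f) \<and>
        PC P (id1 K (tgt1 K f)) f \<bullet>\<^bsub>M\<^esub> (PU P (tgt1 K f) \<triangleright>\<^bsub>M\<^esub> P1 P f) = id2 M (P1 P f))"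

text \<open>Strict 2-functors are the pseudofunctors whose coherence isomorphisms are identities.\<close>

definition strict_pfun ::
  "('p, 'f, 'a) twocat \<Rightarrow> ('x, 'y, 'z) twocat \<Rightarrow> ('p \<Rightarrow> 'x) \<Rightarrow> ('f \<Rightarrow> 'y) \<Rightarrow> ('a \<Rightarrow> 'z) \<Rightarrow>
   ('p, 'f, 'a, 'x, 'y, 'z) pfun" where
  "strict_pfun K M F0 F1 F2 = \<lparr>P0 = F0, P1 = F1, P2 = F2,
     PC = (\<lambda>g f. id2 M (F1 (g \<star>\<^bsub>K\<^esub> f))), PU = (\<lambda>p. id2 M (F1 (id1 K p)))\<rparr>"

definition Lex :: "'k rel \<Rightarrow> (('o, 'm) cat, ('o, 'm, 'o, 'm) ftr, ('o, 'm, 'o, 'm) ntr) twocat" where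
  "Lex \<kappa> = \<lparr>Cell0 = {C. has_small_limits \<kappa> C}, Cell1 = {F. lex_ftr \<kappa> F},
     Cell2 = {\<tau>. nattrans \<tau> \<and> lex_ftr \<kappa> (NDom \<tau>) \<and> lex_ftr \<kappa> (NCod \<tau>)},
     src1 = FDom, tgt1 = FCod, id1 = id_ftr, cmp1 = comp_ftr,
     src2 = NDom, tgt2 = NCod, id2 = id_ntr, vcmp = vcomp_ntr, lwh = lwh_ntr, rwh = rwh_ntr\<rparr>"

type_synonym ('p, 'f, 'a, 'o, 'm) catpfun =
  "('p, 'f, 'a, ('o, 'm) cat, ('o, 'm, 'o, 'm) ftr, ('o, 'm, 'o, 'm) ntr) pfun"


section \<open>Colax and pseudonatural transformations, modifications\<close>

text \<open>The two pseudofunctors may take values in categories over different types: the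
  co-dextrification of a pseudofunctor has values over other types than the pseudofunctor itself.\<close>

record ('p, 'f, 'a, 'o1, 'm1, 'o2, 'm2) trf =
  TDom :: "('p, 'f, 'a, 'o1, 'm1) catpfun"
  TCod :: "('p, 'f, 'a, 'o2, 'm2) catpfun"
  T1 :: "'p \<Rightarrow> ('o1, 'm1, 'o2, 'm2) ftr"
  T2 :: "'f \<Rightarrow> ('o1, 'm1, 'o2, 'm2) ntr"

definition colax ::
  "'k rel \<Rightarrow> ('p, 'f, 'a) twocat \<Rightarrow> ('p, 'f, 'a, 'o1, 'm1, 'o2, 'm2) trf \<Rightarrow> bool" where
  "colax \<kappa> K F \<longleftrightarrow> (let C = TDom F; D = TCod F in
     pseudofunctor K (Lex \<kappa>) C \<and> pseudofunctor K (Lex \<kappa>) D \<and>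
     T1 F \<in> extensional (Cell0 K) \<and> T2 F \<in> extensional (Cell1 K) \<and>
     (\<forall>p \<in> Cell0 K. lex_ftr \<kappa> (T1 F p) \<and> FDom (T1 F p) = P0 C p \<and> FCod (T1 F p) = P0 D p) \<and>
     (\<forall>f \<in> Cell1 K. T2 F f \<in> nats (T1 F (tgt1 K f) \<odot> P1 C f) (P1 D f \<odot> T1 F (src1 K f))) \<and>
     (\<forall>\<alpha> \<in> Cell2 K. let f = src2 K \<alpha>; f' = tgt2 K \<alpha> in
        T2 F f' \<bullet>\<^sub>N (T1 F (tgt1 K f) \<triangleleft>\<^sub>N P2 C \<alpha>) = (P2 D \<alpha> \<triangleright>\<^sub>N T1 F (src1 K f)) \<bullet>\<^sub>N T2 F f) \<and>
     (\<forall>f \<in> Cell1 K. \<forall>g \<in> Cell1 K. src1 K g = tgt1 K f \<longrightarrow>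
        T2 F (g \<star>\<^bsub>K\<^esub> f) \<bullet>\<^sub>N (T1 F (tgt1 K g) \<triangleleft>\<^sub>N PC C g f) =
        (PC D g f \<triangleright>\<^sub>N T1 F (src1 K f)) \<bullet>\<^sub>N (P1 D g \<triangleleft>\<^sub>N T2 F f) \<bullet>\<^sub>N (T2 F g \<triangleright>\<^sub>N P1 C f)) \<and>
     (\<forall>p \<in> Cell0 K. T2 F (id1 K p) \<bullet>\<^sub>N (T1 F p \<triangleleft>\<^sub>N PU C p) = PU D p \<triangleright>\<^sub>N T1 F p))"

definition pseudonatural ::
  "'k rel \<Rightarrow> ('p, 'f, 'a) twocat \<Rightarrow> ('p, 'f, 'a, 'o1, 'm1, 'o2, 'm2) trf \<Rightarrow> bool" where
  "pseudonatural \<kappa> K F \<longleftrightarrow> colax \<kappa> K F \<and> (\<forall>f \<in> Cell1 K. iso_ntr (T2 F f))"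

definition id_trf ::
  "('p, 'f, 'a) twocat \<Rightarrow> ('p, 'f, 'a, 'o, 'm) catpfun \<Rightarrow> ('p, 'f, 'a, 'o, 'm, 'o, 'm) trf" where
  "id_trf K C = \<lparr>TDom = C, TCod = C,
     T1 = (\<lambda>p \<in> Cell0 K. id_ftr (P0 C p)), T2 = (\<lambda>f \<in> Cell1 K. id_ntr (P1 C f))\<rparr>"

definition comp_trf ::
  "('p, 'f, 'a) twocat \<Rightarrow> ('p, 'f, 'a, 'o2, 'm2, 'o3, 'm3) trf \<Rightarrow>
   ('p, 'f, 'a, 'o1, 'm1, 'o2, 'm2) trf \<Rightarrow> ('p, 'f, 'a, 'o1, 'm1, 'o3, 'm3) trf" where
  "comp_trf K G F = \<lparr>TDom = TDom F, TCod = TCod G,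
     T1 = (\<lambda>p \<in> Cell0 K. T1 G p \<odot> T1 F p),
     T2 = (\<lambda>f \<in> Cell1 K. (T2 G f \<triangleright>\<^sub>N T1 F (src1 K f)) \<bullet>\<^sub>N (T1 G (tgt1 K f) \<triangleleft>\<^sub>N T2 F f))\<rparr>"

record ('p, 'f, 'a, 'o1, 'm1, 'o2, 'm2) mdf =
  MDom :: "('p, 'f, 'a, 'o1, 'm1, 'o2, 'm2) trf"
  MCod :: "('p, 'f, 'a, 'o1, 'm1, 'o2, 'm2) trf"
  MC :: "'p \<Rightarrow> ('o1, 'm1, 'o2, 'm2) ntr"

definition modification ::
  "'k rel \<Rightarrow> ('p, 'f, 'a) twocat \<Rightarrow> ('p, 'f, 'a, 'o1, 'm1, 'o2, 'm2) mdf \<Rightarrow> bool" where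
  "modification \<kappa> K m \<longleftrightarrow> (let F = MDom m; G = MCod m in
     colax \<kappa> K F \<and> colax \<kappa> K G \<and> TDom F = TDom G \<and> TCod F = TCod G \<and>
     MC m \<in> extensional (Cell0 K) \<and>
     (\<forall>p \<in> Cell0 K. MC m p \<in> nats (T1 F p) (T1 G p)) \<and>
     (\<forall>f \<in> Cell1 K. (P1 (TCod F) f \<triangleleft>\<^sub>N MC m (src1 K f)) \<bullet>\<^sub>N T2 F f =
        T2 G f \<bullet>\<^sub>N (MC m (tgt1 K f) \<triangleright>\<^sub>N P1 (TDom F) f)))"

definition id_mdf ::
  "('p, 'f, 'a) twocat \<Rightarrow> ('p, 'f, 'a, 'o1, 'm1, 'o2, 'm2) trf \<Rightarrow>
   ('p, 'f, 'a, 'o1, 'm1, 'o2, 'm2) mdf" where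
  "id_mdf K F = \<lparr>MDom = F, MCod = F, MC = (\<lambda>p \<in> Cell0 K. id_ntr (T1 F p))\<rparr>"

definition vcomp_mdf ::
  "('p, 'f, 'a) twocat \<Rightarrow> ('p, 'f, 'a, 'o1, 'm1, 'o2, 'm2) mdf \<Rightarrow>
   ('p, 'f, 'a, 'o1, 'm1, 'o2, 'm2) mdf \<Rightarrow> ('p, 'f, 'a, 'o1, 'm1, 'o2, 'm2) mdf" where
  "vcomp_mdf K n m = \<lparr>MDom = MDom m, MCod = MCod n, MC = (\<lambda>p \<in> Cell0 K. MC n p \<bullet>\<^sub>N MC m p)\<rparr>"

definition lwh_mdf ::
  "('p, 'f, 'a) twocat \<Rightarrow> ('p, 'f, 'a, 'o2, 'm2, 'o3, 'm3) trf \<Rightarrow>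
   ('p, 'f, 'a, 'o1, 'm1, 'o2, 'm2) mdf \<Rightarrow> ('p, 'f, 'a, 'o1, 'm1, 'o3, 'm3) mdf" where
  "lwh_mdf K G m = \<lparr>MDom = comp_trf K G (MDom m), MCod = comp_trf K G (MCod m),
     MC = (\<lambda>p \<in> Cell0 K. T1 G p \<triangleleft>\<^sub>N MC m p)\<rparr>"

definition rwh_mdf ::
  "('p, 'f, 'a) twocat \<Rightarrow> ('p, 'f, 'a, 'o2, 'm2, 'o3, 'm3) mdf \<Rightarrow>
   ('p, 'f, 'a, 'o1, 'm1, 'o2, 'm2) trf \<Rightarrow> ('p, 'f, 'a, 'o1, 'm1, 'o3, 'm3) mdf" where
  "rwh_mdf K m F = \<lparr>MDom = comp_trf K (MDom m) F, MCod = comp_trf K (MCod m) F,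
     MC = (\<lambda>p \<in> Cell0 K. MC m p \<triangleright>\<^sub>N T1 F p)\<rparr>"

definition Ps_colax ::
  "'k rel \<Rightarrow> ('p, 'f, 'a) twocat \<Rightarrow>
   (('p, 'f, 'a, 'o, 'm) catpfun, ('p, 'f, 'a, 'o, 'm, 'o, 'm) trf, ('p, 'f, 'a, 'o, 'm, 'o, 'm) mdf) twocat"
  where
  "Ps_colax \<kappa> K = \<lparr>Cell0 = {C. pseudofunctor K (Lex \<kappa>) C}, Cell1 = {F. colax \<kappa> K F},
     Cell2 = {m. modification \<kappa> K m},
     src1 = TDom, tgt1 = TCod, id1 = id_trf K, cmp1 = comp_trf K,
     src2 = MDom, tgt2 = MCod, id2 = id_mdf K, vcmp = vcomp_mdf K, lwh = lwh_mdf K, rwh = rwh_mdf K\<rparr>"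

definition colax_hom ::
  "'k rel \<Rightarrow> ('p, 'f, 'a) twocat \<Rightarrow> ('p, 'f, 'a, 'o1, 'm1) catpfun \<Rightarrow> ('p, 'f, 'a, 'o2, 'm2) catpfun \<Rightarrow>
   (('p, 'f, 'a, 'o1, 'm1, 'o2, 'm2) trf, ('p, 'f, 'a, 'o1, 'm1, 'o2, 'm2) mdf) cat" where
  "colax_hom \<kappa> K C D = \<lparr>Ob = {F. colax \<kappa> K F \<and> TDom F = C \<and> TCod F = D},
     Ar = {m. modification \<kappa> K m \<and> TDom (MDom m) = C \<and> TCod (MDom m) = D},
     Src = MDom, Tgt = MCod, Idn = id_mdf K, Cmp = vcomp_mdf K\<rparr>"


section \<open>Right adjoints and mates\<close>

definition adjunction ::
  "'k rel \<Rightarrow> ('o1, 'm1, 'o2, 'm2) ftr \<Rightarrow> ('o2, 'm2, 'o1, 'm1) ftr \<Rightarrow>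
   ('o1, 'm1, 'o1, 'm1) ntr \<Rightarrow> ('o2, 'm2, 'o2, 'm2) ntr \<Rightarrow> bool" where
  "adjunction \<kappa> F R \<eta> \<epsilon> \<longleftrightarrow> lex_ftr \<kappa> F \<and> lex_ftr \<kappa> R \<and> FDom R = FCod F \<and> FCod R = FDom F \<and>
     \<eta> \<in> nats (id_ftr (FDom F)) (R \<odot> F) \<and> \<epsilon> \<in> nats (F \<odot> R) (id_ftr (FCod F)) \<and>
     (\<epsilon> \<triangleright>\<^sub>N F) \<bullet>\<^sub>N (F \<triangleleft>\<^sub>N \<eta>) = id_ntr F \<and> (R \<triangleleft>\<^sub>N \<epsilon>) \<bullet>\<^sub>N (\<eta> \<triangleright>\<^sub>N R) = id_ntr R"

definition has_radj :: "'k rel \<Rightarrow> ('o1, 'm1, 'o2, 'm2) ftr \<Rightarrow> bool" where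
  "has_radj \<kappa> F \<longleftrightarrow> (\<exists>R \<eta> \<epsilon>. adjunction \<kappa> F R \<eta> \<epsilon>)"

text \<open>The right adjoints used to define \<open>U\<close> are chosen once and for all.\<close>

definition chosen_adj ::
  "'k rel \<Rightarrow> ('o1, 'm1, 'o2, 'm2) ftr \<Rightarrow>
   ('o2, 'm2, 'o1, 'm1) ftr \<times> ('o1, 'm1, 'o1, 'm1) ntr \<times> ('o2, 'm2, 'o2, 'm2) ntr" where
  "chosen_adj \<kappa> F = (SOME (R, \<eta>, \<epsilon>). adjunction \<kappa> F R \<eta> \<epsilon>)"

definition radj :: "'k rel \<Rightarrow> ('o1, 'm1, 'o2, 'm2) ftr \<Rightarrow> ('o2, 'm2, 'o1, 'm1) ftr" where
  "radj \<kappa> F = fst (chosen_adj \<kappa> F)"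

definition adj_unit :: "'k rel \<Rightarrow> ('o1, 'm1, 'o2, 'm2) ftr \<Rightarrow> ('o1, 'm1, 'o1, 'm1) ntr" where
  "adj_unit \<kappa> F = fst (snd (chosen_adj \<kappa> F))"

definition adj_counit :: "'k rel \<Rightarrow> ('o1, 'm1, 'o2, 'm2) ftr \<Rightarrow> ('o2, 'm2, 'o2, 'm2) ntr" where
  "adj_counit \<kappa> F = snd (snd (chosen_adj \<kappa> F))"

text \<open>For \<open>L \<stileturn> R\<close> with counit \<open>\<epsilon>\<close> and \<open>L' \<stileturn> R'\<close> with unit \<open>\<eta>'\<close>, the mate of
  \<open>\<sigma> : L' \<circ> A \<Rightarrow> B \<circ> L\<close> is the composite \<open>A R \<Rightarrow> R' L' A R \<Rightarrow> R' B L R \<Rightarrow> R' B\<close>.\<close>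

definition mate ::
  "('o1, 'm1, 'o2, 'm2) ftr \<Rightarrow> ('o3, 'm3, 'o4, 'm4) ftr \<Rightarrow>
   ('o4, 'm4, 'o2, 'm2) ftr \<Rightarrow> ('o2, 'm2, 'o2, 'm2) ntr \<Rightarrow>
   ('o3, 'm3, 'o1, 'm1) ftr \<Rightarrow> ('o3, 'm3, 'o3, 'm3) ntr \<Rightarrow>
   ('o1, 'm1, 'o4, 'm4) ntr \<Rightarrow> ('o3, 'm3, 'o2, 'm2) ntr" where
  "mate A B R' \<eta>' R \<epsilon> \<sigma> =
     (R' \<triangleleft>\<^sub>N (B \<triangleleft>\<^sub>N \<epsilon>)) \<bullet>\<^sub>N ((R' \<triangleleft>\<^sub>N \<sigma>) \<triangleright>\<^sub>N R) \<bullet>\<^sub>N (\<eta>' \<triangleright>\<^sub>N (A \<odot> R))"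


section \<open>The 2-category of adjoint pseudofunctors and the 2-functor U\<close>

definition adj_pfun :: "'k rel \<Rightarrow> ('p, 'f, 'a) twocat \<Rightarrow> ('p, 'f, 'a, 'o, 'm) catpfun \<Rightarrow> bool" where
  "adj_pfun \<kappa> L D \<longleftrightarrow>
     pseudofunctor (coop L) (Lex \<kappa>) D \<and> (\<forall>f \<in> Cell1 L. has_radj \<kappa> (P1 D f))"

definition adj_trf ::
  "'k rel \<Rightarrow> ('p, 'f, 'a) twocat \<Rightarrow> ('p, 'f, 'a, 'o1, 'm1, 'o2, 'm2) trf \<Rightarrow> bool" where
  "adj_trf \<kappa> L F \<longleftrightarrow> adj_pfun \<kappa> L (TDom F) \<and> adj_pfun \<kappa> L (TCod F) \<and> pseudonatural \<kappa> (coop L) F"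

definition adj_mdf ::
  "'k rel \<Rightarrow> ('p, 'f, 'a) twocat \<Rightarrow> ('p, 'f, 'a, 'o1, 'm1, 'o2, 'm2) mdf \<Rightarrow> bool" where
  "adj_mdf \<kappa> L m \<longleftrightarrow> adj_trf \<kappa> L (MDom m) \<and> adj_trf \<kappa> L (MCod m) \<and> modification \<kappa> (coop L) m"

definition Ps_adj ::
  "'k rel \<Rightarrow> ('p, 'f, 'a) twocat \<Rightarrow>
   (('p, 'f, 'a, 'o, 'm) catpfun, ('p, 'f, 'a, 'o, 'm, 'o, 'm) trf, ('p, 'f, 'a, 'o, 'm, 'o, 'm) mdf) twocat"
  where
  "Ps_adj \<kappa> L = (let K = coop L in
     \<lparr>Cell0 = {D. adj_pfun \<kappa> L D}, Cell1 = {F. adj_trf \<kappa> L F}, Cell2 = {m. adj_mdf \<kappa> L m},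
     src1 = TDom, tgt1 = TCod, id1 = id_trf K, cmp1 = comp_trf K,
     src2 = MDom, tgt2 = MCod, id2 = id_mdf K, vcmp = vcomp_mdf K, lwh = lwh_mdf K, rwh = rwh_mdf K\<rparr>)"

definition adj_hom ::
  "'k rel \<Rightarrow> ('p, 'f, 'a) twocat \<Rightarrow> ('p, 'f, 'a, 'o1, 'm1) catpfun \<Rightarrow> ('p, 'f, 'a, 'o2, 'm2) catpfun \<Rightarrow>
   (('p, 'f, 'a, 'o1, 'm1, 'o2, 'm2) trf, ('p, 'f, 'a, 'o1, 'm1, 'o2, 'm2) mdf) cat" where
  "adj_hom \<kappa> L D E = \<lparr>Ob = {F. adj_trf \<kappa> L F \<and> TDom F = D \<and> TCod F = E},
     Ar = {m. adj_mdf \<kappa> L m \<and> TDom (MDom m) = D \<and> TCod (MDom m) = E},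
     Src = MDom, Tgt = MCod, Idn = id_mdf (coop L), Cmp = vcomp_mdf (coop L)\<rparr>"

text \<open>The 2-cells and coherence isomorphisms of \<open>U D\<close> are mates of those of \<open>D\<close> (of the inverses of
  the coherence isomorphisms). In \<open>PC\<close>, \<open>PC D f g\<close> is the isomorphism
  \<open>D\<^sup>f \<circ> D\<^sup>g \<Rightarrow> D\<^sup>g\<^sup>f\<close>, and \<open>D\<^sup>f \<circ> D\<^sup>g\<close> has the right adjoint \<open>D\<^sub>g \<circ> D\<^sub>f\<close>.\<close>

definition U0 ::
  "'k rel \<Rightarrow> ('p, 'f, 'a) twocat \<Rightarrow> ('p, 'f, 'a, 'o, 'm) catpfun \<Rightarrow> ('p, 'f, 'a, 'o, 'm) catpfun" where
  "U0 \<kappa> L D = (let R = (\<lambda>f. radj \<kappa> (P1 D f)); \<eta> = (\<lambda>f. adj_unit \<kappa> (P1 D f));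
       \<epsilon> = (\<lambda>f. adj_counit \<kappa> (P1 D f)); I = (\<lambda>p. id_ftr (P0 D p)) in
     \<lparr>P0 = P0 D, P1 = R,
      P2 = (\<lambda>\<alpha>. let f = src2 L \<alpha>; f' = tgt2 L \<alpha> in
         mate (I (tgt1 L f)) (I (src1 L f)) (R f') (\<eta> f') (R f) (\<epsilon> f) (P2 D \<alpha>)),
      PC = (\<lambda>g f. let h = g \<star>\<^bsub>L\<^esub> f in
         mate (I (tgt1 L g)) (I (src1 L f)) (R h) (\<eta> h)
           (R g \<odot> R f) (\<epsilon> f \<bullet>\<^sub>N ((P1 D f \<triangleleft>\<^sub>N \<epsilon> g) \<triangleright>\<^sub>N R f)) (inv_ntr (PC D f g))),
      PU = (\<lambda>p. let i = id1 L p in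
         mate (I p) (I p) (R i) (\<eta> i) (I p) (id_ntr (I p)) (inv_ntr (PU D p)))\<rparr>)"

text \<open>As a transformation over \<^term>\<open>coop L\<close>, \<open>F : C \<Rightarrow> D\<close> has 2-cells
  \<open>F\<^sub>p \<circ> C\<^sup>f \<Rightarrow> D\<^sup>f \<circ> F\<^sub>q\<close> for \<open>f : p \<rightarrow> q\<close> in \<open>L\<close>; the mate is taken of the inverse.\<close>

definition U1 ::
  "'k rel \<Rightarrow> ('p, 'f, 'a) twocat \<Rightarrow> ('p, 'f, 'a, 'o1, 'm1, 'o2, 'm2) trf \<Rightarrow>
   ('p, 'f, 'a, 'o1, 'm1, 'o2, 'm2) trf" where
  "U1 \<kappa> L F = \<lparr>TDom = U0 \<kappa> L (TDom F), TCod = U0 \<kappa> L (TCod F), T1 = T1 F,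
     T2 = (\<lambda>f \<in> Cell1 L. let c = P1 (TDom F) f; d = P1 (TCod F) f in
        mate (T1 F (tgt1 L f)) (T1 F (src1 L f)) (radj \<kappa> d) (adj_unit \<kappa> d)
          (radj \<kappa> c) (adj_counit \<kappa> c) (inv_ntr (T2 F f)))\<rparr>"

definition U2 ::
  "'k rel \<Rightarrow> ('p, 'f, 'a) twocat \<Rightarrow> ('p, 'f, 'a, 'o1, 'm1, 'o2, 'm2) mdf \<Rightarrow>
   ('p, 'f, 'a, 'o1, 'm1, 'o2, 'm2) mdf" where
  "U2 \<kappa> L m = \<lparr>MDom = U1 \<kappa> L (MDom m), MCod = U1 \<kappa> L (MCod m), MC = MC m\<rparr>"

definition U ::
  "'k rel \<Rightarrow> ('p, 'f, 'a) twocat \<Rightarrow>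
   (('p, 'f, 'a, 'o, 'm) catpfun, ('p, 'f, 'a, 'o, 'm, 'o, 'm) trf, ('p, 'f, 'a, 'o, 'm, 'o, 'm) mdf,
    ('p, 'f, 'a, 'o, 'm) catpfun, ('p, 'f, 'a, 'o, 'm, 'o, 'm) trf, ('p, 'f, 'a, 'o, 'm, 'o, 'm) mdf) pfun"
  where
  "U \<kappa> L = strict_pfun (Ps_adj \<kappa> L) (Ps_colax \<kappa> L) (U0 \<kappa> L) (U1 \<kappa> L) (U2 \<kappa> L)"


section \<open>Co-dextrification\<close>

text \<open>\<open>HA \<Gamma> (\<nu>, \<rho>, \<alpha>)\<close> is the structure morphism of \<open>\<Gamma>\<close> at \<open>\<alpha> : \<mu> \<Rightarrow> \<nu> \<circ> \<rho>\<close>.\<close>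

record ('f, 'a, 'o, 'm) hobj =
  HO :: "'f \<Rightarrow> 'o"
  HA :: "'f \<times> 'f \<times> 'a \<Rightarrow> 'm"

record ('f, 'a, 'o, 'm) hmor =
  HDom :: "('f, 'a, 'o, 'm) hobj"
  HCod :: "('f, 'a, 'o, 'm) hobj"
  HM :: "'f \<Rightarrow> 'm"

definition into :: "('p, 'f, 'a) twocat \<Rightarrow> 'p \<Rightarrow> 'f set" where
  "into L r = {\<mu> \<in> Cell1 L. tgt1 L \<mu> = r}"

definition decomp :: "('p, 'f, 'a) twocat \<Rightarrow> 'p \<Rightarrow> ('f \<times> 'f \<times> 'a) set" where
  "decomp L r = {(\<nu>, \<rho>, \<alpha>). \<nu> \<in> into L r \<and> \<rho> \<in> into L (src1 L \<nu>) \<and>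
     \<alpha> \<in> Cell2 L \<and> tgt2 L \<alpha> = \<nu> \<star>\<^bsub>L\<^esub> \<rho>}"

definition codext_obj ::
  "('p, 'f, 'a) twocat \<Rightarrow> ('p, 'f, 'a, 'o, 'm) catpfun \<Rightarrow> 'p \<Rightarrow> ('f, 'a, 'o, 'm) hobj \<Rightarrow> bool" where
  "codext_obj L C r \<Gamma> \<longleftrightarrow>
     HO \<Gamma> \<in> extensional (into L r) \<and> HA \<Gamma> \<in> extensional (decomp L r) \<and>
     (\<forall>\<mu> \<in> into L r. HO \<Gamma> \<mu> \<in> Ob (P0 C (src1 L \<mu>))) \<and>
     (\<forall>(\<nu>, \<rho>, \<alpha>) \<in> decomp L r.
        HA \<Gamma> (\<nu>, \<rho>, \<alpha>) \<in> hom (P0 C (src1 L \<nu>)) (HO \<Gamma> \<nu>) (FO (P1 C \<rho>) (HO \<Gamma> (src2 L \<alpha>)))) \<and>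
     (\<forall>\<mu> \<in> into L r. let p = src1 L \<mu> in
        HA \<Gamma> (\<mu>, id1 L p, id2 L \<mu>) = NC (PU C p) (HO \<Gamma> \<mu>)) \<and>
     (\<forall>(\<nu>, \<rho>, \<alpha>) \<in> decomp L r. \<forall>(\<pi>, \<sigma>, \<beta>) \<in> decomp L r. src2 L \<beta> = \<nu> \<longrightarrow>
        (let S = P0 C (src1 L \<pi>) in
          NC (PC C \<sigma> \<rho>) (HO \<Gamma> (src2 L \<alpha>)) \<cdot>\<^bsub>S\<^esub> FA (P1 C \<sigma>) (HA \<Gamma> (\<nu>, \<rho>, \<alpha>)) \<cdot>\<^bsub>S\<^esub> HA \<Gamma> (\<pi>, \<sigma>, \<beta>) =
          HA \<Gamma> (\<pi>, \<sigma> \<star>\<^bsub>L\<^esub> \<rho>, (\<beta> \<triangleright>\<^bsub>L\<^esub> \<rho>) \<bullet>\<^bsub>L\<^esub> \<alpha>))) \<and>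
     (\<forall>(\<nu>, \<rho>, \<alpha>) \<in> decomp L r. \<forall>\<beta> \<in> Cell2 L. src2 L \<beta> = \<rho> \<longrightarrow>
        NC (P2 C \<beta>) (HO \<Gamma> (src2 L \<alpha>)) \<cdot>\<^bsub>P0 C (src1 L \<nu>)\<^esub> HA \<Gamma> (\<nu>, \<rho>, \<alpha>) =
        HA \<Gamma> (\<nu>, tgt2 L \<beta>, (\<nu> \<triangleleft>\<^bsub>L\<^esub> \<beta>) \<bullet>\<^bsub>L\<^esub> \<alpha>))"

definition codext_mor ::
  "('p, 'f, 'a) twocat \<Rightarrow> ('p, 'f, 'a, 'o, 'm) catpfun \<Rightarrow> 'p \<Rightarrow> ('f, 'a, 'o, 'm) hmor \<Rightarrow> bool" where
  "codext_mor L C r \<theta> \<longleftrightarrow> (let \<Gamma> = HDom \<theta>; \<Delta> = HCod \<theta> in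
     codext_obj L C r \<Gamma> \<and> codext_obj L C r \<Delta> \<and> HM \<theta> \<in> extensional (into L r) \<and>
     (\<forall>\<mu> \<in> into L r. HM \<theta> \<mu> \<in> hom (P0 C (src1 L \<mu>)) (HO \<Gamma> \<mu>) (HO \<Delta> \<mu>)) \<and>
     (\<forall>(\<nu>, \<rho>, \<alpha>) \<in> decomp L r.
        FA (P1 C \<rho>) (HM \<theta> (src2 L \<alpha>)) \<cdot>\<^bsub>P0 C (src1 L \<nu>)\<^esub> HA \<Gamma> (\<nu>, \<rho>, \<alpha>) =
        HA \<Delta> (\<nu>, \<rho>, \<alpha>) \<cdot>\<^bsub>P0 C (src1 L \<nu>)\<^esub> HM \<theta> \<nu>))"

definition codext_cat ::
  "('p, 'f, 'a) twocat \<Rightarrow> ('p, 'f, 'a, 'o, 'm) catpfun \<Rightarrow> 'p \<Rightarrow>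
   (('f, 'a, 'o, 'm) hobj, ('f, 'a, 'o, 'm) hmor) cat" where
  "codext_cat L C r = \<lparr>Ob = {\<Gamma>. codext_obj L C r \<Gamma>}, Ar = {\<theta>. codext_mor L C r \<theta>},
     Src = HDom, Tgt = HCod,
     Idn = (\<lambda>\<Gamma>. \<lparr>HDom = \<Gamma>, HCod = \<Gamma>, HM = (\<lambda>\<mu> \<in> into L r. Idn (P0 C (src1 L \<mu>)) (HO \<Gamma> \<mu>))\<rparr>),
     Cmp = (\<lambda>\<theta>' \<theta>. \<lparr>HDom = HDom \<theta>, HCod = HCod \<theta>',
        HM = (\<lambda>\<mu> \<in> into L r. HM \<theta>' \<mu> \<cdot>\<^bsub>P0 C (src1 L \<mu>)\<^esub> HM \<theta> \<mu>)\<rparr>)\<rparr>"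

definition restr_obj ::
  "('p, 'f, 'a) twocat \<Rightarrow> 'f \<Rightarrow> ('f, 'a, 'o, 'm) hobj \<Rightarrow> ('f, 'a, 'o, 'm) hobj" where
  "restr_obj L \<mu> \<Gamma> = \<lparr>HO = (\<lambda>\<nu> \<in> into L (src1 L \<mu>). HO \<Gamma> (\<mu> \<star>\<^bsub>L\<^esub> \<nu>)),
     HA = (\<lambda>(\<nu>, \<rho>, \<alpha>) \<in> decomp L (src1 L \<mu>). HA \<Gamma> (\<mu> \<star>\<^bsub>L\<^esub> \<nu>, \<rho>, \<mu> \<triangleleft>\<^bsub>L\<^esub> \<alpha>))\<rparr>"

definition codext_ftr ::
  "('p, 'f, 'a) twocat \<Rightarrow> ('p, 'f, 'a, 'o, 'm) catpfun \<Rightarrow> 'f \<Rightarrow>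
   (('f, 'a, 'o, 'm) hobj, ('f, 'a, 'o, 'm) hmor, ('f, 'a, 'o, 'm) hobj, ('f, 'a, 'o, 'm) hmor) ftr" where
  "codext_ftr L C \<mu> = (let E = codext_cat L C (tgt1 L \<mu>) in
     \<lparr>FDom = E, FCod = codext_cat L C (src1 L \<mu>),
      FO = (\<lambda>\<Gamma> \<in> Ob E. restr_obj L \<mu> \<Gamma>),
      FA = (\<lambda>\<theta> \<in> Ar E. \<lparr>HDom = restr_obj L \<mu> (HDom \<theta>), HCod = restr_obj L \<mu> (HCod \<theta>),
         HM = (\<lambda>\<nu> \<in> into L (src1 L \<mu>). HM \<theta> (\<mu> \<star>\<^bsub>L\<^esub> \<nu>))\<rparr>)\<rparr>)"

text \<open>For \<open>\<beta> : \<mu> \<Rightarrow> \<mu>'\<close> and \<open>\<rho>\<close> with source \<open>t\<close>, the 2-cell \<open>\<beta> \<triangleright> \<rho> : \<mu> \<rho> \<Rightarrow> (\<mu>' \<rho>) \<circ> 1\<^sub>t\<close> gives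
  \<open>\<Gamma>\<^sup>\<mu>\<^sup>'\<^sup>\<rho> \<rightarrow> C\<^bsub>1\<^esub> (\<Gamma>\<^sup>\<mu>\<^sup>\<rho>)\<close>, to be followed by the inverse of \<open>PU C t\<close>.\<close>

definition codext_ntr ::
  "('p, 'f, 'a) twocat \<Rightarrow> ('p, 'f, 'a, 'o, 'm) catpfun \<Rightarrow> 'a \<Rightarrow>
   (('f, 'a, 'o, 'm) hobj, ('f, 'a, 'o, 'm) hmor, ('f, 'a, 'o, 'm) hobj, ('f, 'a, 'o, 'm) hmor) ntr" where
  "codext_ntr L C \<beta> = (let \<mu> = src2 L \<beta>; \<mu>' = tgt2 L \<beta> in
     \<lparr>NDom = codext_ftr L C \<mu>', NCod = codext_ftr L C \<mu>,
      NC = (\<lambda>\<Gamma> \<in> Ob (codext_cat L C (tgt1 L \<mu>)).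
        \<lparr>HDom = restr_obj L \<mu>' \<Gamma>, HCod = restr_obj L \<mu> \<Gamma>,
         HM = (\<lambda>\<rho> \<in> into L (src1 L \<mu>). let t = src1 L \<rho> in
            NC (inv_ntr (PU C t)) (HO \<Gamma> (\<mu> \<star>\<^bsub>L\<^esub> \<rho>)) \<cdot>\<^bsub>P0 C t\<^esub>
            HA \<Gamma> (\<mu>' \<star>\<^bsub>L\<^esub> \<rho>, id1 L t, \<beta> \<triangleright>\<^bsub>L\<^esub> \<rho>))\<rparr>)\<rparr>)"

definition codext ::
  "'k rel \<Rightarrow> ('p, 'f, 'a) twocat \<Rightarrow> ('p, 'f, 'a, 'o, 'm) catpfun \<Rightarrow>
   ('p, 'f, 'a, ('f, 'a, 'o, 'm) hobj, ('f, 'a, 'o, 'm) hmor) catpfun" where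
  "codext \<kappa> L C = strict_pfun (coop L) (Lex \<kappa>) (codext_cat L C) (codext_ftr L C) (codext_ntr L C)"

text \<open>The 2-cell of \<open>\<L> : U (codext C) \<Rightarrow> C\<close> at \<open>\<mu> : p \<rightarrow> q\<close> and \<open>\<Gamma>\<close>: with
  \<open>\<Delta> = codext C\<^sub>\<mu> \<Gamma>\<close> and the counit \<open>\<epsilon> : codext C\<^sup>\<mu> \<Delta> \<rightarrow> \<Gamma>\<close>, it is the composite
  \<open>\<Delta>\<^sup>1 \<rightarrow> C\<^sub>\<mu> (\<Delta>\<^sup>\<mu>) \<rightarrow> C\<^sub>\<mu> (\<Gamma>\<^sup>1)\<close> of the structure morphism of \<open>\<Delta>\<close> at \<open>1\<^sub>\<mu> : \<mu> \<Rightarrow> 1\<^sub>q \<circ> \<mu>\<close>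
  and \<open>C\<^sub>\<mu> (\<epsilon>\<^sup>1)\<close>; note \<open>(codext C\<^sup>\<mu> \<Delta>)\<^sup>1 = \<Delta>\<^sup>\<mu>\<close>.\<close>

definition canon_ftr ::
  "('p, 'f, 'a) twocat \<Rightarrow> ('p, 'f, 'a, 'o, 'm) catpfun \<Rightarrow> 'p \<Rightarrow>
   (('f, 'a, 'o, 'm) hobj, ('f, 'a, 'o, 'm) hmor, 'o, 'm) ftr" where
  "canon_ftr L C p = \<lparr>FDom = codext_cat L C p, FCod = P0 C p,
     FO = (\<lambda>\<Gamma> \<in> Ob (codext_cat L C p). HO \<Gamma> (id1 L p)),
     FA = (\<lambda>\<theta> \<in> Ar (codext_cat L C p). HM \<theta> (id1 L p))\<rparr>"

definition canon ::
  "'k rel \<Rightarrow> ('p, 'f, 'a) twocat \<Rightarrow> ('p, 'f, 'a, 'o, 'm) catpfun \<Rightarrow>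
   ('p, 'f, 'a, ('f, 'a, 'o, 'm) hobj, ('f, 'a, 'o, 'm) hmor, 'o, 'm) trf" where
  "canon \<kappa> L C = \<lparr>TDom = U0 \<kappa> L (codext \<kappa> L C), TCod = C,
     T1 = (\<lambda>p \<in> Cell0 L. canon_ftr L C p),
     T2 = (\<lambda>\<mu> \<in> Cell1 L. let p = src1 L \<mu>; q = tgt1 L \<mu>; R = radj \<kappa> (codext_ftr L C \<mu>);
          \<epsilon> = adj_counit \<kappa> (codext_ftr L C \<mu>) in
        \<lparr>NDom = canon_ftr L C q \<odot> R, NCod = P1 C \<mu> \<odot> canon_ftr L C p,
         NC = (\<lambda>\<Gamma> \<in> Ob (codext_cat L C p).
            FA (P1 C \<mu>) (HM (NC \<epsilon> \<Gamma>) (id1 L p)) \<cdot>\<^bsub>P0 C q\<^esub> HA (FO R \<Gamma>) (id1 L q, \<mu>, id2 L \<mu>))\<rparr>)\<rparr>"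


section \<open>Bicategorical right adjoints of U\<close>

text \<open>The functor \<open>e \<circ> U(-)\<close> from \<open>Ps_adj(D, E)\<close> to \<open>Ps_colax(U D, C)\<close>, for \<open>e : U E \<rightarrow> C\<close>.\<close>

definition transpose_U ::
  "'k rel \<Rightarrow> ('p, 'f, 'a) twocat \<Rightarrow> ('p, 'f, 'a, 'o1, 'm1, 'o2, 'm2) trf \<Rightarrow>
   ('p, 'f, 'a, 'o3, 'm3) catpfun \<Rightarrow> ('p, 'f, 'a, 'o1, 'm1) catpfun \<Rightarrow> ('p, 'f, 'a, 'o2, 'm2) catpfun \<Rightarrow>
   (('p, 'f, 'a, 'o3, 'm3, 'o1, 'm1) trf, ('p, 'f, 'a, 'o3, 'm3, 'o1, 'm1) mdf,
    ('p, 'f, 'a, 'o3, 'm3, 'o2, 'm2) trf, ('p, 'f, 'a, 'o3, 'm3, 'o2, 'm2) mdf) ftr" where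
  "transpose_U \<kappa> L e D E C = \<lparr>FDom = adj_hom \<kappa> L D E, FCod = colax_hom \<kappa> L (U0 \<kappa> L D) C,
     FO = (\<lambda>F \<in> Ob (adj_hom \<kappa> L D E). comp_trf L e (U1 \<kappa> L F)),
     FA = (\<lambda>m \<in> Ar (adj_hom \<kappa> L D E). lwh_mdf L e (U2 \<kappa> L m))\<rparr>"

text \<open>\<open>H\<close> is bicategorically right adjoint to \<open>U\<close> with counit \<open>e : U \<circ> H \<Rightarrow> 1\<close>: the 1-cells \<open>e C\<close>
  are pseudonatural in \<open>C\<close> by the invertible modifications \<open>e1 F : e C' \<circ> U (H F) \<Rightarrow> F \<circ> e C\<close> for
  \<open>F : C \<rightarrow> C'\<close>, and all functors \<open>e C \<circ> U(-)\<close> are equivalences. These are then pseudonatural in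
  \<open>C\<close> by \<open>e1\<close>; since \<open>U\<close> is a 2-functor they are strictly natural in \<open>D\<close>. The first argument
  carries the types over which \<open>D\<close> ranges.\<close>

definition right_biadjoint_U ::
  "('o3 \<times> 'm3) itself \<Rightarrow> 'k rel \<Rightarrow> ('p, 'f, 'a) twocat \<Rightarrow>
   (('p, 'f, 'a, 'o2, 'm2) catpfun, ('p, 'f, 'a, 'o2, 'm2, 'o2, 'm2) trf, ('p, 'f, 'a, 'o2, 'm2, 'o2, 'm2) mdf,
    ('p, 'f, 'a, 'o1, 'm1) catpfun, ('p, 'f, 'a, 'o1, 'm1, 'o1, 'm1) trf, ('p, 'f, 'a, 'o1, 'm1, 'o1, 'm1) mdf) pfun \<Rightarrow>
   (('p, 'f, 'a, 'o2, 'm2) catpfun \<Rightarrow> ('p, 'f, 'a, 'o1, 'm1, 'o2, 'm2) trf) \<Rightarrow>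
   (('p, 'f, 'a, 'o2, 'm2, 'o2, 'm2) trf \<Rightarrow> ('p, 'f, 'a, 'o1, 'm1, 'o2, 'm2) mdf) \<Rightarrow> bool" where
  "right_biadjoint_U (_ :: ('o3 \<times> 'm3) itself) \<kappa> L H e e1 \<longleftrightarrow> (let B = Ps_colax \<kappa> L in
     pseudofunctor (Ps_adj \<kappa> L) (Ps_colax \<kappa> L)
       (U \<kappa> L :: (('p, 'f, 'a, 'o3, 'm3) catpfun, _, _, ('p, 'f, 'a, 'o3, 'm3) catpfun, _, _) pfun) \<and>
     pseudofunctor (Ps_adj \<kappa> L) (Ps_colax \<kappa> L)
       (U \<kappa> L :: (('p, 'f, 'a, 'o1, 'm1) catpfun, _, _, ('p, 'f, 'a, 'o1, 'm1) catpfun, _, _) pfun) \<and>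
     pseudofunctor B (Ps_adj \<kappa> L) H \<and>
     (\<forall>C \<in> Cell0 B. e C \<in> Ob (colax_hom \<kappa> L (U0 \<kappa> L (P0 H C)) C)) \<and>
     (\<forall>F \<in> Cell1 B. let X = colax_hom \<kappa> L (U0 \<kappa> L (P0 H (TDom F))) (TCod F);
          s = comp_trf L (e (TCod F)) (U1 \<kappa> L (P1 H F)); t = comp_trf L F (e (TDom F)) in
        e1 F \<in> hom X s t \<and>
        (\<exists>n \<in> hom X t s. n \<cdot>\<^bsub>X\<^esub> e1 F = Idn X s \<and> e1 F \<cdot>\<^bsub>X\<^esub> n = Idn X t)) \<and>
     (\<forall>m \<in> Cell2 B. let F = MDom m; F' = MCod m in
        vcomp_mdf L (e1 F') (lwh_mdf L (e (TCod F)) (U2 \<kappa> L (P2 H m))) =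
        vcomp_mdf L (rwh_mdf L m (e (TDom F))) (e1 F)) \<and>
     (\<forall>F \<in> Cell1 B. \<forall>G \<in> Cell1 B. TDom G = TCod F \<longrightarrow>
        vcomp_mdf L (e1 (comp_trf L G F)) (lwh_mdf L (e (TCod G)) (U2 \<kappa> L (PC H G F))) =
        vcomp_mdf L (lwh_mdf L G (e1 F)) (rwh_mdf L (e1 G) (U1 \<kappa> L (P1 H F)))) \<and>
     (\<forall>C \<in> Cell0 B.
        vcomp_mdf L (e1 (id_trf L C)) (lwh_mdf L (e C) (U2 \<kappa> L (PU H C))) = id_mdf L (e C)) \<and>
     (\<forall>C \<in> Cell0 B. \<forall>D :: ('p, 'f, 'a, 'o3, 'm3) catpfun \<in> Cell0 (Ps_adj \<kappa> L).
        equivalence (transpose_U \<kappa> L (e C) D (P0 H C) C)))"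

end

(* A colax transformation F : U D -> C with components F_p amounts to its half forms
   F_q d -> C_mu (F_p (D^mu d)), obtained by composing the 2-cells with the units of
   D^mu -| D_mu; in this form the right adjoints D_mu disappear. Such data is exactly what
   makes mu |-> F_p (D^mu d) an object of the co-dextrification, and this object, as a function
   of d, extends F along the canonical map: hence the transpose is essentially surjective. It is
   full and faithful because a pseudonatural transformation into the co-dextrification is
   conjugate, at each mu, to its component at an identity 1-cell, via the pseudonaturality
   isomorphisms.

   The right adjoint of restriction along mu sends Gamma to the object whose value at nu is the
   limit of C_rho (Gamma^sigma) over the 2-cells alpha : mu sigma => nu rho.

   The right biadjoint acts on a 1-cell F by extending the composite of F with the canonical map.
   The transpose of this extension equals that composite on the nose, so the naturality 2-cell of
   the canonical map on 1-cells can be taken to be an identity. *)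

theory Submission imports Defs
begin

text \<open>The right adjoints in \<open>U\<close> are chosen by \<open>SOME\<close>, so nothing can
  be computed about them directly. Equations between arrows into a value of \<open>D_\<mu>\<close>
  are therefore proved after transposition along the adjunction, where mates are characterised by
  counits alone (\<open>mate\<close>, \<open>flat_inj\<close>); the axioms of \<open>U D\<close>
  turn there into those of \<open>D\<close> with inverted coherence isomorphisms.

  The obstacle to strictness is the unit constraint of \<open>D\<close>: the transpose of the
  extension of \<open>F\<close> has components \<open>F_p (D^1 d)\<close> instead of
  \<open>F_p d\<close>, and agrees with \<open>F\<close> only up to \<open>PU D\<close>. The
  co-dextrification, however, is a strict 2-functor because \<open>L\<close> is strict, so the
  discrepancy vanishes for \<open>D = codext C'\<close>; this is why the 1-cells of the right
  biadjoint extend on the nose. Its coherence 2-cells can then be defined as those whose transpose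
  is an identity, and their laws follow from faithfulness of transposition, by comparing components
  at identity 1-cells.

  The limits defining the right adjoint of restriction are indexed by cells of \<open>L\<close>, and
  they exist because \<open>L\<close> is small.\<close>

abbreviation cmp_in ("_ \<cdot>[_] _" [71, 0, 70] 70) where "g \<cdot>[C] f == Cmp C g f"
abbreviation cmp1_in ("_ \<star>[_] _" [76, 0, 75] 75) where "g \<star>[K] f == cmp1 K g f"
abbreviation vcmp_in ("_ \<bullet>[_] _" [61, 0, 60] 60) where "b \<bullet>[K] a == vcmp K b a"
abbreviation lwh_in ("_ \<triangleleft>[_] _" [66, 0, 65] 65) where "f \<triangleleft>[K] a == lwh K f a"
abbreviation rwh_in ("_ \<triangleright>[_] _" [66, 0, 67] 66) where "a \<triangleright>[K] f == rwh K a f"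

section \<open>Categories, functors and natural transformations\<close>

lemma hom_iff [simp]: "f \<in> hom C a b \<longleftrightarrow> f \<in> Ar C \<and> Src C f = a \<and> Tgt C f = b"
  by (auto simp: hom_def)

lemma cat_simps [simp]:
  assumes "category C"
  shows "f \<in> Ar C ==> Src C f \<in> Ob C" "f \<in> Ar C ==> Tgt C f \<in> Ob C"
    "a \<in> Ob C ==> Idn C a \<in> Ar C" "a \<in> Ob C ==> Src C (Idn C a) = a" "a \<in> Ob C ==> Tgt C (Idn C a) = a"
    "f \<in> Ar C ==> g \<in> Ar C ==> Src C g = Tgt C f ==> g \<cdot>[C] f \<in> Ar C"
    "f \<in> Ar C ==> g \<in> Ar C ==> Src C g = Tgt C f ==> Src C (g \<cdot>[C] f) = Src C f"
    "f \<in> Ar C ==> g \<in> Ar C ==> Src C g = Tgt C f ==> Tgt C (g \<cdot>[C] f) = Tgt C g"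
    "f \<in> Ar C ==> Src C f = a ==> f \<cdot>[C] Idn C a = f"
    "f \<in> Ar C ==> Tgt C f = a ==> Idn C a \<cdot>[C] f = f"
    "f \<in> Ar C ==> g \<in> Ar C ==> h \<in> Ar C ==> Src C g = Tgt C f ==> Src C h = Tgt C g ==>
      (h \<cdot>[C] g) \<cdot>[C] f = h \<cdot>[C] (g \<cdot>[C] f)"
  using assms unfolding category_def by auto

lemma categoryI:
  assumes "!!f. f \<in> Ar C ==> Src C f \<in> Ob C \<and> Tgt C f \<in> Ob C"
    and "!!a. a \<in> Ob C ==> Idn C a \<in> hom C a a"
    and "!!f g. f \<in> Ar C ==> g \<in> Ar C ==> Src C g = Tgt C f ==> g \<cdot>[C] f \<in> hom C (Src C f) (Tgt C g)"
    and "!!f. f \<in> Ar C ==> f \<cdot>[C] Idn C (Src C f) = f \<and> Idn C (Tgt C f) \<cdot>[C] f = f"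
    and "!!f g h. f \<in> Ar C ==> g \<in> Ar C ==> h \<in> Ar C ==> Src C g = Tgt C f ==> Src C h = Tgt C g ==>
      (h \<cdot>[C] g) \<cdot>[C] f = h \<cdot>[C] (g \<cdot>[C] f)"
  shows "category C"
  unfolding category_def using assms by blast

text \<open>Composites are normalised to the right, so an equation \<open>g f = h\<close> no longer
  matches once a further arrow \<open>k\<close> stands on the right. \<open>THEN cmpE\<close>
  produces the version that matches there; most rewriting rules below are also used in this
  form.\<close>

lemma cmpE:
  assumes "g \<cdot>[C] f = h" "category C" "f \<in> Ar C" "g \<in> Ar C" "Src C g = Tgt C f" "k \<in> Ar C" "Tgt C k = Src C f"
  shows "g \<cdot>[C] (f \<cdot>[C] k) = h \<cdot>[C] k"
  using assms by (metis cat_simps(11))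

definition isom :: "('o, 'm) cat => 'm => bool" where
  "isom C f \<longleftrightarrow> f \<in> Ar C \<and> (\<exists>g. g \<in> hom C (Tgt C f) (Src C f) \<and>
     g \<cdot>[C] f = Idn C (Src C f) \<and> f \<cdot>[C] g = Idn C (Tgt C f))"

definition ainv :: "('o, 'm) cat => 'm => 'm" where
  "ainv C f = (SOME g. g \<in> hom C (Tgt C f) (Src C f) \<and>
     g \<cdot>[C] f = Idn C (Src C f) \<and> f \<cdot>[C] g = Idn C (Tgt C f))"

lemma isomI:
  assumes "f \<in> Ar C" "g \<in> Ar C" "Src C g = Tgt C f" "Tgt C g = Src C f"
    "g \<cdot>[C] f = Idn C (Src C f)" "f \<cdot>[C] g = Idn C (Src C g)"
  shows "isom C f"
  unfolding isom_def using assms by auto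

lemma ainv [simp]:
  assumes "isom C f"
  shows "f \<in> Ar C" "ainv C f \<in> Ar C" "Src C (ainv C f) = Tgt C f" "Tgt C (ainv C f) = Src C f"
    "ainv C f \<cdot>[C] f = Idn C (Src C f)" "f \<cdot>[C] ainv C f = Idn C (Tgt C f)"
proof -
  have "\<exists>g. g \<in> hom C (Tgt C f) (Src C f) \<and> g \<cdot>[C] f = Idn C (Src C f) \<and> f \<cdot>[C] g = Idn C (Tgt C f)"
    using assms unfolding isom_def by blast
  from someI_ex[OF this] show "ainv C f \<in> Ar C" "Src C (ainv C f) = Tgt C f" "Tgt C (ainv C f) = Src C f"
    "ainv C f \<cdot>[C] f = Idn C (Src C f)" "f \<cdot>[C] ainv C f = Idn C (Tgt C f)" by (simp_all add: ainv_def)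
qed (use assms in "auto simp: isom_def")

text \<open>Bracketing \<open>g f h\<close> in two ways shows that a left inverse and a right
  inverse agree. Only one equation is asked of each, so identifying an inverse takes a single
  composite.\<close>

lemma inverse_unique:
  assumes "category C" "f \<in> Ar C" "g \<in> Ar C" "h \<in> Ar C" "Src C g = Tgt C f" "Src C h = Tgt C f" "Tgt C h = Src C f"
    "Tgt C g = Src C f" "g \<cdot>[C] f = Idn C (Src C f)" "f \<cdot>[C] h = Idn C (Tgt C f)"
  shows "g = h"
proof -
  have "g = g \<cdot>[C] (f \<cdot>[C] h)" using assms by simp
  also have "... = (g \<cdot>[C] f) \<cdot>[C] h" using assms(1-8) by simp
  finally show ?thesis using assms by simp
qed

lemma isom_cancel:
  assumes "category C" "isom C k" "f \<in> Ar C" "g \<in> Ar C" "Src C f = Tgt C k" "Src C g = Tgt C k"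
    "f \<cdot>[C] k = g \<cdot>[C] k"
  shows "f = g"
proof -
  have "(f \<cdot>[C] k) \<cdot>[C] ainv C k = (g \<cdot>[C] k) \<cdot>[C] ainv C k" using assms by simp
  then show ?thesis using assms(1-6) by simp
qed

lemma isom_cancel_left:
  assumes "category C" "isom C k" "f \<in> Ar C" "g \<in> Ar C" "Tgt C f = Src C k" "Tgt C g = Src C k"
    "k \<cdot>[C] f = k \<cdot>[C] g"
  shows "f = g"
proof -
  have "ainv C k \<cdot>[C] (k \<cdot>[C] f) = ainv C k \<cdot>[C] (k \<cdot>[C] g)" using assms by simp
  then show ?thesis using assms(1-6) by (simp add: ainv(5)[THEN cmpE])
qed

lemma isom_Idn: "category C ==> a \<in> Ob C ==> isom C (Idn C a)"
  by (rule isomI[where g = "Idn C a"]) auto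

lemma isom_cmp:
  assumes "category C" "isom C f" "isom C g" "Src C g = Tgt C f"
  shows "isom C (g \<cdot>[C] f)"
  by (rule isomI[where g = "ainv C f \<cdot>[C] ainv C g"])
    (use assms in "simp_all add: ainv(5,6)[THEN cmpE]")

lemma functorD:
  assumes "is_functor F"
  shows "category (FDom F)" "category (FCod F)" "FO F \<in> extensional (Ob (FDom F))" "FA F \<in> extensional (Ar (FDom F))"
  using assms unfolding is_functor_def Let_def by (auto simp: PiE_def)

lemma functor_simps [simp]:
  assumes "is_functor F"
  shows "FCod F = D ==> x \<in> Ob (FDom F) ==> FO F x \<in> Ob D"
    "FCod F = D ==> u \<in> Ar (FDom F) ==> FA F u \<in> Ar D"
    "FCod F = D ==> u \<in> Ar (FDom F) ==> Src D (FA F u) = FO F (Src (FDom F) u)"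
    "FCod F = D ==> u \<in> Ar (FDom F) ==> Tgt D (FA F u) = FO F (Tgt (FDom F) u)"
    "FDom F = C ==> x \<in> Ob C ==> FA F (Idn C x) = Idn (FCod F) (FO F x)"
    "FDom F = C ==> u \<in> Ar C ==> v \<in> Ar C ==> Src C v = Tgt C u ==>
      FA F (v \<cdot>[C] u) = FA F v \<cdot>[FCod F] FA F u"
  using assms unfolding is_functor_def Let_def by (auto simp: PiE_def)

lemma functorI:
  assumes "category (FDom F)" "category (FCod F)" "FO F \<in> extensional (Ob (FDom F))" "FA F \<in> extensional (Ar (FDom F))"
    "!!x. x \<in> Ob (FDom F) ==> FO F x \<in> Ob (FCod F)"
    "!!u. u \<in> Ar (FDom F) ==> FA F u \<in> hom (FCod F) (FO F (Src (FDom F) u)) (FO F (Tgt (FDom F) u))"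
    "!!x. x \<in> Ob (FDom F) ==> FA F (Idn (FDom F) x) = Idn (FCod F) (FO F x)"
    "!!u v. u \<in> Ar (FDom F) ==> v \<in> Ar (FDom F) ==> Src (FDom F) v = Tgt (FDom F) u ==>
      FA F (v \<cdot>[FDom F] u) = FA F v \<cdot>[FCod F] FA F u"
  shows "is_functor F"
  unfolding is_functor_def Let_def using assms by (auto simp: PiE_def)

text \<open>The companion of \<open>cmpE\<close> under a functor: the simplifier expands the image
  of a composite, so an equation has to be restated between composites of images before it can
  rewrite. Chains such as \<open>THEN FA_eq, THEN FA_eq, THEN cmpE\<close> apply it under several
  functors and then inside a longer composite.\<close>

lemma FA_eq:
  assumes "v \<cdot>[C] u = w" "is_functor F" "FDom F = C" "FCod F = D" "u \<in> Ar C" "v \<in> Ar C" "Src C v = Tgt C u"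
  shows "FA F v \<cdot>[D] FA F u = FA F w"
  using assms by (metis functor_simps(6))

lemma isom_FA:
  assumes "is_functor F" "FDom F = C" "FCod F = D" "isom C u"
  shows "isom D (FA F u)"
  by (rule isomI[where g = "FA F (ainv C u)"])
    (use assms functorD[OF assms(1)] in "simp_all add: ainv(5,6)[THEN FA_eq]")

lemma ftr_eqI:
  assumes "is_functor F" "is_functor G" "FDom F = FDom G" "FCod F = FCod G"
    "!!x. x \<in> Ob (FDom F) ==> FO F x = FO G x" "!!u. u \<in> Ar (FDom F) ==> FA F u = FA G u"
  shows "F = G"
  using functorD[OF assms(1)] functorD[OF assms(2)] assms(3-6)
  by (intro ftr.equality) (auto intro: extensionalityI)

lemma id_ftr_simps [simp]:
  "FDom (id_ftr C) = C" "FCod (id_ftr C) = C" "x \<in> Ob C ==> FO (id_ftr C) x = x"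
  "u \<in> Ar C ==> FA (id_ftr C) u = u"
  by (simp_all add: id_ftr_def)

lemma id_ftr_functor [simp]: "category C ==> is_functor (id_ftr C)"
  by (rule functorI) (auto simp: id_ftr_def)

lemma comp_ftr_simps [simp]:
  "FDom (G \<odot> F) = FDom F" "FCod (G \<odot> F) = FCod G" "x \<in> Ob (FDom F) ==> FO (G \<odot> F) x = FO G (FO F x)"
  "u \<in> Ar (FDom F) ==> FA (G \<odot> F) u = FA G (FA F u)"
  by (simp_all add: comp_ftr_def)

lemma comp_ftr_functor [simp]:
  assumes "is_functor F" "is_functor G" "FDom G = FCod F" shows "is_functor (G \<odot> F)"
proof -
  have C: "category (FDom F)" "category (FCod F)" "category (FCod G)" using assms functorD by auto
  show ?thesis by (rule functorI) (use C assms in "auto simp: comp_ftr_def")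
qed

lemma comp_ftr_assoc [simp]:
  assumes "is_functor F" "FDom G = FCod F" shows "(H \<odot> G) \<odot> F = H \<odot> (G \<odot> F)"
  using assms by (auto simp: comp_ftr_def fun_eq_iff)

lemma comp_id_ftr [simp]:
  "is_functor F ==> FCod F = D ==> id_ftr D \<odot> F = F" "is_functor F ==> FDom F = C ==> F \<odot> id_ftr C = F"
  using functorD[of F] by (auto intro!: ftr.equality simp: comp_ftr_def extensional_def fun_eq_iff)

lemma nattransD:
  assumes "nattrans ta"
  shows "is_functor (NDom ta)" "is_functor (NCod ta)" "FDom (NCod ta) = FDom (NDom ta)"
    "FCod (NCod ta) = FCod (NDom ta)" "NC ta \<in> extensional (Ob (FDom (NDom ta)))"
  using assms unfolding nattrans_def Let_def by auto

lemma nattrans_simps [simp]: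
  assumes "nattrans ta"
  shows "FCod (NDom ta) = D ==> a \<in> Ob (FDom (NDom ta)) ==> NC ta a \<in> Ar D"
    "FCod (NDom ta) = D ==> a \<in> Ob (FDom (NDom ta)) ==> Src D (NC ta a) = FO (NDom ta) a"
    "FCod (NDom ta) = D ==> a \<in> Ob (FDom (NDom ta)) ==> Tgt D (NC ta a) = FO (NCod ta) a"
  using assms unfolding nattrans_def Let_def by auto

lemma naturality:
  assumes "nattrans ta" "u \<in> Ar (FDom (NDom ta))" "FDom (NDom ta) = C" "FCod (NDom ta) = D" 
    "Src C u = a" "Tgt C u = b"
  shows "FA (NCod ta) u \<cdot>[D] NC ta a = NC ta b \<cdot>[D] FA (NDom ta) u"
  using assms unfolding nattrans_def Let_def by auto

lemma nattransI:
  assumes "is_functor (NDom ta)" "is_functor (NCod ta)" "FDom (NCod ta) = FDom (NDom ta)"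
    "FCod (NCod ta) = FCod (NDom ta)" "NC ta \<in> extensional (Ob (FDom (NDom ta)))"
    "!!a. a \<in> Ob (FDom (NDom ta)) ==> NC ta a \<in> hom (FCod (NDom ta)) (FO (NDom ta) a) (FO (NCod ta) a)"
    "!!u. u \<in> Ar (FDom (NDom ta)) ==> FA (NCod ta) u \<cdot>[FCod (NDom ta)] NC ta (Src (FDom (NDom ta)) u) =
       NC ta (Tgt (FDom (NDom ta)) u) \<cdot>[FCod (NDom ta)] FA (NDom ta) u"
  shows "nattrans ta"
  unfolding nattrans_def Let_def using assms by blast

lemma nats_iff [simp]: "ta \<in> nats F G \<longleftrightarrow> nattrans ta \<and> NDom ta = F \<and> NCod ta = G"
  by (auto simp: nats_def)

lemma ntr_eqI:
  assumes "nattrans ta" "nattrans si" "NDom ta = NDom si" "NCod ta = NCod si"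
    "!!a. a \<in> Ob (FDom (NDom ta)) ==> NC ta a = NC si a"
  shows "ta = si"
  using nattransD[OF assms(1)] nattransD[OF assms(2)] assms(3-5)
  by (intro ntr.equality) (auto intro: extensionalityI)

lemma id_ntr_simps [simp]:
  "NDom (id_ntr F) = F" "NCod (id_ntr F) = F" "a \<in> Ob (FDom F) ==> NC (id_ntr F) a = Idn (FCod F) (FO F a)"
  by (simp_all add: id_ntr_def)

lemma vcomp_ntr_simps [simp]:
  "NDom (ta \<bullet>\<^sub>N si) = NDom si" "NCod (ta \<bullet>\<^sub>N si) = NCod ta"
  "a \<in> Ob (FDom (NDom si)) ==> NC (ta \<bullet>\<^sub>N si) a = NC ta a \<cdot>[FCod (NDom si)] NC si a"
  by (simp_all add: vcomp_ntr_def)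

lemma lwh_ntr_simps [simp]:
  "NDom (G \<triangleleft>\<^sub>N ta) = G \<odot> NDom ta" "NCod (G \<triangleleft>\<^sub>N ta) = G \<odot> NCod ta"
  "a \<in> Ob (FDom (NDom ta)) ==> NC (G \<triangleleft>\<^sub>N ta) a = FA G (NC ta a)"
  by (simp_all add: lwh_ntr_def)

lemma rwh_ntr_simps [simp]:
  "NDom (ta \<triangleright>\<^sub>N F) = NDom ta \<odot> F" "NCod (ta \<triangleright>\<^sub>N F) = NCod ta \<odot> F"
  "a \<in> Ob (FDom F) ==> NC (ta \<triangleright>\<^sub>N F) a = NC ta (FO F a)"
  by (simp_all add: rwh_ntr_def)

lemma id_ntr_nattrans [simp]: assumes "is_functor F" shows "nattrans (id_ntr F)"
proof -
  note functorD[OF assms]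
  then show ?thesis by (intro nattransI) (use assms in "auto simp: id_ntr_def")
qed

lemma vcomp_nattrans [simp]:
  assumes "nattrans ta" "nattrans si" "NDom ta = NCod si" shows "nattrans (ta \<bullet>\<^sub>N si)"
proof -
  note D = nattransD[OF assms(1)] nattransD[OF assms(2)] 
  note C = functorD[OF D(1)] functorD[OF D(6)]
  have 1: "FA (NCod ta) u \<cdot>[FCod (NDom si)] NC ta (Src (FDom (NDom si)) u) = NC ta (Tgt (FDom (NDom si)) u) \<cdot>[FCod (NDom si)] FA (NCod si) u"
    if "u \<in> Ar (FDom (NDom si))" for u using naturality[OF assms(1), of u _ "FCod (NDom si)"] that assms D by auto
  have 2: "FA (NCod si) u \<cdot>[FCod (NDom si)] NC si (Src (FDom (NDom si)) u) = NC si (Tgt (FDom (NDom si)) u) \<cdot>[FCod (NDom si)] FA (NDom si) u"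
    if "u \<in> Ar (FDom (NDom si))" for u by (rule naturality) (use that assms in auto)
  show ?thesis
    by (rule nattransI)
      (use D C assms in "auto simp: vcomp_ntr_def 1[THEN cmpE] 2 2[THEN cmpE]")
qed

lemma lwh_nattrans [simp]:
  assumes "nattrans ta" "is_functor G" "FDom G = FCod (NDom ta)" shows "nattrans (G \<triangleleft>\<^sub>N ta)"
proof -
  note D = nattransD[OF assms(1)] 
  note C = functorD[OF D(1)] functorD[OF assms(2)]
  have 1: "FA (NCod ta) u \<cdot>[FCod (NDom ta)] NC ta (Src (FDom (NDom ta)) u) = NC ta (Tgt (FDom (NDom ta)) u) \<cdot>[FCod (NDom ta)] FA (NDom ta) u"
    if "u \<in> Ar (FDom (NDom ta))" for u by (rule naturality) (use that assms in auto)
  show ?thesis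
    by (rule nattransI)
      (use D C assms in "auto simp: lwh_ntr_def 1[THEN FA_eq]")
qed

lemma rwh_nattrans [simp]:
  assumes "nattrans ta" "is_functor F" "FCod F = FDom (NDom ta)" shows "nattrans (ta \<triangleright>\<^sub>N F)"
proof -
  note D = nattransD[OF assms(1)] 
  note C = functorD[OF D(1)] functorD[OF assms(2)]
  have 1: "FA (NCod ta) u \<cdot>[FCod (NDom ta)] NC ta (Src (FDom (NDom ta)) u) = NC ta (Tgt (FDom (NDom ta)) u) \<cdot>[FCod (NDom ta)] FA (NDom ta) u"
    if "u \<in> Ar (FDom (NDom ta))" for u by (rule naturality) (use that assms in auto)
  have 2: "FA (NCod ta) (FA F u) \<cdot>[FCod (NDom ta)] NC ta (FO F (Src (FDom F) u)) = NC ta (FO F (Tgt (FDom F) u)) \<cdot>[FCod (NDom ta)] FA (NDom ta) (FA F u)"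
    if "u \<in> Ar (FDom F)" for u using 1[of "FA F u"] that assms by simp
  show ?thesis
    by (rule nattransI)
      (use D C assms in "auto simp: rwh_ntr_def 2")
qed

lemma inverse_ntrD:
  assumes "nattrans ta" "inverse_ntr ta si" "a \<in> Ob (FDom (NDom ta))" "FCod (NDom ta) = D"
  shows "NC si a \<cdot>[D] NC ta a = Idn D (FO (NDom ta) a)" "NC ta a \<cdot>[D] NC si a = Idn D (FO (NCod ta) a)"
proof -
  have *: "si \<bullet>\<^sub>N ta = id_ntr (NDom ta)" "ta \<bullet>\<^sub>N si = id_ntr (NCod ta)" "NDom si = NCod ta" using assms by (auto simp: inverse_ntr_def)
  show "NC si a \<cdot>[D] NC ta a = Idn D (FO (NDom ta) a)" "NC ta a \<cdot>[D] NC si a = Idn D (FO (NCod ta) a)"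
    using arg_cong[OF *(1), of "\<lambda>t. NC t a"] arg_cong[OF *(2), of "\<lambda>t. NC t a"] assms(3,4) *(3)
      nattransD[OF assms(1)] by auto
qed

lemma inv_ntr_inverse:
  assumes "iso_ntr ta" shows "inverse_ntr ta (inv_ntr ta)"
proof -
  have n: "nattrans ta" using assms by (simp add: iso_ntr_def)
  note D = nattransD[OF n] and C = functorD(2)[OF nattransD(1)[OF n]]
  obtain si where s: "inverse_ntr ta si" using assms by (auto simp: iso_ntr_def)
  \<comment> \<open>\<open>inv_ntr\<close> is a definite description, so uniqueness of the inverse
    is needed; it holds componentwise.\<close>
  have "rh = si" if "inverse_ntr ta rh" for rh
  proof (rule ntr_eqI)
    show 1: "nattrans rh" "nattrans si" and 2: "NDom rh = NDom si" "NCod rh = NCod si" using that s by (auto simp: inverse_ntr_def)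
    have 3: "NDom rh = NCod ta" "NDom si = NCod ta" "NCod rh = NDom ta" "NCod si = NDom ta" using that s by (auto simp: inverse_ntr_def)
    fix a assume a: "a \<in> Ob (FDom (NDom rh))"
    show "NC rh a = NC si a"
      by (rule inverse_unique[of "FCod (NDom ta)" "NC ta a"])
        (use a 1 2 3 n D C inverse_ntrD[OF n that, of a] inverse_ntrD[OF n s, of a] in auto)
  qed
  then show ?thesis unfolding inv_ntr_def using s by (metis theI)
qed

lemma inv_ntr [simp]:
  assumes "iso_ntr ta"
  shows "nattrans (inv_ntr ta)" "NDom (inv_ntr ta) = NCod ta" "NCod (inv_ntr ta) = NDom ta" "nattrans ta"
    "a \<in> Ob (FDom (NDom ta)) ==> FCod (NDom ta) = D ==> NC (inv_ntr ta) a \<cdot>[D] NC ta a = Idn D (FO (NDom ta) a)"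
    "a \<in> Ob (FDom (NDom ta)) ==> FCod (NDom ta) = D ==> NC ta a \<cdot>[D] NC (inv_ntr ta) a = Idn D (FO (NCod ta) a)"
  using inv_ntr_inverse[OF assms] inverse_ntrD[OF _ inv_ntr_inverse[OF assms]] assms
  by (auto simp: inverse_ntr_def iso_ntr_def)

lemma inv_ntr_iso: "iso_ntr ta ==> iso_ntr (inv_ntr ta)"
  using inv_ntr_inverse[of ta] inv_ntr[of ta] unfolding iso_ntr_def inverse_ntr_def by auto

lemma iso_ntr_isom:
  assumes "iso_ntr ta" "a \<in> Ob (FDom (NDom ta))" "FCod (NDom ta) = D" shows "isom D (NC ta a)"
  by (rule isomI[where g = "NC (inv_ntr ta) a"])
    (use assms nattransD[OF inv_ntr(4)[OF assms(1)]] in auto)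

text \<open>Naturality of the componentwise inverses comes for free: after composition with the
  invertible component it is the naturality square of \<open>ta\<close>.\<close>

lemma iso_ntrI:
  assumes n: "nattrans ta" and i: "!!a. a \<in> Ob (FDom (NDom ta)) ==> isom (FCod (NDom ta)) (NC ta a)"
  shows "iso_ntr ta"
proof -
  let ?si = "\<lparr>NDom = NCod ta, NCod = NDom ta, NC = (\<lambda>a \<in> Ob (FDom (NDom ta)). ainv (FCod (NDom ta)) (NC ta a))\<rparr>"
  note D = nattransD[OF n] and C = functorD(1,2)[OF nattransD(1)[OF n]]
  have nat: "FA (NDom ta) u \<cdot>[FCod (NDom ta)] ainv (FCod (NDom ta)) (NC ta (Src (FDom (NDom ta)) u)) =
     ainv (FCod (NDom ta)) (NC ta (Tgt (FDom (NDom ta)) u)) \<cdot>[FCod (NDom ta)] FA (NCod ta) u" (is "?l = ?r") if u: "u \<in> Ar (FDom (NDom ta))" for u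
  proof -
    note nn = naturality[OF n u refl refl refl refl]
    have T: "isom (FCod (NDom ta)) (NC ta (Src (FDom (NDom ta)) u))" "isom (FCod (NDom ta)) (NC ta (Tgt (FDom (NDom ta)) u))"
      using i u C by auto
    show ?thesis
      by (rule isom_cancel_left[OF C(2) T(2)])
        (use T u C D n in "simp_all add: nn[symmetric, THEN cmpE] ainv(5,6)[THEN cmpE]")
  qed
  have s: "nattrans ?si"
    by (rule nattransI) (use D C i nat n in auto)
  have "inverse_ntr ta ?si"
    unfolding inverse_ntr_def
    by (intro conjI ntr_eqI) (use s D C i n in auto)
  then show ?thesis using n by (auto simp: iso_ntr_def)
qed

lemma inv_ntr_naturality:
  assumes "iso_ntr ta" "u \<in> Ar (FDom (NDom ta))" "FDom (NDom ta) = C" "FCod (NDom ta) = D" "Src C u = a" "Tgt C u = b"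
  shows "FA (NDom ta) u \<cdot>[D] NC (inv_ntr ta) a = NC (inv_ntr ta) b \<cdot>[D] FA (NCod ta) u"
  using naturality[OF inv_ntr(1)[OF assms(1)], of u C D a b] assms nattransD[OF inv_ntr(4)[OF assms(1)]] by simp

section \<open>Limits\<close>

lemma cone_iff:
  "cone G c l \<longleftrightarrow> c \<in> Ob (FCod G) \<and> (\<forall>j \<in> Ob (FDom G). l j \<in> hom (FCod G) c (FO G j)) \<and>
     (\<forall>u \<in> Ar (FDom G). FA G u \<cdot>[FCod G] l (Src (FDom G) u) = l (Tgt (FDom G) u))"
  by (simp add: cone_def Let_def)

lemma limit_coneD:
  assumes "limit_cone G c l"
  shows "cone G c l" "c \<in> Ob (FCod G)" "!!j. j \<in> Ob (FDom G) ==> l j \<in> hom (FCod G) c (FO G j)"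
  using assms by (auto simp: limit_cone_def cone_iff)

lemma limit_cone_lift:
  assumes "limit_cone G c l" "cone G c' l'"
  obtains h where "h \<in> hom (FCod G) c' c" "!!j. j \<in> Ob (FDom G) ==> l j \<cdot>[FCod G] h = l' j"
  using assms unfolding limit_cone_def by meson

text \<open>Both arrows are lifts of the cone with legs \<open>l j h\<close>, so the uniqueness
  clause identifies them.\<close>

lemma limit_cone_joint_monic:
  assumes "limit_cone G c l" "is_functor G" "h \<in> hom (FCod G) c' c" "h' \<in> hom (FCod G) c' c"
    "!!j. j \<in> Ob (FDom G) ==> l j \<cdot>[FCod G] h = l j \<cdot>[FCod G] h'"
  shows "h = h'"
proof -
  note C = functorD(1,2)[OF assms(2)]
  have "cone G c' (\<lambda>j. l j \<cdot>[FCod G] h)"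
    using limit_coneD[OF assms(1)] assms(2,3) C by (auto simp: cone_iff cmpE)
  then show ?thesis using assms unfolding limit_cone_def by (metis (no_types, lifting))
qed

lemma limit_coneI:
  assumes "cone G c l"
    "!!c' l'. cone G c' l' ==> \<exists>h \<in> hom (FCod G) c' c. \<forall>j \<in> Ob (FDom G). l j \<cdot>[FCod G] h = l' j"
    "!!c' h h'. h \<in> hom (FCod G) c' c ==> h' \<in> hom (FCod G) c' c ==>
      (!!j. j \<in> Ob (FDom G) ==> l j \<cdot>[FCod G] h = l j \<cdot>[FCod G] h') ==> h = h'"
  shows "limit_cone G c l"
  unfolding limit_cone_def
proof (intro conjI allI impI)
  fix c' l' assume "cone G c' l'"
  from assms(2)[OF this] obtain h where h: "h \<in> hom (FCod G) c' c" "\<forall>j \<in> Ob (FDom G). l j \<cdot>[FCod G] h = l' j" by blast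
  show "\<exists>!h. h \<in> hom (FCod G) c' c \<and> (\<forall>j \<in> Ob (FDom G). l j \<cdot>[FCod G] h = l' j)"
  proof (rule ex1I)
    show "h \<in> hom (FCod G) c' c \<and> (\<forall>j \<in> Ob (FDom G). l j \<cdot>[FCod G] h = l' j)" using h by blast
    fix h' assume "h' \<in> hom (FCod G) c' c \<and> (\<forall>j \<in> Ob (FDom G). l j \<cdot>[FCod G] h' = l' j)"
    then show "h' = h" using h by (auto intro: assms(3)[of _ c'])
  qed
qed (rule assms(1))

lemma limit_cone_cong:
  assumes "limit_cone G c l" "is_functor G" "!!j. j \<in> Ob (FDom G) ==> l j = l' j"
  shows "limit_cone G c l'"
proof -
  have "cone G c' l \<longleftrightarrow> cone G c' l'" for c' using assms(3) functorD(1)[OF assms(2)] by (auto simp: cone_iff)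
  then show ?thesis using assms unfolding limit_cone_def by simp
qed

lemma limit_cone_unique:
  assumes "limit_cone G c l" "limit_cone G c' l'" "is_functor G"
  obtains h where "isom (FCod G) h" "h \<in> hom (FCod G) c' c" "!!j. j \<in> Ob (FDom G) ==> l j \<cdot>[FCod G] h = l' j"
proof -
  note C = functorD(1,2)[OF assms(3)]
  note l = limit_coneD[OF assms(1)] and l' = limit_coneD[OF assms(2)]
  obtain h where h: "h \<in> hom (FCod G) c' c" "!!j. j \<in> Ob (FDom G) ==> l j \<cdot>[FCod G] h = l' j"
    using limit_cone_lift[OF assms(1) l'(1)] by blast
  obtain k where k: "k \<in> hom (FCod G) c c'" "!!j. j \<in> Ob (FDom G) ==> l' j \<cdot>[FCod G] k = l j"
    using limit_cone_lift[OF assms(2) l(1)] by blast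
  have "h \<cdot>[FCod G] k = Idn (FCod G) c"
    by (rule limit_cone_joint_monic[OF assms(1,3)]) (use h k l C in "auto simp: h(2)[THEN cmpE]")
  moreover have "k \<cdot>[FCod G] h = Idn (FCod G) c'"
    by (rule limit_cone_joint_monic[OF assms(2,3)]) (use h k l' C in "auto simp: k(2)[THEN cmpE]")
  ultimately have "isom (FCod G) h" using h k by (intro isomI[where g = k]) auto
  then show ?thesis using that h by blast
qed

lemma limit_cone_iso:
  assumes "limit_cone G c l" "is_functor G" "isom (FCod G) h" "Tgt (FCod G) h = c" "Src (FCod G) h = c'"
    "!!j. j \<in> Ob (FDom G) ==> l' j = l j \<cdot>[FCod G] h"
  shows "limit_cone G c' l'"
proof (rule limit_coneI)
  note C = functorD(1,2)[OF assms(2)]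
  note l = limit_coneD[OF assms(1)]
  show "cone G c' l'" using l(1) assms C by (auto simp: cone_iff cmpE)
  fix c'' 
  { fix l'' assume "cone G c'' l''"
    then obtain k where k: "k \<in> hom (FCod G) c'' c" "!!j. j \<in> Ob (FDom G) ==> l j \<cdot>[FCod G] k = l'' j"
      using limit_cone_lift[OF assms(1)] by blast
    show "\<exists>h \<in> hom (FCod G) c'' c'. \<forall>j \<in> Ob (FDom G). l' j \<cdot>[FCod G] h = l'' j"
      by (rule bexI[of _ "ainv (FCod G) h \<cdot>[FCod G] k"])
        (use C l k assms in "auto simp: ainv(6)[THEN cmpE]") }
  fix k k' assume k: "k \<in> hom (FCod G) c'' c'" "k' \<in> hom (FCod G) c'' c'"
    "!!j. j \<in> Ob (FDom G) ==> l' j \<cdot>[FCod G] k = l' j \<cdot>[FCod G] k'"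
  have "h \<cdot>[FCod G] k = h \<cdot>[FCod G] k'"
    by (rule limit_cone_joint_monic[OF assms(1,2)]) (use k l C assms in "auto")
  then show "k = k'" using isom_cancel_left[OF C(2) assms(3)] k assms by auto
qed

lemma cone_image:
  assumes "cone G c l" "is_functor G" "is_functor F" "FCod G = FDom F"
  shows "cone (F \<odot> G) (FO F c) (\<lambda>j. FA F (l j))"
  using assms functorD[OF assms(2)] by (auto simp: cone_iff FA_eq)

text \<open>One preserved limit cone per diagram suffices: any other limit cone differs from it by
  an isomorphism, which \<open>F\<close> preserves.\<close>

lemma preserves_small_limitsI:
  fixes kp :: "'k rel" and F :: "('o1,'m1,'o2,'m2) ftr"
  assumes "is_functor F"
    "!!G :: ('k,'k,'o1,'m1) ftr. small_diagram kp G ==> FCod G = FDom F ==>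
      \<exists>c l. limit_cone G c l \<and> limit_cone (F \<odot> G) (FO F c) (\<lambda>j. FA F (l j))"
  shows "preserves_small_limits kp F"
  unfolding preserves_small_limits_def
proof (intro allI impI)
  fix G :: "('k,'k,'o1,'m1) ftr" and c l
  assume G: "small_diagram kp G" "FCod G = FDom F" and l: "limit_cone G c l"
  from assms(2)[OF G] obtain c' l' where l': "limit_cone G c' l'"
    "limit_cone (F \<odot> G) (FO F c') (\<lambda>j. FA F (l' j))" by blast
  have fG: "is_functor G" using G by (simp add: small_diagram_def)
  obtain h where h: "isom (FCod G) h" "h \<in> hom (FCod G) c c'" "!!j. j \<in> Ob (FDom G) ==> l' j \<cdot>[FCod G] h = l j"
    using limit_cone_unique[OF l'(1) l fG] by blast
  note C = functorD(1,2)[OF assms(1)]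
  show "limit_cone (F \<odot> G) (FO F c) (\<lambda>j. FA F (l j))"
    by (rule limit_cone_iso[OF l'(2), where h = "FA F h"])
      (use C assms(1) G h limit_coneD(3)[OF l'(1)] fG in \<open>auto simp: isom_FA[of F "FDom F"] h(3)[THEN FA_eq]\<close>)
qed

lemma lex_ftrD: assumes "lex_ftr kp F" shows "is_functor F" "has_small_limits kp (FDom F)" "has_small_limits kp (FCod F)" "preserves_small_limits kp F"
  using assms by (auto simp: lex_ftr_def)

lemma has_small_limits_category: "has_small_limits kp C ==> category C" by (simp add: has_small_limits_def)

lemma comp_small_diagram:
  "small_diagram kp G ==> is_functor F ==> FDom F = FCod G ==> small_diagram kp (F \<odot> G)"
  by (auto simp: small_diagram_def)

lemma lex_id_ftr [simp]:
  fixes kp :: "'k rel" and C :: "('o,'m) cat"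
  assumes "has_small_limits kp C" shows "lex_ftr kp (id_ftr C)"
proof -
  have "preserves_small_limits kp (id_ftr C)"
    unfolding preserves_small_limits_def
  proof (intro allI impI)
    fix G :: "('k,'k,'o,'m) ftr" and c l
    assume *: "small_diagram kp G" "FCod G = FDom (id_ftr C)" "limit_cone G c l"
    then have G: "is_functor G" "FCod G = C" by (auto simp: small_diagram_def)
    show "limit_cone (id_ftr C \<odot> G) (FO (id_ftr C) c) (\<lambda>j. FA (id_ftr C) (l j))"
      using G limit_coneD[OF *(3)] by (auto intro: limit_cone_cong[OF *(3)])
  qed
  then show ?thesis using assms by (auto simp: lex_ftr_def has_small_limits_category)
qed

lemma lex_comp_ftr [simp]:
  assumes "lex_ftr kp F" "lex_ftr kp G" "FDom G = FCod F" shows "lex_ftr kp (G \<odot> F)"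
proof -
  note F = lex_ftrD[OF assms(1)] and G = lex_ftrD[OF assms(2)]
  have "preserves_small_limits kp (G \<odot> F)"
    unfolding preserves_small_limits_def
  proof (intro allI impI)
    fix H :: "('a,'a,'b,'c) ftr" and c l
    assume H: "small_diagram kp H" "FCod H = FDom (G \<odot> F)" and l: "limit_cone H c l"
    have f: "is_functor H" using H by (simp add: small_diagram_def)
    have 1: "limit_cone (F \<odot> H) (FO F c) (\<lambda>j. FA F (l j))"
      using F(4) H l unfolding preserves_small_limits_def by simp
    have 2: "limit_cone (G \<odot> F \<odot> H) (FO G (FO F c)) (\<lambda>j. FA G (FA F (l j)))"
      using G(4) 1 assms H F f comp_small_diagram[OF H(1) F(1)] unfolding preserves_small_limits_def by simp
    show "limit_cone ((G \<odot> F) \<odot> H) (FO (G \<odot> F) c) (\<lambda>j. FA (G \<odot> F) (l j))"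
      using limit_cone_cong[OF 2] f H F G limit_coneD[OF l] assms by simp
  qed
  then show ?thesis using F G assms by (auto simp: lex_ftr_def)
qed

text \<open>The index categories of small diagrams live over the type of the cardinal; a diagram over
  any other index types is first transported along an injection.\<close>

lemma small_index_limits:
  fixes G :: "('v,'e,'o,'m) ftr" and kp :: "'k rel" and F :: "('o,'m,'o2,'m2) ftr"
  assumes "Card_order kp" and G: "is_functor G" and "|Ob (FDom G)| <o kp" "|Ar (FDom G)| <o kp"
  shows "has_small_limits kp (FCod G) ==> \<exists>c l. limit_cone G c l"
    and "limit_cone G c l ==> lex_ftr kp F ==> FDom F = FCod G ==> limit_cone (F \<odot> G) (FO F c) (\<lambda>j. FA F (l j))"
proof -
  define J where "J = FDom G"
  have cJ: "category J" using functorD[OF G] J_def by simp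
  \<comment> \<open>\<open>Field kp\<close> has cardinality \<open>kp\<close>, so the objects and
    the arrows of the index category inject into the type of the cardinal.\<close>
  have "|Ob J| \<le>o |Field kp|" "|Ar J| \<le>o |Field kp|"
    using assms J_def card_of_Field_ordIso[OF assms(1)] by (meson ordLeq_ordIso_trans ordIso_symmetric ordLess_imp_ordLeq)+
  then obtain i a where i: "inj_on i (Ob J)" and a: "inj_on a (Ar J)" and "i ` Ob J \<subseteq> Field kp" "a ` Ar J \<subseteq> Field kp"
    unfolding card_of_ordLeq[symmetric] by blast
  define i' where "i' = inv_into (Ob J) i" define a' where "a' = inv_into (Ar J) a"
  have i'[simp]: "x \<in> Ob J ==> i' (i x) = x" and a'[simp]: "u \<in> Ar J ==> a' (a u) = u" for x u
    using i a by (auto simp: i'_def a'_def)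
  define K :: "('k,'k) cat" where "K = \<lparr>Ob = i ` Ob J, Ar = a ` Ar J, Src = \<lambda>x. i (Src J (a' x)), Tgt = \<lambda>x. i (Tgt J (a' x)),
     Idn = \<lambda>x. a (Idn J (i' x)), Cmp = \<lambda>g f. a (a' g \<cdot>[J] a' f)\<rparr>"
  have inj: "x \<in> Ob J ==> y \<in> Ob J ==> i x = i y \<longleftrightarrow> x = y" for x y using i by (auto dest: inj_onD)
  have inja: "x \<in> Ar J ==> y \<in> Ar J ==> a x = a y \<longleftrightarrow> x = y" for x y using a by (auto dest: inj_onD)
  have cK: "category K"
    by (rule categoryI) (use cJ inj in "auto simp: K_def")
  \<comment> \<open>\<open>T\<close> and \<open>T2\<close> are the same reindexing. A constant
    defined inside a proof has a fixed type, and the diagrams \<open>G\<close> and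
    \<open>F \<odot> G\<close> live in categories over different types, hence two copies.\<close>
  define T :: "('v,'e,'o,'m) ftr => ('k,'k,'o,'m) ftr" where 
    "T H = \<lparr>FDom = K, FCod = FCod H, FO = (\<lambda>x \<in> Ob K. FO H (i' x)), FA = (\<lambda>x \<in> Ar K. FA H (a' x))\<rparr>" for H
  define T2 :: "('v,'e,'o2,'m2) ftr => ('k,'k,'o2,'m2) ftr" where 
    "T2 H = \<lparr>FDom = K, FCod = FCod H, FO = (\<lambda>x \<in> Ob K. FO H (i' x)), FA = (\<lambda>x \<in> Ar K. FA H (a' x))\<rparr>" for H
  have fT: "is_functor (T G)"
    by (rule functorI) (use cK cJ inj inja G functorD[OF G] J_def in "auto simp: T_def K_def")
  have "|i ` Ob J| <o kp" "|a ` Ar J| <o kp" using assms(3,4) J_def by (auto intro: ordLeq_ordLess_trans[OF card_of_image])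
  then have sT: "small_diagram kp (T G)" using fT by (auto simp: small_diagram_def T_def K_def)
  have cone1: "cone (T G) c' l' \<longleftrightarrow> cone G c' (\<lambda>j. l' (i j))" for c' l'
    using cJ by (auto simp: cone_iff T_def K_def J_def[symmetric])
  have cone2: "cone (T2 H) c' l' \<longleftrightarrow> cone H c' (\<lambda>j. l' (i j))" if "FDom H = J" for H c' l'
    using cJ that by (auto simp: cone_iff T2_def K_def)
  have bk: "cone H c' (\<lambda>j. l' (i' (i j))) \<longleftrightarrow> cone H c' l'" if "FDom H = J" for H :: "('v,'e,'o2,'m2) ftr" and c' l'
    using cJ that by (auto simp: cone_iff)
  have bk1: "cone G c' (\<lambda>j. l' (i' (i j))) \<longleftrightarrow> cone G c' l'" for c' l'
    using cJ J_def by (auto simp: cone_iff)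
  have lim1: "limit_cone (T G) c' l' \<longleftrightarrow> limit_cone G c' (\<lambda>j. l' (i j))" for c' l'
  proof
    assume *: "limit_cone (T G) c' l'"
    then show "limit_cone G c' (\<lambda>j. l' (i j))"
      unfolding limit_cone_def cone1
    proof (intro conjI allI impI; elim conjE)
      fix c'' l'' assume "cone G c'' l''" and u: "\<forall>c'a l'a. cone G c'a (\<lambda>j. l'a (i j)) \<longrightarrow>
         (\<exists>!h. h \<in> hom (FCod (T G)) c'a c' \<and> (\<forall>j\<in>Ob (FDom (T G)). l' j \<cdot>[FCod (T G)] h = l'a j))"
      then have "cone G c'' (\<lambda>j. (l'' \<circ> i') (i j))" using bk1 by simp
      from u[rule_format, OF this] show "\<exists>!h. h \<in> hom (FCod G) c'' c' \<and> (\<forall>j\<in>Ob (FDom G). l' (i j) \<cdot>[FCod G] h = l'' j)"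
        by (simp add: T_def K_def J_def[symmetric])
    qed
  next
    assume *: "limit_cone G c' (\<lambda>j. l' (i j))"
    then show "limit_cone (T G) c' l'"
      unfolding limit_cone_def cone1 by (simp add: T_def K_def J_def[symmetric])
  qed
  have lim2: "limit_cone (T2 H) c' l' ==> limit_cone H c' (\<lambda>j. l' (i j))" if "FDom H = J" for H c' l'
      unfolding limit_cone_def cone2[OF that]
    proof (intro conjI allI impI; elim conjE)
      fix c'' l'' assume "cone H c'' l''" and u: "\<forall>c'a l'a. cone H c'a (\<lambda>j. l'a (i j)) \<longrightarrow>
         (\<exists>!h. h \<in> hom (FCod (T2 H)) c'a c' \<and> (\<forall>j\<in>Ob (FDom (T2 H)). l' j \<cdot>[FCod (T2 H)] h = l'a j))"
      then have "cone H c'' (\<lambda>j. (l'' \<circ> i') (i j))" using bk[OF that] by simp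
      from u[rule_format, OF this] show "\<exists>!h. h \<in> hom (FCod H) c'' c' \<and> (\<forall>j\<in>Ob (FDom H). l' (i j) \<cdot>[FCod H] h = l'' j)"
        using that by (simp add: T2_def K_def)
    qed
  { assume "has_small_limits kp (FCod G)"
    then show "\<exists>c l. limit_cone G c l" using sT lim1 unfolding has_small_limits_def by (metis (no_types, lifting) T_def ftr.select_convs(2)) }
  assume l: "limit_cone G c l" and F: "lex_ftr kp F" "FDom F = FCod G"
  note F' = lex_ftrD[OF F(1)]
  have "limit_cone G c (\<lambda>j. l (i' (i j)))" by (rule limit_cone_cong[OF l G]) (simp add: J_def[symmetric])
  then have "limit_cone (T G) c (\<lambda>j. l (i' j))" by (simp add: lim1)
  then have 1: "limit_cone (F \<odot> T G) (FO F c) (\<lambda>j. FA F (l (i' j)))"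
    using F' F sT unfolding preserves_small_limits_def by (simp add: T_def)
  have 2: "F \<odot> T G = T2 (F \<odot> G)"
    by (auto simp: T_def T2_def K_def J_def fun_eq_iff comp_ftr_def)
  have "limit_cone (F \<odot> G) (FO F c) (\<lambda>j. FA F (l (i' (i j))))"
    using 1 lim2[of "F \<odot> G"] by (simp add: 2 J_def)
  then show "limit_cone (F \<odot> G) (FO F c) (\<lambda>j. FA F (l j))"
    by (rule limit_cone_cong) (use F F' G in "auto simp: J_def[symmetric]")
qed

section \<open>Small sets, and limits of graph-shaped diagrams\<close>

lemma small_image: "|A| <o kp ==> |f ` A| <o kp"
  by (rule ordLeq_ordLess_trans[OF card_of_image])

lemma small_subset: "A \<subseteq> B ==> |B| <o kp ==> |A| <o kp"
  by (rule ordLeq_ordLess_trans[OF card_of_mono1])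

text \<open>The smaller factor is absorbed: for an infinite set the product with a nonempty set of
  at most its size has the same cardinality, and finite products lie below \<open>kp\<close> because
  \<open>kp\<close> is infinite.\<close>

lemma small_Times:
  assumes kp: "Card_order kp" "cinfinite kp" and "|A| <o kp" "|B| <o kp"
  shows "|A \<times> B| <o kp"
proof -
  have *: "|A \<times> B| <o kp" if "|A| <o kp" "|B| \<le>o |A|" for A :: "'x set" and B :: "'y set"
  proof (cases "finite A \<or> B = {}")
    case True
    then have "finite (A \<times> B)" using card_of_ordLeq_finite[OF that(2)] by auto
    then show ?thesis using kp
      by (intro finite_ordLess_infinite) (simp_all add: cinfinite_def card_order_on_def Field_card_of card_of_well_order_on)
  next
    case False
    then have "|A \<times> B| =o |A|" using card_of_Times_infinite[of A B] that(2) by blast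
    then show ?thesis using that(1) by (rule ordIso_ordLess_trans)
  qed
  from ordLeq_total[OF card_of_Well_order card_of_Well_order, of A B] show ?thesis
  proof
    assume "|A| \<le>o |B|"
    from *[OF assms(4) this] show ?thesis by (rule ordIso_ordLess_trans[OF card_of_Times_commute])
  next
    assume "|B| \<le>o |A|"
    from *[OF assms(3) this] show ?thesis .
  qed
qed

text \<open>The objects of a graph diagram are the \<open>X v\<close>, and a triple \<open>(v, w, m)\<close> stands for a morphism
  \<open>m : X v \<rightarrow> X w\<close>; no composition of these is specified.\<close>

definition gdiag :: "('o, 'm) cat => 'v set => ('v => 'o) => ('v \<times> 'v \<times> 'm) set => bool" where
  "gdiag C V X E \<longleftrightarrow> category C \<and> (\<forall>v \<in> V. X v \<in> Ob C) \<and> (\<forall>(v, w, m) \<in> E. v \<in> V \<and> w \<in> V \<and> m \<in> hom C (X v) (X w))"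

definition gcone :: "('o, 'm) cat => 'v set => ('v => 'o) => ('v \<times> 'v \<times> 'm) set => 'o => ('v => 'm) => bool" where
  "gcone C V X E c l \<longleftrightarrow> c \<in> Ob C \<and> (\<forall>v \<in> V. l v \<in> hom C c (X v)) \<and> (\<forall>(v, w, m) \<in> E. m \<cdot>[C] l v = l w)"

definition glimit :: "('o, 'm) cat => 'v set => ('v => 'o) => ('v \<times> 'v \<times> 'm) set => 'o => ('v => 'm) => bool" where
  "glimit C V X E c l \<longleftrightarrow> gcone C V X E c l \<and>
     (\<forall>c' l'. gcone C V X E c' l' \<longrightarrow> (\<exists>!h. h \<in> hom C c' c \<and> (\<forall>v \<in> V. l v \<cdot>[C] h = l' v)))"

text \<open>A graph becomes a category without forming free composites: each edge \<open>e\<close>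
  from \<open>v\<close> to \<open>w\<close> is made an object, with arrows
  \<open>v -> e <- w\<close> and no other non-identity arrows. Two non-identity arrows never
  compose, so composition is a case distinction.\<close>

definition gindex :: "'v set => ('v \<times> 'v \<times> 'm) set =>
    ('v + 'v \<times> 'v \<times> 'm, ('v + 'v \<times> 'v \<times> 'm) + 'v \<times> 'v \<times> 'm + 'v \<times> 'v \<times> 'm) cat" where
  "gindex V E = \<lparr>Ob = V <+> E, Ar = (V <+> E) <+> (E <+> E),
     Src = (\<lambda>u. case u of Inl x => x | Inr (Inl e) => Inl (fst e) | Inr (Inr e) => Inl (fst (snd e))),
     Tgt = (\<lambda>u. case u of Inl x => x | Inr (Inl e) => Inr e | Inr (Inr e) => Inr e),
     Idn = Inl, Cmp = (\<lambda>g f. case f of Inl x => g | Inr e => f)\<rparr>"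

text \<open>The new object \<open>e\<close> is sent to \<open>X w\<close>, the arrow from
  \<open>v\<close> to the morphism on the edge and the arrow from \<open>w\<close> to an identity. A
  cone then has the same leg at \<open>e\<close> as at \<open>w\<close>, and its condition at
  \<open>v -> e\<close> is the condition for the edge.\<close>

definition gftr :: "('o, 'm) cat => 'v set => ('v => 'o) => ('v \<times> 'v \<times> 'm) set =>
    ('v + 'v \<times> 'v \<times> 'm, ('v + 'v \<times> 'v \<times> 'm) + 'v \<times> 'v \<times> 'm + 'v \<times> 'v \<times> 'm, 'o, 'm) ftr" where
  "gftr C V X E = (let O' = (\<lambda>x. case x of Inl v => X v | Inr e => X (fst (snd e))) in
     \<lparr>FDom = gindex V E, FCod = C, FO = restrict O' (V <+> E),
      FA = (\<lambda>u \<in> (V <+> E) <+> (E <+> E). case u of Inl x => Idn C (O' x) | Inr (Inl e) => snd (snd e)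
        | Inr (Inr e) => Idn C (X (fst (snd e))))\<rparr>)"

lemma gindex_category:
  assumes "gdiag C V X E" shows "category (gindex V E)"
  by (rule categoryI) (use assms in "auto simp: gindex_def gdiag_def split: sum.splits")

lemma gftr_functor:
  assumes "gdiag C V X E" shows "is_functor (gftr C V X E)"
proof (rule functorI)
  show "category (FDom (gftr C V X E))" using gindex_category[OF assms] by (simp add: gftr_def Let_def)
qed (use assms in "auto simp: gftr_def gindex_def gdiag_def Let_def split: sum.splits")

lemma gftr_simps:
  "FDom (gftr C V X E) = gindex V E" "FCod (gftr C V X E) = C"
  "Ob (gindex V E) = V <+> E" "Ar (gindex V E) = (V <+> E) <+> (E <+> E)"
  "Src (gindex V E) (Inl x) = x" "Src (gindex V E) (Inr (Inl e)) = Inl (fst e)" "Src (gindex V E) (Inr (Inr e)) = Inl (fst (snd e))"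
  "Tgt (gindex V E) (Inl x) = x" "Tgt (gindex V E) (Inr (Inl e)) = Inr e" "Tgt (gindex V E) (Inr (Inr e)) = Inr e"
  "v \<in> V ==> FO (gftr C V X E) (Inl v) = X v" "e \<in> E ==> FO (gftr C V X E) (Inr e) = X (fst (snd e))"
  "v \<in> V ==> FA (gftr C V X E) (Inl (Inl v)) = Idn C (X v)" "e \<in> E ==> FA (gftr C V X E) (Inl (Inr e)) = Idn C (X (fst (snd e)))"
  "e \<in> E ==> FA (gftr C V X E) (Inr (Inl e)) = snd (snd e)" "e \<in> E ==> FA (gftr C V X E) (Inr (Inr e)) = Idn C (X (fst (snd e)))"
  by (auto simp: gftr_def gindex_def Let_def)

lemma gftr_coneD:
  assumes g: "gdiag C V X E" and c: "cone (gftr C V X E) c l"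
  shows "e \<in> E ==> l (Inr e) = l (Inl (fst (snd e)))" and "gcone C V X E c (\<lambda>v. l (Inl v))"
proof -
  have o: "c \<in> Ob C" and h: "!!j. j \<in> V <+> E ==> l j \<in> hom C c (FO (gftr C V X E) j)"
    and u: "!!u. u \<in> (V <+> E) <+> (E <+> E) ==>
      FA (gftr C V X E) u \<cdot>[C] l (Src (gindex V E) u) = l (Tgt (gindex V E) u)"
    using c unfolding cone_iff gftr_simps by blast+
  have hv: "l (Inl v) \<in> hom C c (X v)" if "v \<in> V" for v using h[OF InlI[OF that]] that by (simp add: gftr_simps)
  have g': "category C" "!!v w m. (v, w, m) \<in> E ==> v \<in> V \<and> w \<in> V" using g by (auto simp: gdiag_def)
  show 1: "l (Inr e) = l (Inl (fst (snd e)))" if "e \<in> E" for e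
    using u[OF InrI[OF InrI[OF that]]] that hv[of "fst (snd e)"] g' by (cases e) (auto simp: gftr_simps)
  have "m \<cdot>[C] l (Inl v) = l (Inl w)" if e: "(v, w, m) \<in> E" for v w m
    using u[OF InrI[OF InlI[OF e]]] 1[OF e] e by (auto simp: gftr_simps)
  then show "gcone C V X E c (\<lambda>v. l (Inl v))" using o hv by (auto simp: gcone_def)
qed

lemma gftr_coneI:
  assumes "gdiag C V X E" "gcone C V X E c l"
  shows "cone (gftr C V X E) c (\<lambda>x. case x of Inl v => l v | Inr e => l (fst (snd e)))"
  using assms unfolding cone_iff gcone_def gdiag_def
  by (auto simp: gftr_simps)

lemma gftr_limit_cone:
  assumes g: "gdiag C V X E"
  shows "limit_cone (gftr C V X E) c l ==> glimit C V X E c (\<lambda>v. l (Inl v))"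
    and "glimit C V X E c k ==> limit_cone (gftr C V X E) c (\<lambda>x. case x of Inl v => k v | Inr e => k (fst (snd e)))"
proof -
  have s: "FDom (gftr C V X E) = gindex V E" "Ob (gindex V E) = V <+> E" "FCod (gftr C V X E) = C"
    by (auto simp: gftr_def gindex_def Let_def)
  have g1: "v \<in> V \<and> w \<in> V" if "(v, w, m) \<in> E" for v w m using g that by (auto simp: gdiag_def)
  { assume l: "limit_cone (gftr C V X E) c l"
    note c = gftr_coneD(1)[OF g limit_coneD(1)[OF l]]
    show "glimit C V X E c (\<lambda>v. l (Inl v))"
      unfolding glimit_def
    proof (intro conjI allI impI)
      show "gcone C V X E c (\<lambda>v. l (Inl v))" using gftr_coneD(2)[OF g limit_coneD(1)[OF l]] .
      fix c' l' assume "gcone C V X E c' l'"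
      note c' = gftr_coneI[OF g this]
      have *: "(\<forall>j\<in>V <+> E. l j \<cdot>[C] h = (case j of Inl v => l' v | Inr e => l' (fst (snd e)))) \<longleftrightarrow>
         (\<forall>v\<in>V. l (Inl v) \<cdot>[C] h = l' v)" for h
        using c g1 by (auto simp: Plus_def ball_Un)
      show "\<exists>!h. h \<in> hom C c' c \<and> (\<forall>v\<in>V. l (Inl v) \<cdot>[C] h = l' v)"
        using l c' unfolding limit_cone_def s *[symmetric] by blast
    qed }
  assume l: "glimit C V X E c k"
  show "limit_cone (gftr C V X E) c (\<lambda>x. case x of Inl v => k v | Inr e => k (fst (snd e)))"
    unfolding limit_cone_def s
  proof (intro conjI allI impI)
    show "cone (gftr C V X E) c (\<lambda>x. case x of Inl v => k v | Inr e => k (fst (snd e)))"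
      using gftr_coneI[OF g] l by (auto simp: glimit_def)
    fix c' l' assume c': "cone (gftr C V X E) c' l'"
    have *: "(\<forall>j\<in>V <+> E. (case j of Inl v => k v | Inr e => k (fst (snd e))) \<cdot>[C] h = l' j) \<longleftrightarrow>
         (\<forall>v\<in>V. k v \<cdot>[C] h = l' (Inl v))" for h
        using g1 gftr_coneD(1)[OF g c'] by (auto simp: Plus_def ball_Un)
    show "\<exists>!h. h \<in> hom C c' c \<and> (\<forall>j\<in>V <+> E. (case j of Inl v => k v | Inr e => k (fst (snd e))) \<cdot>[C] h = l' j)"
      using l gftr_coneD(2)[OF g c'] unfolding * glimit_def by blast
  qed
qed

text \<open>Limits of graphs are limits over \<open>gindex\<close>, whose objects and arrows are
  disjoint unions of copies of \<open>V\<close> and \<open>E\<close>, small because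
  \<open>kp\<close> is infinite. The second part translates cones over the mapped graph into cones
  over \<open>F\<close> composed with \<open>gftr\<close>.\<close>

lemma glimit_exists:
  fixes kp :: "'k rel"
  assumes kp: "Card_order kp" "cinfinite kp" and "|V| <o kp" "|E| <o kp" and g: "gdiag C V X E"
  shows "has_small_limits kp C ==> \<exists>c l. glimit C V X E c l"
    and "glimit C V X E c l ==> lex_ftr kp F ==> FDom F = C ==>
      glimit (FCod F) V (\<lambda>v. FO F (X v)) ((\<lambda>(v, w, m). (v, w, FA F m)) ` E) (FO F c) (\<lambda>v. FA F (l v))"
proof -
  have s: "FDom (gftr C V X E) = gindex V E" "Ob (gindex V E) = V <+> E" "FCod (gftr C V X E) = C"
    by (auto simp: gftr_def gindex_def Let_def)
  have inf: "\<not> finite (Field kp)" using kp by (simp add: cinfinite_def)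
  have g1: "v \<in> V \<and> w \<in> V" if "(v, w, m) \<in> E" for v w m using g that by (auto simp: gdiag_def)
  note P = card_of_Plus_ordLess_infinite_Field[OF inf kp(1)]
  have sm: "|Ob (FDom (gftr C V X E))| <o kp" "|Ar (FDom (gftr C V X E))| <o kp"
    using assms(3,4) by (auto simp: s gindex_def intro!: P)
  note lim = small_index_limits[OF kp(1) gftr_functor[OF g] sm]
  { assume "has_small_limits kp C"
    then show "\<exists>c l. glimit C V X E c l" using lim(1) gftr_limit_cone(1)[OF g] unfolding s by blast }
  assume l: "glimit C V X E c l" and F: "lex_ftr kp F" "FDom F = C"
  let ?E = "(\<lambda>(v, w, m). (v, w, FA F m)) ` E" and ?X = "\<lambda>v. FO F (X v)"
  note F' = lex_ftrD[OF F(1)]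
  have g': "gdiag (FCod F) V ?X ?E" using g F F' functorD[OF F'(1)] by (auto simp: gdiag_def)
  let ?l = "\<lambda>x. case x of Inl v => l v | Inr e => l (fst (snd e))"
  have 1: "limit_cone (F \<odot> gftr C V X E) (FO F c) (\<lambda>j. FA F (?l j))"
    using lim(2)[OF gftr_limit_cone(2)[OF g l] F(1)] F(2) by (simp add: s)
  have Fs: "FA F (?l j) = (case j of Inl v => FA F (l v) | Inr e => FA F (l (fst (snd e))))" for j
    by (cases j) auto
  show "glimit (FCod F) V ?X ?E (FO F c) (\<lambda>v. FA F (l v))"
    unfolding glimit_def
  proof (intro conjI allI impI)
    show "gcone (FCod F) V ?X ?E (FO F c) (\<lambda>v. FA F (l v))"
      using l g F F' unfolding glimit_def gcone_def gdiag_def by (fastforce simp: FA_eq)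
    fix c' l' assume c': "gcone (FCod F) V ?X ?E c' l'"
    let ?l' = "\<lambda>x. case x of Inl v => l' v | Inr e => l' (fst (snd e))"
    have F3: "FA F (Idn C (X v)) = Idn (FCod F) (FO F (X v))" if "v \<in> V" for v using that g F F' by (auto simp: gdiag_def)
    have c'': "cone (F \<odot> gftr C V X E) c' ?l'"
      using c' g F F' functorD[OF F'(1)] gftr_functor[OF g] unfolding cone_iff gcone_def gdiag_def
      by (auto simp: s gftr_def gindex_def Let_def F3)
    have *: "(\<forall>j\<in>V <+> E. FA F (?l j) \<cdot>[FCod F] h = ?l' j) \<longleftrightarrow>
         (\<forall>v\<in>V. FA F (l v) \<cdot>[FCod F] h = l' v)" for h
      using g1 by (auto simp: Plus_def ball_Un)
    show "\<exists>!h. h \<in> hom (FCod F) c' (FO F c) \<and> (\<forall>v\<in>V. FA F (l v) \<cdot>[FCod F] h = l' v)"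
      using 1 c'' unfolding limit_cone_def comp_ftr_simps s *[symmetric] by blast
  qed
qed

lemma glimitD:
  assumes "glimit C V X E c l"
  shows "c \<in> Ob C" "v \<in> V ==> l v \<in> Ar C" "v \<in> V ==> Src C (l v) = c" "v \<in> V ==> Tgt C (l v) = X v"
    "(v, w, m) \<in> E ==> m \<cdot>[C] l v = l w"
  using assms by (auto simp: glimit_def gcone_def)

lemma glimit_joint_monic:
  assumes "glimit C V X E c l" "gdiag C V X E" "h \<in> hom C c' c" "h' \<in> hom C c' c" "!!v. v \<in> V ==> l v \<cdot>[C] h = l v \<cdot>[C] h'"
  shows "h = h'"
proof -
  have "gcone C V X E c' (\<lambda>v. l v \<cdot>[C] h)"
    using assms(1-4) unfolding glimit_def gcone_def gdiag_def by (fastforce simp: cmpE)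
  then show ?thesis using assms unfolding glimit_def by (metis (no_types, lifting))
qed

section \<open>Adjunctions\<close>

text \<open>In contrast to \<open>adjunction\<close>, the triangle identities are stated objectwise
  and no limits are mentioned. This serves for adjunctions whose right adjoint is yet to be shown
  lex, and for those between hom categories.\<close>

locale adjn =
  fixes F :: "('o1,'m1,'o2,'m2) ftr" and R :: "('o2,'m2,'o1,'m1) ftr"
    and \<eta> :: "('o1,'m1,'o1,'m1) ntr" and ep :: "('o2,'m2,'o2,'m2) ntr" and C D
  assumes F: "is_functor F" "FDom F = C" "FCod F = D" and R: "is_functor R" "FDom R = D" "FCod R = C"
    and \<eta>: "nattrans \<eta>" "NDom \<eta> = id_ftr C" "NCod \<eta> = R \<odot> F"
    and ep: "nattrans ep" "NDom ep = F \<odot> R" "NCod ep = id_ftr D"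
    and tri1: "x \<in> Ob C ==> NC ep (FO F x) \<cdot>[D] FA F (NC \<eta> x) = Idn D (FO F x)"
    and tri2: "y \<in> Ob D ==> FA R (NC ep y) \<cdot>[C] NC \<eta> (FO R y) = Idn C (FO R y)"
begin

lemma cats: "category C" "category D" using F functorD by blast+

lemmas ty = F R \<eta> ep cats

lemma unit_nat: "u \<in> Ar C ==> Src C u = a ==> Tgt C u = b ==> FA R (FA F u) \<cdot>[C] NC \<eta> a = NC \<eta> b \<cdot>[C] u"
  using naturality[OF \<eta>(1), of u C C] by (simp add: ty)

lemma counit_nat: "u \<in> Ar D ==> Src D u = a ==> Tgt D u = b ==> NC ep b \<cdot>[D] FA F (FA R u) = u \<cdot>[D] NC ep a"
  using naturality[OF ep(1), of u D D] by (simp add: ty)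

text \<open>An arrow \<open>w\<close> into \<open>R y\<close> is recovered from its transpose, as
  \<open>R\<close> of the transpose precomposed with the unit. Below this is the standard way to
  prove equations that involve right adjoints.\<close>

lemma flat_inj:
  assumes "y \<in> Ob D" "u \<in> hom C x (FO R y)" "v \<in> hom C x (FO R y)" "NC ep y \<cdot>[D] FA F u = NC ep y \<cdot>[D] FA F v"
  shows "u = v"
proof -
  have "w = FA R (NC ep y \<cdot>[D] FA F w) \<cdot>[C] NC \<eta> x" if "w \<in> hom C x (FO R y)" for w
  proof -
    have "x \<in> Ob C" using that cats by auto
    then show ?thesis using that assms(1) ty by (simp add: unit_nat[of w x "FO R y"] tri2[THEN cmpE])
  qed
  then show ?thesis using assms(2-4) by metis
qed

lemma flat_sharp:
  assumes "w \<in> hom D (FO F x) y" "x \<in> Ob C" 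
  shows "NC ep y \<cdot>[D] FA F (FA R w \<cdot>[C] NC \<eta> x) = w"
proof -
  have "y \<in> Ob D" using assms cats by auto
  then show ?thesis using assms ty by (simp add: counit_nat[of w "FO F x" y, THEN cmpE] tri1)
qed

text \<open>Cones over \<open>R \<odot> G\<close> transpose to cones over \<open>G\<close>; the lift
  found in \<open>D\<close> is transposed back, and \<open>flat_inj\<close> reduces uniqueness to
  uniqueness in \<open>D\<close>.\<close>

lemma right_adjoint_preserves:
  assumes G: "is_functor G" "FCod G = D" and l: "limit_cone G c l"
  shows "limit_cone (R \<odot> G) (FO R c) (\<lambda>j. FA R (l j))"
proof (rule limit_coneI)
  note G' = functorD[OF G(1)] and lc = limit_coneD[OF l]
  show "cone (R \<odot> G) (FO R c) (\<lambda>j. FA R (l j))" by (rule cone_image[OF lc(1)]) (use ty G in auto)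
  fix c' :: 'o1
  { fix l' assume l': "cone (R \<odot> G) c' l'"
    have c': "c' \<in> Ob C" using l' ty G by (auto simp: cone_iff)
    have l'ty: "l' j \<in> Ar C" "Src C (l' j) = c'" "Tgt C (l' j) = FO R (FO G j)" if "j \<in> Ob (FDom G)" for j
      using l' ty G that by (auto simp: cone_iff)
    have l'eq: "FA R (FA G u) \<cdot>[C] l' (Src (FDom G) u) = l' (Tgt (FDom G) u)" if "u \<in> Ar (FDom G)" for u
      using l' ty G that by (auto simp: cone_iff)
    have "cone G (FO F c') (\<lambda>j. NC ep (FO G j) \<cdot>[D] FA F (l' j))"
      unfolding cone_iff
    proof (intro conjI ballI)
      fix u assume u: "u \<in> Ar (FDom G)"
      show "FA G u \<cdot>[FCod G] NC ep (FO G (Src (FDom G) u)) \<cdot>[D] FA F (l' (Src (FDom G) u)) =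
         NC ep (FO G (Tgt (FDom G) u)) \<cdot>[D] FA F (l' (Tgt (FDom G) u))"
        using ty G G' u c' l'ty l'eq[THEN FA_eq, OF u F(1)] counit_nat[OF functor_simps(2)[OF G u] refl refl, THEN cmpE, symmetric]
        by (simp add: l'eq[OF u, symmetric])
    qed (use ty G G' c' l'ty in auto)
    then obtain h where h': "h \<in> hom (FCod G) (FO F c') c"
      "!!j. j \<in> Ob (FDom G) ==> l j \<cdot>[FCod G] h = NC ep (FO G j) \<cdot>[D] FA F (l' j)"
      using limit_cone_lift[OF l] by blast
    note h = h'[unfolded G(2)]
    show "\<exists>h\<in>hom (FCod (R \<odot> G)) c' (FO R c). \<forall>j\<in>Ob (FDom (R \<odot> G)). FA R (l j) \<cdot>[FCod (R \<odot> G)] h = l' j"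
    proof (rule bexI[of _ "FA R h \<cdot>[C] NC \<eta> c'"], rule ballI)
      fix j assume "j \<in> Ob (FDom (R \<odot> G))" then have j: "j \<in> Ob (FDom G)" by simp
      have "FA R (l j) \<cdot>[C] FA R h = FA R (NC ep (FO G j) \<cdot>[D] FA F (l' j))"
        using h(2)[OF j, THEN FA_eq] ty G G' h(1) lc j by (auto simp del: functor_simps(6))
      note * = this[THEN cmpE]
      show "FA R (l j) \<cdot>[FCod (R \<odot> G)] FA R h \<cdot>[C] NC \<eta> c' = l' j"
        using ty G G' c' l'ty[OF j] h lc j
        by (simp add: * unit_nat[of "l' j" c' "FO R (FO G j)"] tri2[THEN cmpE])
    qed (use ty G c' h in auto) }
  fix h h' assume h: "h \<in> hom (FCod (R \<odot> G)) c' (FO R c)" "h' \<in> hom (FCod (R \<odot> G)) c' (FO R c)"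
    "!!j. j \<in> Ob (FDom (R \<odot> G)) ==> FA R (l j) \<cdot>[FCod (R \<odot> G)] h = FA R (l j) \<cdot>[FCod (R \<odot> G)] h'"
  have hty: "h \<in> hom C c' (FO R c)" "h' \<in> hom C c' (FO R c)" using h R by auto
  then have c': "c' \<in> Ob C" using ty by auto
  \<comment> \<open>A leg after the transpose of \<open>k\<close> is the transpose of the composite
    with the mapped leg, so agreement on the mapped legs carries over to the transposes.\<close>
  have e: "l j \<cdot>[D] NC ep c \<cdot>[D] FA F k = NC ep (FO G j) \<cdot>[D] FA F (FA R (l j) \<cdot>[C] k)" if "k \<in> hom C c' (FO R c)" "j \<in> Ob (FDom G)" for k j
    using that ty G G' lc c' by (simp add: counit_nat[of "l j" c "FO G j", THEN cmpE])
  have "NC ep c \<cdot>[D] FA F h = NC ep c \<cdot>[D] FA F h'"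
  proof (rule limit_cone_joint_monic[OF l G(1), of _ "FO F c'"])
    fix j assume j: "j \<in> Ob (FDom G)"
    then have "FA R (l j) \<cdot>[C] h = FA R (l j) \<cdot>[C] h'" using h(3)[of j] R by simp
    then show "l j \<cdot>[FCod G] (NC ep c \<cdot>[D] FA F h) = l j \<cdot>[FCod G] (NC ep c \<cdot>[D] FA F h')"
      using e[OF hty(1) j] e[OF hty(2) j] G(2) by metis
  qed (use hty ty G lc c' in auto)
  then show "h = h'" using flat_inj[of c h c' h'] hty lc G by auto
qed

end

text \<open>The right adjoint has to be given on objects only, with a universal arrow for each: its
  action on arrows, the unit and all laws follow from unique factorisation. Both restriction
  functors and equivalences obtain their right adjoints in this way.\<close>

lemma universal_arrows_adjn:
  assumes F: "is_functor F" "FDom F = C" "FCod F = D"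
    and r: "!!y. y \<in> Ob D ==> r y \<in> Ob C" and e: "!!y. y \<in> Ob D ==> e y \<in> hom D (FO F (r y)) y"
    and univ: "!!x y f. x \<in> Ob C ==> y \<in> Ob D ==> f \<in> hom D (FO F x) y ==>
      \<exists>!g. g \<in> hom C x (r y) \<and> e y \<cdot>[D] FA F g = f"
  shows "\<exists>R \<eta> ep. adjn F R \<eta> ep C D"
proof -
  have cats: "category C" "category D" using F functorD by blast+
  define sh where "sh x y f = (THE g. g \<in> hom C x (r y) \<and> e y \<cdot>[D] FA F g = f)" for x y f
  have sh: "sh x y f \<in> Ar C" "Src C (sh x y f) = x" "Tgt C (sh x y f) = r y" "e y \<cdot>[D] FA F (sh x y f) = f"
    if "x \<in> Ob C" "y \<in> Ob D" "f \<in> Ar D" "Src D f = FO F x" "Tgt D f = y" for x y f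
    using theI'[OF univ[OF that(1,2), of f]] that(3-5) by (auto simp: sh_def)
  have eq: "g = g'" if "x \<in> Ob C" "y \<in> Ob D" "g \<in> hom C x (r y)" "g' \<in> hom C x (r y)"
    "e y \<cdot>[D] FA F g = e y \<cdot>[D] FA F g'" for x y g g'
  proof -
    have "e y \<cdot>[D] FA F g' \<in> hom D (FO F x) y" using that e[OF that(2)] F cats by auto
    from univ[OF that(1,2) this] that show ?thesis by blast
  qed
  note ty = F cats r e
  let ?R = "\<lparr>FDom = D, FCod = C, FO = restrict r (Ob D), 
     FA = (\<lambda>u \<in> Ar D. sh (r (Src D u)) (Tgt D u) (u \<cdot>[D] e (Src D u)))\<rparr>"
  have R: "is_functor ?R"
  proof (rule functorI)
    fix y assume "y \<in> Ob (FDom ?R)"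
    then have y: "y \<in> Ob D" by simp
    have "sh (r y) y (Idn D y \<cdot>[D] e y) = Idn C (r y)" by (rule eq[of "r y" y]) (use ty y in "simp_all add: sh")
    then show "FA ?R (Idn (FDom ?R) y) = Idn (FCod ?R) (FO ?R y)" using ty y by (simp add: sh)
  next
    fix u v assume "u \<in> Ar (FDom ?R)" "v \<in> Ar (FDom ?R)" "Src (FDom ?R) v = Tgt (FDom ?R) u"
    then have uv: "u \<in> Ar D" "v \<in> Ar D" "Src D v = Tgt D u" by simp_all
    have "sh (r (Src D u)) (Tgt D v) ((v \<cdot>[D] u) \<cdot>[D] e (Src D u)) =
      sh (r (Tgt D u)) (Tgt D v) (v \<cdot>[D] e (Tgt D u)) \<cdot>[C] sh (r (Src D u)) (Tgt D u) (u \<cdot>[D] e (Src D u))"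
      by (rule eq[of "r (Src D u)" "Tgt D v"]) (use ty uv in "simp_all add: sh sh(4)[THEN cmpE]")
    then show "FA ?R (v \<cdot>[FDom ?R] u) = FA ?R v \<cdot>[FCod ?R] FA ?R u" using ty uv by (simp add: sh)
  qed (use ty in "simp_all add: sh")
  let ?\<eta> = "\<lparr>NDom = id_ftr C, NCod = ?R \<odot> F, NC = (\<lambda>x \<in> Ob C. sh x (FO F x) (Idn D (FO F x)))\<rparr>"
  let ?ep = "\<lparr>NDom = F \<odot> ?R, NCod = id_ftr D, NC = (\<lambda>y \<in> Ob D. e y)\<rparr>"
  have \<eta>: "nattrans ?\<eta>"
  proof (rule nattransI)
    fix u assume "u \<in> Ar (FDom (NDom ?\<eta>))"
    then have u: "u \<in> Ar C" by simp
    have "sh (r (FO F (Src C u))) (FO F (Tgt C u)) (FA F u \<cdot>[D] e (FO F (Src C u))) \<cdot>[C]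
        sh (Src C u) (FO F (Src C u)) (Idn D (FO F (Src C u))) =
      sh (Tgt C u) (FO F (Tgt C u)) (Idn D (FO F (Tgt C u))) \<cdot>[C] u"
      by (rule eq[of "Src C u" "FO F (Tgt C u)"]) (use ty u in "simp_all add: sh sh(4)[THEN cmpE]")
    then show "FA (NCod ?\<eta>) u \<cdot>[FCod (NDom ?\<eta>)] NC ?\<eta> (Src (FDom (NDom ?\<eta>)) u) =
       NC ?\<eta> (Tgt (FDom (NDom ?\<eta>)) u) \<cdot>[FCod (NDom ?\<eta>)] FA (NDom ?\<eta>) u" using ty u by (simp add: sh)
  qed (use R ty in "simp_all add: sh")
  have ep: "nattrans ?ep"
    by (rule nattransI) (use R ty in "simp_all add: sh")
  have "adjn F ?R ?\<eta> ?ep C D"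
  proof
    fix y assume y: "y \<in> Ob D"
    have "sh (r (FO F (r y))) y (e y \<cdot>[D] e (FO F (r y))) \<cdot>[C] sh (r y) (FO F (r y)) (Idn D (FO F (r y))) = Idn C (r y)"
      by (rule eq[of "r y" y]) (use ty y in "simp_all add: sh sh(4)[THEN cmpE]")
    then show "FA ?R (NC ?ep y) \<cdot>[C] NC ?\<eta> (FO ?R y) = Idn C (FO ?R y)" using ty y by (simp add: sh)
  qed (use R \<eta> ep ty in "simp_all add: sh")
  then show ?thesis by blast
qed

lemma adjn_has_radj:
  fixes kp :: "'k rel"
  assumes "adjn F R \<eta> ep C D" "lex_ftr kp F"
  shows "has_radj kp F"
proof -
  interpret adjn F R \<eta> ep C D by fact
  note F' = lex_ftrD[OF assms(2)]
  have "lex_ftr kp R"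
    unfolding lex_ftr_def preserves_small_limits_def
    using ty F' right_adjoint_preserves by (auto simp: small_diagram_def)
  moreover have "(ep \<triangleright>\<^sub>N F) \<bullet>\<^sub>N (F \<triangleleft>\<^sub>N \<eta>) = id_ntr F" by (rule ntr_eqI) (use ty tri1 in auto)
  moreover have "(R \<triangleleft>\<^sub>N ep) \<bullet>\<^sub>N (\<eta> \<triangleright>\<^sub>N R) = id_ntr R" by (rule ntr_eqI) (use ty tri2 in auto)
  ultimately have "adjunction kp F R \<eta> ep" using ty assms(2) by (auto simp: adjunction_def)
  then show ?thesis unfolding has_radj_def by blast
qed

lemma adjunction_adjn:
  assumes "adjunction kp F R \<eta> ep" "FDom F = C" "FCod F = D"
  shows "adjn F R \<eta> ep C D"
proof -
  have a: "is_functor F" "is_functor R" "FDom R = D" "FCod R = C" "nattrans \<eta>" "NDom \<eta> = id_ftr C" "NCod \<eta> = R \<odot> F"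
    "nattrans ep" "NDom ep = F \<odot> R" "NCod ep = id_ftr D"
    and t: "(ep \<triangleright>\<^sub>N F) \<bullet>\<^sub>N (F \<triangleleft>\<^sub>N \<eta>) = id_ntr F" "(R \<triangleleft>\<^sub>N ep) \<bullet>\<^sub>N (\<eta> \<triangleright>\<^sub>N R) = id_ntr R"
    using assms unfolding adjunction_def by (auto dest: lex_ftrD)
  show ?thesis
  proof
    fix x assume "x \<in> Ob C"
    then show "NC ep (FO F x) \<cdot>[D] FA F (NC \<eta> x) = Idn D (FO F x)"
      using arg_cong[OF t(1), of "\<lambda>t. NC t x"] a assms(2,3) by simp
  next
    fix y assume "y \<in> Ob D"
    then show "FA R (NC ep y) \<cdot>[C] NC \<eta> (FO R y) = Idn C (FO R y)"
      using arg_cong[OF t(2), of "\<lambda>t. NC t y"] a assms(2,3) by simp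
  qed (use a assms in simp_all)
qed

text \<open>Whatever is used of the chosen \<open>radj\<close>, \<open>adj_unit\<close> and
  \<open>adj_counit\<close> comes from here.\<close>

lemma chosen_adjunction:
  assumes "has_radj kp F"
  shows "adjunction kp F (radj kp F) (adj_unit kp F) (adj_counit kp F)"
proof -
  have "\<exists>t. (\<lambda>(R, \<eta>, ep). adjunction kp F R \<eta> ep) t" using assms by (auto simp: has_radj_def)
  from someI_ex[OF this] show ?thesis
    unfolding radj_def adj_unit_def adj_counit_def chosen_adj_def by (auto split: prod.splits)
qed

section \<open>2-categories and pseudofunctors, componentwise\<close>

locale twocat =
  fixes L :: "('p, 'f, 'a) twocat"
  assumes two: "two_category L"
begin

lemma cell1 [simp]:
  "f \<in> Cell1 L ==> src1 L f \<in> Cell0 L" "f \<in> Cell1 L ==> tgt1 L f \<in> Cell0 L"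
  "p \<in> Cell0 L ==> id1 L p \<in> Cell1 L" "p \<in> Cell0 L ==> src1 L (id1 L p) = p" "p \<in> Cell0 L ==> tgt1 L (id1 L p) = p"
  "f \<in> Cell1 L ==> g \<in> Cell1 L ==> src1 L g = tgt1 L f ==> g \<star>[L] f \<in> Cell1 L"
  "f \<in> Cell1 L ==> g \<in> Cell1 L ==> src1 L g = tgt1 L f ==> src1 L (g \<star>[L] f) = src1 L f"
  "f \<in> Cell1 L ==> g \<in> Cell1 L ==> src1 L g = tgt1 L f ==> tgt1 L (g \<star>[L] f) = tgt1 L g"
  "f \<in> Cell1 L ==> src1 L f = p ==> f \<star>[L] id1 L p = f" "f \<in> Cell1 L ==> tgt1 L f = p ==> id1 L p \<star>[L] f = f"
  "f \<in> Cell1 L ==> g \<in> Cell1 L ==> h \<in> Cell1 L ==> src1 L g = tgt1 L f ==> src1 L h = tgt1 L g ==>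
    (h \<star>[L] g) \<star>[L] f = h \<star>[L] (g \<star>[L] f)"
proof -
  have "category \<lparr>Ob = Cell0 L, Ar = Cell1 L, Src = src1 L, Tgt = tgt1 L, Idn = id1 L, Cmp = cmp1 L\<rparr>"
    using two unfolding two_category_def by blast
  note * = cat_simps[OF this, simplified]
  show "f \<in> Cell1 L ==> src1 L f \<in> Cell0 L" "f \<in> Cell1 L ==> tgt1 L f \<in> Cell0 L"
    "p \<in> Cell0 L ==> id1 L p \<in> Cell1 L" "p \<in> Cell0 L ==> src1 L (id1 L p) = p" "p \<in> Cell0 L ==> tgt1 L (id1 L p) = p"
    "f \<in> Cell1 L ==> g \<in> Cell1 L ==> src1 L g = tgt1 L f ==> g \<star>[L] f \<in> Cell1 L"
    "f \<in> Cell1 L ==> g \<in> Cell1 L ==> src1 L g = tgt1 L f ==> src1 L (g \<star>[L] f) = src1 L f"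
    "f \<in> Cell1 L ==> g \<in> Cell1 L ==> src1 L g = tgt1 L f ==> tgt1 L (g \<star>[L] f) = tgt1 L g"
    "f \<in> Cell1 L ==> src1 L f = p ==> f \<star>[L] id1 L p = f" "f \<in> Cell1 L ==> tgt1 L f = p ==> id1 L p \<star>[L] f = f"
    "f \<in> Cell1 L ==> g \<in> Cell1 L ==> h \<in> Cell1 L ==> src1 L g = tgt1 L f ==> src1 L h = tgt1 L g ==>
      (h \<star>[L] g) \<star>[L] f = h \<star>[L] (g \<star>[L] f)"
    using * by simp_all
qed

lemma cell2 [simp]:
  "al \<in> Cell2 L ==> src2 L al \<in> Cell1 L" "al \<in> Cell2 L ==> tgt2 L al \<in> Cell1 L"
  "f \<in> Cell1 L ==> id2 L f \<in> Cell2 L" "f \<in> Cell1 L ==> src2 L (id2 L f) = f" "f \<in> Cell1 L ==> tgt2 L (id2 L f) = f"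
  "al \<in> Cell2 L ==> be \<in> Cell2 L ==> src2 L be = tgt2 L al ==> be \<bullet>[L] al \<in> Cell2 L"
  "al \<in> Cell2 L ==> be \<in> Cell2 L ==> src2 L be = tgt2 L al ==> src2 L (be \<bullet>[L] al) = src2 L al"
  "al \<in> Cell2 L ==> be \<in> Cell2 L ==> src2 L be = tgt2 L al ==> tgt2 L (be \<bullet>[L] al) = tgt2 L be"
  "al \<in> Cell2 L ==> src2 L al = f ==> al \<bullet>[L] id2 L f = al" "al \<in> Cell2 L ==> tgt2 L al = f ==> id2 L f \<bullet>[L] al = al"
  "al \<in> Cell2 L ==> be \<in> Cell2 L ==> ga \<in> Cell2 L ==> src2 L be = tgt2 L al ==> src2 L ga = tgt2 L be ==>
    (ga \<bullet>[L] be) \<bullet>[L] al = ga \<bullet>[L] (be \<bullet>[L] al)"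
proof -
  have "category \<lparr>Ob = Cell1 L, Ar = Cell2 L, Src = src2 L, Tgt = tgt2 L, Idn = id2 L, Cmp = vcmp L\<rparr>"
    using two unfolding two_category_def by blast
  note * = cat_simps[OF this, simplified]
  show "al \<in> Cell2 L ==> src2 L al \<in> Cell1 L" "al \<in> Cell2 L ==> tgt2 L al \<in> Cell1 L"
    "f \<in> Cell1 L ==> id2 L f \<in> Cell2 L" "f \<in> Cell1 L ==> src2 L (id2 L f) = f" "f \<in> Cell1 L ==> tgt2 L (id2 L f) = f"
    "al \<in> Cell2 L ==> be \<in> Cell2 L ==> src2 L be = tgt2 L al ==> be \<bullet>[L] al \<in> Cell2 L"
    "al \<in> Cell2 L ==> be \<in> Cell2 L ==> src2 L be = tgt2 L al ==> src2 L (be \<bullet>[L] al) = src2 L al"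
    "al \<in> Cell2 L ==> be \<in> Cell2 L ==> src2 L be = tgt2 L al ==> tgt2 L (be \<bullet>[L] al) = tgt2 L be"
    "al \<in> Cell2 L ==> src2 L al = f ==> al \<bullet>[L] id2 L f = al" "al \<in> Cell2 L ==> tgt2 L al = f ==> id2 L f \<bullet>[L] al = al"
    "al \<in> Cell2 L ==> be \<in> Cell2 L ==> ga \<in> Cell2 L ==> src2 L be = tgt2 L al ==> src2 L ga = tgt2 L be ==>
      (ga \<bullet>[L] be) \<bullet>[L] al = ga \<bullet>[L] (be \<bullet>[L] al)"
    using * by simp_all
qed

lemma cell21 [simp]:
  "al \<in> Cell2 L ==> src1 L (src2 L al) = src1 L (tgt2 L al)" "al \<in> Cell2 L ==> tgt1 L (src2 L al) = tgt1 L (tgt2 L al)"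
  using two unfolding two_category_def by simp_all

lemma lwh [simp]:
  assumes "f \<in> Cell1 L" "al \<in> Cell2 L" "src1 L f = tgt1 L (tgt2 L al)"
  shows "f \<triangleleft>[L] al \<in> Cell2 L" "src2 L (f \<triangleleft>[L] al) = f \<star>[L] src2 L al" "tgt2 L (f \<triangleleft>[L] al) = f \<star>[L] tgt2 L al"
  using two assms unfolding two_category_def hom2_def by simp_all

lemma rwh [simp]:
  assumes "f \<in> Cell1 L" "al \<in> Cell2 L" "src1 L (tgt2 L al) = tgt1 L f"
  shows "al \<triangleright>[L] f \<in> Cell2 L" "src2 L (al \<triangleright>[L] f) = src2 L al \<star>[L] f" "tgt2 L (al \<triangleright>[L] f) = tgt2 L al \<star>[L] f"
  using two assms unfolding two_category_def hom2_def by simp_all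

lemma wh_id [simp]:
  "f \<in> Cell1 L ==> g \<in> Cell1 L ==> src1 L g = tgt1 L f ==> g \<triangleleft>[L] id2 L f = id2 L (g \<star>[L] f)"
  "f \<in> Cell1 L ==> g \<in> Cell1 L ==> src1 L g = tgt1 L f ==> id2 L g \<triangleright>[L] f = id2 L (g \<star>[L] f)"
  "al \<in> Cell2 L ==> tgt1 L (tgt2 L al) = p ==> id1 L p \<triangleleft>[L] al = al"
  "al \<in> Cell2 L ==> src1 L (tgt2 L al) = p ==> al \<triangleright>[L] id1 L p = al"
  using two unfolding two_category_def by (metis cell21)+

lemma wh_vcmp [simp]:
  assumes "al \<in> Cell2 L" "be \<in> Cell2 L" "src2 L be = tgt2 L al" "f \<in> Cell1 L"
  shows "src1 L f = tgt1 L (tgt2 L al) ==> f \<triangleleft>[L] (be \<bullet>[L] al) = (f \<triangleleft>[L] be) \<bullet>[L] (f \<triangleleft>[L] al)"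
    "src1 L (tgt2 L al) = tgt1 L f ==> (be \<bullet>[L] al) \<triangleright>[L] f = (be \<triangleright>[L] f) \<bullet>[L] (al \<triangleright>[L] f)"
  using two assms unfolding two_category_def by simp_all

lemma wh_cmp [simp]:
  assumes "al \<in> Cell2 L" "f \<in> Cell1 L" "g \<in> Cell1 L"
  shows "src1 L f = tgt1 L (tgt2 L al) ==> src1 L g = tgt1 L f ==> (g \<star>[L] f) \<triangleleft>[L] al = g \<triangleleft>[L] (f \<triangleleft>[L] al)"
    "src1 L (tgt2 L al) = tgt1 L g ==> src1 L g = tgt1 L f ==> al \<triangleright>[L] (g \<star>[L] f) = (al \<triangleright>[L] g) \<triangleright>[L] f"
    "src1 L g = tgt1 L (tgt2 L al) ==> src1 L (tgt2 L al) = tgt1 L f ==> g \<triangleleft>[L] (al \<triangleright>[L] f) = (g \<triangleleft>[L] al) \<triangleright>[L] f"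
  using two assms unfolding two_category_def by simp_all

lemma wh_interchange:
  assumes "al \<in> Cell2 L" "be \<in> Cell2 L" "src1 L (tgt2 L be) = tgt1 L (tgt2 L al)"
  shows "(be \<triangleright>[L] tgt2 L al) \<bullet>[L] (src2 L be \<triangleleft>[L] al) = (tgt2 L be \<triangleleft>[L] al) \<bullet>[L] (be \<triangleright>[L] src2 L al)"
  using two assms unfolding two_category_def by simp

end

lemma coop_simps [simp]:
  "Cell0 (coop L) = Cell0 L" "Cell1 (coop L) = Cell1 L" "Cell2 (coop L) = Cell2 L"
  "src1 (coop L) = tgt1 L" "tgt1 (coop L) = src1 L" "id1 (coop L) = id1 L" "g \<star>[coop L] f = f \<star>[L] g"
  "src2 (coop L) = tgt2 L" "tgt2 (coop L) = src2 L" "id2 (coop L) = id2 L" "be \<bullet>[coop L] al = al \<bullet>[L] be"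
  "f \<triangleleft>[coop L] al = al \<triangleright>[L] f" "al \<triangleright>[coop L] f = f \<triangleleft>[L] al"
  by (simp_all add: coop_def)

lemma hom2_iff [simp]: "al \<in> hom2 K f g \<longleftrightarrow> al \<in> Cell2 K \<and> src2 K al = f \<and> tgt2 K al = g"
  by (auto simp: hom2_def)

lemma two_category_coop:
  assumes "two_category L" shows "two_category (coop L)"
proof -
  interpret twocat L by standard (fact assms)
  show ?thesis unfolding two_category_def
    by (intro conjI categoryI) (simp_all add: wh_interchange)
qed

lemma Lex_simps [simp]:
  "Cell0 (Lex kp) = {C. has_small_limits kp C}" "Cell1 (Lex kp) = {F. lex_ftr kp F}"
  "Cell2 (Lex kp) = {ta. nattrans ta \<and> lex_ftr kp (NDom ta) \<and> lex_ftr kp (NCod ta)}"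
  "src1 (Lex kp) = FDom" "tgt1 (Lex kp) = FCod" "id1 (Lex kp) = id_ftr" "cmp1 (Lex kp) = comp_ftr"
  "src2 (Lex kp) = NDom" "tgt2 (Lex kp) = NCod" "id2 (Lex kp) = id_ntr" "vcmp (Lex kp) = vcomp_ntr"
  "lwh (Lex kp) = lwh_ntr" "rwh (Lex kp) = rwh_ntr"
  by (simp_all add: Lex_def)

lemma invertible2_Lex [simp]:
  "invertible2 (Lex kp) ta \<longleftrightarrow> iso_ntr ta \<and> lex_ftr kp (NDom ta) \<and> lex_ftr kp (NCod ta)"
  unfolding invertible2_def iso_ntr_def inverse_ntr_def by auto

text \<open>Natural transformations between given functors are determined by their components, so
  each pseudofunctor axiom is restated below at an object \<open>x\<close>, as an equation between
  arrows of one category, where rewriting is possible.\<close>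

locale psf =
  fixes kp :: "'k rel" and K :: "('p, 'f, 'a) twocat" and P :: "('p, 'f, 'a, 'o, 'm) catpfun"
  assumes twoK: "two_category K" and psf: "pseudofunctor K (Lex kp) P"
begin

lemma P0 [simp]: "p \<in> Cell0 K ==> category (P0 P p)" "p \<in> Cell0 K ==> has_small_limits kp (P0 P p)"
  using psf unfolding pseudofunctor_def by (auto intro: has_small_limits_category)

lemma P1 [simp]:
  assumes "f \<in> Cell1 K"
  shows "lex_ftr kp (P1 P f)" "is_functor (P1 P f)" "FDom (P1 P f) = P0 P (src1 K f)" "FCod (P1 P f) = P0 P (tgt1 K f)"
  using psf assms unfolding pseudofunctor_def by (auto dest: lex_ftrD)

lemma P2 [simp]:
  assumes "al \<in> Cell2 K"
  shows "nattrans (P2 P al)" "NDom (P2 P al) = P1 P (src2 K al)" "NCod (P2 P al) = P1 P (tgt2 K al)"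
  using psf assms unfolding pseudofunctor_def by auto

lemma PC [simp]:
  assumes "f \<in> Cell1 K" "g \<in> Cell1 K" "src1 K g = tgt1 K f"
  shows "iso_ntr (PC P g f)" "NDom (PC P g f) = P1 P g \<odot> P1 P f" "NCod (PC P g f) = P1 P (g \<star>[K] f)"
  using psf assms unfolding pseudofunctor_def by auto

lemma PU [simp]:
  assumes "p \<in> Cell0 K"
  shows "iso_ntr (PU P p)" "NDom (PU P p) = id_ftr (P0 P p)" "NCod (PU P p) = P1 P (id1 K p)"
  using psf assms unfolding pseudofunctor_def by auto

lemma P2_id:
  assumes "f \<in> Cell1 K" "x \<in> Ob (P0 P (src1 K f))"
  shows "NC (P2 P (id2 K f)) x = Idn (P0 P (tgt1 K f)) (FO (P1 P f) x)"
proof -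
  have "P2 P (id2 K f) = id_ntr (P1 P f)" using psf assms unfolding pseudofunctor_def by auto
  then show ?thesis using assms by simp
qed

lemma P2_vcmp:
  assumes "al \<in> Cell2 K" "be \<in> Cell2 K" "src2 K be = tgt2 K al" "x \<in> Ob (P0 P (src1 K (src2 K al)))"
  shows "NC (P2 P (be \<bullet>[K] al)) x = NC (P2 P be) x \<cdot>[P0 P (tgt1 K (src2 K al))] NC (P2 P al) x"
proof -
  interpret twocat K using twoK by unfold_locales
  have "P2 P (be \<bullet>[K] al) = P2 P be \<bullet>\<^sub>N P2 P al" using psf assms unfolding pseudofunctor_def by auto
  then show ?thesis using assms by simp
qed

lemma P2_rwh:
  assumes "f \<in> Cell1 K" "be \<in> Cell2 K" "src1 K (src2 K be) = tgt1 K f" "x \<in> Ob (P0 P (src1 K f))"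
  shows "NC (P2 P (be \<triangleright>[K] f)) x \<cdot>[P0 P (tgt1 K (src2 K be))] NC (PC P (src2 K be) f) x =
    NC (PC P (tgt2 K be) f) x \<cdot>[P0 P (tgt1 K (src2 K be))] NC (P2 P be) (FO (P1 P f) x)"
proof -
  interpret twocat K using twoK by unfold_locales
  have "P2 P (be \<triangleright>[K] f) \<bullet>\<^sub>N PC P (src2 K be) f = PC P (tgt2 K be) f \<bullet>\<^sub>N (P2 P be \<triangleright>\<^sub>N P1 P f)"
    using psf assms unfolding pseudofunctor_def by simp
  from arg_cong[OF this, of "\<lambda>t. NC t x"] show ?thesis using assms by simp
qed

lemma P2_lwh:
  assumes "g \<in> Cell1 K" "al \<in> Cell2 K" "src1 K g = tgt1 K (src2 K al)" "x \<in> Ob (P0 P (src1 K (src2 K al)))"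
  shows "NC (P2 P (g \<triangleleft>[K] al)) x \<cdot>[P0 P (tgt1 K g)] NC (PC P g (src2 K al)) x =
    NC (PC P g (tgt2 K al)) x \<cdot>[P0 P (tgt1 K g)] FA (P1 P g) (NC (P2 P al) x)"
proof -
  interpret twocat K using twoK by unfold_locales
  have "P2 P (g \<triangleleft>[K] al) \<bullet>\<^sub>N PC P g (src2 K al) = PC P g (tgt2 K al) \<bullet>\<^sub>N (P1 P g \<triangleleft>\<^sub>N P2 P al)"
    using psf assms unfolding pseudofunctor_def by simp
  from arg_cong[OF this, of "\<lambda>t. NC t x"] show ?thesis using assms by simp
qed

lemma PC_assoc:
  assumes "f \<in> Cell1 K" "g \<in> Cell1 K" "h \<in> Cell1 K" "src1 K g = tgt1 K f" "src1 K h = tgt1 K g" "x \<in> Ob (P0 P (src1 K f))"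
  shows "NC (PC P (h \<star>[K] g) f) x \<cdot>[P0 P (tgt1 K h)] NC (PC P h g) (FO (P1 P f) x) =
    NC (PC P h (g \<star>[K] f)) x \<cdot>[P0 P (tgt1 K h)] FA (P1 P h) (NC (PC P g f) x)"
proof -
  interpret twocat K using twoK by unfold_locales
  have "PC P (h \<star>[K] g) f \<bullet>\<^sub>N (PC P h g \<triangleright>\<^sub>N P1 P f) = PC P h (g \<star>[K] f) \<bullet>\<^sub>N (P1 P h \<triangleleft>\<^sub>N PC P g f)"
    using psf assms unfolding pseudofunctor_def by simp
  from arg_cong[OF this, of "\<lambda>t. NC t x"] show ?thesis using assms by simp
qed

lemma PC_unit:
  assumes "f \<in> Cell1 K" "x \<in> Ob (P0 P (src1 K f))"
  shows "src1 K f = p ==> tgt1 K f = q ==>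
      NC (PC P f (id1 K p)) x \<cdot>[P0 P q] FA (P1 P f) (NC (PU P p) x) = Idn (P0 P q) (FO (P1 P f) x)"
    and "tgt1 K f = q ==> NC (PC P (id1 K q) f) x \<cdot>[P0 P q] NC (PU P q) (FO (P1 P f) x) = Idn (P0 P q) (FO (P1 P f) x)"
proof -
  interpret twocat K using twoK by unfold_locales
  have "PC P f (id1 K (src1 K f)) \<bullet>\<^sub>N (P1 P f \<triangleleft>\<^sub>N PU P (src1 K f)) = id_ntr (P1 P f)"
    "PC P (id1 K (tgt1 K f)) f \<bullet>\<^sub>N (PU P (tgt1 K f) \<triangleright>\<^sub>N P1 P f) = id_ntr (P1 P f)"
    using psf assms unfolding pseudofunctor_def by simp_all
  from arg_cong[OF this(1), of "\<lambda>t. NC t x"] arg_cong[OF this(2), of "\<lambda>t. NC t x"] assms cell1(1,2)[OF assms(1)]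
  show "src1 K f = p ==> tgt1 K f = q ==>
      NC (PC P f (id1 K p)) x \<cdot>[P0 P q] FA (P1 P f) (NC (PU P p) x) = Idn (P0 P q) (FO (P1 P f) x)"
    "tgt1 K f = q ==> NC (PC P (id1 K q) f) x \<cdot>[P0 P q] NC (PU P q) (FO (P1 P f) x) = Idn (P0 P q) (FO (P1 P f) x)"
    by simp_all
qed

text \<open>Naturality squares, oriented so that \<open>_L\<close> moves the transformation to the left and \<open>_R\<close>
  moves it to the right.\<close>

lemma P2_L:
  assumes "al \<in> Cell2 K" "tgt2 K al = f'" "u \<in> Ar (P0 P (src1 K f'))" "Src (P0 P (src1 K f')) u = a" "q = tgt1 K f'"
  shows "FA (P1 P f') u \<cdot>[P0 P q] NC (P2 P al) a = NC (P2 P al) (Tgt (P0 P (src1 K f')) u) \<cdot>[P0 P q] FA (P1 P (src2 K al)) u"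
proof -
  interpret twocat K using twoK by unfold_locales
  show ?thesis using naturality[of "P2 P al" u "P0 P (src1 K f')" "P0 P q" "Src (P0 P (src1 K f')) u" "Tgt (P0 P (src1 K f')) u"] assms cell2(1,2)[OF assms(1)] by simp
qed

lemma P2_R:
  assumes "al \<in> Cell2 K" "src2 K al = f" "u \<in> Ar (P0 P (src1 K f))" "Tgt (P0 P (src1 K f)) u = b" "q = tgt1 K f"
  shows "NC (P2 P al) b \<cdot>[P0 P q] FA (P1 P f) u = FA (P1 P (tgt2 K al)) u \<cdot>[P0 P q] NC (P2 P al) (Src (P0 P (src1 K f)) u)"
proof -
  interpret twocat K using twoK by unfold_locales
  show ?thesis using naturality[of "P2 P al" u "P0 P (src1 K f)" "P0 P q" "Src (P0 P (src1 K f)) u" "Tgt (P0 P (src1 K f)) u"] assms cell2(1,2)[OF assms(1)] by simp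
qed

lemma PC_L:
  assumes "f \<in> Cell1 K" "g \<in> Cell1 K" "src1 K g = tgt1 K f" "h = g \<star>[K] f" "q = tgt1 K g"
    "u \<in> Ar (P0 P (src1 K f))" "Src (P0 P (src1 K f)) u = a"
  shows "FA (P1 P h) u \<cdot>[P0 P q] NC (PC P g f) a = NC (PC P g f) (Tgt (P0 P (src1 K f)) u) \<cdot>[P0 P q] FA (P1 P g) (FA (P1 P f) u)"
  using naturality[of "PC P g f" u "P0 P (src1 K f)" "P0 P q" "Src (P0 P (src1 K f)) u" "Tgt (P0 P (src1 K f)) u"] assms by simp

lemma PC_R:
  assumes "f \<in> Cell1 K" "g \<in> Cell1 K" "src1 K g = tgt1 K f" "q = tgt1 K g"
    "u \<in> Ar (P0 P (src1 K f))" "Tgt (P0 P (src1 K f)) u = b"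
  shows "NC (PC P g f) b \<cdot>[P0 P q] FA (P1 P g) (FA (P1 P f) u) = FA (P1 P (g \<star>[K] f)) u \<cdot>[P0 P q] NC (PC P g f) (Src (P0 P (src1 K f)) u)"
  using naturality[of "PC P g f" u "P0 P (src1 K f)" "P0 P q" "Src (P0 P (src1 K f)) u" "Tgt (P0 P (src1 K f)) u"] assms by simp

lemma PCi_L:
  assumes "f \<in> Cell1 K" "g \<in> Cell1 K" "src1 K g = tgt1 K f" "q = tgt1 K g"
    "u \<in> Ar (P0 P (src1 K f))" "Src (P0 P (src1 K f)) u = a"
  shows "FA (P1 P g) (FA (P1 P f) u) \<cdot>[P0 P q] NC (inv_ntr (PC P g f)) a =
    NC (inv_ntr (PC P g f)) (Tgt (P0 P (src1 K f)) u) \<cdot>[P0 P q] FA (P1 P (g \<star>[K] f)) u"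
proof -
  interpret twocat K using twoK by unfold_locales
  show ?thesis using naturality[of "inv_ntr (PC P g f)" u "P0 P (src1 K f)" "P0 P q" "Src (P0 P (src1 K f)) u" "Tgt (P0 P (src1 K f)) u"] assms by simp
qed

lemma PCi_R:
  assumes "f \<in> Cell1 K" "g \<in> Cell1 K" "src1 K g = tgt1 K f" "q = tgt1 K g" "h = g \<star>[K] f"
    "u \<in> Ar (P0 P (src1 K f))" "Tgt (P0 P (src1 K f)) u = b"
  shows "NC (inv_ntr (PC P g f)) b \<cdot>[P0 P q] FA (P1 P h) u =
    FA (P1 P g) (FA (P1 P f) u) \<cdot>[P0 P q] NC (inv_ntr (PC P g f)) (Src (P0 P (src1 K f)) u)"
proof -
  interpret twocat K using twoK by unfold_locales
  show ?thesis using naturality[of "inv_ntr (PC P g f)" u "P0 P (src1 K f)" "P0 P q" "Src (P0 P (src1 K f)) u" "Tgt (P0 P (src1 K f)) u"] assms by simp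
qed

lemma PU_L:
  assumes "p \<in> Cell0 K" "u \<in> Ar (P0 P p)" "Src (P0 P p) u = a"
  shows "FA (P1 P (id1 K p)) u \<cdot>[P0 P p] NC (PU P p) a = NC (PU P p) (Tgt (P0 P p) u) \<cdot>[P0 P p] u"
proof -
  interpret twocat K using twoK by unfold_locales
  show ?thesis using naturality[of "PU P p" u "P0 P p" "P0 P p" "Src (P0 P p) u" "Tgt (P0 P p) u"] assms by simp
qed

lemma PUi_L:
  assumes "p \<in> Cell0 K" "u \<in> Ar (P0 P p)" "Src (P0 P p) u = a"
  shows "u \<cdot>[P0 P p] NC (inv_ntr (PU P p)) a = NC (inv_ntr (PU P p)) (Tgt (P0 P p) u) \<cdot>[P0 P p] FA (P1 P (id1 K p)) u"
proof -
  interpret twocat K using twoK by unfold_locales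
  show ?thesis using naturality[of "inv_ntr (PU P p)" u "P0 P p" "P0 P p" "Src (P0 P p) u" "Tgt (P0 P p) u"] assms by simp
qed

lemma PC_inv:
  assumes "f \<in> Cell1 K" "g \<in> Cell1 K" "src1 K g = tgt1 K f" "x \<in> Ob (P0 P (src1 K f))" "q = tgt1 K g"
  shows "NC (PC P g f) x \<cdot>[P0 P q] NC (inv_ntr (PC P g f)) x = Idn (P0 P q) (FO (P1 P (g \<star>[K] f)) x)"
    "NC (inv_ntr (PC P g f)) x \<cdot>[P0 P q] NC (PC P g f) x = Idn (P0 P q) (FO (P1 P g) (FO (P1 P f) x))"
  using assms inv_ntr(5,6)[OF PC(1)] by simp_all

lemma PU_inv:
  assumes "p \<in> Cell0 K" "x \<in> Ob (P0 P p)"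
  shows "NC (PU P p) x \<cdot>[P0 P p] NC (inv_ntr (PU P p)) x = Idn (P0 P p) (FO (P1 P (id1 K p)) x)"
    "NC (inv_ntr (PU P p)) x \<cdot>[P0 P p] NC (PU P p) x = Idn (P0 P p) x"
  using assms inv_ntr(5,6)[OF PU(1)] by simp_all

end

lemma pseudofunctorI:
  fixes kp :: "'k rel"
  assumes "two_category K"
    and P0: "!!p. p \<in> Cell0 K ==> has_small_limits kp (P0 P p)"
    and P1: "!!f. f \<in> Cell1 K ==> lex_ftr kp (P1 P f) \<and> FDom (P1 P f) = P0 P (src1 K f) \<and> FCod (P1 P f) = P0 P (tgt1 K f)"
    and P2: "!!al. al \<in> Cell2 K ==> P2 P al \<in> nats (P1 P (src2 K al)) (P1 P (tgt2 K al))"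
    and PC: "!!f g. f \<in> Cell1 K ==> g \<in> Cell1 K ==> src1 K g = tgt1 K f ==>
      iso_ntr (PC P g f) \<and> PC P g f \<in> nats (P1 P g \<odot> P1 P f) (P1 P (g \<star>[K] f))"
    and PU: "!!p. p \<in> Cell0 K ==> iso_ntr (PU P p) \<and> PU P p \<in> nats (id_ftr (P0 P p)) (P1 P (id1 K p))"
    and id: "!!f x. f \<in> Cell1 K ==> x \<in> Ob (P0 P (src1 K f)) ==> NC (P2 P (id2 K f)) x = Idn (P0 P (tgt1 K f)) (FO (P1 P f) x)"
    and vcmp: "!!al be x. al \<in> Cell2 K ==> be \<in> Cell2 K ==> src2 K be = tgt2 K al ==> x \<in> Ob (P0 P (src1 K (src2 K al))) ==>
      NC (P2 P (be \<bullet>[K] al)) x = NC (P2 P be) x \<cdot>[P0 P (tgt1 K (src2 K al))] NC (P2 P al) x"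
    and rwh': "!!f be x. f \<in> Cell1 K ==> be \<in> Cell2 K ==> src1 K (src2 K be) = tgt1 K f ==> x \<in> Ob (P0 P (src1 K f)) ==>
      NC (P2 P (be \<triangleright>[K] f)) x \<cdot>[P0 P (tgt1 K (src2 K be))] NC (PC P (src2 K be) f) x =
      NC (PC P (tgt2 K be) f) x \<cdot>[P0 P (tgt1 K (src2 K be))] NC (P2 P be) (FO (P1 P f) x)"
    and lwh': "!!g al x. g \<in> Cell1 K ==> al \<in> Cell2 K ==> src1 K g = tgt1 K (src2 K al) ==> x \<in> Ob (P0 P (src1 K (src2 K al))) ==>
      NC (P2 P (g \<triangleleft>[K] al)) x \<cdot>[P0 P (tgt1 K g)] NC (PC P g (src2 K al)) x =
      NC (PC P g (tgt2 K al)) x \<cdot>[P0 P (tgt1 K g)] FA (P1 P g) (NC (P2 P al) x)"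
    and assoc: "!!f g h x. f \<in> Cell1 K ==> g \<in> Cell1 K ==> h \<in> Cell1 K ==> src1 K g = tgt1 K f ==> src1 K h = tgt1 K g ==>
      x \<in> Ob (P0 P (src1 K f)) ==>
      NC (PC P (h \<star>[K] g) f) x \<cdot>[P0 P (tgt1 K h)] NC (PC P h g) (FO (P1 P f) x) =
      NC (PC P h (g \<star>[K] f)) x \<cdot>[P0 P (tgt1 K h)] FA (P1 P h) (NC (PC P g f) x)"
    and unit: "!!f x. f \<in> Cell1 K ==> x \<in> Ob (P0 P (src1 K f)) ==>
      NC (PC P f (id1 K (src1 K f))) x \<cdot>[P0 P (tgt1 K f)] FA (P1 P f) (NC (PU P (src1 K f)) x) = Idn (P0 P (tgt1 K f)) (FO (P1 P f) x) \<and>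
      NC (PC P (id1 K (tgt1 K f)) f) x \<cdot>[P0 P (tgt1 K f)] NC (PU P (tgt1 K f)) (FO (P1 P f) x) = Idn (P0 P (tgt1 K f)) (FO (P1 P f) x)"
  shows "pseudofunctor K (Lex kp) P"
proof -
  interpret twocat K using assms(1) by unfold_locales
  have P1': "!!f. f \<in> Cell1 K ==> is_functor (P1 P f)" using P1 lex_ftrD by blast
  have P0': "!!p. p \<in> Cell0 K ==> category (P0 P p)" using P0 has_small_limits_category by blast
  note ty = P0 P0' P1 P1' P2[unfolded nats_iff] PC[unfolded nats_iff] PU[unfolded nats_iff]
  have 1: "P2 P (id2 K f) = id_ntr (P1 P f)" if "f \<in> Cell1 K" for f
    by (rule ntr_eqI) (use that in "simp_all add: ty id")
  have 2: "P2 P (be \<bullet>[K] al) = P2 P be \<bullet>\<^sub>N P2 P al" if "al \<in> Cell2 K" "be \<in> Cell2 K" "src2 K be = tgt2 K al" for al be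
    by (rule ntr_eqI) (use that vcmp[OF that] in "simp_all add: ty")
  have 3: "P2 P (be \<triangleright>[K] f) \<bullet>\<^sub>N PC P (src2 K be) f = PC P (tgt2 K be) f \<bullet>\<^sub>N (P2 P be \<triangleright>\<^sub>N P1 P f)"
    if "f \<in> Cell1 K" "be \<in> Cell2 K" "src1 K (src2 K be) = tgt1 K f" for f be
    by (rule ntr_eqI) (use that rwh'[OF that] in "simp_all add: ty")
  have 4: "P2 P (g \<triangleleft>[K] al) \<bullet>\<^sub>N PC P g (src2 K al) = PC P g (tgt2 K al) \<bullet>\<^sub>N (P1 P g \<triangleleft>\<^sub>N P2 P al)"
    if "g \<in> Cell1 K" "al \<in> Cell2 K" "src1 K g = tgt1 K (src2 K al)" for g al
    by (rule ntr_eqI) (use that lwh'[OF that] in "simp_all add: ty")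
  have 5: "PC P (h \<star>[K] g) f \<bullet>\<^sub>N (PC P h g \<triangleright>\<^sub>N P1 P f) = PC P h (g \<star>[K] f) \<bullet>\<^sub>N (P1 P h \<triangleleft>\<^sub>N PC P g f)"
    if "f \<in> Cell1 K" "g \<in> Cell1 K" "h \<in> Cell1 K" "src1 K g = tgt1 K f" "src1 K h = tgt1 K g" for f g h
    by (rule ntr_eqI) (use that assoc[OF that] in "simp_all add: ty")
  have 6: "PC P f (id1 K (src1 K f)) \<bullet>\<^sub>N (P1 P f \<triangleleft>\<^sub>N PU P (src1 K f)) = id_ntr (P1 P f)"
    "PC P (id1 K (tgt1 K f)) f \<bullet>\<^sub>N (PU P (tgt1 K f) \<triangleright>\<^sub>N P1 P f) = id_ntr (P1 P f)" if "f \<in> Cell1 K" for f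
    by (rule ntr_eqI; use that unit[OF that] in "simp add: ty")+
  show ?thesis
    unfolding pseudofunctor_def using 1 2 3 4 5 6 by (simp add: ty)
qed

locale clx =
  fixes kp :: "'k rel" and K :: "('p, 'f, 'a) twocat" and F :: "('p, 'f, 'a, 'o1, 'm1, 'o2, 'm2) trf"
  assumes twoK: "two_category K" and clx: "colax kp K F"

sublocale clx \<subseteq> S: psf kp K "TDom F" by unfold_locales (use twoK clx in "auto simp: colax_def Let_def")
sublocale clx \<subseteq> T: psf kp K "TCod F" by unfold_locales (use twoK clx in "auto simp: colax_def Let_def")

context clx
begin

lemma T1 [simp]:
  assumes "p \<in> Cell0 K"
  shows "lex_ftr kp (T1 F p)" "is_functor (T1 F p)" "FDom (T1 F p) = P0 (TDom F) p" "FCod (T1 F p) = P0 (TCod F) p"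
  using clx assms unfolding colax_def Let_def by (auto dest: lex_ftrD)

lemma T2 [simp]:
  assumes "f \<in> Cell1 K"
  shows "nattrans (T2 F f)" "NDom (T2 F f) = T1 F (tgt1 K f) \<odot> P1 (TDom F) f" "NCod (T2 F f) = P1 (TCod F) f \<odot> T1 F (src1 K f)"
  using clx assms unfolding colax_def Let_def by auto

lemma ext: "T1 F \<in> extensional (Cell0 K)" "T2 F \<in> extensional (Cell1 K)"
  using clx unfolding colax_def Let_def by auto

lemma T2_cell2:
  assumes "al \<in> Cell2 K" "x \<in> Ob (P0 (TDom F) (src1 K (tgt2 K al)))"
  shows "NC (T2 F (tgt2 K al)) x \<cdot>[P0 (TCod F) (tgt1 K (tgt2 K al))] FA (T1 F (tgt1 K (tgt2 K al))) (NC (P2 (TDom F) al) x) =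
    NC (P2 (TCod F) al) (FO (T1 F (src1 K (tgt2 K al))) x) \<cdot>[P0 (TCod F) (tgt1 K (tgt2 K al))] NC (T2 F (src2 K al)) x"
proof -
  interpret twocat K using twoK by unfold_locales
  have "T2 F (tgt2 K al) \<bullet>\<^sub>N (T1 F (tgt1 K (tgt2 K al)) \<triangleleft>\<^sub>N P2 (TDom F) al) = (P2 (TCod F) al \<triangleright>\<^sub>N T1 F (src1 K (tgt2 K al))) \<bullet>\<^sub>N T2 F (src2 K al)"
    using clx assms unfolding colax_def Let_def by simp
  from arg_cong[OF this, of "\<lambda>t. NC t x"] show ?thesis using assms by simp
qed

lemma T2_cmp:
  assumes "f \<in> Cell1 K" "g \<in> Cell1 K" "src1 K g = tgt1 K f" "x \<in> Ob (P0 (TDom F) (src1 K f))"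
  shows "NC (T2 F (g \<star>[K] f)) x \<cdot>[P0 (TCod F) (tgt1 K g)] FA (T1 F (tgt1 K g)) (NC (PC (TDom F) g f) x) =
    NC (PC (TCod F) g f) (FO (T1 F (src1 K f)) x) \<cdot>[P0 (TCod F) (tgt1 K g)]
      FA (P1 (TCod F) g) (NC (T2 F f) x) \<cdot>[P0 (TCod F) (tgt1 K g)] NC (T2 F g) (FO (P1 (TDom F) f) x)"
proof -
  interpret twocat K using twoK by unfold_locales
  have "T2 F (g \<star>[K] f) \<bullet>\<^sub>N (T1 F (tgt1 K g) \<triangleleft>\<^sub>N PC (TDom F) g f) =
        (PC (TCod F) g f \<triangleright>\<^sub>N T1 F (src1 K f)) \<bullet>\<^sub>N (P1 (TCod F) g \<triangleleft>\<^sub>N T2 F f) \<bullet>\<^sub>N (T2 F g \<triangleright>\<^sub>N P1 (TDom F) f)"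
    using clx assms unfolding colax_def Let_def by simp
  from arg_cong[OF this, of "\<lambda>t. NC t x"] show ?thesis using assms by simp
qed

lemma T2_unit:
  assumes "p \<in> Cell0 K" "x \<in> Ob (P0 (TDom F) p)"
  shows "NC (T2 F (id1 K p)) x \<cdot>[P0 (TCod F) p] FA (T1 F p) (NC (PU (TDom F) p) x) = NC (PU (TCod F) p) (FO (T1 F p) x)"
proof -
  interpret twocat K using twoK by unfold_locales
  have "T2 F (id1 K p) \<bullet>\<^sub>N (T1 F p \<triangleleft>\<^sub>N PU (TDom F) p) = PU (TCod F) p \<triangleright>\<^sub>N T1 F p"
    using clx assms unfolding colax_def Let_def by simp
  from arg_cong[OF this, of "\<lambda>t. NC t x"] show ?thesis using assms by simp
qed

lemma T2_L:
  assumes "f \<in> Cell1 K" "p = src1 K f" "q = tgt1 K f" "u \<in> Ar (P0 (TDom F) p)" "Src (P0 (TDom F) p) u = a"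
  shows "FA (P1 (TCod F) f) (FA (T1 F p) u) \<cdot>[P0 (TCod F) q] NC (T2 F f) a =
    NC (T2 F f) (Tgt (P0 (TDom F) p) u) \<cdot>[P0 (TCod F) q] FA (T1 F q) (FA (P1 (TDom F) f) u)"
proof -
  interpret twocat K using twoK by unfold_locales
  show ?thesis using naturality[of "T2 F f" u "P0 (TDom F) p" "P0 (TCod F) q" "Src (P0 (TDom F) p) u" "Tgt (P0 (TDom F) p) u"] assms by simp
qed

lemma T2_R:
  assumes "f \<in> Cell1 K" "q = tgt1 K f" "u \<in> Ar (P0 (TDom F) (src1 K f))" "Tgt (P0 (TDom F) (src1 K f)) u = b"
  shows "NC (T2 F f) b \<cdot>[P0 (TCod F) q] FA (T1 F q) (FA (P1 (TDom F) f) u) =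
    FA (P1 (TCod F) f) (FA (T1 F (src1 K f)) u) \<cdot>[P0 (TCod F) q] NC (T2 F f) (Src (P0 (TDom F) (src1 K f)) u)"
  using T2_L[of f "src1 K f" q u] assms by simp

end

lemma colaxI:
  fixes kp :: "'k rel"
  assumes "two_category K" "pseudofunctor K (Lex kp) (TDom F)" "pseudofunctor K (Lex kp) (TCod F)"
    and ext: "T1 F \<in> extensional (Cell0 K)" "T2 F \<in> extensional (Cell1 K)"
    and T1: "!!p. p \<in> Cell0 K ==> lex_ftr kp (T1 F p) \<and> FDom (T1 F p) = P0 (TDom F) p \<and> FCod (T1 F p) = P0 (TCod F) p"
    and T2: "!!f. f \<in> Cell1 K ==> T2 F f \<in> nats (T1 F (tgt1 K f) \<odot> P1 (TDom F) f) (P1 (TCod F) f \<odot> T1 F (src1 K f))"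
    and cell2': "!!al x. al \<in> Cell2 K ==> x \<in> Ob (P0 (TDom F) (src1 K (tgt2 K al))) ==>
      NC (T2 F (tgt2 K al)) x \<cdot>[P0 (TCod F) (tgt1 K (tgt2 K al))] FA (T1 F (tgt1 K (tgt2 K al))) (NC (P2 (TDom F) al) x) =
      NC (P2 (TCod F) al) (FO (T1 F (src1 K (tgt2 K al))) x) \<cdot>[P0 (TCod F) (tgt1 K (tgt2 K al))] NC (T2 F (src2 K al)) x"
    and cmp: "!!f g x. f \<in> Cell1 K ==> g \<in> Cell1 K ==> src1 K g = tgt1 K f ==> x \<in> Ob (P0 (TDom F) (src1 K f)) ==>
      NC (T2 F (g \<star>[K] f)) x \<cdot>[P0 (TCod F) (tgt1 K g)] FA (T1 F (tgt1 K g)) (NC (PC (TDom F) g f) x) =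
      NC (PC (TCod F) g f) (FO (T1 F (src1 K f)) x) \<cdot>[P0 (TCod F) (tgt1 K g)]
      FA (P1 (TCod F) g) (NC (T2 F f) x) \<cdot>[P0 (TCod F) (tgt1 K g)] NC (T2 F g) (FO (P1 (TDom F) f) x)"
    and unit: "!!p x. p \<in> Cell0 K ==> x \<in> Ob (P0 (TDom F) p) ==>
      NC (T2 F (id1 K p)) x \<cdot>[P0 (TCod F) p] FA (T1 F p) (NC (PU (TDom F) p) x) = NC (PU (TCod F) p) (FO (T1 F p) x)"
  shows "colax kp K F"
proof -
  interpret twocat K using assms(1) by unfold_locales
  interpret S: psf kp K "TDom F" using assms by unfold_locales
  interpret T: psf kp K "TCod F" using assms by unfold_locales
  have T1': "!!p. p \<in> Cell0 K ==> is_functor (T1 F p)" using T1 lex_ftrD by blast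
  note ty = T1 T1' T2[unfolded nats_iff]
  have 1: "T2 F (tgt2 K al) \<bullet>\<^sub>N (T1 F (tgt1 K (tgt2 K al)) \<triangleleft>\<^sub>N P2 (TDom F) al) =
     (P2 (TCod F) al \<triangleright>\<^sub>N T1 F (src1 K (tgt2 K al))) \<bullet>\<^sub>N T2 F (src2 K al)" if "al \<in> Cell2 K" for al
    by (rule ntr_eqI) (use that cell2'[OF that] in "simp_all add: ty")
  have 2: "T2 F (g \<star>[K] f) \<bullet>\<^sub>N (T1 F (tgt1 K g) \<triangleleft>\<^sub>N PC (TDom F) g f) =
        (PC (TCod F) g f \<triangleright>\<^sub>N T1 F (src1 K f)) \<bullet>\<^sub>N (P1 (TCod F) g \<triangleleft>\<^sub>N T2 F f) \<bullet>\<^sub>N (T2 F g \<triangleright>\<^sub>N P1 (TDom F) f)"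
    if "f \<in> Cell1 K" "g \<in> Cell1 K" "src1 K g = tgt1 K f" for f g
    by (rule ntr_eqI) (use that cmp[OF that] in "simp_all add: ty")
  have 3: "T2 F (id1 K p) \<bullet>\<^sub>N (T1 F p \<triangleleft>\<^sub>N PU (TDom F) p) = PU (TCod F) p \<triangleright>\<^sub>N T1 F p" if "p \<in> Cell0 K" for p
    by (rule ntr_eqI) (use that unit[OF that] in "simp_all add: ty")
  show ?thesis
    unfolding colax_def Let_def using 1 2 3 assms by (simp add: ty)
qed

lemma modificationD:
  assumes m: "modification kp K m" "two_category K"
  shows "colax kp K (MDom m)" "colax kp K (MCod m)" "TDom (MCod m) = TDom (MDom m)" "TCod (MCod m) = TCod (MDom m)"
    "MC m \<in> extensional (Cell0 K)"
    "p \<in> Cell0 K ==> nattrans (MC m p)" "p \<in> Cell0 K ==> NDom (MC m p) = T1 (MDom m) p" "p \<in> Cell0 K ==> NCod (MC m p) = T1 (MCod m) p"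
    "f \<in> Cell1 K ==> x \<in> Ob (P0 (TDom (MDom m)) (src1 K f)) ==>
      FA (P1 (TCod (MDom m)) f) (NC (MC m (src1 K f)) x) \<cdot>[P0 (TCod (MDom m)) (tgt1 K f)] NC (T2 (MDom m) f) x =
      NC (T2 (MCod m) f) x \<cdot>[P0 (TCod (MDom m)) (tgt1 K f)] NC (MC m (tgt1 K f)) (FO (P1 (TDom (MDom m)) f) x)"
proof -
  show 1: "colax kp K (MDom m)" "colax kp K (MCod m)" "TDom (MCod m) = TDom (MDom m)" "TCod (MCod m) = TCod (MDom m)"
    "MC m \<in> extensional (Cell0 K)"
    and 2: "p \<in> Cell0 K ==> nattrans (MC m p)" "p \<in> Cell0 K ==> NDom (MC m p) = T1 (MDom m) p" "p \<in> Cell0 K ==> NCod (MC m p) = T1 (MCod m) p" for p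
    using m unfolding modification_def Let_def by auto
  interpret F: clx kp K "MDom m" using 1 m by unfold_locales
  interpret twocat K using m by unfold_locales
  assume f: "f \<in> Cell1 K" and x: "x \<in> Ob (P0 (TDom (MDom m)) (src1 K f))"
  have "(P1 (TCod (MDom m)) f \<triangleleft>\<^sub>N MC m (src1 K f)) \<bullet>\<^sub>N T2 (MDom m) f = T2 (MCod m) f \<bullet>\<^sub>N (MC m (tgt1 K f) \<triangleright>\<^sub>N P1 (TDom (MDom m)) f)"
    using m f unfolding modification_def Let_def by blast
  from arg_cong[OF this, of "\<lambda>t. NC t x"] show "FA (P1 (TCod (MDom m)) f) (NC (MC m (src1 K f)) x) \<cdot>[P0 (TCod (MDom m)) (tgt1 K f)] NC (T2 (MDom m) f) x =
      NC (T2 (MCod m) f) x \<cdot>[P0 (TCod (MDom m)) (tgt1 K f)] NC (MC m (tgt1 K f)) (FO (P1 (TDom (MDom m)) f) x)"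
    using f x 2 by simp
qed

lemma modificationI:
  assumes "two_category K" "colax kp K (MDom m)" "colax kp K (MCod m)" "TDom (MCod m) = TDom (MDom m)" "TCod (MCod m) = TCod (MDom m)"
    "MC m \<in> extensional (Cell0 K)" "!!p. p \<in> Cell0 K ==> MC m p \<in> nats (T1 (MDom m) p) (T1 (MCod m) p)"
    "!!f x. f \<in> Cell1 K ==> x \<in> Ob (P0 (TDom (MDom m)) (src1 K f)) ==>
      FA (P1 (TCod (MDom m)) f) (NC (MC m (src1 K f)) x) \<cdot>[P0 (TCod (MDom m)) (tgt1 K f)] NC (T2 (MDom m) f) x =
      NC (T2 (MCod m) f) x \<cdot>[P0 (TCod (MDom m)) (tgt1 K f)] NC (MC m (tgt1 K f)) (FO (P1 (TDom (MDom m)) f) x)"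
  shows "modification kp K m"
proof -
  interpret twocat K using assms by unfold_locales
  interpret F: clx kp K "MDom m" using assms by unfold_locales
  interpret G: clx kp K "MCod m" using assms by unfold_locales
  note ty = assms(4-5) assms(7)[unfolded nats_iff]
  have "(P1 (TCod (MDom m)) f \<triangleleft>\<^sub>N MC m (src1 K f)) \<bullet>\<^sub>N T2 (MDom m) f = T2 (MCod m) f \<bullet>\<^sub>N (MC m (tgt1 K f) \<triangleright>\<^sub>N P1 (TDom (MDom m)) f)"
    if "f \<in> Cell1 K" for f
    by (rule ntr_eqI) (use that assms(8)[OF that] in "simp_all add: ty")
  then show ?thesis using assms unfolding modification_def Let_def by simp
qed

section \<open>Mates and the right adjoints of a pseudofunctor\<close>

context adjn begin
lemmas adjn_simps = F R \<eta> ep cats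
end

text \<open>The last conclusion characterises the mate by its transpose. It mentions counits and
  \<open>si\<close> only, and mostly replaces the defining composite in what follows.\<close>

lemma mate:
  assumes l: "adjn F R \<eta> ep C D" and l': "adjn F' R' \<eta>' ep' C' D'"
    and A: "is_functor A" "FDom A = C" "FCod A = C'" and B: "is_functor B" "FDom B = D" "FCod B = D'"
    and si: "nattrans si" "NDom si = F' \<odot> A" "NCod si = B \<odot> F"
  shows "nattrans (mate A B R' \<eta>' R ep si)" "NDom (mate A B R' \<eta>' R ep si) = A \<odot> R" "NCod (mate A B R' \<eta>' R ep si) = R' \<odot> B"
    "x \<in> Ob D ==> NC (mate A B R' \<eta>' R ep si) x =
       FA R' (FA B (NC ep x)) \<cdot>[C'] FA R' (NC si (FO R x)) \<cdot>[C'] NC \<eta>' (FO A (FO R x))"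
    "x \<in> Ob D ==> NC ep' (FO B x) \<cdot>[D'] FA F' (NC (mate A B R' \<eta>' R ep si) x) = FA B (NC ep x) \<cdot>[D'] NC si (FO R x)"
proof -
  interpret l: adjn F R \<eta> ep C D by fact
  interpret l': adjn F' R' \<eta>' ep' C' D' by fact
  note ty = l.adjn_simps l'.adjn_simps A B si
  show "nattrans (mate A B R' \<eta>' R ep si)" "NDom (mate A B R' \<eta>' R ep si) = A \<odot> R" "NCod (mate A B R' \<eta>' R ep si) = R' \<odot> B"
    unfolding mate_def by (simp_all add: ty)
  assume x: "x \<in> Ob D"
  show e: "NC (mate A B R' \<eta>' R ep si) x =
       FA R' (FA B (NC ep x)) \<cdot>[C'] FA R' (NC si (FO R x)) \<cdot>[C'] NC \<eta>' (FO A (FO R x))"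
    unfolding mate_def using x by (simp add: ty)
  show "NC ep' (FO B x) \<cdot>[D'] FA F' (NC (mate A B R' \<eta>' R ep si) x) = FA B (NC ep x) \<cdot>[D'] NC si (FO R x)"
    using x l'.flat_sharp[of "FA B (NC ep x) \<cdot>[D'] NC si (FO R x)" "FO A (FO R x)" "FO B x"] by (simp add: ty e)
qed

text \<open>The inverse is the mate of the inverse of \<open>si\<close>. After transposition each
  composite of the two mates reduces, by naturality, to \<open>si\<close> composed with its
  inverse.\<close>

lemma mate_iso:
  assumes l: "adjn F R \<eta> ep C D" and l': "adjn F' R' \<eta>' ep' C D"
    and si: "iso_ntr si" "NDom si = F'" "NCod si = F"
  shows "iso_ntr (mate (id_ftr C) (id_ftr D) R' \<eta>' R ep si)"
proof (rule iso_ntrI)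
  interpret l: adjn F R \<eta> ep C D by fact
  interpret l': adjn F' R' \<eta>' ep' C D by fact
  note ty = l.adjn_simps l'.adjn_simps si
  let ?m = "mate (id_ftr C) (id_ftr D) R' \<eta>' R ep si" and ?m' = "mate (id_ftr C) (id_ftr D) R \<eta> R' ep' (inv_ntr si)"
  have m: "nattrans ?m" "NDom ?m = R" "NCod ?m = R'" "!!x. x \<in> Ob D ==> NC ep' x \<cdot>[D] FA F' (NC ?m x) = NC ep x \<cdot>[D] NC si (FO R x)"
    using mate[OF l l', of "id_ftr C" "id_ftr D" si] by (simp_all add: ty)
  have m': "nattrans ?m'" "NDom ?m' = R'" "NCod ?m' = R" "!!x. x \<in> Ob D ==> NC ep x \<cdot>[D] FA F (NC ?m' x) = NC ep' x \<cdot>[D] NC (inv_ntr si) (FO R' x)"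
    using mate[OF l' l, of "id_ftr C" "id_ftr D" "inv_ntr si"] by (simp_all add: ty)
  show "nattrans ?m" by fact
  fix x assume "x \<in> Ob (FDom (NDom ?m))"
  then have x: "x \<in> Ob D" by (simp add: ty m)
  have n1: "NC (inv_ntr si) (FO R' x) \<cdot>[D] FA F (NC ?m x) = FA F' (NC ?m x) \<cdot>[D] NC (inv_ntr si) (FO R x)"
    using inv_ntr_naturality[OF si(1), of "NC ?m x" C D "FO R x" "FO R' x"] x by (simp add: ty m)
  have n2: "NC si (FO R x) \<cdot>[D] FA F' (NC ?m' x) = FA F (NC ?m' x) \<cdot>[D] NC si (FO R' x)"
    using naturality[of si "NC ?m' x" C D "FO R' x" "FO R x"] x by (simp add: ty m')
  have 1: "NC ?m' x \<cdot>[C] NC ?m x = Idn C (FO R x)"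
    by (rule l.flat_inj[OF x, of _ "FO R x"])
      (use x in "simp_all add: ty m m' n1 m(4)[THEN cmpE] m'(4)[THEN cmpE] inv_ntr(5,6)[OF si(1)] inv_ntr(5,6)[OF si(1), THEN cmpE]")
  have 2: "NC ?m x \<cdot>[C] NC ?m' x = Idn C (FO R' x)"
    by (rule l'.flat_inj[OF x, of _ "FO R' x"])
      (use x in "simp_all add: ty m m' n2 m(4)[THEN cmpE] m'(4)[THEN cmpE] inv_ntr(5,6)[OF si(1)] inv_ntr(5,6)[OF si(1), THEN cmpE]")
  show "isom (FCod (NDom ?m)) (NC ?m x)"
    by (rule isomI[where g = "NC ?m' x"]) (use x 1 2 in "simp_all add: ty m m'")
qed

lemma adjn_id: "category C ==> adjn (id_ftr C) (id_ftr C) (id_ntr (id_ftr C)) (id_ntr (id_ftr C)) C C"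
  by unfold_locales simp_all

text \<open>The coherence cells \<open>PC\<close> of \<open>U0\<close> are mates with respect to
  this composite adjunction, and the counit has the shape used in that definition; the identity
  adjunction serves for \<open>PU\<close>.\<close>

lemma adjn_comp:
  assumes l: "adjn F R \<eta> ep C D" and l': "adjn F' R' \<eta>' ep' D E"
  shows "adjn (F' \<odot> F) (R \<odot> R') ((R \<triangleleft>\<^sub>N (\<eta>' \<triangleright>\<^sub>N F)) \<bullet>\<^sub>N \<eta>) (ep' \<bullet>\<^sub>N ((F' \<triangleleft>\<^sub>N ep) \<triangleright>\<^sub>N R')) C E"
proof -
  interpret l: adjn F R \<eta> ep C D by fact
  interpret l': adjn F' R' \<eta>' ep' D E by fact
  note ty = l.adjn_simps l'.adjn_simps
  show ?thesis
  proof
    fix x assume x: "x \<in> Ob C"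
    then have "NC ep (FO R' (FO F' (FO F x))) \<cdot>[D] FA F (FA R (NC \<eta>' (FO F x))) = NC \<eta>' (FO F x) \<cdot>[D] NC ep (FO F x)"
      using l.counit_nat[of "NC \<eta>' (FO F x)"] by (simp add: ty)
    note * = this[THEN FA_eq, THEN cmpE]
    show "NC (ep' \<bullet>\<^sub>N ((F' \<triangleleft>\<^sub>N ep) \<triangleright>\<^sub>N R')) (FO (F' \<odot> F) x) \<cdot>[E] FA (F' \<odot> F) (NC ((R \<triangleleft>\<^sub>N (\<eta>' \<triangleright>\<^sub>N F)) \<bullet>\<^sub>N \<eta>) x) = Idn E (FO (F' \<odot> F) x)"
      using x by (simp add: ty * l.tri1[THEN FA_eq] l'.tri1)
  next
    fix y assume y: "y \<in> Ob E"
    then have "FA R' (FA F' (NC ep (FO R' y))) \<cdot>[D] NC \<eta>' (FO F (FO R (FO R' y))) = NC \<eta>' (FO R' y) \<cdot>[D] NC ep (FO R' y)"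
      using l'.unit_nat[of "NC ep (FO R' y)"] by (simp add: ty)
    note * = this[THEN FA_eq, THEN cmpE]
    show "FA (R \<odot> R') (NC (ep' \<bullet>\<^sub>N ((F' \<triangleleft>\<^sub>N ep) \<triangleright>\<^sub>N R')) y) \<cdot>[C] NC ((R \<triangleleft>\<^sub>N (\<eta>' \<triangleright>\<^sub>N F)) \<bullet>\<^sub>N \<eta>) (FO (R \<odot> R') y) = Idn C (FO (R \<odot> R') y)"
      using y by (simp add: ty * l.tri2 l'.tri2[THEN FA_eq] l'.tri2[THEN FA_eq, THEN cmpE])
  qed (simp_all add: ty)
qed

locale adjp =
  fixes kp :: "'k rel" and L :: "('p, 'f, 'a) twocat" and D :: "('p, 'f, 'a, 'o, 'm) catpfun"
  assumes twoL: "two_category L" and adjD: "adj_pfun kp L D"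

sublocale adjp \<subseteq> twocat L by unfold_locales (rule twoL)
sublocale adjp \<subseteq> D: psf kp "coop L" D
  by unfold_locales (use twoL adjD in "auto simp: adj_pfun_def two_category_coop")

context adjp begin

abbreviation "R f \<equiv> radj kp (P1 D f)"
abbreviation "n f y \<equiv> NC (adj_unit kp (P1 D f)) y"
abbreviation "e f x \<equiv> NC (adj_counit kp (P1 D f)) x"

lemma adjn_f:
  assumes "f \<in> Cell1 L"
  shows "adjn (P1 D f) (R f) (adj_unit kp (P1 D f)) (adj_counit kp (P1 D f)) (P0 D (tgt1 L f)) (P0 D (src1 L f))"
  by (rule adjunction_adjn[OF chosen_adjunction]) (use assms adjD in "auto simp: adj_pfun_def")

lemma R [simp]:
  assumes "f \<in> Cell1 L"
  shows "is_functor (R f)" "FDom (R f) = P0 D (src1 L f)" "FCod (R f) = P0 D (tgt1 L f)" "lex_ftr kp (R f)"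
    "nattrans (adj_unit kp (P1 D f))" "NDom (adj_unit kp (P1 D f)) = id_ftr (P0 D (tgt1 L f))" "NCod (adj_unit kp (P1 D f)) = R f \<odot> P1 D f"
    "nattrans (adj_counit kp (P1 D f))" "NDom (adj_counit kp (P1 D f)) = P1 D f \<odot> R f" "NCod (adj_counit kp (P1 D f)) = id_ftr (P0 D (src1 L f))"
proof -
  have "adjunction kp (P1 D f) (R f) (adj_unit kp (P1 D f)) (adj_counit kp (P1 D f))"
    using chosen_adjunction assms adjD by (auto simp: adj_pfun_def)
  then show "is_functor (R f)" "FDom (R f) = P0 D (src1 L f)" "FCod (R f) = P0 D (tgt1 L f)" "lex_ftr kp (R f)"
    "nattrans (adj_unit kp (P1 D f))" "NDom (adj_unit kp (P1 D f)) = id_ftr (P0 D (tgt1 L f))" "NCod (adj_unit kp (P1 D f)) = R f \<odot> P1 D f"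
    "nattrans (adj_counit kp (P1 D f))" "NDom (adj_counit kp (P1 D f)) = P1 D f \<odot> R f" "NCod (adj_counit kp (P1 D f)) = id_ftr (P0 D (src1 L f))"
    using assms by (auto simp: adjunction_def dest: lex_ftrD)
qed

lemma tri:
  assumes "f \<in> Cell1 L"
  shows "p = src1 L f ==> x \<in> Ob (P0 D (tgt1 L f)) ==> e f (FO (P1 D f) x) \<cdot>[P0 D p] FA (P1 D f) (n f x) = Idn (P0 D p) (FO (P1 D f) x)"
    "q = tgt1 L f ==> y \<in> Ob (P0 D (src1 L f)) ==> FA (R f) (e f y) \<cdot>[P0 D q] n f (FO (R f) y) = Idn (P0 D q) (FO (R f) y)"
  using adjn.tri1[OF adjn_f] adjn.tri2[OF adjn_f] assms by auto

lemma unit_L: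
  assumes "f \<in> Cell1 L" "q = tgt1 L f" "u \<in> Ar (P0 D q)" "Src (P0 D q) u = a"
  shows "FA (R f) (FA (P1 D f) u) \<cdot>[P0 D q] n f a = n f (Tgt (P0 D q) u) \<cdot>[P0 D q] u"
  using adjn.unit_nat[OF adjn_f] assms by auto

lemma counit_R:
  assumes "f \<in> Cell1 L" "p = src1 L f" "u \<in> Ar (P0 D p)" "Tgt (P0 D p) u = b"
  shows "e f b \<cdot>[P0 D p] FA (P1 D f) (FA (R f) u) = u \<cdot>[P0 D p] e f (Src (P0 D p) u)"
  using adjn.counit_nat[OF adjn_f] assms by auto

lemma flat_inj:
  assumes "f \<in> Cell1 L" "y \<in> Ob (P0 D (src1 L f))" "u \<in> hom (P0 D (tgt1 L f)) x (FO (R f) y)" "v \<in> hom (P0 D (tgt1 L f)) x (FO (R f) y)"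
    "e f y \<cdot>[P0 D (src1 L f)] FA (P1 D f) u = e f y \<cdot>[P0 D (src1 L f)] FA (P1 D f) v"
  shows "u = v"
  by (rule adjn.flat_inj[OF adjn_f]) (use assms in auto)

text \<open>From here to \<open>D_unit\<close>: the axioms of a pseudofunctor on
  \<open>coop L\<close>, expressed in \<open>L\<close>, so that composites of 1-cells and of 2-cells
  appear reversed.\<close>

lemma D_vcmp:
  assumes "al \<in> Cell2 L" "be \<in> Cell2 L" "src2 L be = tgt2 L al" "x \<in> Ob (P0 D (tgt1 L (tgt2 L al)))"
  shows "NC (P2 D (be \<bullet>[L] al)) x = NC (P2 D al) x \<cdot>[P0 D (src1 L (tgt2 L al))] NC (P2 D be) x"
proof -
  have "src1 L (tgt2 L be) = src1 L (tgt2 L al)" "tgt1 L (tgt2 L be) = tgt1 L (tgt2 L al)" using cell21[OF assms(2)] assms(3) by simp_all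
  then show ?thesis using D.P2_vcmp[of be al x] assms by simp
qed

lemma D_lwh:
  assumes "f \<in> Cell1 L" "be \<in> Cell2 L" "src1 L f = tgt1 L (tgt2 L be)" "x \<in> Ob (P0 D (tgt1 L f))" "p = src1 L (tgt2 L be)" "g = tgt2 L be"
  shows "NC (P2 D (f \<triangleleft>[L] be)) x \<cdot>[P0 D p] NC (PC D g f) x = NC (PC D (src2 L be) f) x \<cdot>[P0 D p] NC (P2 D be) (FO (P1 D f) x)"
  using D.P2_rwh[of f be x] assms by simp

lemma D_rwh:
  assumes "g \<in> Cell1 L" "al \<in> Cell2 L" "tgt1 L g = src1 L (tgt2 L al)" "x \<in> Ob (P0 D (tgt1 L (tgt2 L al)))" "p = src1 L g" "f = tgt2 L al"
  shows "NC (P2 D (al \<triangleright>[L] g)) x \<cdot>[P0 D p] NC (PC D g f) x = NC (PC D g (src2 L al)) x \<cdot>[P0 D p] FA (P1 D g) (NC (P2 D al) x)"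
  using D.P2_lwh[of g al x] assms by simp

lemma D_assoc:
  assumes "f \<in> Cell1 L" "g \<in> Cell1 L" "h \<in> Cell1 L" "tgt1 L g = src1 L f" "tgt1 L h = src1 L g" "x \<in> Ob (P0 D (tgt1 L f))" "p = src1 L h"
  shows "NC (PC D (g \<star>[L] h) f) x \<cdot>[P0 D p] NC (PC D h g) (FO (P1 D f) x) =
    NC (PC D h (f \<star>[L] g)) x \<cdot>[P0 D p] FA (P1 D h) (NC (PC D g f) x)"
  using D.PC_assoc[of f g h x] assms by simp

lemma D_unit:
  assumes "f \<in> Cell1 L" "x \<in> Ob (P0 D (tgt1 L f))" "p = src1 L f"
  shows "q = tgt1 L f ==> NC (PC D f (id1 L q)) x \<cdot>[P0 D p] FA (P1 D f) (NC (PU D q) x) = Idn (P0 D p) (FO (P1 D f) x)"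
    and "NC (PC D (id1 L p) f) x \<cdot>[P0 D p] NC (PU D p) (FO (P1 D f) x) = Idn (P0 D p) (FO (P1 D f) x)"
  using D.PC_unit[of f x] assms by simp_all

text \<open>The mates in \<open>U0\<close> are taken of inverse coherence isomorphisms, so the
  axioms of \<open>D\<close> are needed, here and in the next three lemmas, with \<open>PC\<close>
  and \<open>PU\<close> inverted.\<close>

lemma D_lwh_i:
  assumes "f \<in> Cell1 L" "be \<in> Cell2 L" "src1 L f = tgt1 L (tgt2 L be)" "x \<in> Ob (P0 D (tgt1 L f))" "p = src1 L (tgt2 L be)" "h = src2 L be"
  shows "NC (inv_ntr (PC D h f)) x \<cdot>[P0 D p] NC (P2 D (f \<triangleleft>[L] be)) x = NC (P2 D be) (FO (P1 D f) x) \<cdot>[P0 D p] NC (inv_ntr (PC D (tgt2 L be) f)) x"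
  by (rule isom_cancel[of "P0 D p", OF _ iso_ntr_isom[OF D.PC(1)[of f "tgt2 L be"], of x]])
    (use assms D_lwh[OF assms(1-4) refl refl] in "simp_all add: D.PC_inv D.PC_inv[THEN cmpE]")

lemma D_rwh_i:
  assumes "g \<in> Cell1 L" "al \<in> Cell2 L" "tgt1 L g = src1 L (tgt2 L al)" "x \<in> Ob (P0 D (tgt1 L (tgt2 L al)))" "p = src1 L g" "h = src2 L al"
  shows "NC (inv_ntr (PC D g h)) x \<cdot>[P0 D p] NC (P2 D (al \<triangleright>[L] g)) x = FA (P1 D g) (NC (P2 D al) x) \<cdot>[P0 D p] NC (inv_ntr (PC D g (tgt2 L al))) x"
  by (rule isom_cancel[of "P0 D p", OF _ iso_ntr_isom[OF D.PC(1)[of "tgt2 L al" g], of x]])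
    (use assms D_rwh[OF assms(1-4) refl refl] in "simp_all add: D.PC_inv D.PC_inv[THEN cmpE]")

lemma D_assoc_i:
  assumes "f \<in> Cell1 L" "g \<in> Cell1 L" "h \<in> Cell1 L" "tgt1 L g = src1 L f" "tgt1 L h = src1 L g" "x \<in> Ob (P0 D (tgt1 L f))" "p = src1 L h"
    "k = f \<star>[L] g"
  shows "FA (P1 D h) (NC (inv_ntr (PC D g f)) x) \<cdot>[P0 D p] NC (inv_ntr (PC D h k)) x =
    NC (inv_ntr (PC D h g)) (FO (P1 D f) x) \<cdot>[P0 D p] NC (inv_ntr (PC D (g \<star>[L] h) f)) x"
proof -
  have i: "isom (P0 D p) (NC (PC D h (f \<star>[L] g)) x \<cdot>[P0 D p] FA (P1 D h) (NC (PC D g f) x))"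
    by (rule isom_cmp[OF _ isom_FA[OF _ _ _ iso_ntr_isom[OF D.PC(1)[of f g]]] iso_ntr_isom[OF D.PC(1)[of "f \<star>[L] g" h]]])
      (use assms in simp_all)
  have 1: "(FA (P1 D h) (NC (inv_ntr (PC D g f)) x) \<cdot>[P0 D p] NC (inv_ntr (PC D h k)) x) \<cdot>[P0 D p]
     NC (PC D h (f \<star>[L] g)) x \<cdot>[P0 D p] FA (P1 D h) (NC (PC D g f) x) = Idn (P0 D p) (FO (P1 D h) (FO (P1 D g) (FO (P1 D f) x)))"
    using assms by (simp add: D.PC_inv D.PC_inv[THEN cmpE] D.PC_inv[THEN FA_eq])
  have 2: "(NC (inv_ntr (PC D h g)) (FO (P1 D f) x) \<cdot>[P0 D p] NC (inv_ntr (PC D (g \<star>[L] h) f)) x) \<cdot>[P0 D p]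
     NC (PC D (g \<star>[L] h) f) x \<cdot>[P0 D p] NC (PC D h g) (FO (P1 D f) x) = Idn (P0 D p) (FO (P1 D h) (FO (P1 D g) (FO (P1 D f) x)))"
    using assms by (simp add: D.PC_inv D.PC_inv[THEN cmpE])
  show ?thesis
    by (rule isom_cancel[OF _ i])
      (use assms in simp_all, use 1 2 assms D_assoc[OF assms(1-6) refl] in simp)
qed

lemma D_unit_i:
  assumes "f \<in> Cell1 L" "x \<in> Ob (P0 D (tgt1 L f))" "p = src1 L f"
  shows "q = tgt1 L f ==> FA (P1 D f) (NC (inv_ntr (PU D q)) x) \<cdot>[P0 D p] NC (inv_ntr (PC D f (id1 L q))) x = Idn (P0 D p) (FO (P1 D f) x)"
    and "NC (inv_ntr (PU D p)) (FO (P1 D f) x) \<cdot>[P0 D p] NC (inv_ntr (PC D (id1 L p) f)) x = Idn (P0 D p) (FO (P1 D f) x)"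
proof -
  assume q: "q = tgt1 L f"
  have i: "NC (inv_ntr (PC D f (id1 L q))) x = FA (P1 D f) (NC (PU D q) x)"
    by (rule inverse_unique[of "P0 D p" "NC (PC D f (id1 L q)) x"]) (use assms q D_unit(1)[OF assms q] in "simp_all add: D.PC_inv")
  then show "FA (P1 D f) (NC (inv_ntr (PU D q)) x) \<cdot>[P0 D p] NC (inv_ntr (PC D f (id1 L q))) x = Idn (P0 D p) (FO (P1 D f) x)"
    using assms q by (simp add: D.PU_inv[THEN FA_eq])
next
  have i: "NC (inv_ntr (PC D (id1 L p) f)) x = NC (PU D p) (FO (P1 D f) x)"
    by (rule inverse_unique[of "P0 D p" "NC (PC D (id1 L p) f) x"]) (use assms D_unit(2)[OF assms] in "simp_all add: D.PC_inv")
  then show "NC (inv_ntr (PU D p)) (FO (P1 D f) x) \<cdot>[P0 D p] NC (inv_ntr (PC D (id1 L p) f)) x = Idn (P0 D p) (FO (P1 D f) x)"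
    using assms by (simp add: D.PU_inv)
qed

lemma U0_simps [simp]: "P0 (U0 kp L D) = P0 D" "P1 (U0 kp L D) f = R f" by (simp_all add: U0_def Let_def)

lemma U0_P2:
  assumes a: "al \<in> Cell2 L"
  shows "nattrans (P2 (U0 kp L D) al)" "NDom (P2 (U0 kp L D) al) = R (src2 L al)" "NCod (P2 (U0 kp L D) al) = R (tgt2 L al)"
    "f' = tgt2 L al ==> x \<in> Ob (P0 D (src1 L f')) ==> p = src1 L f' ==>
      e f' x \<cdot>[P0 D p] FA (P1 D f') (NC (P2 (U0 kp L D) al) x) = e (src2 L al) x \<cdot>[P0 D p] NC (P2 D al) (FO (R (src2 L al)) x)"
proof -
  have m: "P2 (U0 kp L D) al = mate (id_ftr (P0 D (tgt1 L (src2 L al)))) (id_ftr (P0 D (src1 L (src2 L al))))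
      (R (tgt2 L al)) (adj_unit kp (P1 D (tgt2 L al))) (R (src2 L al)) (adj_counit kp (P1 D (src2 L al))) (P2 D al)"
    by (simp add: U0_def Let_def)
  note * = mate[OF adjn_f[of "src2 L al"] adjn_f[of "tgt2 L al"], of "id_ftr (P0 D (tgt1 L (tgt2 L al)))" "id_ftr (P0 D (src1 L (tgt2 L al)))" "P2 D al"]
  show "nattrans (P2 (U0 kp L D) al)" "NDom (P2 (U0 kp L D) al) = R (src2 L al)" "NCod (P2 (U0 kp L D) al) = R (tgt2 L al)"
    "f' = tgt2 L al ==> x \<in> Ob (P0 D (src1 L f')) ==> p = src1 L f' ==>
      e f' x \<cdot>[P0 D p] FA (P1 D f') (NC (P2 (U0 kp L D) al) x) = e (src2 L al) x \<cdot>[P0 D p] NC (P2 D al) (FO (R (src2 L al)) x)"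
    using a * by (simp_all add: m)
qed

lemma U0_PC:
  assumes f: "f \<in> Cell1 L" "g \<in> Cell1 L" "src1 L g = tgt1 L f"
  shows "iso_ntr (PC (U0 kp L D) g f)" "nattrans (PC (U0 kp L D) g f)" "NDom (PC (U0 kp L D) g f) = R g \<odot> R f" "NCod (PC (U0 kp L D) g f) = R (g \<star>[L] f)"
    "h = g \<star>[L] f ==> x \<in> Ob (P0 D (src1 L f)) ==> p = src1 L f ==>
      e h x \<cdot>[P0 D p] FA (P1 D h) (NC (PC (U0 kp L D) g f) x) =
      e f x \<cdot>[P0 D p] FA (P1 D f) (e g (FO (R f) x)) \<cdot>[P0 D p] NC (inv_ntr (PC D f g)) (FO (R g) (FO (R f) x))"
proof -
  let ?E = "adj_counit kp (P1 D f) \<bullet>\<^sub>N ((P1 D f \<triangleleft>\<^sub>N adj_counit kp (P1 D g)) \<triangleright>\<^sub>N R f)"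
  have m: "PC (U0 kp L D) g f = mate (id_ftr (P0 D (tgt1 L g))) (id_ftr (P0 D (src1 L f)))
      (R (g \<star>[L] f)) (adj_unit kp (P1 D (g \<star>[L] f))) (R g \<odot> R f) ?E (inv_ntr (PC D f g))"
    by (simp add: U0_def Let_def)
  note c = adjn_comp[OF adjn_f[OF f(2)] adjn_f[OF f(1), folded f(3)]]
  have h: "adjn (P1 D (g \<star>[L] f)) (R (g \<star>[L] f)) (adj_unit kp (P1 D (g \<star>[L] f))) (adj_counit kp (P1 D (g \<star>[L] f))) (P0 D (tgt1 L g)) (P0 D (src1 L f))"
    using adjn_f[of "g \<star>[L] f"] f by simp
  show "iso_ntr (PC (U0 kp L D) g f)"
    unfolding m by (rule mate_iso[OF c h]) (use f in "simp_all add: inv_ntr_iso")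
  note * = mate[OF c h, of "id_ftr (P0 D (tgt1 L g))" "id_ftr (P0 D (src1 L f))" "inv_ntr (PC D f g)"]
  show "nattrans (PC (U0 kp L D) g f)" "NDom (PC (U0 kp L D) g f) = R g \<odot> R f" "NCod (PC (U0 kp L D) g f) = R (g \<star>[L] f)"
    "h = g \<star>[L] f ==> x \<in> Ob (P0 D (src1 L f)) ==> p = src1 L f ==>
      e h x \<cdot>[P0 D p] FA (P1 D h) (NC (PC (U0 kp L D) g f) x) =
      e f x \<cdot>[P0 D p] FA (P1 D f) (e g (FO (R f) x)) \<cdot>[P0 D p] NC (inv_ntr (PC D f g)) (FO (R g) (FO (R f) x))"
    using f * by (simp_all add: m)
qed

lemma U0_PU:
  assumes p: "p \<in> Cell0 L"
  shows "iso_ntr (PU (U0 kp L D) p)" "nattrans (PU (U0 kp L D) p)" "NDom (PU (U0 kp L D) p) = id_ftr (P0 D p)" "NCod (PU (U0 kp L D) p) = R (id1 L p)"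
    "x \<in> Ob (P0 D p) ==> e (id1 L p) x \<cdot>[P0 D p] FA (P1 D (id1 L p)) (NC (PU (U0 kp L D) p) x) = NC (inv_ntr (PU D p)) x"
proof -
  have m: "PU (U0 kp L D) p = mate (id_ftr (P0 D p)) (id_ftr (P0 D p)) (R (id1 L p)) (adj_unit kp (P1 D (id1 L p)))
     (id_ftr (P0 D p)) (id_ntr (id_ftr (P0 D p))) (inv_ntr (PU D p))"
    by (simp add: U0_def Let_def)
  have c: "adjn (id_ftr (P0 D p)) (id_ftr (P0 D p)) (id_ntr (id_ftr (P0 D p))) (id_ntr (id_ftr (P0 D p))) (P0 D p) (P0 D p)"
    using p by (simp add: adjn_id)
  have h: "adjn (P1 D (id1 L p)) (R (id1 L p)) (adj_unit kp (P1 D (id1 L p))) (adj_counit kp (P1 D (id1 L p))) (P0 D p) (P0 D p)"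
    using adjn_f[of "id1 L p"] p by simp
  show "iso_ntr (PU (U0 kp L D) p)"
    unfolding m by (rule mate_iso[OF c h]) (use p in "simp_all add: inv_ntr_iso")
  note * = mate[OF c h, of "id_ftr (P0 D p)" "id_ftr (P0 D p)" "inv_ntr (PU D p)"]
  show "nattrans (PU (U0 kp L D) p)" "NDom (PU (U0 kp L D) p) = id_ftr (P0 D p)" "NCod (PU (U0 kp L D) p) = R (id1 L p)"
    "x \<in> Ob (P0 D p) ==> e (id1 L p) x \<cdot>[P0 D p] FA (P1 D (id1 L p)) (NC (PU (U0 kp L D) p) x) = NC (inv_ntr (PU D p)) x"
    using p * by (simp_all add: m)
qed

lemma PUi_R:
  assumes "p \<in> Cell0 L" "u \<in> Ar (P0 D p)" "Tgt (P0 D p) u = b"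
  shows "NC (inv_ntr (PU D p)) b \<cdot>[P0 D p] FA (P1 D (id1 L p)) u = u \<cdot>[P0 D p] NC (inv_ntr (PU D p)) (Src (P0 D p) u)"
  using D.PUi_L[of p u] assms by simp

text \<open>A rewriting system for transposed arrows: a counit that meets a 2-cell of
  \<open>U0\<close> turns into data of \<open>D\<close>, a counit that meets a unit disappears, and
  what remains are axioms of \<open>D\<close> with inverted coherence.\<close>

lemmas flats = U0_P2(4) U0_P2(4)[THEN cmpE] U0_P2(4)[THEN FA_eq] U0_P2(4)[THEN FA_eq, THEN cmpE]
  U0_PC(5) U0_PC(5)[THEN cmpE] U0_PC(5)[THEN FA_eq] U0_PC(5)[THEN FA_eq, THEN cmpE]
  U0_PU(5) U0_PU(5)[THEN cmpE] U0_PU(5)[THEN FA_eq] U0_PU(5)[THEN FA_eq, THEN cmpE]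
  counit_R counit_R[THEN cmpE] counit_R[THEN FA_eq] counit_R[THEN FA_eq, THEN cmpE]
  tri(1) tri(1)[THEN cmpE] tri(1)[THEN FA_eq] tri(1)[THEN FA_eq, THEN cmpE]
  D.P2_R D.P2_R[THEN cmpE] D.PCi_R D.PCi_R[THEN cmpE] PUi_R PUi_R[THEN cmpE]
  D_lwh_i D_rwh_i D_assoc_i D_unit_i D_lwh_i[THEN cmpE] D_rwh_i[THEN cmpE] D_assoc_i[THEN cmpE] D_unit_i[THEN cmpE]

text \<open>Each axiom is transposed by \<open>flat_inj\<close> at the right adjoint in which it
  lands, where \<open>flats\<close> reduces it to an axiom of \<open>D\<close>.\<close>

lemma U0_pseudofunctor: "pseudofunctor L (Lex kp) (U0 kp L D)"
proof (rule pseudofunctorI)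
  fix f x assume a: "f \<in> Cell1 L" "x \<in> Ob (P0 (U0 kp L D) (src1 L f))"
  show "NC (P2 (U0 kp L D) (id2 L f)) x = Idn (P0 (U0 kp L D) (tgt1 L f)) (FO (P1 (U0 kp L D) f) x)"
    by (rule flat_inj[of f x _ "FO (R f) x"]) (use a D.P2_id[of f "FO (R f) x"] in "simp_all add: U0_P2 flats")
next
  fix al be x assume a: "al \<in> Cell2 L" "be \<in> Cell2 L" "src2 L be = tgt2 L al" "x \<in> Ob (P0 (U0 kp L D) (src1 L (src2 L al)))"
  have [simp]: "src1 L (tgt2 L be) = src1 L (tgt2 L al)" "tgt1 L (tgt2 L be) = tgt1 L (tgt2 L al)" using cell21[OF a(2)] a(3) by simp_all
  show "NC (P2 (U0 kp L D) (be \<bullet>[L] al)) x = NC (P2 (U0 kp L D) be) x \<cdot>[P0 (U0 kp L D) (tgt1 L (src2 L al))] NC (P2 (U0 kp L D) al) x"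
    by (rule flat_inj[of "tgt2 L be" x _ "FO (R (src2 L al)) x"]) (use a in "simp_all add: U0_P2 flats D_vcmp")
next
  fix f be x assume a: "f \<in> Cell1 L" "be \<in> Cell2 L" "src1 L (src2 L be) = tgt1 L f" "x \<in> Ob (P0 (U0 kp L D) (src1 L f))"
  then show "NC (P2 (U0 kp L D) (be \<triangleright>[L] f)) x \<cdot>[P0 (U0 kp L D) (tgt1 L (src2 L be))] NC (PC (U0 kp L D) (src2 L be) f) x =
    NC (PC (U0 kp L D) (tgt2 L be) f) x \<cdot>[P0 (U0 kp L D) (tgt1 L (src2 L be))] NC (P2 (U0 kp L D) be) (FO (P1 (U0 kp L D) f) x)"
    by - (rule flat_inj[of "tgt2 L be \<star>[L] f" x _ "FO (R (src2 L be)) (FO (R f) x)"]; simp add: U0_P2 U0_PC flats)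
next
  fix g al x assume a: "g \<in> Cell1 L" "al \<in> Cell2 L" "src1 L g = tgt1 L (src2 L al)" "x \<in> Ob (P0 (U0 kp L D) (src1 L (src2 L al)))"
  then show "NC (P2 (U0 kp L D) (g \<triangleleft>[L] al)) x \<cdot>[P0 (U0 kp L D) (tgt1 L g)] NC (PC (U0 kp L D) g (src2 L al)) x =
    NC (PC (U0 kp L D) g (tgt2 L al)) x \<cdot>[P0 (U0 kp L D) (tgt1 L g)] FA (P1 (U0 kp L D) g) (NC (P2 (U0 kp L D) al) x)"
    by - (rule flat_inj[of "g \<star>[L] tgt2 L al" x _ "FO (R g) (FO (R (src2 L al)) x)"]; simp add: U0_P2 U0_PC flats)
next
  fix f g h x assume a: "f \<in> Cell1 L" "g \<in> Cell1 L" "h \<in> Cell1 L" "src1 L g = tgt1 L f" "src1 L h = tgt1 L g" "x \<in> Ob (P0 (U0 kp L D) (src1 L f))"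
  then show "NC (PC (U0 kp L D) (h \<star>[L] g) f) x \<cdot>[P0 (U0 kp L D) (tgt1 L h)] NC (PC (U0 kp L D) h g) (FO (P1 (U0 kp L D) f) x) =
    NC (PC (U0 kp L D) h (g \<star>[L] f)) x \<cdot>[P0 (U0 kp L D) (tgt1 L h)] FA (P1 (U0 kp L D) h) (NC (PC (U0 kp L D) g f) x)"
    by - (rule flat_inj[of "h \<star>[L] g \<star>[L] f" x _ "FO (R h) (FO (R g) (FO (R f) x))"]; simp add: U0_PC flats)
next
  fix f x assume a: "f \<in> Cell1 L" "x \<in> Ob (P0 (U0 kp L D) (src1 L f))"
  have "NC (PC (U0 kp L D) f (id1 L (src1 L f))) x \<cdot>[P0 D (tgt1 L f)] FA (R f) (NC (PU (U0 kp L D) (src1 L f)) x) = Idn (P0 D (tgt1 L f)) (FO (R f) x)"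
    by (rule flat_inj[of f x _ "FO (R f) x"]) (use a in "simp_all add: U0_PC U0_PU flats")
  moreover have "NC (PC (U0 kp L D) (id1 L (tgt1 L f)) f) x \<cdot>[P0 D (tgt1 L f)] NC (PU (U0 kp L D) (tgt1 L f)) (FO (R f) x) = Idn (P0 D (tgt1 L f)) (FO (R f) x)"
    by (rule flat_inj[of f x _ "FO (R f) x"]) (use a in "simp_all add: U0_PC U0_PU flats")
  ultimately show "NC (PC (U0 kp L D) f (id1 L (src1 L f))) x \<cdot>[P0 (U0 kp L D) (tgt1 L f)] FA (P1 (U0 kp L D) f) (NC (PU (U0 kp L D) (src1 L f)) x) =
      Idn (P0 (U0 kp L D) (tgt1 L f)) (FO (P1 (U0 kp L D) f) x) \<and>
    NC (PC (U0 kp L D) (id1 L (tgt1 L f)) f) x \<cdot>[P0 (U0 kp L D) (tgt1 L f)] NC (PU (U0 kp L D) (tgt1 L f)) (FO (P1 (U0 kp L D) f) x) =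
      Idn (P0 (U0 kp L D) (tgt1 L f)) (FO (P1 (U0 kp L D) f) x)" by simp
qed (use twoL in "simp_all add: U0_P2 U0_PC U0_PU")

lemma unit_cell2:
  assumes "al \<in> Cell2 L" "d \<in> Ob (P0 D (tgt1 L (tgt2 L al)))" "f' = tgt2 L al" "q = tgt1 L f'"
  shows "FA (R f') (NC (P2 D al) d) \<cdot>[P0 D q] n f' d =
    NC (P2 (U0 kp L D) al) (FO (P1 D (src2 L al)) d) \<cdot>[P0 D q] n (src2 L al) d"
  by (rule flat_inj[of f' "FO (P1 D (src2 L al)) d" _ d]) (use assms in "simp_all add: U0_P2 flats")

lemma unit_cmp:
  assumes "f \<in> Cell1 L" "g \<in> Cell1 L" "src1 L g = tgt1 L f" "d \<in> Ob (P0 D (tgt1 L g))" "q = tgt1 L g"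
  shows "n (g \<star>[L] f) d = FA (R (g \<star>[L] f)) (NC (PC D f g) d) \<cdot>[P0 D q] NC (PC (U0 kp L D) g f) (FO (P1 D f) (FO (P1 D g) d)) \<cdot>[P0 D q]
     FA (R g) (n f (FO (P1 D g) d)) \<cdot>[P0 D q] n g d"
  by (rule flat_inj[of "g \<star>[L] f" "FO (P1 D (g \<star>[L] f)) d" _ d]) (use assms in "simp_all add: U0_PC flats D.PC_inv")

lemma unit_id:
  assumes "p \<in> Cell0 L" "d \<in> Ob (P0 D p)"
  shows "n (id1 L p) d = FA (R (id1 L p)) (NC (PU D p) d) \<cdot>[P0 D p] NC (PU (U0 kp L D) p) d"
  by (rule flat_inj[of "id1 L p" "FO (P1 D (id1 L p)) d" _ d]) (use assms in "simp_all add: U0_PU flats D.PU_inv")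

end

section \<open>Composition of colax transformations\<close>

lemma id_trf_simps [simp]: "TDom (id_trf K C) = C" "TCod (id_trf K C) = C"
  "p \<in> Cell0 K ==> T1 (id_trf K C) p = id_ftr (P0 C p)" "f \<in> Cell1 K ==> T2 (id_trf K C) f = id_ntr (P1 C f)"
  by (simp_all add: id_trf_def)

lemma comp_trf_simps [simp]: "TDom (comp_trf K G F) = TDom F" "TCod (comp_trf K G F) = TCod G"
  "p \<in> Cell0 K ==> T1 (comp_trf K G F) p = T1 G p \<odot> T1 F p"
  "f \<in> Cell1 K ==> T2 (comp_trf K G F) f = (T2 G f \<triangleright>\<^sub>N T1 F (src1 K f)) \<bullet>\<^sub>N (T1 G (tgt1 K f) \<triangleleft>\<^sub>N T2 F f)"
  by (simp_all add: comp_trf_def)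

lemma id_trf_colax:
  assumes "two_category K" "pseudofunctor K (Lex kp) C"
  shows "colax kp K (id_trf K C)" "pseudonatural kp K (id_trf K C)"
proof -
  interpret twocat K by unfold_locales fact
  interpret C: psf kp K C using assms by unfold_locales
  show 1: "colax kp K (id_trf K C)"
    by (rule colaxI) (use assms in "simp_all, simp_all add: id_trf_def")
  have "iso_ntr (id_ntr (P1 C f))" if "f \<in> Cell1 K" for f
    by (rule iso_ntrI) (use that in "simp_all add: isom_Idn")
  then show "pseudonatural kp K (id_trf K C)" using 1 by (simp add: pseudonatural_def)
qed

lemma comp_trf_colax:
  assumes "two_category K" "colax kp K F" "colax kp K G" "TDom G = TCod F"
  shows "colax kp K (comp_trf K G F)"
proof -
  interpret twocat K by unfold_locales fact
  interpret F: clx kp K F using assms by unfold_locales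
  interpret G: clx kp K G using assms by unfold_locales
  note eq = assms(4)
  note G = G.T2_cell2[unfolded eq] G.T2_cmp[unfolded eq] G.T2_unit[unfolded eq] G.T2_L[unfolded eq]
  show ?thesis
    by (rule colaxI)
      (use assms F.S.psf G.T.psf in "simp_all add: G G[THEN cmpE] F.T2_cell2 F.T2_cell2[THEN FA_eq] F.T2_cmp F.T2_cmp[THEN FA_eq]
         F.T2_unit F.T2_unit[THEN FA_eq]",
       simp_all add: comp_trf_def)
qed

lemma comp_trf_pseudonatural:
  assumes "two_category K" "pseudonatural kp K F" "pseudonatural kp K G" "TDom G = TCod F"
  shows "pseudonatural kp K (comp_trf K G F)"
  unfolding pseudonatural_def
proof (intro conjI ballI)
  have a: "colax kp K F" "colax kp K G" using assms by (auto simp: pseudonatural_def)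
  then show "colax kp K (comp_trf K G F)" using assms comp_trf_colax by blast
  interpret twocat K by unfold_locales fact
  interpret F: clx kp K F using assms a by unfold_locales
  interpret G: clx kp K G using assms a by unfold_locales
  fix f assume f: "f \<in> Cell1 K"
  then have i: "iso_ntr (T2 F f)" "iso_ntr (T2 G f)" using assms by (auto simp: pseudonatural_def)
  show "iso_ntr (T2 (comp_trf K G F) f)"
  proof (rule iso_ntrI)
    fix a assume "a \<in> Ob (FDom (NDom (T2 (comp_trf K G F) f)))"
    then have a: "a \<in> Ob (P0 (TDom F) (src1 K f))" using f by simp
    have "isom (P0 (TCod G) (tgt1 K f)) (NC (T2 G f) (FO (T1 F (src1 K f)) a))"
      "isom (P0 (TCod F) (tgt1 K f)) (NC (T2 F f) a)"
      by (rule iso_ntr_isom; use i f a assms(4) in simp)+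
    then show "isom (FCod (NDom (T2 (comp_trf K G F) f))) (NC (T2 (comp_trf K G F) f) a)"
      using f a assms(4) by (auto intro!: isom_cmp isom_FA)
  qed (use f assms(4) in simp)
qed

section \<open>Transposing colax transformations out of \<open>U D\<close>\<close>

text \<open>A colax transformation \<open>F : U D \<Rightarrow> C\<close> with components \<open>T\<close> is determined by the maps
  \<open>\<phi> f d : T\<^sub>q d \<rightarrow> C\<^sub>f (T\<^sub>p (D\<^sup>f d))\<close> obtained from its 2-cells by precomposition with the units.
  In this form the right adjoints no longer occur.\<close>

definition hlf :: "'k rel => ('p, 'f, 'a) twocat => ('p, 'f, 'a, 'o1, 'm1) catpfun =>
    ('p, 'f, 'a, 'o1, 'm1, 'o2, 'm2) trf => 'f => 'o1 => 'm2" where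
  "hlf kp L D F f d = NC (T2 F f) (FO (P1 D f) d) \<cdot>[P0 (TCod F) (tgt1 L f)] FA (T1 F (tgt1 L f)) (NC (adj_unit kp (P1 D f)) d)"

text \<open>The way back from half forms: the 2-cell at \<open>x\<close> is \<open>\<phi>\<close> at
  \<open>D_f x\<close>, followed by the image of the counit at \<open>x\<close>.\<close>

definition htrf :: "'k rel => ('p, 'f, 'a) twocat => ('p, 'f, 'a, 'o1, 'm1) catpfun => ('p, 'f, 'a, 'o2, 'm2) catpfun =>
    ('p => ('o1, 'm1, 'o2, 'm2) ftr) => ('f => 'o1 => 'm2) => ('p, 'f, 'a, 'o1, 'm1, 'o2, 'm2) trf" where
  "htrf kp L D C T \<phi> = \<lparr>TDom = U0 kp L D, TCod = C, T1 = restrict T (Cell0 L),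
     T2 = (\<lambda>f \<in> Cell1 L. \<lparr>NDom = T (tgt1 L f) \<odot> radj kp (P1 D f), NCod = P1 C f \<odot> T (src1 L f),
       NC = (\<lambda>x \<in> Ob (P0 D (src1 L f)). FA (P1 C f) (FA (T (src1 L f)) (NC (adj_counit kp (P1 D f)) x)) \<cdot>[P0 C (tgt1 L f)]
          \<phi> f (FO (radj kp (P1 D f)) x))\<rparr>)\<rparr>"

locale hctx = adjp kp L D + C: psf kp L C
  for kp :: "'k rel" and L :: "('p, 'f, 'a) twocat" and D :: "('p, 'f, 'a, 'o1, 'm1) catpfun" and C :: "('p, 'f, 'a, 'o2, 'm2) catpfun"

text \<open>\<open>H1\<close>, \<open>H2\<close> and \<open>H3\<close> are the colax axioms for
  2-cells, composites and identities after composition with units. Only \<open>T\<close>,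
  \<open>\<phi>\<close> and the two pseudofunctors occur in them, which is why they can serve as
  input for building objects of the co-dextrification.\<close>

locale hcolax = hctx kp L D C
  for kp :: "'k rel" and L :: "('p, 'f, 'a) twocat" and D :: "('p, 'f, 'a, 'o1, 'm1) catpfun" and C :: "('p, 'f, 'a, 'o2, 'm2) catpfun" +
  fixes T :: "'p => ('o1, 'm1, 'o2, 'm2) ftr" and \<phi> :: "'f => 'o1 => 'm2"
  assumes T: "p \<in> Cell0 L ==> lex_ftr kp (T p) \<and> FDom (T p) = P0 D p \<and> FCod (T p) = P0 C p"
    and \<phi>: "f \<in> Cell1 L ==> d \<in> Ob (P0 D (tgt1 L f)) ==>
      \<phi> f d \<in> hom (P0 C (tgt1 L f)) (FO (T (tgt1 L f)) d) (FO (P1 C f) (FO (T (src1 L f)) (FO (P1 D f) d)))"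
    and \<phi>_nat: "f \<in> Cell1 L ==> u \<in> Ar (P0 D (tgt1 L f)) ==>
      FA (P1 C f) (FA (T (src1 L f)) (FA (P1 D f) u)) \<cdot>[P0 C (tgt1 L f)] \<phi> f (Src (P0 D (tgt1 L f)) u) =
      \<phi> f (Tgt (P0 D (tgt1 L f)) u) \<cdot>[P0 C (tgt1 L f)] FA (T (tgt1 L f)) u"
    and H1: "al \<in> Cell2 L ==> d \<in> Ob (P0 D (tgt1 L (tgt2 L al))) ==> f' = tgt2 L al ==> p = src1 L f' ==> q = tgt1 L f' ==>
      FA (P1 C f') (FA (T p) (NC (P2 D al) d)) \<cdot>[P0 C q] \<phi> f' d =
      NC (P2 C al) (FO (T p) (FO (P1 D (src2 L al)) d)) \<cdot>[P0 C q] \<phi> (src2 L al) d"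
    and H2: "f \<in> Cell1 L ==> g \<in> Cell1 L ==> src1 L g = tgt1 L f ==> d \<in> Ob (P0 D (tgt1 L g)) ==>
      \<phi> (g \<star>[L] f) d = FA (P1 C (g \<star>[L] f)) (FA (T (src1 L f)) (NC (PC D f g) d)) \<cdot>[P0 C (tgt1 L g)]
        NC (PC C g f) (FO (T (src1 L f)) (FO (P1 D f) (FO (P1 D g) d))) \<cdot>[P0 C (tgt1 L g)]
        FA (P1 C g) (\<phi> f (FO (P1 D g) d)) \<cdot>[P0 C (tgt1 L g)] \<phi> g d"
    and H3: "p \<in> Cell0 L ==> d \<in> Ob (P0 D p) ==>
      \<phi> (id1 L p) d = FA (P1 C (id1 L p)) (FA (T p) (NC (PU D p) d)) \<cdot>[P0 C p] NC (PU C p) (FO (T p) d)"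
begin

lemma T_simps [simp]: "p \<in> Cell0 L ==> is_functor (T p)" "p \<in> Cell0 L ==> lex_ftr kp (T p)"
  "p \<in> Cell0 L ==> FDom (T p) = P0 D p" "p \<in> Cell0 L ==> FCod (T p) = P0 C p"
  using T lex_ftrD by blast+

lemma \<phi>_simps [simp]:
  assumes "f \<in> Cell1 L" "q = tgt1 L f" "d \<in> Ob (P0 D q)"
  shows "\<phi> f d \<in> Ar (P0 C q)" "Src (P0 C q) (\<phi> f d) = FO (T q) d"
    "Tgt (P0 C q) (\<phi> f d) = FO (P1 C f) (FO (T (src1 L f)) (FO (P1 D f) d))"
  using \<phi>[of f d] assms by simp_all

lemma \<phi>_R:
  assumes "f \<in> Cell1 L" "q = tgt1 L f" "u \<in> Ar (P0 D q)" "Tgt (P0 D q) u = b"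
  shows "\<phi> f b \<cdot>[P0 C q] FA (T q) u = FA (P1 C f) (FA (T (src1 L f)) (FA (P1 D f) u)) \<cdot>[P0 C q] \<phi> f (Src (P0 D q) u)"
  using \<phi>_nat[of f u] assms by simp

lemma \<phi>_L:
  assumes "f \<in> Cell1 L" "q = tgt1 L f" "p = src1 L f" "u \<in> Ar (P0 D q)" "Src (P0 D q) u = a"
  shows "FA (P1 C f) (FA (T p) (FA (P1 D f) u)) \<cdot>[P0 C q] \<phi> f a = \<phi> f (Tgt (P0 D q) u) \<cdot>[P0 C q] FA (T q) u"
  using \<phi>_nat[of f u] assms by simp

lemma htrf_simps [simp]:
  "TDom (htrf kp L D C T \<phi>) = U0 kp L D" "TCod (htrf kp L D C T \<phi>) = C" "p \<in> Cell0 L ==> T1 (htrf kp L D C T \<phi>) p = T p"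
  "f \<in> Cell1 L ==> NDom (T2 (htrf kp L D C T \<phi>) f) = T (tgt1 L f) \<odot> R f" "f \<in> Cell1 L ==> NCod (T2 (htrf kp L D C T \<phi>) f) = P1 C f \<odot> T (src1 L f)"
  "f \<in> Cell1 L ==> x \<in> Ob (P0 D (src1 L f)) ==>
    NC (T2 (htrf kp L D C T \<phi>) f) x = FA (P1 C f) (FA (T (src1 L f)) (e f x)) \<cdot>[P0 C (tgt1 L f)] \<phi> f (FO (R f) x)"
  by (simp_all add: htrf_def)

text \<open>As \<open>flats\<close>, but beneath two functors: in a half form the arrows of
  \<open>D\<close> sit under \<open>T\<close> and then under \<open>P1 C f\<close>.\<close>

lemmas e2 = counit_R[THEN FA_eq, THEN FA_eq] counit_R[THEN FA_eq, THEN FA_eq, THEN cmpE]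
  tri(1)[THEN FA_eq, THEN FA_eq] tri(1)[THEN FA_eq, THEN FA_eq, THEN cmpE]
  U0_P2(4)[THEN FA_eq, THEN FA_eq, THEN cmpE] U0_PC(5)[THEN FA_eq, THEN FA_eq, THEN cmpE] U0_PU(5)[THEN FA_eq, THEN FA_eq, THEN cmpE]
  D.PC_inv(2)[THEN FA_eq, THEN FA_eq, THEN cmpE] D.PU_inv(2)[THEN FA_eq, THEN FA_eq, THEN cmpE]

text \<open>Naturality of \<open>\<phi>\<close> moves arrows of \<open>D\<close> to its left, where
  the counits absorb the 2-cells of \<open>U0\<close>; the rest is \<open>H1\<close>,
  \<open>H2\<close> or \<open>H3\<close>.\<close>

lemma htrf_colax: "colax kp L (htrf kp L D C T \<phi>)"
proof (rule colaxI)
  fix f assume f: "f \<in> Cell1 L"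
  have "nattrans (T2 (htrf kp L D C T \<phi>) f)"
  proof (rule nattransI)
    show "NC (T2 (htrf kp L D C T \<phi>) f) \<in> extensional (Ob (FDom (NDom (T2 (htrf kp L D C T \<phi>) f))))"
      using f by (simp add: htrf_def)
  qed (use f in "simp_all add: \<phi>_R e2")
  then show "T2 (htrf kp L D C T \<phi>) f \<in> nats (T1 (htrf kp L D C T \<phi>) (tgt1 L f) \<odot> P1 (TDom (htrf kp L D C T \<phi>)) f)
      (P1 (TCod (htrf kp L D C T \<phi>)) f \<odot> T1 (htrf kp L D C T \<phi>) (src1 L f))" using f by simp
next
  show "T1 (htrf kp L D C T \<phi>) \<in> extensional (Cell0 L)" "T2 (htrf kp L D C T \<phi>) \<in> extensional (Cell1 L)"
    by (simp_all add: htrf_def)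
next
  fix al x assume a: "al \<in> Cell2 L" "x \<in> Ob (P0 (TDom (htrf kp L D C T \<phi>)) (src1 L (tgt2 L al)))"
  then show "NC (T2 (htrf kp L D C T \<phi>) (tgt2 L al)) x \<cdot>[P0 (TCod (htrf kp L D C T \<phi>)) (tgt1 L (tgt2 L al))]
      FA (T1 (htrf kp L D C T \<phi>) (tgt1 L (tgt2 L al))) (NC (P2 (TDom (htrf kp L D C T \<phi>)) al) x) =
    NC (P2 (TCod (htrf kp L D C T \<phi>)) al) (FO (T1 (htrf kp L D C T \<phi>) (src1 L (tgt2 L al))) x) \<cdot>[P0 (TCod (htrf kp L D C T \<phi>)) (tgt1 L (tgt2 L al))]
      NC (T2 (htrf kp L D C T \<phi>) (src2 L al)) x"
    by (simp add: U0_P2 \<phi>_R e2 H1 C.P2_R C.P2_R[THEN cmpE])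
next
  fix f g x assume a: "f \<in> Cell1 L" "g \<in> Cell1 L" "src1 L g = tgt1 L f" "x \<in> Ob (P0 (TDom (htrf kp L D C T \<phi>)) (src1 L f))"
  then show "NC (T2 (htrf kp L D C T \<phi>) (g \<star>[L] f)) x \<cdot>[P0 (TCod (htrf kp L D C T \<phi>)) (tgt1 L g)]
      FA (T1 (htrf kp L D C T \<phi>) (tgt1 L g)) (NC (PC (TDom (htrf kp L D C T \<phi>)) g f) x) =
    NC (PC (TCod (htrf kp L D C T \<phi>)) g f) (FO (T1 (htrf kp L D C T \<phi>) (src1 L f)) x) \<cdot>[P0 (TCod (htrf kp L D C T \<phi>)) (tgt1 L g)]
      FA (P1 (TCod (htrf kp L D C T \<phi>)) g) (NC (T2 (htrf kp L D C T \<phi>) f) x) \<cdot>[P0 (TCod (htrf kp L D C T \<phi>)) (tgt1 L g)]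
      NC (T2 (htrf kp L D C T \<phi>) g) (FO (P1 (TDom (htrf kp L D C T \<phi>)) f) x)"
    by (simp add: U0_PC \<phi>_R \<phi>_R[THEN FA_eq] \<phi>_R[THEN FA_eq, THEN cmpE] e2 C.PC_R C.PC_R[THEN cmpE],
        simp add: H2 e2)
next
  fix p x assume a: "p \<in> Cell0 L" "x \<in> Ob (P0 (TDom (htrf kp L D C T \<phi>)) p)"
  then show "NC (T2 (htrf kp L D C T \<phi>) (id1 L p)) x \<cdot>[P0 (TCod (htrf kp L D C T \<phi>)) p]
      FA (T1 (htrf kp L D C T \<phi>) p) (NC (PU (TDom (htrf kp L D C T \<phi>)) p) x) =
    NC (PU (TCod (htrf kp L D C T \<phi>)) p) (FO (T1 (htrf kp L D C T \<phi>) p) x)"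
    by (simp add: U0_PU \<phi>_R e2, simp add: H3 e2)
qed (use twoL U0_pseudofunctor C.psf in simp_all)

lemma hlf_htrf:
  assumes "f \<in> Cell1 L" "d \<in> Ob (P0 D (tgt1 L f))"
  shows "hlf kp L D (htrf kp L D C T \<phi>) f d = \<phi> f d"
  using assms by (simp add: hlf_def \<phi>_R e2)

end

context hctx begin

lemma hlf_hcolax:
  assumes F: "colax kp L F" and eq: "TDom F = U0 kp L D" "TCod F = C"
  shows "hcolax kp L D C (T1 F) (hlf kp L D F)"
proof -
  interpret F: clx kp L F using F twoL by unfold_locales
  note T2 = F.T2_cell2[unfolded eq U0_simps] F.T2_cmp[unfolded eq U0_simps] F.T2_unit[unfolded eq U0_simps] 
  note T2_L = F.T2_L[unfolded eq U0_simps] and T2_R = F.T2_R[unfolded eq U0_simps]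
  show ?thesis
  proof unfold_locales
    fix al d f' p q assume "al \<in> Cell2 L" "d \<in> Ob (P0 D (tgt1 L (tgt2 L al)))" "f' = tgt2 L al" "p = src1 L f'" "q = tgt1 L f'"
    then show "FA (P1 C f') (FA (T1 F p) (NC (P2 D al) d)) \<cdot>[P0 C q] hlf kp L D F f' d =
        NC (P2 C al) (FO (T1 F p) (FO (P1 D (src2 L al)) d)) \<cdot>[P0 C q] hlf kp L D F (src2 L al) d"
      by (simp add: hlf_def eq T2_L[THEN cmpE] unit_cell2[THEN FA_eq] U0_P2 T2(1)[THEN cmpE])
  next
    fix f g d assume "f \<in> Cell1 L" "g \<in> Cell1 L" "src1 L g = tgt1 L f" "d \<in> Ob (P0 D (tgt1 L g))"
    then show "hlf kp L D F (g \<star>[L] f) d = FA (P1 C (g \<star>[L] f)) (FA (T1 F (src1 L f)) (NC (PC D f g) d)) \<cdot>[P0 C (tgt1 L g)]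
        NC (PC C g f) (FO (T1 F (src1 L f)) (FO (P1 D f) (FO (P1 D g) d))) \<cdot>[P0 C (tgt1 L g)]
        FA (P1 C g) (hlf kp L D F f (FO (P1 D g) d)) \<cdot>[P0 C (tgt1 L g)] hlf kp L D F g d"
      by (simp add: hlf_def eq T2_R[THEN cmpE] unit_cmp U0_PC T2(2)[THEN cmpE])
  next
    fix p d assume "p \<in> Cell0 L" "d \<in> Ob (P0 D p)"
    then show "hlf kp L D F (id1 L p) d = FA (P1 C (id1 L p)) (FA (T1 F p) (NC (PU D p) d)) \<cdot>[P0 C p] NC (PU C p) (FO (T1 F p) d)"
      by (simp add: hlf_def eq T2_R[THEN cmpE] unit_id U0_PU T2(3))
  qed (simp_all add: eq hlf_def T2_L[THEN cmpE] unit_L[THEN FA_eq])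
qed

text \<open>One round trip between 2-cells and half forms, by the second triangle identity;
  \<open>hlf_htrf\<close> is the other, by the first.\<close>

lemma T2_hlf:
  assumes F: "colax kp L F" and eq: "TDom F = U0 kp L D" "TCod F = C" and f: "f \<in> Cell1 L" "x \<in> Ob (P0 D (src1 L f))"
  shows "NC (T2 F f) x = FA (P1 C f) (FA (T1 F (src1 L f)) (e f x)) \<cdot>[P0 C (tgt1 L f)] hlf kp L D F f (FO (R f) x)"
proof -
  interpret F: clx kp L F using F twoL by unfold_locales
  note T2_L = F.T2_L[unfolded eq U0_simps]
  show ?thesis using f by (simp add: hlf_def eq T2_L[THEN cmpE] tri(2)[THEN FA_eq])
qed

text \<open>By \<open>T2_hlf\<close> the half forms determine the 2-cells. Strictness of
  \<open>U\<close> on 1-cells and of the extension is proved in this way.\<close>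

lemma trf_eqI:
  assumes F: "colax kp L F" and eqF: "TDom F = U0 kp L D" "TCod F = C"
    and G: "colax kp L G" and eqG: "TDom G = U0 kp L D" "TCod G = C"
    and 1: "!!p. p \<in> Cell0 L ==> T1 F p = T1 G p"
    and 2: "!!f d. f \<in> Cell1 L ==> d \<in> Ob (P0 D (tgt1 L f)) ==> hlf kp L D F f d = hlf kp L D G f d"
  shows "F = G"
proof (rule trf.equality)
  interpret F: clx kp L F using F twoL by unfold_locales
  interpret G: clx kp L G using G twoL by unfold_locales
  show "T1 F = T1 G" using F.ext G.ext 1 by (auto intro: extensionalityI)
  have "T2 F f = T2 G f" if f: "f \<in> Cell1 L" for f
    by (rule ntr_eqI) (use f in "simp_all add: eqF eqG 1 2 T2_hlf[OF F eqF f] T2_hlf[OF G eqG f]")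
  then show "T2 F = T2 G" using F.ext G.ext by (auto intro: extensionalityI)
qed (use eqF eqG in simp_all)

text \<open>The forward direction evaluates the modification axiom at \<open>D^f d\<close> and
  precomposes with the unit. The converse writes the 2-cells at \<open>x\<close> through the half
  forms at \<open>D_f x\<close> and uses naturality of the components at the counit.\<close>

lemma modification_hlf:
  assumes F: "colax kp L (MDom m)" and eqF: "TDom (MDom m) = U0 kp L D" "TCod (MDom m) = C"
    and G: "colax kp L (MCod m)" and eqG: "TDom (MCod m) = U0 kp L D" "TCod (MCod m) = C"
    and m: "MC m \<in> extensional (Cell0 L)" "!!p. p \<in> Cell0 L ==> MC m p \<in> nats (T1 (MDom m) p) (T1 (MCod m) p)"
  shows "modification kp L m \<longleftrightarrow> (\<forall>f \<in> Cell1 L. \<forall>d \<in> Ob (P0 D (tgt1 L f)).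
     FA (P1 C f) (NC (MC m (src1 L f)) (FO (P1 D f) d)) \<cdot>[P0 C (tgt1 L f)] hlf kp L D (MDom m) f d =
     hlf kp L D (MCod m) f d \<cdot>[P0 C (tgt1 L f)] NC (MC m (tgt1 L f)) d)" (is "_ = ?rhs")
proof
  interpret F: clx kp L "MDom m" using F twoL by unfold_locales
  interpret G: clx kp L "MCod m" using G twoL by unfold_locales
  note m' = m(2)[unfolded nats_iff]
  have mty [simp]: "NDom (MC m p) = T1 (MDom m) p" "NCod (MC m p) = T1 (MCod m) p" "nattrans (MC m p)" if "p \<in> Cell0 L" for p using m' that by simp_all
  have nat: "NC (MC m p) b \<cdot>[P0 C p] FA (T1 (MDom m) p) u = FA (T1 (MCod m) p) u \<cdot>[P0 C p] NC (MC m p) (Src (P0 D p) u)"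
    if "p \<in> Cell0 L" "u \<in> Ar (P0 D p)" "Tgt (P0 D p) u = b" for p u b
    using naturality[of "MC m p" u "P0 D p" "P0 C p" "Src (P0 D p) u" b] that eqF eqG by simp
  { assume mm: "modification kp L m"
    note M = modificationD(9)[OF mm twoL, unfolded eqF U0_simps]
    show ?rhs
      by (intro ballI) (simp add: hlf_def eqF eqG M[THEN cmpE] nat) }
  assume ?rhs
  then have r: "f \<in> Cell1 L ==> q = tgt1 L f ==> d \<in> Ob (P0 D q) ==> p = src1 L f ==> FA (P1 C f) (NC (MC m p) (FO (P1 D f) d)) \<cdot>[P0 C q] hlf kp L D (MDom m) f d =
     hlf kp L D (MCod m) f d \<cdot>[P0 C q] NC (MC m q) d" for f q d p by blast
  interpret hF: hcolax kp L D C "T1 (MDom m)" "hlf kp L D (MDom m)" by (rule hlf_hcolax[OF F eqF])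
  interpret hG: hcolax kp L D C "T1 (MCod m)" "hlf kp L D (MCod m)" by (rule hlf_hcolax[OF G eqG])
  show "modification kp L m"
  proof (rule modificationI)
    fix f x assume f: "f \<in> Cell1 L" and "x \<in> Ob (P0 (TDom (MDom m)) (src1 L f))"
    then have x: "x \<in> Ob (P0 D (src1 L f))" by (simp add: eqF)
    show "FA (P1 (TCod (MDom m)) f) (NC (MC m (src1 L f)) x) \<cdot>[P0 (TCod (MDom m)) (tgt1 L f)] NC (T2 (MDom m) f) x =
      NC (T2 (MCod m) f) x \<cdot>[P0 (TCod (MDom m)) (tgt1 L f)] NC (MC m (tgt1 L f)) (FO (P1 (TDom (MDom m)) f) x)"
      using f x by (simp add: eqF eqG T2_hlf[OF F eqF f] T2_hlf[OF G eqG f] nat[THEN FA_eq, THEN cmpE] r)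
  qed (use F G eqF eqG m twoL in simp_all)
qed

end

text \<open>Reverses two opposite sides of a commuting square, given a left inverse of one and a
  right inverse of the other. It transfers naturality, colax and modification axioms to inverse
  2-cells.\<close>

lemma inv_square:
  assumes "category C" and e: "a \<cdot>[C] u = v \<cdot>[C] b" and "a' \<cdot>[C] a = Idn C (Src C a)" "b \<cdot>[C] b' = Idn C (Tgt C b)"
    and ty: "a \<in> Ar C" "u \<in> Ar C" "v \<in> Ar C" "b \<in> Ar C" "a' \<in> Ar C" "b' \<in> Ar C" "Src C a = Tgt C u" "Src C v = Tgt C b"
    "Src C u = Src C b" "Tgt C v = Tgt C a" "Src C a' = Tgt C a" "Tgt C a' = Src C a" "Src C b' = Tgt C b" "Tgt C b' = Src C b"
  shows "u \<cdot>[C] b' = a' \<cdot>[C] v"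
proof -
  have "u \<cdot>[C] b' = a' \<cdot>[C] (a \<cdot>[C] u) \<cdot>[C] b'"
    using assms(1,3) ty by (simp add: assms(3)[THEN cmpE])
  also have "... = a' \<cdot>[C] v" using assms(1,4) ty unfolding e by simp
  finally show ?thesis .
qed

lemma vcomp_id_ntr:
  assumes "nattrans ta"
  shows "NDom ta = F ==> ta \<bullet>\<^sub>N id_ntr F = ta" "NCod ta = G ==> id_ntr G \<bullet>\<^sub>N ta = ta"
proof -
  note D = nattransD[OF assms]
  note C = functorD[OF D(1)]
  show "NDom ta = F ==> ta \<bullet>\<^sub>N id_ntr F = ta" by (rule ntr_eqI) (use assms C D in auto)
  show "NCod ta = G ==> id_ntr G \<bullet>\<^sub>N ta = ta" by (rule ntr_eqI) (use assms C D in auto)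
qed

section \<open>Calculus of modifications\<close>

lemma mdf_simps [simp]:
  "MDom (id_mdf K F) = F" "MCod (id_mdf K F) = F" "p \<in> Cell0 K ==> MC (id_mdf K F) p = id_ntr (T1 F p)"
  "MC (id_mdf K F) \<in> extensional (Cell0 K)"
  by (simp_all add: id_mdf_def)

lemma vcomp_mdf_simps [simp]:
  "MDom (vcomp_mdf K n m) = MDom m" "MCod (vcomp_mdf K n m) = MCod n" "p \<in> Cell0 K ==> MC (vcomp_mdf K n m) p = MC n p \<bullet>\<^sub>N MC m p"
  "MC (vcomp_mdf K n m) \<in> extensional (Cell0 K)"
  by (simp_all add: vcomp_mdf_def)

lemma lwh_mdf_simps [simp]:
  "MDom (lwh_mdf K G m) = comp_trf K G (MDom m)" "MCod (lwh_mdf K G m) = comp_trf K G (MCod m)"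
  "p \<in> Cell0 K ==> MC (lwh_mdf K G m) p = T1 G p \<triangleleft>\<^sub>N MC m p" "MC (lwh_mdf K G m) \<in> extensional (Cell0 K)"
  by (simp_all add: lwh_mdf_def)

lemma rwh_mdf_simps [simp]:
  "MDom (rwh_mdf K m F) = comp_trf K (MDom m) F" "MCod (rwh_mdf K m F) = comp_trf K (MCod m) F"
  "p \<in> Cell0 K ==> MC (rwh_mdf K m F) p = MC m p \<triangleright>\<^sub>N T1 F p" "MC (rwh_mdf K m F) \<in> extensional (Cell0 K)"
  by (simp_all add: rwh_mdf_def)

lemma mdf_coop [simp]:
  "vcomp_mdf (coop L) = vcomp_mdf L" "id_mdf (coop L) = id_mdf L"
  by (simp_all add: vcomp_mdf_def id_mdf_def fun_eq_iff)

lemma mdf_eqI: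
  fixes m n :: "('p, 'f, 'a, 'o1, 'm1, 'o2, 'm2) mdf"
  assumes "MDom m = MDom n" "MCod m = MCod n" "MC m \<in> extensional (Cell0 K)" "MC n \<in> extensional (Cell0 K)"
    "!!p. p \<in> Cell0 K ==> MC m p = MC n p"
  shows "m = n"
  using assms by (intro mdf.equality) (auto intro: extensionalityI)

lemma id_mdf_modification:
  assumes "two_category K" "colax kp K F" shows "modification kp K (id_mdf K F)"
proof -
  interpret twocat K by unfold_locales fact
  interpret F: clx kp K F using assms by unfold_locales
  show ?thesis by (rule modificationI) (use assms in simp_all)
qed

lemma vcomp_mdf_modification:
  assumes "two_category K" "modification kp K m" "modification kp K n" "MDom n = MCod m"
  shows "modification kp K (vcomp_mdf K n m)"
proof -
  interpret twocat K by unfold_locales fact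
  note m = modificationD[OF assms(2,1)] and n = modificationD[OF assms(3,1)]
  interpret F: clx kp K "MDom m" using m assms by unfold_locales
  interpret G: clx kp K "MCod m" using m assms by unfold_locales
  interpret H: clx kp K "MCod n" using n assms by unfold_locales
  note eq = m(3,4) n(3,4)[unfolded assms(4) m(3,4)]
  note ty = eq m(6-8) n(6-8)[unfolded assms(4)]
  note mm = m(9) and nn = n(9)[unfolded assms(4) m(3,4)]
  show ?thesis
  proof (rule modificationI)
    fix f x assume f: "f \<in> Cell1 K" "x \<in> Ob (P0 (TDom (MDom (vcomp_mdf K n m))) (src1 K f))"
    then show "FA (P1 (TCod (MDom (vcomp_mdf K n m))) f) (NC (MC (vcomp_mdf K n m) (src1 K f)) x) \<cdot>[P0 (TCod (MDom (vcomp_mdf K n m))) (tgt1 K f)]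
        NC (T2 (MDom (vcomp_mdf K n m)) f) x =
      NC (T2 (MCod (vcomp_mdf K n m)) f) x \<cdot>[P0 (TCod (MDom (vcomp_mdf K n m))) (tgt1 K f)]
        NC (MC (vcomp_mdf K n m) (tgt1 K f)) (FO (P1 (TDom (MDom (vcomp_mdf K n m))) f) x)"
      by (simp add: ty mm nn[THEN cmpE])
  qed (use assms m n ty in simp_all)
qed

section \<open>The 2-functor \<open>U\<close>\<close>

text \<open>A 1-cell \<open>G\<close> of \<open>Ps_adj\<close>. It is a transformation over
  \<open>coop L\<close>, while its image under \<open>U\<close> lives over \<open>L\<close> and ends
  in \<open>U0\<close> of its codomain; the sublocales supply both views.\<close>

locale adjt =
  fixes kp :: "'k rel" and L :: "('p, 'f, 'a) twocat" and G :: "('p, 'f, 'a, 'o1, 'm1, 'o2, 'm2) trf"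
  assumes twoL: "two_category L" and adjG: "adj_trf kp L G"

sublocale adjt \<subseteq> twocat L by unfold_locales (rule twoL)
sublocale adjt \<subseteq> A: adjp kp L "TDom G" by unfold_locales (use twoL adjG in "auto simp: adj_trf_def")
sublocale adjt \<subseteq> B: adjp kp L "TCod G" by unfold_locales (use twoL adjG in "auto simp: adj_trf_def")
sublocale adjt \<subseteq> G: clx kp "coop L" G
  by unfold_locales (use twoL adjG in "auto simp: adj_trf_def pseudonatural_def two_category_coop")
sublocale adjt \<subseteq> hctx kp L "TDom G" "U0 kp L (TCod G)"
  by unfold_locales (use twoL B.U0_pseudofunctor in simp_all)

context adjt begin

abbreviation "gi f d \<equiv> NC (inv_ntr (T2 G f)) d"

lemma T2_iso [simp]: "f \<in> Cell1 L ==> iso_ntr (T2 G f)"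
  using adjG by (auto simp: adj_trf_def pseudonatural_def)

lemma gi_inv:
  assumes "f \<in> Cell1 L" "q = tgt1 L f" "p = src1 L f" "d \<in> Ob (P0 (TDom G) q)"
  shows "gi f d \<cdot>[P0 (TCod G) p] NC (T2 G f) d = Idn (P0 (TCod G) p) (FO (T1 G p) (FO (P1 (TDom G) f) d))"
    "NC (T2 G f) d \<cdot>[P0 (TCod G) p] gi f d = Idn (P0 (TCod G) p) (FO (P1 (TCod G) f) (FO (T1 G q) d))"
  using inv_ntr(5,6)[OF T2_iso[OF assms(1)]] assms by simp_all

lemma Gi_L:
  assumes "f \<in> Cell1 L" "q = tgt1 L f" "p = src1 L f" "u \<in> Ar (P0 (TDom G) q)" "Src (P0 (TDom G) q) u = a"
  shows "FA (T1 G p) (FA (P1 (TDom G) f) u) \<cdot>[P0 (TCod G) p] gi f a =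
    gi f (Tgt (P0 (TDom G) q) u) \<cdot>[P0 (TCod G) p] FA (P1 (TCod G) f) (FA (T1 G q) u)"
  using inv_ntr_naturality[OF T2_iso[OF assms(1)], of u "P0 (TDom G) q" "P0 (TCod G) p" a "Tgt (P0 (TDom G) q) u"] assms by simp

text \<open>\<open>U1\<close> takes mates of the inverses of the 2-cells of \<open>G\<close>, so the
  three axioms of \<open>G\<close> are needed for these inverses; here and in \<open>Gi_cmp\<close>
  and \<open>Gi_unit\<close> they arise from the colax axioms by \<open>inv_square\<close>.\<close>

lemma Gi_cell2:
  assumes "al \<in> Cell2 L" "f' = tgt2 L al" "q = tgt1 L f'" "p = src1 L f'" "d \<in> Ob (P0 (TDom G) q)"
  shows "FA (T1 G p) (NC (P2 (TDom G) al) d) \<cdot>[P0 (TCod G) p] gi f' d =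
    gi (src2 L al) d \<cdot>[P0 (TCod G) p] NC (P2 (TCod G) al) (FO (T1 G q) d)"
  by (rule inv_square[of _ "NC (T2 G (src2 L al)) d" _ _ "NC (T2 G f') d"])
    (use assms G.T2_cell2[of al d] in "simp_all add: gi_inv")

lemma Gi_cmp:
  assumes "f \<in> Cell1 L" "g \<in> Cell1 L" "src1 L g = tgt1 L f" "d \<in> Ob (P0 (TDom G) (tgt1 L g))" "p = src1 L f" "q = tgt1 L f"
  shows "FA (T1 G p) (NC (PC (TDom G) f g) d) \<cdot>[P0 (TCod G) p] gi f (FO (P1 (TDom G) g) d) \<cdot>[P0 (TCod G) p]
      FA (P1 (TCod G) f) (gi g d) \<cdot>[P0 (TCod G) p] NC (inv_ntr (PC (TCod G) f g)) (FO (T1 G (tgt1 L g)) d) = gi (g \<star>[L] f) d"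
proof -
  have "FA (T1 G p) (NC (PC (TDom G) f g) d) \<cdot>[P0 (TCod G) p] (gi f (FO (P1 (TDom G) g) d) \<cdot>[P0 (TCod G) p] FA (P1 (TCod G) f) (gi g d)) =
     gi (g \<star>[L] f) d \<cdot>[P0 (TCod G) p] NC (PC (TCod G) f g) (FO (T1 G (tgt1 L g)) d)"
    by (rule inv_square[of _ "NC (T2 G (g \<star>[L] f)) d" _ _
          "FA (P1 (TCod G) f) (NC (T2 G g) d) \<cdot>[P0 (TCod G) p] NC (T2 G f) (FO (P1 (TDom G) g) d)"])
      (use assms G.T2_cmp[of g f d] in "simp_all add: gi_inv gi_inv[THEN cmpE] gi_inv[THEN FA_eq]")
  from arg_cong[OF this, of "\<lambda>t. t \<cdot>[P0 (TCod G) p] NC (inv_ntr (PC (TCod G) f g)) (FO (T1 G (tgt1 L g)) d)"]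
  show ?thesis using assms by (simp add: B.D.PC_inv)
qed

lemma Gi_unit:
  assumes "p \<in> Cell0 L" "d \<in> Ob (P0 (TDom G) p)"
  shows "FA (T1 G p) (NC (PU (TDom G) p) d) \<cdot>[P0 (TCod G) p] NC (inv_ntr (PU (TCod G) p)) (FO (T1 G p) d) = gi (id1 L p) d"
proof -
  have "FA (T1 G p) (NC (PU (TDom G) p) d) \<cdot>[P0 (TCod G) p] Idn (P0 (TCod G) p) (FO (T1 G p) d) =
     gi (id1 L p) d \<cdot>[P0 (TCod G) p] NC (PU (TCod G) p) (FO (T1 G p) d)"
    by (rule inv_square[of _ "NC (T2 G (id1 L p)) d" _ _ "Idn (P0 (TCod G) p) (FO (T1 G p) d)"])
      (use assms G.T2_unit[of p d] in "simp_all add: gi_inv")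
  from arg_cong[OF this, of "\<lambda>t. t \<cdot>[P0 (TCod G) p] NC (inv_ntr (PU (TCod G) p)) (FO (T1 G p) d)"]
  show ?thesis using assms by (simp add: B.D.PU_inv)
qed

text \<open>The half form of \<open>U1 kp L G\<close>: the arrow whose transpose, along the
  adjunction of \<open>TCod G\<close> at \<open>f\<close>, is the inverse 2-cell
  \<open>gi f d\<close> (see \<open>\<phi>_flat\<close>).\<close>

definition \<phi> where "\<phi> f d = FA (B.R f) (gi f d) \<cdot>[P0 (TCod G) (tgt1 L f)] B.n f (FO (T1 G (tgt1 L f)) d)"

lemmas gflats = B.flats Gi_cell2 Gi_cell2[THEN cmpE] Gi_cmp Gi_unit

lemma \<phi>_flat:
  assumes "f \<in> Cell1 L" "p = src1 L f" "d \<in> Ob (P0 (TDom G) (tgt1 L f))"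
  shows "B.e f (FO (T1 G p) (FO (P1 (TDom G) f) d)) \<cdot>[P0 (TCod G) p] FA (P1 (TCod G) f) (\<phi> f d) = gi f d"
  using assms by (simp add: \<phi>_def B.flats)

lemma \<phi>_ty:
  assumes "f \<in> Cell1 L" "d \<in> Ob (P0 (TDom G) (tgt1 L f))" "q = tgt1 L f"
  shows "\<phi> f d \<in> Ar (P0 (TCod G) q)" "Src (P0 (TCod G) q) (\<phi> f d) = FO (T1 G q) d"
    "Tgt (P0 (TCod G) q) (\<phi> f d) = FO (B.R f) (FO (T1 G (src1 L f)) (FO (P1 (TDom G) f) d))"
  using assms by (simp_all add: \<phi>_def)

lemmas pflats = \<phi>_flat \<phi>_flat[THEN cmpE] \<phi>_flat[THEN FA_eq] \<phi>_flat[THEN FA_eq, THEN cmpE]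

text \<open>Transposing turns \<open>\<phi>\<close> into \<open>gi\<close>, so \<open>H1\<close>,
  \<open>H2\<close> and \<open>H3\<close> become \<open>Gi_cell2\<close>, \<open>Gi_cmp\<close> and
  \<open>Gi_unit\<close>.\<close>

lemma U1_hcolax: "hcolax kp L (TDom G) (U0 kp L (TCod G)) (T1 G) \<phi>"
proof unfold_locales
  fix al d f' p q assume a: "al \<in> Cell2 L" "d \<in> Ob (P0 (TDom G) (tgt1 L (tgt2 L al)))" "f' = tgt2 L al" "p = src1 L f'" "q = tgt1 L f'"
  then show "FA (P1 (U0 kp L (TCod G)) f') (FA (T1 G p) (NC (P2 (TDom G) al) d)) \<cdot>[P0 (U0 kp L (TCod G)) q] \<phi> f' d =
      NC (P2 (U0 kp L (TCod G)) al) (FO (T1 G p) (FO (P1 (TDom G) (src2 L al)) d)) \<cdot>[P0 (U0 kp L (TCod G)) q] \<phi> (src2 L al) d"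
    by - (rule B.flat_inj[of f' "FO (T1 G p) (FO (P1 (TDom G) (src2 L al)) d)" _ "FO (T1 G q) d"];
        simp add: B.U0_P2 gflats pflats \<phi>_ty)
next
  fix f g d assume a: "f \<in> Cell1 L" "g \<in> Cell1 L" "src1 L g = tgt1 L f" "d \<in> Ob (P0 (TDom G) (tgt1 L g))"
  then show "\<phi> (g \<star>[L] f) d = FA (P1 (U0 kp L (TCod G)) (g \<star>[L] f)) (FA (T1 G (src1 L f)) (NC (PC (TDom G) f g) d)) \<cdot>[P0 (U0 kp L (TCod G)) (tgt1 L g)]
      NC (PC (U0 kp L (TCod G)) g f) (FO (T1 G (src1 L f)) (FO (P1 (TDom G) f) (FO (P1 (TDom G) g) d))) \<cdot>[P0 (U0 kp L (TCod G)) (tgt1 L g)]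
      FA (P1 (U0 kp L (TCod G)) g) (\<phi> f (FO (P1 (TDom G) g) d)) \<cdot>[P0 (U0 kp L (TCod G)) (tgt1 L g)] \<phi> g d"
    by - (rule B.flat_inj[of "g \<star>[L] f" "FO (T1 G (src1 L f)) (FO (P1 (TDom G) (g \<star>[L] f)) d)" _ "FO (T1 G (tgt1 L g)) d"];
        simp add: B.U0_PC gflats pflats \<phi>_ty)
next
  fix p d assume a: "p \<in> Cell0 L" "d \<in> Ob (P0 (TDom G) p)"
  then show "\<phi> (id1 L p) d = FA (P1 (U0 kp L (TCod G)) (id1 L p)) (FA (T1 G p) (NC (PU (TDom G) p) d)) \<cdot>[P0 (U0 kp L (TCod G)) p]
      NC (PU (U0 kp L (TCod G)) p) (FO (T1 G p) d)"
    by - (rule B.flat_inj[of "id1 L p" "FO (T1 G p) (FO (P1 (TDom G) (id1 L p)) d)" _ "FO (T1 G p) d"];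
        simp add: B.U0_PU gflats pflats \<phi>_ty)
next
  fix f u assume "f \<in> Cell1 L" "u \<in> Ar (P0 (TDom G) (tgt1 L f))"
  then show "FA (P1 (U0 kp L (TCod G)) f) (FA (T1 G (src1 L f)) (FA (P1 (TDom G) f) u)) \<cdot>[P0 (U0 kp L (TCod G)) (tgt1 L f)] \<phi> f (Src (P0 (TDom G) (tgt1 L f)) u) =
     \<phi> f (Tgt (P0 (TDom G) (tgt1 L f)) u) \<cdot>[P0 (U0 kp L (TCod G)) (tgt1 L f)] FA (T1 G (tgt1 L f)) u"
    by (simp add: \<phi>_def Gi_L[THEN FA_eq, THEN cmpE] B.unit_L)
qed (simp_all add: \<phi>_ty)

sublocale h: hcolax kp L "TDom G" "U0 kp L (TCod G)" "T1 G" \<phi> by (rule U1_hcolax)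

text \<open>The mate in \<open>U1\<close> unfolds to \<open>\<phi>\<close> followed by the image of
  a counit. Colaxness of \<open>U1 kp L G\<close> is then an instance of
  \<open>htrf_colax\<close>.\<close>

lemma U1_htrf: "U1 kp L G = htrf kp L (TDom G) (U0 kp L (TCod G)) (T1 G) \<phi>"
proof (rule trf.equality)
  show "T1 (U1 kp L G) = T1 (htrf kp L (TDom G) (U0 kp L (TCod G)) (T1 G) \<phi>)"
    using G.ext(1) by (auto simp: U1_def htrf_def restrict_def extensional_def fun_eq_iff)
  interpret H: clx kp L "htrf kp L (TDom G) (U0 kp L (TCod G)) (T1 G) \<phi>" using h.htrf_colax twoL by unfold_locales
  have "T2 (U1 kp L G) f = T2 (htrf kp L (TDom G) (U0 kp L (TCod G)) (T1 G) \<phi>) f" if f: "f \<in> Cell1 L" for f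
  proof -
    have m: "T2 (U1 kp L G) f = mate (T1 G (tgt1 L f)) (T1 G (src1 L f)) (B.R f) (adj_unit kp (P1 (TCod G) f)) (A.R f) (adj_counit kp (P1 (TDom G) f)) (inv_ntr (T2 G f))"
      using f by (simp add: U1_def Let_def)
    note mm = mate[OF A.adjn_f[OF f] B.adjn_f[OF f], of "T1 G (tgt1 L f)" "T1 G (src1 L f)" "inv_ntr (T2 G f)"]
    show ?thesis
      unfolding m by (rule ntr_eqI) (use f mm in "simp_all add: \<phi>_def")
  qed
  then show "T2 (U1 kp L G) = T2 (htrf kp L (TDom G) (U0 kp L (TCod G)) (T1 G) \<phi>)"
    using H.ext(2) by (intro extensionalityI[of _ "Cell1 L"]) (auto simp: U1_def)
qed (simp_all add: U1_def)

lemma U1_simps [simp]: "TDom (U1 kp L G) = U0 kp L (TDom G)" "TCod (U1 kp L G) = U0 kp L (TCod G)" "T1 (U1 kp L G) = T1 G"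
  by (simp_all add: U1_def)

lemma U1_colax: "colax kp L (U1 kp L G)"
  unfolding U1_htrf by (rule h.htrf_colax)

lemma U1_hlf: "f \<in> Cell1 L ==> d \<in> Ob (P0 (TDom G) (tgt1 L f)) ==> hlf kp L (TDom G) (U1 kp L G) f d = \<phi> f d"
  unfolding U1_htrf by (rule h.hlf_htrf)

text \<open>Naturality of the 2-cell of \<open>X\<close> moves \<open>gi f d\<close> to the left and
  leaves that 2-cell composed with a unit of \<open>TCod G\<close>, which is the half form of
  \<open>X\<close>. This makes the transpose of \<open>G\<close> computable although the right
  adjoints are unknown.\<close>

lemma hlf_comp_U1:
  assumes X: "colax kp L X" "TDom X = U0 kp L (TCod G)" and f: "f \<in> Cell1 L" "d \<in> Ob (P0 (TDom G) (tgt1 L f))"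
  shows "hlf kp L (TDom G) (comp_trf L X (U1 kp L G)) f d =
    FA (P1 (TCod X) f) (FA (T1 X (src1 L f)) (gi f d)) \<cdot>[P0 (TCod X) (tgt1 L f)] hlf kp L (TCod G) X f (FO (T1 G (tgt1 L f)) d)"
proof -
  interpret X: clx kp L X using X twoL by unfold_locales
  interpret V: clx kp L "U1 kp L G" using U1_colax twoL by unfold_locales
  note X_R = X.T2_R[unfolded X B.U0_simps]
  have 1: "NC (T2 (U1 kp L G) f) (FO (P1 (TDom G) f) d) \<cdot>[P0 (TCod G) (tgt1 L f)] FA (T1 G (tgt1 L f)) (A.n f d) = \<phi> f d"
    using U1_hlf[OF f] by (simp add: hlf_def)
  show ?thesis using f X 1[THEN FA_eq, of "T1 X (tgt1 L f)"]
    by (simp add: hlf_def) (simp add: \<phi>_def X_R[THEN cmpE])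
qed

end

text \<open>Tested on half forms and transposed, the condition is the modification axiom of
  \<open>m\<close> with both 2-cells inverted.\<close>

lemma U2_modification:
  assumes two: "two_category L" and m: "adj_mdf kp L m"
  shows "modification kp L (U2 kp L m)"
proof -
  have m': "modification kp (coop L) m" "adj_trf kp L (MDom m)" "adj_trf kp L (MCod m)" using m by (auto simp: adj_mdf_def)
  interpret twocat L by unfold_locales fact
  interpret F: adjt kp L "MDom m" using two m' by unfold_locales
  interpret G: adjt kp L "MCod m" using two m' by unfold_locales
  note M = modificationD[OF m'(1) two_category_coop[OF two], simplified]
  have U: "MDom (U2 kp L m) = U1 kp L (MDom m)" "MCod (U2 kp L m) = U1 kp L (MCod m)" "MC (U2 kp L m) = MC m"
    by (simp_all add: U2_def)
  note Gs = G.U1_simps[unfolded M(3,4)] G.pflats[unfolded M(3,4)] G.\<phi>_ty[unfolded M(3,4)] and Gh = G.U1_hlf[unfolded M(3,4)]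
  have nat: "NC (MC m p) b \<cdot>[P0 (TCod (MDom m)) p] FA (T1 (MDom m) p) u = FA (T1 (MCod m) p) u \<cdot>[P0 (TCod (MDom m)) p] NC (MC m p) (Src (P0 (TDom (MDom m)) p) u)"
    if "p \<in> Cell0 L" "u \<in> Ar (P0 (TDom (MDom m)) p)" "Tgt (P0 (TDom (MDom m)) p) u = b" for p u b
    using naturality[of "MC m p" u "P0 (TDom (MDom m)) p" "P0 (TCod (MDom m)) p" "Src (P0 (TDom (MDom m)) p) u" b] that M by simp
  show ?thesis
  proof (subst F.modification_hlf, unfold U)
    show "\<forall>f\<in>Cell1 L. \<forall>d\<in>Ob (P0 (TDom (MDom m)) (tgt1 L f)).
       FA (P1 (U0 kp L (TCod (MDom m))) f) (NC (MC m (src1 L f)) (FO (P1 (TDom (MDom m)) f) d)) \<cdot>[P0 (U0 kp L (TCod (MDom m))) (tgt1 L f)]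
         hlf kp L (TDom (MDom m)) (U1 kp L (MDom m)) f d =
       hlf kp L (TDom (MDom m)) (U1 kp L (MCod m)) f d \<cdot>[P0 (U0 kp L (TCod (MDom m))) (tgt1 L f)] NC (MC m (tgt1 L f)) d"
    proof (intro ballI)
      fix f d assume f: "f \<in> Cell1 L" and d: "d \<in> Ob (P0 (TDom (MDom m)) (tgt1 L f))"
      have sq: "NC (MC m (src1 L f)) (FO (P1 (TDom (MDom m)) f) d) \<cdot>[P0 (TCod (MDom m)) (src1 L f)] F.gi f d =
          G.gi f d \<cdot>[P0 (TCod (MDom m)) (src1 L f)] FA (P1 (TCod (MDom m)) f) (NC (MC m (tgt1 L f)) d)"
        by (rule inv_square[of _ "NC (T2 (MCod m) f) d" _ _ "NC (T2 (MDom m) f) d"])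
          (use f d M M(9)[OF f d] G.gi_inv[OF f refl refl, unfolded M(3,4), OF d] in "simp_all add: F.gi_inv")
      show "FA (P1 (U0 kp L (TCod (MDom m))) f) (NC (MC m (src1 L f)) (FO (P1 (TDom (MDom m)) f) d)) \<cdot>[P0 (U0 kp L (TCod (MDom m))) (tgt1 L f)]
           hlf kp L (TDom (MDom m)) (U1 kp L (MDom m)) f d =
         hlf kp L (TDom (MDom m)) (U1 kp L (MCod m)) f d \<cdot>[P0 (U0 kp L (TCod (MDom m))) (tgt1 L f)] NC (MC m (tgt1 L f)) d"
        by (rule F.B.flat_inj[of f "FO (T1 (MCod m) (src1 L f)) (FO (P1 (TDom (MDom m)) f) d)" _ "FO (T1 (MDom m) (tgt1 L f)) d"])
          (use f d M(5-8) sq in "simp_all add: M(3,4) F.U1_hlf Gh F.gflats F.pflats F.\<phi>_ty Gs")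
    qed
  qed (use M F.U1_colax G.U1_colax in simp_all)
qed

lemma vcomp_ntr_assoc:
  assumes "nattrans ta" "nattrans si" "nattrans rh" "NDom ta = NCod si" "NDom si = NCod rh"
  shows "(ta \<bullet>\<^sub>N si) \<bullet>\<^sub>N rh = ta \<bullet>\<^sub>N si \<bullet>\<^sub>N rh"
proof -
  note D = nattransD[OF assms(1)] nattransD[OF assms(2)] nattransD[OF assms(3)]
  note C = functorD(1,2)[OF nattransD(1)[OF assms(3)]]
  show ?thesis by (rule ntr_eqI) (use assms D C in simp_all)
qed

lemma P0_U0 [simp]: "P0 (U0 kp L D) = P0 D"
  by (simp add: U0_def Let_def)

lemma lwh_id_ntr:
  assumes "is_functor F" "is_functor G" "FDom G = FCod F"
  shows "G \<triangleleft>\<^sub>N id_ntr F = id_ntr (G \<odot> F)" "id_ntr G \<triangleright>\<^sub>N F = id_ntr (G \<odot> F)"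
  by (rule ntr_eqI; use assms in simp)+

lemma lwh_vcomp_ntr:
  assumes "nattrans ta" "nattrans si" "NDom ta = NCod si" "is_functor G" "FDom G = FCod (NDom si)"
  shows "G \<triangleleft>\<^sub>N (ta \<bullet>\<^sub>N si) = (G \<triangleleft>\<^sub>N ta) \<bullet>\<^sub>N (G \<triangleleft>\<^sub>N si)"
  by (rule ntr_eqI) (use assms nattransD[OF assms(1)] nattransD[OF assms(2)] in simp_all)

lemma comp_trf_assoc:
  fixes F :: "('p, 'f, 'a, 'o1, 'm1, 'o2, 'm2) trf" and H :: "('p, 'f, 'a, 'o3, 'm3, 'o4, 'm4) trf"
  assumes two: "two_category K" and "colax kp K F" "colax kp K G" "colax kp K H" and eq: "TDom G = TCod F" "TDom H = TCod G"
  shows "comp_trf K (comp_trf K H G) F = comp_trf K H (comp_trf K G F)"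
proof -
  interpret twocat K by unfold_locales fact
  interpret F: clx kp K F using assms by unfold_locales
  interpret G: clx kp K G using assms by unfold_locales
  interpret H: clx kp K H using assms by unfold_locales
  have "T2 (comp_trf K (comp_trf K H G) F) f = T2 (comp_trf K H (comp_trf K G F)) f" if "f \<in> Cell1 K" for f
    by (rule ntr_eqI) (use that eq in simp_all)
  then show ?thesis
    by (intro trf.equality extensionalityI[of "T2 _" "Cell1 K"] extensionalityI[of "T1 _" "Cell0 K"])
      (use eq in "simp_all, simp_all add: comp_trf_def")
qed

lemma comp_trf_id:
  fixes F :: "('p, 'f, 'a, 'o1, 'm1, 'o2, 'm2) trf"
  assumes two: "two_category K" and "colax kp K F"
  shows "TDom F = C ==> comp_trf K F (id_trf K C) = F" "TCod F = D ==> comp_trf K (id_trf K D) F = F"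
proof -
  interpret twocat K by unfold_locales fact
  interpret F: clx kp K F using assms by unfold_locales
  have "T2 (comp_trf K F (id_trf K (TDom F))) f = T2 F f" "T2 (comp_trf K (id_trf K (TCod F)) F) f = T2 F f" if "f \<in> Cell1 K" for f
    by (rule ntr_eqI; use that in simp)+
  then have "comp_trf K F (id_trf K (TDom F)) = F" "comp_trf K (id_trf K (TCod F)) F = F"
    by (intro trf.equality extensionalityI[of "T2 _" "Cell1 K"] extensionalityI[of "T1 _" "Cell0 K"];
      use F.ext in "(simp; fail) | simp add: comp_trf_def")+
  then show "TDom F = C ==> comp_trf K F (id_trf K C) = F" "TCod F = D ==> comp_trf K (id_trf K D) F = F" by auto
qed

lemma Ps_colax_simps [simp]:
  "Cell0 (Ps_colax kp K) = {C. pseudofunctor K (Lex kp) C}" "Cell1 (Ps_colax kp K) = {F. colax kp K F}"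
  "Cell2 (Ps_colax kp K) = {m. modification kp K m}"
  "src1 (Ps_colax kp K) = TDom" "tgt1 (Ps_colax kp K) = TCod" "id1 (Ps_colax kp K) = id_trf K" "cmp1 (Ps_colax kp K) = comp_trf K"
  "src2 (Ps_colax kp K) = MDom" "tgt2 (Ps_colax kp K) = MCod" "id2 (Ps_colax kp K) = id_mdf K"
  "vcmp (Ps_colax kp K) = vcomp_mdf K" "lwh (Ps_colax kp K) = lwh_mdf K" "rwh (Ps_colax kp K) = rwh_mdf K"
  by (simp_all add: Ps_colax_def)

lemma Ps_adj_simps [simp]:
  "Cell0 (Ps_adj kp L) = {D. adj_pfun kp L D}" "Cell1 (Ps_adj kp L) = {F. adj_trf kp L F}"
  "Cell2 (Ps_adj kp L) = {m. adj_mdf kp L m}"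
  "src1 (Ps_adj kp L) = TDom" "tgt1 (Ps_adj kp L) = TCod" "id1 (Ps_adj kp L) = id_trf (coop L)" "cmp1 (Ps_adj kp L) = comp_trf (coop L)"
  "src2 (Ps_adj kp L) = MDom" "tgt2 (Ps_adj kp L) = MCod" "id2 (Ps_adj kp L) = id_mdf L"
  "vcmp (Ps_adj kp L) = vcomp_mdf L" "lwh (Ps_adj kp L) = lwh_mdf (coop L)" "rwh (Ps_adj kp L) = rwh_mdf (coop L)"
  by (simp_all add: Ps_adj_def Let_def)

lemma adj_trf_id:
  assumes "two_category L" "adj_pfun kp L D" shows "adj_trf kp L (id_trf (coop L) D)"
proof -
  have "pseudonatural kp (coop L) (id_trf (coop L) D)"
    by (rule id_trf_colax) (use assms two_category_coop in "auto simp: adj_pfun_def")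
  then show ?thesis using assms unfolding adj_trf_def by simp
qed

lemma adj_trf_comp:
  assumes "two_category L" "adj_trf kp L F" "adj_trf kp L G" "TDom G = TCod F"
  shows "adj_trf kp L (comp_trf (coop L) G F)"
  using assms comp_trf_pseudonatural[OF two_category_coop[OF assms(1)], of kp F G] unfolding adj_trf_def by simp

lemma inv_ntr_comp:
  assumes "iso_ntr ta" "nattrans si" "NDom si = NCod ta" "NCod si = NDom ta" "a \<in> Ob (FDom (NDom ta))" "FCod (NDom ta) = D"
    "NC si a \<cdot>[D] NC ta a = Idn D (FO (NDom ta) a)"
  shows "NC (inv_ntr ta) a = NC si a"
proof -
  note D = nattransD[OF inv_ntr(4)[OF assms(1)]]
  note C = functorD(1,2)[OF D(1)]
  show ?thesis
    by (rule inverse_unique[of D "NC ta a", symmetric]) (use assms C D in simp_all)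
qed

text \<open>Both half forms are the unit of the adjunction at \<open>f\<close>, since the 2-cells of
  an identity transformation are identities.\<close>

lemma U1_id:
  assumes two: "two_category L" and D: "adj_pfun kp L D"
  shows "U1 kp L (id_trf (coop L) D) = id_trf L (U0 kp L D)"
proof -
  interpret G: adjt kp L "id_trf (coop L) D" using two adj_trf_id[OF two D] by unfold_locales
  interpret adjp kp L D using two D by unfold_locales
  have 1: "NC (inv_ntr (id_ntr (P1 D f))) d = Idn (P0 D (src1 L f)) (FO (P1 D f) d)"
    if "f \<in> Cell1 L" "d \<in> Ob (P0 D (tgt1 L f))" for f d
    using inv_ntr_comp[of "id_ntr (P1 D f)" "id_ntr (P1 D f)" d "P0 D (src1 L f)"] that G.T2_iso[of f] by simp
  have col: "colax kp L (id_trf L (U0 kp L D))" by (rule id_trf_colax[OF two U0_pseudofunctor])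
  show ?thesis
    by (rule G.trf_eqI)
      (use G.U1_colax col in "simp_all add: G.U1_hlf[unfolded id_trf_simps] G.U1_simps[unfolded id_trf_simps], simp_all add: G.\<phi>_def hlf_def 1")
qed

text \<open>Pasting of mates, hence an equality: both half forms are \<open>R_f\<close> of the
  inverse of the composite 2-cell, computed in \<open>inv\<close>, precomposed with a unit of the
  adjunction of \<open>TCod G\<close>.\<close>

lemma U1_comp:
  assumes two: "two_category L" and F: "adj_trf kp L F" and G: "adj_trf kp L G" and eq: "TDom G = TCod F"
  shows "U1 kp L (comp_trf (coop L) G F) = comp_trf L (U1 kp L G) (U1 kp L F)"
proof -
  interpret F: adjt kp L F using two F by unfold_locales
  interpret G: adjt kp L G using two G by unfold_locales
  interpret W: adjt kp L "comp_trf (coop L) G F" using two adj_trf_comp[OF two F G eq] by unfold_locales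
  have inv: "NC (inv_ntr (T2 (comp_trf (coop L) G F) f)) d =
     FA (T1 G (src1 L f)) (F.gi f d) \<cdot>[P0 (TCod G) (src1 L f)] G.gi f (FO (T1 F (tgt1 L f)) d)"
    if f: "f \<in> Cell1 L" and d: "d \<in> Ob (P0 (TDom F) (tgt1 L f))" for f d
    by (rule inverse_unique[of "P0 (TCod G) (src1 L f)" "NC (T2 (comp_trf (coop L) G F) f) d"])
      (use f d W.gi_inv[OF f refl refl, of d] W.T2_iso[OF f] eq in "simp_all add: G.gi_inv[THEN cmpE] F.gi_inv F.gi_inv[THEN FA_eq] F.gi_inv[THEN FA_eq, THEN cmpE] G.gi_inv")
  have col: "colax kp L (comp_trf L (U1 kp L G) (U1 kp L F))"
    by (rule comp_trf_colax[OF two F.U1_colax G.U1_colax]) (simp add: eq)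
  show ?thesis
  proof (rule W.trf_eqI)
    fix f d assume f: "f \<in> Cell1 L" and "d \<in> Ob (P0 (TDom (comp_trf (coop L) G F)) (tgt1 L f))"
    then have d: "d \<in> Ob (P0 (TDom F) (tgt1 L f))" by simp
    have "FO (T1 F (tgt1 L f)) d \<in> Ob (P0 (TCod F) (tgt1 L f))" using f d by simp
    then have g: "hlf kp L (TCod F) (U1 kp L G) f (FO (T1 F (tgt1 L f)) d) = G.\<phi> f (FO (T1 F (tgt1 L f)) d)"
      using G.U1_hlf[OF f] eq by simp
    show "hlf kp L (TDom (comp_trf (coop L) G F)) (U1 kp L (comp_trf (coop L) G F)) f d =
      hlf kp L (TDom (comp_trf (coop L) G F)) (comp_trf L (U1 kp L G) (U1 kp L F)) f d"
      using W.U1_hlf[OF f, of d] F.hlf_comp_U1[OF G.U1_colax _ f d] f d eq inv[OF f d]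
      by (simp add: g G.\<phi>_def W.\<phi>_def)
  qed (use W.U1_colax col eq in simp_all)
qed

lemma lwh_mdf_modification:
  assumes "two_category K" "modification kp K m" "colax kp K G" "TDom G = TCod (MDom m)"
  shows "modification kp K (lwh_mdf K G m)"
proof -
  interpret twocat K by unfold_locales fact
  note m = modificationD[OF assms(2,1)]
  interpret F: clx kp K "MDom m" using m assms by unfold_locales
  interpret F': clx kp K "MCod m" using m assms by unfold_locales
  interpret G: clx kp K G using assms by unfold_locales
  have c: "colax kp K (comp_trf K G (MDom m))" "colax kp K (comp_trf K G (MCod m))"
    using comp_trf_colax[OF assms(1) m(1) assms(3)] comp_trf_colax[OF assms(1) m(2) assms(3)] m(3,4) assms(4) by simp_all
  note L = G.T2_L[unfolded assms(4)]
  show ?thesis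
  proof (rule modificationI)
    fix f x assume "f \<in> Cell1 K" "x \<in> Ob (P0 (TDom (MDom (lwh_mdf K G m))) (src1 K f))"
    then show "FA (P1 (TCod (MDom (lwh_mdf K G m))) f) (NC (MC (lwh_mdf K G m) (src1 K f)) x) \<cdot>[P0 (TCod (MDom (lwh_mdf K G m))) (tgt1 K f)]
        NC (T2 (MDom (lwh_mdf K G m)) f) x =
      NC (T2 (MCod (lwh_mdf K G m)) f) x \<cdot>[P0 (TCod (MDom (lwh_mdf K G m))) (tgt1 K f)]
        NC (MC (lwh_mdf K G m) (tgt1 K f)) (FO (P1 (TDom (MDom (lwh_mdf K G m))) f) x)"
      using m(6-8) m(3,4) assms(4) by (simp add: L[THEN cmpE] m(9)[THEN FA_eq])
  qed (use assms m c in simp_all)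
qed

lemma rwh_mdf_modification:
  assumes "two_category K" "modification kp K m" "colax kp K F" "TDom (MDom m) = TCod F"
  shows "modification kp K (rwh_mdf K m F)"
proof -
  interpret twocat K by unfold_locales fact
  note m = modificationD[OF assms(2,1)]
  interpret G: clx kp K "MDom m" using m assms by unfold_locales
  interpret G': clx kp K "MCod m" using m assms by unfold_locales
  interpret F: clx kp K F using assms by unfold_locales
  have c: "colax kp K (comp_trf K (MDom m) F)" "colax kp K (comp_trf K (MCod m) F)"
    using comp_trf_colax[OF assms(1,3) m(1)] comp_trf_colax[OF assms(1,3) m(2)] m(3,4) assms(4) by simp_all
  have nat: "NC (MC m p) b \<cdot>[P0 (TCod (MDom m)) p] FA (T1 (MDom m) p) u =
      FA (T1 (MCod m) p) u \<cdot>[P0 (TCod (MDom m)) p] NC (MC m p) (Src (P0 (TCod F) p) u)"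
    if "p \<in> Cell0 K" "u \<in> Ar (P0 (TCod F) p)" "Tgt (P0 (TCod F) p) u = b" for p u b
    using naturality[of "MC m p" u "P0 (TCod F) p" "P0 (TCod (MDom m)) p" "Src (P0 (TCod F) p) u" b] that m assms(4) by simp
  show ?thesis
  proof (rule modificationI)
    fix f x assume "f \<in> Cell1 K" "x \<in> Ob (P0 (TDom (MDom (rwh_mdf K m F))) (src1 K f))"
    then show "FA (P1 (TCod (MDom (rwh_mdf K m F))) f) (NC (MC (rwh_mdf K m F) (src1 K f)) x) \<cdot>[P0 (TCod (MDom (rwh_mdf K m F))) (tgt1 K f)]
        NC (T2 (MDom (rwh_mdf K m F)) f) x =
      NC (T2 (MCod (rwh_mdf K m F)) f) x \<cdot>[P0 (TCod (MDom (rwh_mdf K m F))) (tgt1 K f)]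
        NC (MC (rwh_mdf K m F) (tgt1 K f)) (FO (P1 (TDom (MDom (rwh_mdf K m F))) f) x)"
      using m(6-8) m(3,4) assms(4) by (simp add: m(9)[unfolded assms(4), THEN cmpE] nat)
  qed (use assms m c in simp_all)
qed

text \<open>\<open>U1\<close> preserves identities and composites strictly, so the coherence cells
  are identities, and every axiom is an equality of components of modifications, which
  \<open>U2\<close> leaves unchanged.\<close>

lemma U_pseudofunctor:
  fixes kp :: "'k rel" and L :: "('p, 'f, 'a) twocat"
  assumes two: "two_category L"
  shows "pseudofunctor (Ps_adj kp L) (Ps_colax kp L)
    (U kp L :: (('p, 'f, 'a, 'o, 'm) catpfun, _, _, ('p, 'f, 'a, 'o, 'm) catpfun, _, _) pfun)"
proof -
  have a0: "pseudofunctor L (Lex kp) (U0 kp L D)" if "adj_pfun kp L D" for D :: "('p, 'f, 'a, 'o, 'm) catpfun"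
  proof -
    interpret adjp kp L D using two that by unfold_locales
    show ?thesis by (rule U0_pseudofunctor)
  qed
  have a1: "colax kp L (U1 kp L F)" "TDom (U1 kp L F) = U0 kp L (TDom F)" "TCod (U1 kp L F) = U0 kp L (TCod F)" "T1 (U1 kp L F) = T1 F"
    "!!p. p \<in> Cell0 L ==> is_functor (T1 F p)"
    if "adj_trf kp L F" for F :: "('p, 'f, 'a, 'o, 'm, 'o, 'm) trf"
  proof -
    interpret adjt kp L F using two that by unfold_locales
    show "colax kp L (U1 kp L F)" "TDom (U1 kp L F) = U0 kp L (TDom F)" "TCod (U1 kp L F) = U0 kp L (TCod F)" "T1 (U1 kp L F) = T1 F"
      "!!p. p \<in> Cell0 L ==> is_functor (T1 F p)" using U1_colax by simp_all
  qed
  note id1 = U1_id[OF two, of kp] and cmp1 = U1_comp[OF two, of kp]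
  have t: "adj_trf kp L (MDom m)" "adj_trf kp L (MCod m)" "modification kp (coop L) m" "TDom (MCod m) = TDom (MDom m)" "TCod (MCod m) = TCod (MDom m)"
    "!!p. p \<in> Cell0 L ==> nattrans (MC m p) \<and> NDom (MC m p) = T1 (MDom m) p \<and> NCod (MC m p) = T1 (MCod m) p"
    if "adj_mdf kp L m" for m :: "('p, 'f, 'a, 'o, 'm, 'o, 'm) mdf"
    using that modificationD[of kp "coop L" m] two_category_coop[OF two] by (auto simp: adj_mdf_def)
  have i: "invertible2 (Ps_colax kp L) (id_mdf L F)" if "colax kp L F" for F :: "('p, 'f, 'a, 'o, 'm, 'o, 'm) trf"
  proof -
    interpret clx kp L F using two that by unfold_locales
    have "vcomp_mdf L (id_mdf L F) (id_mdf L F) = id_mdf L F"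
      by (rule mdf_eqI[of _ _ L]) (simp_all add: vcomp_id_ntr)
    then show ?thesis using id_mdf_modification[OF two that] unfolding invertible2_def by auto
  qed
  have fty: "FDom (T1 F p) = P0 (TDom F) p" "FCod (T1 F p) = P0 (TCod F) p" "category (P0 (TDom F) p)" "category (P0 (TCod F) p)" if "adj_trf kp L F" "p \<in> Cell0 L" for p and F :: "('p, 'f, 'a, 'o, 'm, 'o, 'm) trf"
  proof -
    interpret adjt kp L F using two that by unfold_locales
    show "FDom (T1 F p) = P0 (TDom F) p" "FCod (T1 F p) = P0 (TCod F) p" "category (P0 (TDom F) p)" "category (P0 (TCod F) p)" using that by simp_all
  qed
  have u2: "MDom (U2 kp L m) = U1 kp L (MDom m)" "MCod (U2 kp L m) = U1 kp L (MCod m)" "MC (U2 kp L m) = MC m"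
    for m :: "('p, 'f, 'a, 'o, 'm, 'o, 'm) mdf" by (simp_all add: U2_def)
  have c: "colax kp L (id_trf L (U0 kp L D))" if "adj_pfun kp L D" for D :: "('p, 'f, 'a, 'o, 'm) catpfun"
    by (rule id_trf_colax[OF two a0[OF that]])
  have c2: "colax kp L (comp_trf L (U1 kp L G) (U1 kp L F))" if "adj_trf kp L F" "adj_trf kp L G" "TDom G = TCod F"
    for F G :: "('p, 'f, 'a, 'o, 'm, 'o, 'm) trf"
    by (rule comp_trf_colax[OF two a1(1)[OF that(1)] a1(1)[OF that(2)]]) (simp add: a1 that)
  have as: "comp_trf (coop L) (comp_trf (coop L) H G) F = comp_trf (coop L) H (comp_trf (coop L) G F)"
    "comp_trf L (comp_trf L (U1 kp L H) (U1 kp L G)) (U1 kp L F) = comp_trf L (U1 kp L H) (comp_trf L (U1 kp L G) (U1 kp L F))"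
    if "adj_trf kp L F" "adj_trf kp L G" "adj_trf kp L H" "TDom G = TCod F" "TDom H = TCod G"
    for F G H :: "('p, 'f, 'a, 'o, 'm, 'o, 'm) trf"
    using that comp_trf_assoc[OF two_category_coop[OF two], of kp F G H] comp_trf_assoc[OF two, of kp "U1 kp L F" "U1 kp L G" "U1 kp L H"]
    by (simp_all add: a1 adj_trf_def pseudonatural_def)
  have un: "comp_trf (coop L) F (id_trf (coop L) (TDom F)) = F" "comp_trf (coop L) (id_trf (coop L) (TCod F)) F = F"
    "comp_trf L (U1 kp L F) (id_trf L (U0 kp L (TDom F))) = U1 kp L F" "comp_trf L (id_trf L (U0 kp L (TCod F))) (U1 kp L F) = U1 kp L F"
    if "adj_trf kp L F" for F :: "('p, 'f, 'a, 'o, 'm, 'o, 'm) trf"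
    using that comp_trf_id[OF two_category_coop[OF two], of kp F] comp_trf_id[OF two, of kp "U1 kp L F"]
    by (simp_all add: a1 adj_trf_def pseudonatural_def)
  have dc: "adj_pfun kp L (TDom F)" "adj_pfun kp L (TCod F)" if "adj_trf kp L F" for F :: "('p, 'f, 'a, 'o, 'm, 'o, 'm) trf"
    using that by (auto simp: adj_trf_def)
  note ss = dc c c2 as un a0 a1 t u2 fty i id1 cmp1 adj_trf_id[OF two] adj_trf_comp[OF two] id_mdf_modification[OF two] U2_modification[OF two]
  show ?thesis
    unfolding pseudofunctor_def
  proof (intro conjI ballI impI)
    fix f assume "f \<in> Cell1 (Ps_adj kp L :: (('p, 'f, 'a, 'o, 'm) catpfun, ('p, 'f, 'a, 'o, 'm, 'o, 'm) trf, _) twocat)"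
    then show "P2 (U kp L) (id2 (Ps_adj kp L) f) = id2 (Ps_colax kp L) (P1 (U kp L) f)"
      by (simp add: U_def strict_pfun_def) (rule mdf_eqI[of _ _ L]; simp add: ss)
  next
    fix m n assume "m \<in> Cell2 (Ps_adj kp L :: (('p, 'f, 'a, 'o, 'm) catpfun, ('p, 'f, 'a, 'o, 'm, 'o, 'm) trf, _) twocat)" 
      "n \<in> Cell2 (Ps_adj kp L :: (('p, 'f, 'a, 'o, 'm) catpfun, ('p, 'f, 'a, 'o, 'm, 'o, 'm) trf, _) twocat)" "src2 (Ps_adj kp L) n = tgt2 (Ps_adj kp L) m"
    then show "P2 (U kp L) (n \<bullet>[Ps_adj kp L] m) = P2 (U kp L) n \<bullet>[Ps_colax kp L] P2 (U kp L) m"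
      by (simp add: U_def strict_pfun_def) (rule mdf_eqI[of _ _ L]; simp add: ss)
  next
    fix F m assume "F \<in> Cell1 (Ps_adj kp L :: (('p, 'f, 'a, 'o, 'm) catpfun, ('p, 'f, 'a, 'o, 'm, 'o, 'm) trf, _) twocat)"
      "m \<in> Cell2 (Ps_adj kp L :: (('p, 'f, 'a, 'o, 'm) catpfun, ('p, 'f, 'a, 'o, 'm, 'o, 'm) trf, _) twocat)"
      "src1 (Ps_adj kp L) (src2 (Ps_adj kp L) m) = tgt1 (Ps_adj kp L) F"
    then show "P2 (U kp L) (m \<triangleright>[Ps_adj kp L] F) \<bullet>[Ps_colax kp L] PC (U kp L) (src2 (Ps_adj kp L) m) F =
        PC (U kp L) (tgt2 (Ps_adj kp L) m) F \<bullet>[Ps_colax kp L] (P2 (U kp L) m \<triangleright>[Ps_colax kp L] P1 (U kp L) F)"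
      by (simp add: U_def strict_pfun_def) (rule mdf_eqI[of _ _ L]; simp add: ss vcomp_id_ntr)
  next
    fix F m assume "F \<in> Cell1 (Ps_adj kp L :: (('p, 'f, 'a, 'o, 'm) catpfun, ('p, 'f, 'a, 'o, 'm, 'o, 'm) trf, _) twocat)"
      "m \<in> Cell2 (Ps_adj kp L :: (('p, 'f, 'a, 'o, 'm) catpfun, ('p, 'f, 'a, 'o, 'm, 'o, 'm) trf, _) twocat)"
      "src1 (Ps_adj kp L) F = tgt1 (Ps_adj kp L) (src2 (Ps_adj kp L) m)"
    then show "P2 (U kp L) (F \<triangleleft>[Ps_adj kp L] m) \<bullet>[Ps_colax kp L] PC (U kp L) F (src2 (Ps_adj kp L) m) =
        PC (U kp L) F (tgt2 (Ps_adj kp L) m) \<bullet>[Ps_colax kp L] (P1 (U kp L) F \<triangleleft>[Ps_colax kp L] P2 (U kp L) m)"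
      by (simp add: U_def strict_pfun_def) (rule mdf_eqI[of _ _ L]; simp add: ss vcomp_id_ntr)
  next
    fix F G H assume "F \<in> Cell1 (Ps_adj kp L :: (('p, 'f, 'a, 'o, 'm) catpfun, ('p, 'f, 'a, 'o, 'm, 'o, 'm) trf, _) twocat)"
      "G \<in> Cell1 (Ps_adj kp L :: (('p, 'f, 'a, 'o, 'm) catpfun, ('p, 'f, 'a, 'o, 'm, 'o, 'm) trf, _) twocat)"
      "H \<in> Cell1 (Ps_adj kp L :: (('p, 'f, 'a, 'o, 'm) catpfun, ('p, 'f, 'a, 'o, 'm, 'o, 'm) trf, _) twocat)"
      "src1 (Ps_adj kp L) G = tgt1 (Ps_adj kp L) F" "src1 (Ps_adj kp L) H = tgt1 (Ps_adj kp L) G"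
    then show "PC (U kp L) (H \<star>[Ps_adj kp L] G) F \<bullet>[Ps_colax kp L] (PC (U kp L) H G \<triangleright>[Ps_colax kp L] P1 (U kp L) F) =
      PC (U kp L) H (G \<star>[Ps_adj kp L] F) \<bullet>[Ps_colax kp L] (P1 (U kp L) H \<triangleleft>[Ps_colax kp L] PC (U kp L) G F)"
      by (simp add: U_def strict_pfun_def) (rule mdf_eqI[of _ _ L]; simp add: ss vcomp_id_ntr lwh_id_ntr)
  next
    fix F assume "F \<in> Cell1 (Ps_adj kp L :: (('p, 'f, 'a, 'o, 'm) catpfun, ('p, 'f, 'a, 'o, 'm, 'o, 'm) trf, _) twocat)"
    then show "PC (U kp L) F (id1 (Ps_adj kp L) (src1 (Ps_adj kp L) F)) \<bullet>[Ps_colax kp L] (P1 (U kp L) F \<triangleleft>[Ps_colax kp L] PU (U kp L) (src1 (Ps_adj kp L) F)) =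
        id2 (Ps_colax kp L) (P1 (U kp L) F)"
      "PC (U kp L) (id1 (Ps_adj kp L) (tgt1 (Ps_adj kp L) F)) F \<bullet>[Ps_colax kp L] (PU (U kp L) (tgt1 (Ps_adj kp L) F) \<triangleright>[Ps_colax kp L] P1 (U kp L) F) =
        id2 (Ps_colax kp L) (P1 (U kp L) F)"
      by - (simp add: U_def strict_pfun_def, rule mdf_eqI[of _ _ L]; simp add: ss vcomp_id_ntr lwh_id_ntr)+
  qed (simp_all add: U_def strict_pfun_def ss)
qed

section \<open>Hom categories and equivalences\<close>

lemma modification_vcomp_assoc:
  assumes "two_category K" "modification kp K l" "modification kp K m" "modification kp K n" "MDom m = MCod l" "MDom n = MCod m"
  shows "vcomp_mdf K (vcomp_mdf K n m) l = vcomp_mdf K n (vcomp_mdf K m l)"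
  by (rule mdf_eqI[of _ _ K])
    (use assms modificationD[OF assms(2,1)] modificationD[OF assms(3,1)] modificationD[OF assms(4,1)] in "simp_all add: vcomp_ntr_assoc")

lemma modification_vcomp_id:
  assumes "two_category K" "modification kp K m"
  shows "MDom m = F ==> vcomp_mdf K m (id_mdf K F) = m" "MCod m = G ==> vcomp_mdf K (id_mdf K G) m = m"
proof -
  note m = modificationD[OF assms(2,1)]
  show "MDom m = F ==> vcomp_mdf K m (id_mdf K F) = m" by (rule mdf_eqI[of _ _ K]) (use m in "simp_all add: vcomp_id_ntr")
  show "MCod m = G ==> vcomp_mdf K (id_mdf K G) m = m" by (rule mdf_eqI[of _ _ K]) (use m in "simp_all add: vcomp_id_ntr")
qed

lemma colax_hom_simps [simp]:
  "F \<in> Ob (colax_hom kp K C D) \<longleftrightarrow> colax kp K F \<and> TDom F = C \<and> TCod F = D"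
  "m \<in> Ar (colax_hom kp K C D) \<longleftrightarrow> modification kp K m \<and> TDom (MDom m) = C \<and> TCod (MDom m) = D"
  "Src (colax_hom kp K C D) = MDom" "Tgt (colax_hom kp K C D) = MCod" "Idn (colax_hom kp K C D) = id_mdf K"
  "Cmp (colax_hom kp K C D) = vcomp_mdf K"
  by (simp_all add: colax_hom_def)

lemma adj_hom_simps [simp]:
  "F \<in> Ob (adj_hom kp L C D) \<longleftrightarrow> adj_trf kp L F \<and> TDom F = C \<and> TCod F = D"
  "m \<in> Ar (adj_hom kp L C D) \<longleftrightarrow> adj_mdf kp L m \<and> TDom (MDom m) = C \<and> TCod (MDom m) = D"
  "Src (adj_hom kp L C D) = MDom" "Tgt (adj_hom kp L C D) = MCod" "Idn (adj_hom kp L C D) = id_mdf L"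
  "Cmp (adj_hom kp L C D) = vcomp_mdf L"
  by (simp_all add: adj_hom_def)

lemma colax_hom_category:
  assumes "two_category K" shows "category (colax_hom kp K C D)"
  by (rule categoryI)
    (use assms modificationD(1-4)[OF _ assms] in "auto simp: id_mdf_modification vcomp_mdf_modification modification_vcomp_id modification_vcomp_assoc")

lemma adj_hom_category:
  assumes two: "two_category L" shows "category (adj_hom kp L C D)"
proof -
  note two' = two_category_coop[OF two]
  have t: "adj_trf kp L F ==> colax kp (coop L) F" for F by (simp add: adj_trf_def pseudonatural_def)
  have i: "adj_trf kp L F ==> modification kp (coop L) (id_mdf L F)" for F
    using id_mdf_modification[OF two' t] by simp
  have v: "modification kp (coop L) m ==> modification kp (coop L) n ==> MDom n = MCod m ==> modification kp (coop L) (vcomp_mdf L n m)" for m n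
    using vcomp_mdf_modification[OF two', of kp m n] by simp
  show ?thesis
    by (rule categoryI)
      (auto simp: adj_mdf_def i v modification_vcomp_id[OF two', simplified] modification_vcomp_assoc[OF two', simplified]
         dest: modificationD(3,4)[OF _ two'])
qed

lemma transpose_U_simps [simp]:
  "FDom (transpose_U kp L e D E C) = adj_hom kp L D E" "FCod (transpose_U kp L e D E C) = colax_hom kp L (U0 kp L D) C"
  "adj_trf kp L F ==> TDom F = D ==> TCod F = E ==> FO (transpose_U kp L e D E C) F = comp_trf L e (U1 kp L F)"
  "adj_mdf kp L m ==> TDom (MDom m) = D ==> TCod (MDom m) = E ==> FA (transpose_U kp L e D E C) m = lwh_mdf L e (U2 kp L m)"
  by (simp_all add: transpose_U_def)

lemma U2_simps [simp]: "MDom (U2 kp L m) = U1 kp L (MDom m)" "MCod (U2 kp L m) = U1 kp L (MCod m)" "MC (U2 kp L m) = MC m"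
  by (simp_all add: U2_def)

lemma U1_colax:
  assumes "two_category L" "adj_trf kp L F"
  shows "colax kp L (U1 kp L F)" "TDom (U1 kp L F) = U0 kp L (TDom F)" "TCod (U1 kp L F) = U0 kp L (TCod F)" "T1 (U1 kp L F) = T1 F"
proof -
  interpret adjt kp L F using assms by unfold_locales
  show "colax kp L (U1 kp L F)" "TDom (U1 kp L F) = U0 kp L (TDom F)" "TCod (U1 kp L F) = U0 kp L (TCod F)" "T1 (U1 kp L F) = T1 F"
    using U1_colax by simp_all
qed

lemma adj_mdfD:
  assumes "adj_mdf kp L m" "two_category L"
  shows "adj_trf kp L (MDom m)" "adj_trf kp L (MCod m)" "modification kp (coop L) m" "TDom (MCod m) = TDom (MDom m)" "TCod (MCod m) = TCod (MDom m)"
    "MC m \<in> extensional (Cell0 L)"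
    "p \<in> Cell0 L ==> nattrans (MC m p)" "p \<in> Cell0 L ==> NDom (MC m p) = T1 (MDom m) p" "p \<in> Cell0 L ==> NCod (MC m p) = T1 (MCod m) p"
  using assms modificationD[of kp "coop L" m] two_category_coop[OF assms(2)] by (simp_all add: adj_mdf_def)

lemma transpose_U_functor:
  assumes two: "two_category L" and e: "e \<in> Ob (colax_hom kp L (U0 kp L E) C)"
  shows "is_functor (transpose_U kp L e D E C)"
proof -
  have e': "colax kp L e" "TDom e = U0 kp L E" "TCod e = C" using e by simp_all
  interpret e: clx kp L e using two e' by unfold_locales
  have T1: "is_functor (T1 F p)" "FDom (T1 F p) = P0 (TDom F) p" "FCod (T1 F p) = P0 (TCod F) p" if "adj_trf kp L F" "p \<in> Cell0 L" for F p
  proof -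
    interpret adjt kp L F using two that by unfold_locales
    show "is_functor (T1 F p)" "FDom (T1 F p) = P0 (TDom F) p" "FCod (T1 F p) = P0 (TCod F) p" using that by simp_all
  qed
  note m = adj_mdfD[OF _ two]
  have P0e: "P0 (TDom e) = P0 E" by (simp add: e' U0_def Let_def)
  show ?thesis
  proof (rule functorI)
    fix F assume "F \<in> Ob (FDom (transpose_U kp L e D E C))"
    then have F: "adj_trf kp L F" "TDom F = D" "TCod F = E" by simp_all
    then have "colax kp (coop L) F" by (simp add: adj_trf_def pseudonatural_def)
    from id_mdf_modification[OF two_category_coop[OF two] this] F have i: "adj_mdf kp L (id_mdf L F)" by (simp add: adj_mdf_def)
    show "FO (transpose_U kp L e D E C) F \<in> Ob (FCod (transpose_U kp L e D E C))"
      using F U1_colax[OF two F(1)] e' comp_trf_colax[OF two _ e'(1), of "U1 kp L F"] by simp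
    show "FA (transpose_U kp L e D E C) (Idn (FDom (transpose_U kp L e D E C)) F) =
        Idn (FCod (transpose_U kp L e D E C)) (FO (transpose_U kp L e D E C) F)"
      using F i by simp (rule mdf_eqI[of _ _ L]; simp add: U1_colax[OF two F(1)] T1 P0e lwh_id_ntr)
  next
    fix m assume "m \<in> Ar (FDom (transpose_U kp L e D E C))"
    then have m: "adj_mdf kp L m" "TDom (MDom m) = D" "TCod (MDom m) = E" by simp_all
    show "FA (transpose_U kp L e D E C) m \<in> hom (FCod (transpose_U kp L e D E C))
         (FO (transpose_U kp L e D E C) (Src (FDom (transpose_U kp L e D E C)) m)) (FO (transpose_U kp L e D E C) (Tgt (FDom (transpose_U kp L e D E C)) m))"
      using m adj_mdfD[OF m(1) two] e' lwh_mdf_modification[OF two U2_modification[OF two m(1)] e'(1)]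
      by (simp add: U1_colax[OF two])
  next
    fix m n assume "m \<in> Ar (FDom (transpose_U kp L e D E C))" "n \<in> Ar (FDom (transpose_U kp L e D E C))"
      "Src (FDom (transpose_U kp L e D E C)) n = Tgt (FDom (transpose_U kp L e D E C)) m"
    then have mn: "adj_mdf kp L m" "TDom (MDom m) = D" "TCod (MDom m) = E" "adj_mdf kp L n" "TDom (MDom n) = D" "TCod (MDom n) = E"
      "MDom n = MCod m" by simp_all
    have nm: "adj_mdf kp L (vcomp_mdf L n m)"
      using vcomp_mdf_modification[OF two_category_coop[OF two] adj_mdfD(3)[OF mn(1) two] adj_mdfD(3)[OF mn(4) two] mn(7)]
        adj_mdfD[OF mn(1) two] adj_mdfD[OF mn(4) two] by (simp add: adj_mdf_def)
    show "FA (transpose_U kp L e D E C) (n \<cdot>[FDom (transpose_U kp L e D E C)] m) =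
       FA (transpose_U kp L e D E C) n \<cdot>[FCod (transpose_U kp L e D E C)] FA (transpose_U kp L e D E C) m"
      using mn nm by simp (rule mdf_eqI[of _ _ L]; simp add: U1_colax[OF two] m T1 P0e lwh_vcomp_ntr)
  qed (simp_all add: adj_hom_category[OF two] colax_hom_category[OF two], simp_all add: transpose_U_def)
qed

text \<open>\<open>equivalence\<close> asks for a quasi-inverse with invertible unit and counit.
  Choosing for each \<open>y\<close> an object with an isomorphism onto \<open>y\<close> gives
  universal arrows, hence an adjunction, whose unit and counit are then shown to be
  invertible.\<close>

lemma equivalenceI:
  assumes F: "is_functor F" "FDom F = C" "FCod F = D"
    and faithful: "!!u v. u \<in> Ar C ==> v \<in> Ar C ==> Src C u = Src C v ==> Tgt C u = Tgt C v ==> FA F u = FA F v ==> u = v"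
    and full: "!!a b w. a \<in> Ob C ==> b \<in> Ob C ==> w \<in> hom D (FO F a) (FO F b) ==> \<exists>u \<in> hom C a b. FA F u = w"
    and surj: "!!y. y \<in> Ob D ==> \<exists>x \<in> Ob C. \<exists>i \<in> hom D (FO F x) y. isom D i"
  shows "equivalence F"
proof -
  have cats: "category C" "category D" using F functorD by blast+
  have "\<forall>y \<in> Ob D. \<exists>xi. fst xi \<in> Ob C \<and> snd xi \<in> hom D (FO F (fst xi)) y \<and> isom D (snd xi)"
    using surj by (metis fst_conv snd_conv)
  from bchoice[OF this] obtain xi where xi: "!!y. y \<in> Ob D ==> fst (xi y) \<in> Ob C \<and> snd (xi y) \<in> hom D (FO F (fst (xi y))) y \<and> isom D (snd (xi y))"
    by blast
  have "\<exists>R \<eta> ep. adjn F R \<eta> ep C D"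
  proof (rule universal_arrows_adjn[where r = "\<lambda>y. fst (xi y)" and e = "\<lambda>y. snd (xi y)"])
    fix x y f assume x: "x \<in> Ob C" and y: "y \<in> Ob D" and f: "f \<in> hom D (FO F x) y"
    have "ainv D (snd (xi y)) \<cdot>[D] f \<in> hom D (FO F x) (FO F (fst (xi y)))" using xi[OF y] f cats by simp
    from full[OF x _ this] xi[OF y] obtain g where g: "g \<in> hom C x (fst (xi y))" "FA F g = ainv D (snd (xi y)) \<cdot>[D] f" by auto
    show "\<exists>!g. g \<in> hom C x (fst (xi y)) \<and> snd (xi y) \<cdot>[D] FA F g = f"
    proof (rule ex1I[of _ g])
      show "g \<in> hom C x (fst (xi y)) \<and> snd (xi y) \<cdot>[D] FA F g = f"
        using g xi[OF y] f cats by (simp add: ainv(6)[THEN cmpE])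
      fix g' assume g': "g' \<in> hom C x (fst (xi y)) \<and> snd (xi y) \<cdot>[D] FA F g' = f"
      have "FA F g' = FA F g"
        by (rule isom_cancel_left[of D "snd (xi y)"]) (use g g' xi[OF y] f cats F in "simp_all add: ainv(6)[THEN cmpE]")
      then show "g' = g" using g g' by (intro faithful) simp_all
    qed
  qed (use F xi in simp_all)
  then obtain R \<eta> ep where "adjn F R \<eta> ep C D" by blast
  then interpret adjn F R \<eta> ep C D .
  note ty = adjn_simps
  \<comment> \<open>The adjunction is only known to exist, so its counit need not be the chosen
    isomorphism. An isomorphism \<open>i\<close> onto \<open>y\<close> factors through
    \<open>ep\<close> at \<open>y\<close>, which gives a section \<open>k\<close>; the idempotent
    \<open>k ep\<close> lifts by fullness to an endomorphism of \<open>R y\<close>, and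
    \<open>flat_inj\<close> shows that it is the identity.\<close>
  have eps: "isom D (NC ep y)" if y: "y \<in> Ob D" for y
  proof -
    obtain x i where x: "x \<in> Ob C" and i: "i \<in> Ar D" "Src D i = FO F x" "Tgt D i = y" "isom D i" using surj[OF y] by auto
    define g where "g = FA R i \<cdot>[C] NC \<eta> x"
    have g: "g \<in> Ar C" "Src C g = x" "Tgt C g = FO R y" using x i ty by (simp_all add: g_def)
    have eg: "NC ep y \<cdot>[D] FA F g = i" unfolding g_def by (rule flat_sharp) (use x i in simp_all)
    define k where "k = FA F g \<cdot>[D] ainv D i"
    have k: "k \<in> Ar D" "Src D k = y" "Tgt D k = FO F (FO R y)" "NC ep y \<cdot>[D] k = Idn D y"
      using g x i y ty by (simp_all add: k_def eg[THEN cmpE])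
    have "k \<cdot>[D] NC ep y \<in> hom D (FO F (FO R y)) (FO F (FO R y))" using k y ty by simp
    from full[OF _ _ this] y ty obtain h where h: "h \<in> Ar C" "Src C h = FO R y" "Tgt C h = FO R y" "FA F h = k \<cdot>[D] NC ep y" by auto
    have "h = Idn C (FO R y)"
      by (rule flat_inj[of y _ "FO R y"]) (use y h k ty in "simp_all add: k(4)[THEN cmpE]")
    then have "k \<cdot>[D] NC ep y = Idn D (FO F (FO R y))" using h y ty by simp
    then show ?thesis by (intro isomI[where g = k]) (use k y ty in simp_all)
  qed
  \<comment> \<open>Fullness lifts the counit at \<open>F x\<close> to an inverse of the unit at
    \<open>x\<close>; faithfulness checks both composites.\<close>
  have eta: "isom C (NC \<eta> x)" if x: "x \<in> Ob C" for x
  proof -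
    have "NC ep (FO F x) \<in> hom D (FO F (FO R (FO F x))) (FO F x)" using x ty by simp
    from full[OF _ _ this] x ty obtain g where g: "g \<in> Ar C" "Src C g = FO R (FO F x)" "Tgt C g = x" "FA F g = NC ep (FO F x)" by auto
    have 1: "g \<cdot>[C] NC \<eta> x = Idn C x" by (rule faithful) (use x g ty tri1[OF x] in simp_all)
    have i: "isom D (NC ep (FO F x))" using eps x ty by simp
    have "NC ep (FO F x) \<cdot>[D] (FA F (NC \<eta> x) \<cdot>[D] NC ep (FO F x)) = NC ep (FO F x) \<cdot>[D] Idn D (FO F (FO R (FO F x)))"
      using x ty by (simp add: tri1[THEN cmpE])
    then have "FA F (NC \<eta> x) \<cdot>[D] NC ep (FO F x) = Idn D (FO F (FO R (FO F x)))"
      by (rule isom_cancel_left[OF cats(2) i, rotated -1]) (use x ty in simp_all)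
    then have 2: "NC \<eta> x \<cdot>[C] g = Idn C (FO R (FO F x))" by (intro faithful) (use x g ty in simp_all)
    show ?thesis by (rule isomI[where g = g]) (use 1 2 x g ty in simp_all)
  qed
  have "iso_ntr \<eta>" "iso_ntr ep" by (rule iso_ntrI; use eta eps ty in simp)+
  then show ?thesis unfolding equivalence_def using ty by (auto intro!: exI[of _ R] exI[of _ \<eta>] exI[of _ ep])
qed

section \<open>The co-dextrification\<close>

lemma (in psf) P1_limit:
  assumes "f \<in> Cell1 K" "small_diagram kp G" "FCod G = P0 P (src1 K f)" "limit_cone G c l"
  shows "limit_cone (P1 P f \<odot> G) (FO (P1 P f) c) (\<lambda>j. FA (P1 P f) (l j))"
  using P1(1)[OF assms(1)] assms unfolding lex_ftr_def preserves_small_limits_def by simp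

locale cod = twocat L + psf kp L C
  for kp :: "'k rel" and L :: "('p, 'f, 'a) twocat" and C :: "('p, 'f, 'a, 'o, 'm) catpfun"
begin

lemma hobj:
  assumes "codext_obj L C r Ga"
  shows "HO Ga \<in> extensional (into L r)" "HA Ga \<in> extensional (decomp L r)"
  using assms unfolding codext_obj_def by auto

lemma HO [simp]:
  assumes "codext_obj L C (tgt1 L mu) Ga" "mu \<in> Cell1 L" "p = src1 L mu"
  shows "HO Ga mu \<in> Ob (P0 C p)"
  using assms unfolding codext_obj_def by (auto simp: into_def)

lemma HA [simp]:
  assumes "codext_obj L C (tgt1 L nu) Ga" "nu \<in> Cell1 L" "rh \<in> Cell1 L" "src1 L nu = tgt1 L rh" "al \<in> Cell2 L" "tgt2 L al = nu \<star>[L] rh" "p = src1 L nu"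
  shows "HA Ga (nu, rh, al) \<in> Ar (P0 C p)" "Src (P0 C p) (HA Ga (nu, rh, al)) = HO Ga nu"
    "Tgt (P0 C p) (HA Ga (nu, rh, al)) = FO (P1 C rh) (HO Ga (src2 L al))"
proof -
  have "(nu, rh, al) \<in> decomp L (tgt1 L nu)" using assms by (simp add: decomp_def into_def)
  then show "HA Ga (nu, rh, al) \<in> Ar (P0 C p)" "Src (P0 C p) (HA Ga (nu, rh, al)) = HO Ga nu"
    "Tgt (P0 C p) (HA Ga (nu, rh, al)) = FO (P1 C rh) (HO Ga (src2 L al))"
    using assms unfolding codext_obj_def by fastforce+
qed

lemma HA_id:
  assumes "codext_obj L C (tgt1 L mu) Ga" "mu \<in> Cell1 L" "p = src1 L mu"
  shows "HA Ga (mu, id1 L p, id2 L mu) = NC (PU C p) (HO Ga mu)"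
  using assms unfolding codext_obj_def by (auto simp: into_def Let_def)

lemma HA_cmp:
  assumes "codext_obj L C (tgt1 L \<pi>) Ga" "rh \<in> Cell1 L" "src1 L nu = tgt1 L rh" "al \<in> Cell2 L" "tgt2 L al = nu \<star>[L] rh" 
    "\<pi> \<in> Cell1 L" "si \<in> Cell1 L" "src1 L \<pi> = tgt1 L si" "be \<in> Cell2 L" "tgt2 L be = \<pi> \<star>[L] si" "src2 L be = nu" "p = src1 L \<pi>" "mu = src2 L al"
  shows "NC (PC C si rh) (HO Ga mu) \<cdot>[P0 C p] FA (P1 C si) (HA Ga (nu, rh, al)) \<cdot>[P0 C p] HA Ga (\<pi>, si, be) =
    HA Ga (\<pi>, si \<star>[L] rh, (be \<triangleright>[L] rh) \<bullet>[L] al)"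
proof -
  have "nu \<in> Cell1 L" "tgt1 L nu = tgt1 L \<pi>" using assms cell2(1)[OF assms(9)] cell21[OF assms(9)] by auto
  then have "(nu, rh, al) \<in> decomp L (tgt1 L \<pi>)" "(\<pi>, si, be) \<in> decomp L (tgt1 L \<pi>)" using assms by (auto simp: decomp_def into_def)
  moreover have "\<forall>(nu, rh, al) \<in> decomp L (tgt1 L \<pi>). \<forall>(\<pi>, si, be) \<in> decomp L (tgt1 L \<pi>). src2 L be = nu \<longrightarrow>
        (let S = P0 C (src1 L \<pi>) in
          NC (PC C si rh) (HO Ga (src2 L al)) \<cdot>[S] FA (P1 C si) (HA Ga (nu, rh, al)) \<cdot>[S] HA Ga (\<pi>, si, be) =
          HA Ga (\<pi>, si \<star>[L] rh, (be \<triangleright>[L] rh) \<bullet>[L] al))"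
    using assms(1) unfolding codext_obj_def by blast
  ultimately show ?thesis using assms(11-13) by (fastforce simp: Let_def)
qed

lemma HA_2cell:
  assumes "codext_obj L C (tgt1 L nu) Ga" "nu \<in> Cell1 L" "rh \<in> Cell1 L" "src1 L nu = tgt1 L rh" "al \<in> Cell2 L" "tgt2 L al = nu \<star>[L] rh" 
    "be \<in> Cell2 L" "src2 L be = rh" "p = src1 L nu" "mu = src2 L al"
  shows "NC (P2 C be) (HO Ga mu) \<cdot>[P0 C p] HA Ga (nu, rh, al) = HA Ga (nu, tgt2 L be, (nu \<triangleleft>[L] be) \<bullet>[L] al)"
proof -
  have "(nu, rh, al) \<in> decomp L (tgt1 L nu)" using assms by (auto simp: decomp_def into_def)
  moreover have "\<forall>(nu, rh, al) \<in> decomp L (tgt1 L nu). \<forall>be \<in> Cell2 L. src2 L be = rh \<longrightarrow>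
        NC (P2 C be) (HO Ga (src2 L al)) \<cdot>[P0 C (src1 L nu)] HA Ga (nu, rh, al) =
        HA Ga (nu, tgt2 L be, (nu \<triangleleft>[L] be) \<bullet>[L] al)"
    using assms(1) unfolding codext_obj_def by blast
  ultimately show ?thesis using assms(7-10) by fastforce
qed

lemma codext_objI:
  assumes "HO Ga \<in> extensional (into L r)" "HA Ga \<in> extensional (decomp L r)"
    "!!mu. mu \<in> Cell1 L ==> tgt1 L mu = r ==> HO Ga mu \<in> Ob (P0 C (src1 L mu))"
    "!!nu rh al. nu \<in> Cell1 L ==> tgt1 L nu = r ==> rh \<in> Cell1 L ==> src1 L nu = tgt1 L rh ==> al \<in> Cell2 L ==> tgt2 L al = nu \<star>[L] rh ==>
      HA Ga (nu, rh, al) \<in> hom (P0 C (tgt1 L rh)) (HO Ga nu) (FO (P1 C rh) (HO Ga (src2 L al)))"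
    "!!mu. mu \<in> Cell1 L ==> tgt1 L mu = r ==> HA Ga (mu, id1 L (src1 L mu), id2 L mu) = NC (PU C (src1 L mu)) (HO Ga mu)"
    "!!rh al \<pi> si be. rh \<in> Cell1 L ==> \<pi> \<in> Cell1 L ==> tgt1 L \<pi> = r ==> si \<in> Cell1 L ==> src1 L \<pi> = tgt1 L si ==>
      src1 L si = tgt1 L rh ==> be \<in> Cell2 L ==> tgt2 L be = \<pi> \<star>[L] si ==>
      al \<in> Cell2 L ==> tgt2 L al = src2 L be \<star>[L] rh ==>
      NC (PC C si rh) (HO Ga (src2 L al)) \<cdot>[P0 C (tgt1 L si)] FA (P1 C si) (HA Ga (src2 L be, rh, al)) \<cdot>[P0 C (tgt1 L si)] HA Ga (\<pi>, si, be) =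
      HA Ga (\<pi>, si \<star>[L] rh, (be \<triangleright>[L] rh) \<bullet>[L] al)"
    "!!nu al be. nu \<in> Cell1 L ==> tgt1 L nu = r ==> src1 L nu = tgt1 L (tgt2 L be) ==> al \<in> Cell2 L ==>
      be \<in> Cell2 L ==> tgt2 L al = nu \<star>[L] src2 L be ==>
      NC (P2 C be) (HO Ga (src2 L al)) \<cdot>[P0 C (tgt1 L (tgt2 L be))] HA Ga (nu, src2 L be, al) = HA Ga (nu, tgt2 L be, (nu \<triangleleft>[L] be) \<bullet>[L] al)"
  shows "codext_obj L C r Ga"
proof -
  have 1: "\<forall>(nu, rh, al) \<in> decomp L r. HA Ga (nu, rh, al) \<in> hom (P0 C (src1 L nu)) (HO Ga nu) (FO (P1 C rh) (HO Ga (src2 L al)))"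
  proof (clarify)
    fix nu rh al assume "(nu, rh, al) \<in> decomp L r"
    then have d: "nu \<in> Cell1 L" "tgt1 L nu = r" "rh \<in> Cell1 L" "src1 L nu = tgt1 L rh" "al \<in> Cell2 L" "tgt2 L al = nu \<star>[L] rh"
      unfolding decomp_def into_def by simp_all
    show "HA Ga (nu, rh, al) \<in> hom (P0 C (src1 L nu)) (HO Ga nu) (FO (P1 C rh) (HO Ga (src2 L al)))"
      using assms(4)[OF d] d(4) by simp
  qed
  have 2: "\<forall>(nu, rh, al) \<in> decomp L r. \<forall>(\<pi>, si, be) \<in> decomp L r. src2 L be = nu \<longrightarrow>
        (let S = P0 C (src1 L \<pi>) in
          NC (PC C si rh) (HO Ga (src2 L al)) \<cdot>[S] FA (P1 C si) (HA Ga (nu, rh, al)) \<cdot>[S] HA Ga (\<pi>, si, be) =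
          HA Ga (\<pi>, si \<star>[L] rh, (be \<triangleright>[L] rh) \<bullet>[L] al))"
  proof (clarify, unfold Let_def)
    fix rh al \<pi> si be assume "(src2 L be, rh, al) \<in> decomp L r" "(\<pi>, si, be) \<in> decomp L r"
    then have d: "rh \<in> Cell1 L" "tgt1 L rh = src1 L (src2 L be)" "al \<in> Cell2 L" "tgt2 L al = src2 L be \<star>[L] rh"
      "\<pi> \<in> Cell1 L" "tgt1 L \<pi> = r" "si \<in> Cell1 L" "tgt1 L si = src1 L \<pi>" "be \<in> Cell2 L" "tgt2 L be = \<pi> \<star>[L] si"
      unfolding decomp_def into_def by simp_all
    show "NC (PC C si rh) (HO Ga (src2 L al)) \<cdot>[P0 C (src1 L \<pi>)] FA (P1 C si) (HA Ga (src2 L be, rh, al)) \<cdot>[P0 C (src1 L \<pi>)] HA Ga (\<pi>, si, be) =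
          HA Ga (\<pi>, si \<star>[L] rh, (be \<triangleright>[L] rh) \<bullet>[L] al)"
      using assms(6)[OF d(1,5,6,7) d(8)[symmetric] _ d(9,10,3,4)] d cell21[OF d(9)] by simp
  qed
  have 3: "\<forall>(nu, rh, al) \<in> decomp L r. \<forall>be \<in> Cell2 L. src2 L be = rh \<longrightarrow>
        NC (P2 C be) (HO Ga (src2 L al)) \<cdot>[P0 C (src1 L nu)] HA Ga (nu, rh, al) =
        HA Ga (nu, tgt2 L be, (nu \<triangleleft>[L] be) \<bullet>[L] al)"
  proof (clarify)
    fix nu al be assume "(nu, src2 L be, al) \<in> decomp L r" and b: "be \<in> Cell2 L"
    then have d: "tgt1 L (src2 L be) = src1 L nu" "al \<in> Cell2 L" "tgt2 L al = nu \<star>[L] src2 L be" "nu \<in> Cell1 L" "tgt1 L nu = r"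
      unfolding decomp_def into_def by simp_all
    show "NC (P2 C be) (HO Ga (src2 L al)) \<cdot>[P0 C (src1 L nu)] HA Ga (nu, src2 L be, al) =
        HA Ga (nu, tgt2 L be, (nu \<triangleleft>[L] be) \<bullet>[L] al)"
      using assms(7)[OF d(4,5) _ d(2) b d(3)] d cell21[OF b] by simp
  qed
  show ?thesis
    unfolding codext_obj_def using assms(1,2,3,5) 1 2 3 by (simp add: into_def Let_def)
qed

lemma codext_mor:
  assumes "codext_mor L C r th"
  shows "codext_obj L C r (HDom th)" "codext_obj L C r (HCod th)" "HM th \<in> extensional (into L r)"
  using assms unfolding codext_mor_def by (auto simp: Let_def)

lemma HM [simp]:
  assumes "codext_mor L C (tgt1 L mu) th" "mu \<in> Cell1 L" "p = src1 L mu"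
  shows "HM th mu \<in> Ar (P0 C p)" "Src (P0 C p) (HM th mu) = HO (HDom th) mu" "Tgt (P0 C p) (HM th mu) = HO (HCod th) mu"
  using assms unfolding codext_mor_def by (auto simp: into_def Let_def)

lemma HM_HA:
  assumes "codext_mor L C (tgt1 L nu) th" "nu \<in> Cell1 L" "rh \<in> Cell1 L" "src1 L nu = tgt1 L rh" "al \<in> Cell2 L" "tgt2 L al = nu \<star>[L] rh" 
    "p = src1 L nu" "mu = src2 L al" "HDom th = Ga"
  shows "FA (P1 C rh) (HM th mu) \<cdot>[P0 C p] HA Ga (nu, rh, al) = HA (HCod th) (nu, rh, al) \<cdot>[P0 C p] HM th nu"
proof -
  have "(nu, rh, al) \<in> decomp L (tgt1 L nu)" using assms by (auto simp: decomp_def into_def)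
  then show ?thesis using assms(1,7-9) unfolding codext_mor_def Let_def by fastforce
qed

lemma codext_morI:
  assumes "codext_obj L C r (HDom th)" "codext_obj L C r (HCod th)" "HM th \<in> extensional (into L r)"
    "!!mu. mu \<in> Cell1 L ==> tgt1 L mu = r ==> HM th mu \<in> hom (P0 C (src1 L mu)) (HO (HDom th) mu) (HO (HCod th) mu)"
    "!!nu rh al. nu \<in> Cell1 L ==> tgt1 L nu = r ==> rh \<in> Cell1 L ==> src1 L nu = tgt1 L rh ==> al \<in> Cell2 L ==> tgt2 L al = nu \<star>[L] rh ==>
      FA (P1 C rh) (HM th (src2 L al)) \<cdot>[P0 C (tgt1 L rh)] HA (HDom th) (nu, rh, al) = HA (HCod th) (nu, rh, al) \<cdot>[P0 C (tgt1 L rh)] HM th nu"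
  shows "codext_mor L C r th"
proof -
  have "\<forall>(nu, rh, al) \<in> decomp L r. FA (P1 C rh) (HM th (src2 L al)) \<cdot>[P0 C (src1 L nu)] HA (HDom th) (nu, rh, al) =
      HA (HCod th) (nu, rh, al) \<cdot>[P0 C (src1 L nu)] HM th nu"
  proof (clarify)
    fix nu rh al assume "(nu, rh, al) \<in> decomp L r"
    then have d: "nu \<in> Cell1 L" "tgt1 L nu = r" "rh \<in> Cell1 L" "src1 L nu = tgt1 L rh" "al \<in> Cell2 L" "tgt2 L al = nu \<star>[L] rh"
      unfolding decomp_def into_def by simp_all
    show "FA (P1 C rh) (HM th (src2 L al)) \<cdot>[P0 C (src1 L nu)] HA (HDom th) (nu, rh, al) =
      HA (HCod th) (nu, rh, al) \<cdot>[P0 C (src1 L nu)] HM th nu"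
      using assms(5)[OF d] d(4) by simp
  qed
  then show ?thesis unfolding codext_mor_def Let_def using assms(1-4) by (simp add: into_def)
qed

lemma hmor_eqI:
  fixes th th' :: "('f, 'a, 'o, 'm) hmor"
  assumes "codext_mor L C r th" "codext_mor L C r th'" "HDom th = HDom th'" "HCod th = HCod th'"
    "!!mu. mu \<in> Cell1 L ==> tgt1 L mu = r ==> HM th mu = HM th' mu"
  shows "th = th'"
  using codext_mor(3)[OF assms(1)] codext_mor(3)[OF assms(2)] assms(3-5)
  by (intro hmor.equality extensionalityI[of _ "into L r"]) (simp_all add: into_def)

lemma hobj_eqI:
  fixes Ga \<Delta> :: "('f, 'a, 'o, 'm) hobj"
  assumes "codext_obj L C r Ga" "codext_obj L C r \<Delta>" "!!mu. mu \<in> Cell1 L ==> tgt1 L mu = r ==> HO Ga mu = HO \<Delta> mu"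
    "!!nu rh al. nu \<in> Cell1 L ==> tgt1 L nu = r ==> rh \<in> Cell1 L ==> src1 L nu = tgt1 L rh ==> al \<in> Cell2 L ==> tgt2 L al = nu \<star>[L] rh ==>
      HA Ga (nu, rh, al) = HA \<Delta> (nu, rh, al)"
  shows "Ga = \<Delta>"
proof (rule hobj.equality)
  show "HO Ga = HO \<Delta>" using hobj(1)[OF assms(1)] hobj(1)[OF assms(2)] assms(3)
    by (intro extensionalityI[of _ "into L r"]) (simp_all add: into_def)
  show "HA Ga = HA \<Delta>" using hobj(2)[OF assms(1)] hobj(2)[OF assms(2)]
    by (rule extensionalityI) (use assms(4) in "auto simp: decomp_def into_def")
qed simp

abbreviation "E r \<equiv> codext_cat L C r"

lemma E_simps [simp]:
  "Ga \<in> Ob (E r) \<longleftrightarrow> codext_obj L C r Ga" "th \<in> Ar (E r) \<longleftrightarrow> codext_mor L C r th" "Src (E r) = HDom" "Tgt (E r) = HCod"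
  "HDom (Idn (E r) Ga) = Ga" "HCod (Idn (E r) Ga) = Ga" "HDom (th' \<cdot>[E r] th) = HDom th" "HCod (th' \<cdot>[E r] th) = HCod th'"
  "mu \<in> Cell1 L ==> tgt1 L mu = r ==> HM (Idn (E r) Ga) mu = Idn (P0 C (src1 L mu)) (HO Ga mu)"
  "mu \<in> Cell1 L ==> tgt1 L mu = r ==> HM (th' \<cdot>[E r] th) mu = HM th' mu \<cdot>[P0 C (src1 L mu)] HM th mu"
  by (simp_all add: codext_cat_def into_def)

lemma E_cmp:
  assumes "codext_mor L C r th" "codext_mor L C r th'" "HDom th' = HCod th"
  shows "codext_mor L C r (th' \<cdot>[E r] th)"
proof (rule codext_morI)
  show "HM (th' \<cdot>[E r] th) \<in> extensional (into L r)" by (simp add: codext_cat_def)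
qed (use assms codext_mor[OF assms(1)] codext_mor[OF assms(2)] in "simp_all add: HM_HA HM_HA[THEN cmpE]")

lemma E_id:
  assumes "codext_obj L C r Ga"
  shows "codext_mor L C r (Idn (E r) Ga)"
proof (rule codext_morI)
  show "HM (Idn (E r) Ga) \<in> extensional (into L r)" by (simp add: codext_cat_def)
qed (use assms in simp_all)

lemma E_category [simp]: "category (E r)"
  by (rule categoryI) (auto simp: E_cmp E_id codext_mor intro!: hmor_eqI[of r])

text \<open>The pointwise inverses form a morphism, by \<open>inv_square\<close> applied to the
  compatibility of \<open>th\<close> with each structure morphism.\<close>

lemma E_isom:
  assumes th: "codext_mor L C r th" and i: "!!mu. mu \<in> Cell1 L ==> tgt1 L mu = r ==> isom (P0 C (src1 L mu)) (HM th mu)"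
  shows "isom (E r) th"
proof -
  let ?k = "\<lparr>HDom = HCod th, HCod = HDom th, HM = (\<lambda>mu \<in> into L r. ainv (P0 C (src1 L mu)) (HM th mu))\<rparr>"
  have ks: "HM ?k mu = ainv (P0 C (src1 L mu)) (HM th mu)" if "mu \<in> Cell1 L" "tgt1 L mu = r" for mu using that by (simp add: into_def)
  have k: "codext_mor L C r ?k"
  proof (rule codext_morI)
    fix nu rh al assume a: "nu \<in> Cell1 L" "tgt1 L nu = r" "rh \<in> Cell1 L" "src1 L nu = tgt1 L rh" "al \<in> Cell2 L" "tgt2 L al = nu \<star>[L] rh"
    have m: "src2 L al \<in> Cell1 L" "tgt1 L (src2 L al) = r" "src1 L (src2 L al) = src1 L rh" using a by simp_all
    have in': "isom (P0 C (src1 L rh)) (HM th (src2 L al))" "isom (P0 C (tgt1 L rh)) (HM th nu)" using i[of "src2 L al"] i[of nu] a m by simp_all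
    have "HA (HDom th) (nu, rh, al) \<cdot>[P0 C (tgt1 L rh)] ainv (P0 C (tgt1 L rh)) (HM th nu) =
      FA (P1 C rh) (ainv (P0 C (src1 L rh)) (HM th (src2 L al))) \<cdot>[P0 C (tgt1 L rh)] HA (HCod th) (nu, rh, al)"
      by (rule inv_square[of _ "FA (P1 C rh) (HM th (src2 L al))" _ _ "HM th nu"])
        (use a m th codext_mor[OF th] in' in "simp_all add: HM_HA ainv(5)[THEN FA_eq]")
    then show "FA (P1 C rh) (HM ?k (src2 L al)) \<cdot>[P0 C (tgt1 L rh)] HA (HDom ?k) (nu, rh, al) = HA (HCod ?k) (nu, rh, al) \<cdot>[P0 C (tgt1 L rh)] HM ?k nu"
      using a m ks[of "src2 L al"] ks[of nu] by (simp add: into_def)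
  qed (use th codext_mor[OF th] i in "simp_all add: into_def")
  show ?thesis
  proof (rule isomI[where g = ?k])
    show "?k \<cdot>[E r] th = Idn (E r) (Src (E r) th)"
      by (rule hmor_eqI[of r]) (use th k i codext_mor[OF th] in "simp_all add: E_cmp E_id into_def")
    show "th \<cdot>[E r] ?k = Idn (E r) (Src (E r) ?k)"
      by (rule hmor_eqI[of r]) (use th k i codext_mor[OF th] in "simp_all add: E_cmp E_id into_def")
  qed (use th k in simp_all)
qed

section \<open>Pointwise limits in the co-dextrification\<close>

definition "ev r mu = \<lparr>FDom = E r, FCod = P0 C (src1 L mu), FO = (\<lambda>Ga \<in> Ob (E r). HO Ga mu), FA = (\<lambda>th \<in> Ar (E r). HM th mu)\<rparr>"

lemma ev [simp]:
  "FDom (ev r mu) = E r" "FCod (ev r mu) = P0 C (src1 L mu)" "codext_obj L C r Ga ==> FO (ev r mu) Ga = HO Ga mu"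
  "codext_mor L C r th ==> FA (ev r mu) th = HM th mu"
  by (simp_all add: ev_def)

lemma ev_functor [simp]: "mu \<in> Cell1 L ==> tgt1 L mu = r ==> is_functor (ev r mu)"
proof (rule functorI)
  show "FO (ev r mu) \<in> extensional (Ob (FDom (ev r mu)))" "FA (ev r mu) \<in> extensional (Ar (FDom (ev r mu)))" by (simp_all add: ev_def)
qed (auto simp: codext_mor E_id E_cmp)

text \<open>Pointwise lifts are automatically compatible with structure morphisms: both composites
  land in the image of a limit under \<open>P1 C rh\<close>, which is again a limit because
  \<open>P1 C rh\<close> is lex (\<open>lim2\<close>), so they can be compared on its legs.\<close>

lemma E_limitI:
  fixes G :: "('k, 'k, ('f, 'a, 'o, 'm) hobj, ('f, 'a, 'o, 'm) hmor) ftr"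
  assumes G: "small_diagram kp G" "FCod G = E r" and c: "cone G Ga l"
    and lim: "!!mu. mu \<in> Cell1 L ==> tgt1 L mu = r ==> limit_cone (ev r mu \<odot> G) (HO Ga mu) (\<lambda>j. HM (l j) mu)"
  shows "limit_cone G Ga l"
proof (rule limit_coneI[OF c])
  have G': "is_functor G" using G by (simp add: small_diagram_def)
  have Ga: "codext_obj L C r Ga" using c G by (simp add: cone_iff)
  have l: "codext_mor L C r (l j)" "HDom (l j) = Ga" "HCod (l j) = FO G j" if "j \<in> Ob (FDom G)" for j
    using c G that by (auto simp: cone_iff)
  have Gj: "codext_obj L C r (FO G j)" if "j \<in> Ob (FDom G)" for j using functor_simps(1)[OF G' G(2) that] by simp
  have lim2: "limit_cone (P1 C rh \<odot> ev r (src2 L al) \<odot> G) (FO (P1 C rh) (HO Ga (src2 L al))) (\<lambda>j. FA (P1 C rh) (HM (l j) (src2 L al)))"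
    if "nu \<in> Cell1 L" "tgt1 L nu = r" "rh \<in> Cell1 L" "src1 L nu = tgt1 L rh" "al \<in> Cell2 L" "tgt2 L al = nu \<star>[L] rh" for nu rh al
    by (rule P1_limit) (use that G G' lim[of "src2 L al"] in "simp_all add: comp_small_diagram")
  fix \<Delta>
  { fix l' assume c': "cone G \<Delta> l'"
    have \<Delta>: "codext_obj L C r \<Delta>" using c' G by (simp add: cone_iff)
    have l': "codext_mor L C r (l' j)" "HDom (l' j) = \<Delta>" "HCod (l' j) = FO G j" if "j \<in> Ob (FDom G)" for j
      using c' G that by (auto simp: cone_iff)
    have "\<exists>h. h \<in> hom (P0 C (src1 L mu)) (HO \<Delta> mu) (HO Ga mu) \<and> (\<forall>j \<in> Ob (FDom G). HM (l j) mu \<cdot>[P0 C (src1 L mu)] h = HM (l' j) mu)"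
      if mu: "mu \<in> Cell1 L" "tgt1 L mu = r" for mu
    proof -
      have "cone (ev r mu \<odot> G) (FO (ev r mu) \<Delta>) (\<lambda>j. FA (ev r mu) (l' j))"
        by (rule cone_image[OF c' G']) (use mu G in simp_all)
      then have "cone (ev r mu \<odot> G) (HO \<Delta> mu) (\<lambda>j. HM (l' j) mu)"
        using \<Delta> l' functorD(1)[OF G'] by (simp add: cone_iff)
      from limit_cone_lift[OF lim[OF mu] this] show ?thesis by (metis comp_ftr_simps(1,2) ev(2))
    qed
    then obtain h where h: "!!mu. mu \<in> Cell1 L ==> tgt1 L mu = r ==> h mu \<in> hom (P0 C (src1 L mu)) (HO \<Delta> mu) (HO Ga mu)"
      "!!mu j. mu \<in> Cell1 L ==> tgt1 L mu = r ==> j \<in> Ob (FDom G) ==> HM (l j) mu \<cdot>[P0 C (src1 L mu)] h mu = HM (l' j) mu"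
      by metis
    let ?h = "\<lparr>HDom = \<Delta>, HCod = Ga, HM = restrict h (into L r)\<rparr>"
    have hs: "restrict h (into L r) mu = h mu" if "mu \<in> Cell1 L" "tgt1 L mu = r" for mu using that by (simp add: into_def)
    have hm: "codext_mor L C r ?h"
    proof (rule codext_morI)
      fix nu rh al assume a: "nu \<in> Cell1 L" "tgt1 L nu = r" "rh \<in> Cell1 L" "src1 L nu = tgt1 L rh" "al \<in> Cell2 L" "tgt2 L al = nu \<star>[L] rh"
      have m: "src2 L al \<in> Cell1 L" "tgt1 L (src2 L al) = r" "src1 L (src2 L al) = src1 L rh" using a by simp_all
      have hty: "h nu \<in> Ar (P0 C (tgt1 L rh))" "Src (P0 C (tgt1 L rh)) (h nu) = HO \<Delta> nu" "Tgt (P0 C (tgt1 L rh)) (h nu) = HO Ga nu"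
        "h (src2 L al) \<in> Ar (P0 C (src1 L rh))" "Src (P0 C (src1 L rh)) (h (src2 L al)) = HO \<Delta> (src2 L al)" "Tgt (P0 C (src1 L rh)) (h (src2 L al)) = HO Ga (src2 L al)"
        using h(1)[OF a(1,2)] h(1)[OF m(1,2)] m(3) a(4) by simp_all
      have "FA (P1 C rh) (h (src2 L al)) \<cdot>[P0 C (tgt1 L rh)] HA \<Delta> (nu, rh, al) = HA Ga (nu, rh, al) \<cdot>[P0 C (tgt1 L rh)] h nu"
      proof (rule limit_cone_joint_monic[OF lim2[OF a]])
        fix j assume "j \<in> Ob (FDom (P1 C rh \<odot> ev r (src2 L al) \<odot> G))"
        then have j: "j \<in> Ob (FDom G)" by simp
        note lj = l[OF j] l'[OF j]
        have h1: "HM (l j) (src2 L al) \<cdot>[P0 C (src1 L rh)] h (src2 L al) = HM (l' j) (src2 L al)" using h(2)[OF m(1,2) j] m(3) by simp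
        have h2: "HM (l j) nu \<cdot>[P0 C (tgt1 L rh)] h nu = HM (l' j) nu" using h(2)[OF a(1,2) j] a(4) by simp
        show "FA (P1 C rh) (HM (l j) (src2 L al)) \<cdot>[FCod (P1 C rh \<odot> ev r (src2 L al) \<odot> G)] FA (P1 C rh) (h (src2 L al)) \<cdot>[P0 C (tgt1 L rh)] HA \<Delta> (nu, rh, al) =
          FA (P1 C rh) (HM (l j) (src2 L al)) \<cdot>[FCod (P1 C rh \<odot> ev r (src2 L al) \<odot> G)] HA Ga (nu, rh, al) \<cdot>[P0 C (tgt1 L rh)] h nu"
          using a m hty lj Ga \<Delta> Gj[OF j]
          by (simp add: h1[THEN FA_eq, THEN cmpE] h2 HM_HA HM_HA[THEN cmpE])
      qed (use a m hty Ga \<Delta> G G' in simp_all)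
      then show "FA (P1 C rh) (HM ?h (src2 L al)) \<cdot>[P0 C (tgt1 L rh)] HA (HDom ?h) (nu, rh, al) = HA (HCod ?h) (nu, rh, al) \<cdot>[P0 C (tgt1 L rh)] HM ?h nu"
        using hs[OF a(1,2)] hs[OF m(1,2)] by simp
    qed (use Ga \<Delta> h in "simp_all add: into_def")
    show "\<exists>h\<in>hom (FCod G) \<Delta> Ga. \<forall>j\<in>Ob (FDom G). l j \<cdot>[FCod G] h = l' j"
    proof (rule bexI[of _ ?h], rule ballI)
      fix j assume j: "j \<in> Ob (FDom G)"
      show "l j \<cdot>[FCod G] ?h = l' j"
        by (rule hmor_eqI[of r]) (use l[OF j] l'[OF j] hm G h(2)[OF _ _ j] in "simp_all add: E_cmp into_def")
    qed (use G hm in simp) }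
  fix h h' assume h: "h \<in> hom (FCod G) \<Delta> Ga" "h' \<in> hom (FCod G) \<Delta> Ga" "!!j. j \<in> Ob (FDom G) ==> l j \<cdot>[FCod G] h = l j \<cdot>[FCod G] h'"
  have hm: "codext_mor L C r h" "HDom h = \<Delta>" "HCod h = Ga" "codext_mor L C r h'" "HDom h' = \<Delta>" "HCod h' = Ga" using h G by auto
  show "h = h'"
  proof (rule hmor_eqI[of r])
    fix mu assume mu: "mu \<in> Cell1 L" "tgt1 L mu = r"
    show "HM h mu = HM h' mu"
    proof (rule limit_cone_joint_monic[OF lim[OF mu], of _ "HO \<Delta> mu"])
      fix j assume "j \<in> Ob (FDom (ev r mu \<odot> G))"
      then have "l j \<cdot>[E r] h = l j \<cdot>[E r] h'" using h(3)[of j] G by simp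
      from arg_cong[OF this, of "\<lambda>t. HM t mu"] show "HM (l j) mu \<cdot>[FCod (ev r mu \<odot> G)] HM h mu = HM (l j) mu \<cdot>[FCod (ev r mu \<odot> G)] HM h' mu"
        using mu by simp
    qed (use mu hm G G' in simp_all)
  qed (use hm in simp_all)
qed

end

text \<open>For rules whose left side has three factors, such as \<open>HA_cmp\<close>.\<close>

lemma cmpE3:
  assumes "g \<cdot>[C] f \<cdot>[C] e = h" "category C" "e \<in> Ar C" "f \<in> Ar C" "g \<in> Ar C" "Src C g = Tgt C f" "Src C f = Tgt C e" "k \<in> Ar C" "Tgt C k = Src C e"
  shows "g \<cdot>[C] f \<cdot>[C] e \<cdot>[C] k = h \<cdot>[C] k"
  unfolding assms(1)[symmetric] using assms(2-) by simp

lemma (in psf) PC_id: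
  assumes "f \<in> Cell1 K" "x \<in> Ob (P0 P (src1 K f))" "q = tgt1 K f"
  shows "p = src1 K f ==> NC (PC P f (id1 K p)) x = FA (P1 P f) (NC (inv_ntr (PU P p)) x)"
    "NC (PC P (id1 K q) f) x = NC (inv_ntr (PU P q)) (FO (P1 P f) x)"
proof -
  interpret twocat K using twoK by unfold_locales
  show "NC (PC P f (id1 K p)) x = FA (P1 P f) (NC (inv_ntr (PU P p)) x)" if p: "p = src1 K f"
  proof -
    have i: "isom (P0 P q) (FA (P1 P f) (NC (PU P p) x))"
      by (rule isom_FA[OF _ _ _ iso_ntr_isom[OF PU(1)[of p]]]) (use assms p in simp_all)
    show ?thesis by (rule isom_cancel[OF _ i]) (use assms p in "simp_all add: PC_unit PU_inv[THEN FA_eq]")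
  qed
  have j: "isom (P0 P q) (NC (PU P q) (FO (P1 P f) x))"
    by (rule iso_ntr_isom[OF PU(1)]) (use assms in simp_all)
  show "NC (PC P (id1 K q) f) x = NC (inv_ntr (PU P q)) (FO (P1 P f) x)"
    by (rule isom_cancel[OF _ j]) (use assms in "simp_all add: PC_unit PU_inv")
qed

context cod begin

text \<open>Limits are taken at each \<open>mu\<close> separately. The structure morphism at
  \<open>(nu, rh, al)\<close> is a lift through the image of the limit at \<open>src2 L al\<close>
  under \<open>P1 C rh\<close>, and the object axioms hold because they hold on the legs. The
  pointwise limits are kept in the conclusion because \<open>ev_lex\<close> needs them.\<close>

lemma E_limit_exists:
  fixes G :: "('k, 'k, ('f, 'a, 'o, 'm) hobj, ('f, 'a, 'o, 'm) hmor) ftr"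
  assumes G: "small_diagram kp G" "FCod G = E r"
  shows "\<exists>Ga l. cone G Ga l \<and> (\<forall>mu. mu \<in> Cell1 L \<longrightarrow> tgt1 L mu = r \<longrightarrow> limit_cone (ev r mu \<odot> G) (HO Ga mu) (\<lambda>j. HM (l j) mu))"
proof -
  have G': "is_functor G" using G by (simp add: small_diagram_def)
  have Gj: "codext_obj L C r (FO G j)" if "j \<in> Ob (FDom G)" for j using functor_simps(1)[OF G' G(2) that] by simp
  have Gu: "codext_mor L C r (FA G u)" "HDom (FA G u) = FO G (Src (FDom G) u)" "HCod (FA G u) = FO G (Tgt (FDom G) u)"
    if "u \<in> Ar (FDom G)" for u using functor_simps(2-4)[OF G' G(2) that] by simp_all
  have "\<exists>c l. limit_cone (ev r mu \<odot> G) c l" if "mu \<in> Cell1 L" "tgt1 L mu = r" for mu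
  proof -
    have "small_diagram kp (ev r mu \<odot> G)" using G that by (intro comp_small_diagram) simp_all
    moreover have "has_small_limits kp (P0 C (src1 L mu))" using that by simp
    ultimately show ?thesis unfolding has_small_limits_def by simp
  qed
  then obtain c l where lim: "!!mu. mu \<in> Cell1 L ==> tgt1 L mu = r ==> limit_cone (ev r mu \<odot> G) (c mu) (l mu)" by metis
  have c: "c mu \<in> Ob (P0 C p)" if "mu \<in> Cell1 L" "tgt1 L mu = r" "p = src1 L mu" for mu p
    using limit_coneD(2)[OF lim[OF that(1,2)]] that(3) by simp
  have l: "l mu j \<in> Ar (P0 C p)" "Src (P0 C p) (l mu j) = c mu" "Tgt (P0 C p) (l mu j) = HO (FO G j) mu"
    if "mu \<in> Cell1 L" "tgt1 L mu = r" "p = src1 L mu" "j \<in> Ob (FDom G)" for mu p j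
    using limit_coneD(3)[OF lim[OF that(1,2)], of j] that(3,4) Gj by simp_all
  have l_nat: "HM (FA G u) mu \<cdot>[P0 C p] l mu (Src (FDom G) u) = l mu (Tgt (FDom G) u)"
    if "mu \<in> Cell1 L" "tgt1 L mu = r" "p = src1 L mu" "u \<in> Ar (FDom G)" for mu p u
  proof -
    have "FA (ev r mu \<odot> G) u \<cdot>[FCod (ev r mu \<odot> G)] l mu (Src (FDom G) u) = l mu (Tgt (FDom G) u)"
      using limit_coneD(1)[OF lim[OF that(1,2)]] that(4) unfolding cone_iff comp_ftr_simps(1) by blast
    then show ?thesis using that Gu[OF that(4)] by simp
  qed
  have lim2: "limit_cone (P1 C ta \<odot> ev r mu \<odot> G) (FO (P1 C ta) (c mu)) (\<lambda>j. FA (P1 C ta) (l mu j))"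
    if "ta \<in> Cell1 L" "mu \<in> Cell1 L" "tgt1 L mu = r" "src1 L mu = src1 L ta" for ta mu
    by (rule P1_limit) (use that G lim[of mu] in "simp_all add: comp_small_diagram")
  \<comment> \<open>The comparison on legs that proves each of the three object axioms of the
    limit.\<close>
  have jm: "h = h'" if "ta \<in> Cell1 L" "mu \<in> Cell1 L" "tgt1 L mu = r" "src1 L mu = src1 L ta"
    "h \<in> hom (P0 C (tgt1 L ta)) x (FO (P1 C ta) (c mu))" "h' \<in> hom (P0 C (tgt1 L ta)) x (FO (P1 C ta) (c mu))"
    "!!j. j \<in> Ob (FDom G) ==> FA (P1 C ta) (l mu j) \<cdot>[P0 C (tgt1 L ta)] h = FA (P1 C ta) (l mu j) \<cdot>[P0 C (tgt1 L ta)] h'" for ta mu h h' x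
    by (rule limit_cone_joint_monic[OF lim2[OF that(1-4)], of _ x]) (use that G G' in simp_all)
  have "\<exists>h. h \<in> hom (P0 C (tgt1 L rh)) (c nu) (FO (P1 C rh) (c (src2 L al))) \<and>
     (\<forall>j \<in> Ob (FDom G). FA (P1 C rh) (l (src2 L al) j) \<cdot>[P0 C (tgt1 L rh)] h = HA (FO G j) (nu, rh, al) \<cdot>[P0 C (tgt1 L rh)] l nu j)"
    if a: "nu \<in> Cell1 L" "tgt1 L nu = r" "rh \<in> Cell1 L" "src1 L nu = tgt1 L rh" "al \<in> Cell2 L" "tgt2 L al = nu \<star>[L] rh" for nu rh al
  proof -
    have m: "src2 L al \<in> Cell1 L" "tgt1 L (src2 L al) = r" "src1 L (src2 L al) = src1 L rh" using a by simp_all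
    have k: "cone (P1 C rh \<odot> ev r (src2 L al) \<odot> G) (c nu) (\<lambda>j. HA (FO G j) (nu, rh, al) \<cdot>[P0 C (tgt1 L rh)] l nu j)"
      unfolding cone_iff
    proof (intro conjI ballI)
      fix u assume "u \<in> Ar (FDom (P1 C rh \<odot> ev r (src2 L al) \<odot> G))"
      then have u: "u \<in> Ar (FDom G)" by simp
      show "FA (P1 C rh \<odot> ev r (src2 L al) \<odot> G) u \<cdot>[FCod (P1 C rh \<odot> ev r (src2 L al) \<odot> G)]
          HA (FO G (Src (FDom (P1 C rh \<odot> ev r (src2 L al) \<odot> G)) u)) (nu, rh, al) \<cdot>[P0 C (tgt1 L rh)] l nu (Src (FDom (P1 C rh \<odot> ev r (src2 L al) \<odot> G)) u) =
        HA (FO G (Tgt (FDom (P1 C rh \<odot> ev r (src2 L al) \<odot> G)) u)) (nu, rh, al) \<cdot>[P0 C (tgt1 L rh)] l nu (Tgt (FDom (P1 C rh \<odot> ev r (src2 L al) \<odot> G)) u)"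
        using u a m Gu[OF u] Gj functorD(1)[OF G'] by (simp add: HM_HA[THEN cmpE] l l_nat)
    qed (use a m Gj in "simp_all add: c l")
    from limit_cone_lift[OF lim2[OF a(3) m] k] show ?thesis by (metis comp_ftr_simps(1,2) P1(4)[OF a(3)])
  qed
  then obtain A where A: "!!nu rh al. nu \<in> Cell1 L ==> tgt1 L nu = r ==> rh \<in> Cell1 L ==> src1 L nu = tgt1 L rh ==> al \<in> Cell2 L ==> tgt2 L al = nu \<star>[L] rh ==>
     A nu rh al \<in> hom (P0 C (tgt1 L rh)) (c nu) (FO (P1 C rh) (c (src2 L al)))"
    "!!nu rh al j p. nu \<in> Cell1 L ==> tgt1 L nu = r ==> rh \<in> Cell1 L ==> src1 L nu = tgt1 L rh ==> al \<in> Cell2 L ==> tgt2 L al = nu \<star>[L] rh ==>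
     j \<in> Ob (FDom G) ==> p = tgt1 L rh ==> FA (P1 C rh) (l (src2 L al) j) \<cdot>[P0 C p] A nu rh al = HA (FO G j) (nu, rh, al) \<cdot>[P0 C p] l nu j"
    by metis
  have At: "A nu rh al \<in> Ar (P0 C p)" "Src (P0 C p) (A nu rh al) = c nu" "Tgt (P0 C p) (A nu rh al) = FO (P1 C rh) (c (src2 L al))"
    if "nu \<in> Cell1 L" "tgt1 L nu = r" "rh \<in> Cell1 L" "src1 L nu = tgt1 L rh" "al \<in> Cell2 L" "tgt2 L al = nu \<star>[L] rh" "p = tgt1 L rh" for nu rh al p
    using A(1)[OF that(1-6)] that(7) by simp_all
  define \<Lambda> where "\<Lambda> = \<lparr>HO = restrict c (into L r), HA = (\<lambda>(nu, rh, al) \<in> decomp L r. A nu rh al)\<rparr>"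
  have \<Lambda>O: "HO \<Lambda> mu = c mu" if "mu \<in> Cell1 L" "tgt1 L mu = r" for mu using that by (simp add: \<Lambda>_def into_def)
  have \<Lambda>A: "HA \<Lambda> (nu, rh, al) = A nu rh al" if "nu \<in> Cell1 L" "tgt1 L nu = r" "rh \<in> Cell1 L" "src1 L nu = tgt1 L rh" "al \<in> Cell2 L" "tgt2 L al = nu \<star>[L] rh" for nu rh al
    using that by (simp add: \<Lambda>_def into_def decomp_def)
  have \<Lambda>: "codext_obj L C r \<Lambda>"
  proof (rule codext_objI)
    show "HO \<Lambda> \<in> extensional (into L r)" "HA \<Lambda> \<in> extensional (decomp L r)" by (simp_all add: \<Lambda>_def)
  next
    fix mu assume mu: "mu \<in> Cell1 L" "tgt1 L mu = r"
    have "A mu (id1 L (src1 L mu)) (id2 L mu) = NC (PU C (src1 L mu)) (c mu)"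
      by (rule jm[of "id1 L (src1 L mu)" mu _ "c mu"]) 
        (use mu A(2)[of mu "id1 L (src1 L mu)" "id2 L mu"] Gj in "simp_all add: c l At HA_id PU_L")
    then show "HA \<Lambda> (mu, id1 L (src1 L mu), id2 L mu) = NC (PU C (src1 L mu)) (HO \<Lambda> mu)" using mu by (simp add: \<Lambda>O \<Lambda>A)
  next
    fix rh al \<pi> si be assume a: "rh \<in> Cell1 L" "\<pi> \<in> Cell1 L" "tgt1 L \<pi> = r" "si \<in> Cell1 L" "src1 L \<pi> = tgt1 L si"
      "src1 L si = tgt1 L rh" "be \<in> Cell2 L" "tgt2 L be = \<pi> \<star>[L] si" "al \<in> Cell2 L" "tgt2 L al = src2 L be \<star>[L] rh"
    note A2 = A(2)[of "src2 L be" rh al] A(2)[of \<pi> si be] A(2)[of \<pi> "si \<star>[L] rh" "(be \<triangleright>[L] rh) \<bullet>[L] al"]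
    have "NC (PC C si rh) (c (src2 L al)) \<cdot>[P0 C (tgt1 L si)] FA (P1 C si) (A (src2 L be) rh al) \<cdot>[P0 C (tgt1 L si)] A \<pi> si be =
      A \<pi> (si \<star>[L] rh) ((be \<triangleright>[L] rh) \<bullet>[L] al)"
      by (rule jm[of "si \<star>[L] rh" "src2 L al" _ "c \<pi>"])
        (use a Gj A2(3) in "simp_all add: c l At PC_L[THEN cmpE] A2(1)[THEN FA_eq, THEN cmpE] A2(2) HA_cmp[THEN cmpE3]")
    then show "NC (PC C si rh) (HO \<Lambda> (src2 L al)) \<cdot>[P0 C (tgt1 L si)] FA (P1 C si) (HA \<Lambda> (src2 L be, rh, al)) \<cdot>[P0 C (tgt1 L si)] HA \<Lambda> (\<pi>, si, be) =
      HA \<Lambda> (\<pi>, si \<star>[L] rh, (be \<triangleright>[L] rh) \<bullet>[L] al)" using a by (simp add: \<Lambda>O \<Lambda>A)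
  next
    fix nu al be assume a: "nu \<in> Cell1 L" "tgt1 L nu = r" "src1 L nu = tgt1 L (tgt2 L be)" "al \<in> Cell2 L"
      "be \<in> Cell2 L" "tgt2 L al = nu \<star>[L] src2 L be"
    note A2 = A(2)[of nu "src2 L be" al] A(2)[of nu "tgt2 L be" "(nu \<triangleleft>[L] be) \<bullet>[L] al"]
    have "NC (P2 C be) (c (src2 L al)) \<cdot>[P0 C (tgt1 L (tgt2 L be))] A nu (src2 L be) al = A nu (tgt2 L be) ((nu \<triangleleft>[L] be) \<bullet>[L] al)"
      by (rule jm[of "tgt2 L be" "src2 L al" _ "c nu"])
        (use a Gj A2(2) in "simp_all add: c l At P2_L[THEN cmpE] A2(1) HA_2cell[THEN cmpE]")
    then show "NC (P2 C be) (HO \<Lambda> (src2 L al)) \<cdot>[P0 C (tgt1 L (tgt2 L be))] HA \<Lambda> (nu, src2 L be, al) = HA \<Lambda> (nu, tgt2 L be, (nu \<triangleleft>[L] be) \<bullet>[L] al)"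
      using a by (simp add: \<Lambda>O \<Lambda>A)
  qed (simp_all add: \<Lambda>O \<Lambda>A c At)
  define lam where "lam j = \<lparr>HDom = \<Lambda>, HCod = FO G j, HM = (\<lambda>mu \<in> into L r. l mu j)\<rparr>" for j
  have lamM: "HM (lam j) mu = l mu j" if "mu \<in> Cell1 L" "tgt1 L mu = r" for mu j using that by (simp add: lam_def into_def)
  have lamD: "HDom (lam j) = \<Lambda>" "HCod (lam j) = FO G j" for j by (simp_all add: lam_def)
  have lam: "codext_mor L C r (lam j)" if j: "j \<in> Ob (FDom G)" for j
  proof (rule codext_morI)
    show "HM (lam j) \<in> extensional (into L r)" by (simp add: lam_def)
  qed (use j Gj \<Lambda> A(2) in "simp_all add: lamM lamD \<Lambda>O \<Lambda>A l")
  have "cone G \<Lambda> lam"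
    unfolding cone_iff
  proof (intro conjI ballI)
    fix u assume u: "u \<in> Ar (FDom G)"
    show "FA G u \<cdot>[FCod G] lam (Src (FDom G) u) = lam (Tgt (FDom G) u)"
      by (rule hmor_eqI[of r]) (use u G Gu[OF u] functorD(1)[OF G'] in "simp_all add: lam E_cmp lamD lamM l_nat")
  qed (use G \<Lambda> lam lamD in simp_all)
  moreover have "limit_cone (ev r mu \<odot> G) (HO \<Lambda> mu) (\<lambda>j. HM (lam j) mu)" if "mu \<in> Cell1 L" "tgt1 L mu = r" for mu
    using lim[OF that] that by (simp add: \<Lambda>O lamM)
  ultimately show ?thesis by blast
qed

lemma E_limits [simp]: "has_small_limits kp (E r)"
  unfolding has_small_limits_def using E_limit_exists E_limitI by (metis E_category)

lemma ev_lex [simp]: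
  assumes "mu \<in> Cell1 L" "tgt1 L mu = r" shows "lex_ftr kp (ev r mu)"
proof -
  have "preserves_small_limits kp (ev r mu)"
  proof (rule preserves_small_limitsI)
    fix G :: "('k, 'k, ('f, 'a, 'o, 'm) hobj, ('f, 'a, 'o, 'm) hmor) ftr"
    assume G: "small_diagram kp G" "FCod G = FDom (ev r mu)"
    then have G': "FCod G = E r" "is_functor G" by (simp_all add: small_diagram_def)
    from E_limit_exists[OF G(1) G'(1)] obtain Ga l where c: "cone G Ga l"
      and l: "!!mu. mu \<in> Cell1 L ==> tgt1 L mu = r ==> limit_cone (ev r mu \<odot> G) (HO Ga mu) (\<lambda>j. HM (l j) mu)" by blast
    have lim: "limit_cone G Ga l" by (rule E_limitI[OF G(1) G'(1) c l])
    have "limit_cone (ev r mu \<odot> G) (FO (ev r mu) Ga) (\<lambda>j. FA (ev r mu) (l j))"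
      using limit_cone_cong[OF l[OF assms], of "\<lambda>j. FA (ev r mu) (l j)"] c G' assms by (simp add: cone_iff)
    with lim show "\<exists>c l. limit_cone G c l \<and> limit_cone (ev r mu \<odot> G) (FO (ev r mu) c) (\<lambda>j. FA (ev r mu) (l j))" by blast
  qed (use assms in simp)
  then show ?thesis using assms by (simp add: lex_ftr_def)
qed

text \<open>By \<open>E_limitI\<close> a cone is a limit as soon as its evaluations are, so lexness
  can be tested pointwise. Restriction functors and extensions are lex for this reason.\<close>

lemma lex_into_E:
  assumes F: "is_functor F" "FCod F = E r" "has_small_limits kp (FDom F)"
    and l: "!!mu. mu \<in> Cell1 L ==> tgt1 L mu = r ==> lex_ftr kp (ev r mu \<odot> F)"
  shows "lex_ftr kp F"
proof -
  have "preserves_small_limits kp F"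
    unfolding preserves_small_limits_def
  proof (intro allI impI)
    fix G :: "('k, 'k, 'b, 'c) ftr" and c k
    assume G: "small_diagram kp G" "FCod G = FDom F" and lim: "limit_cone G c k"
    have G': "is_functor G" using G by (simp add: small_diagram_def)
    note k = limit_coneD[OF lim]
    show "limit_cone (F \<odot> G) (FO F c) (\<lambda>j. FA F (k j))"
    proof (rule E_limitI)
      show "cone (F \<odot> G) (FO F c) (\<lambda>j. FA F (k j))" using cone_image[OF k(1) G' F(1) G(2)] .
      fix mu assume mu: "mu \<in> Cell1 L" "tgt1 L mu = r"
      have "limit_cone ((ev r mu \<odot> F) \<odot> G) (FO (ev r mu \<odot> F) c) (\<lambda>j. FA (ev r mu \<odot> F) (k j))"
        using lex_ftrD(4)[OF l[OF mu]] G lim unfolding preserves_small_limits_def by simp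
      moreover have Fc: "codext_obj L C r (FO F c)" using functor_simps(1)[OF F(1,2)] k G by simp
      moreover have "codext_mor L C r (FA F (k j))" if "j \<in> Ob (FDom G)" for j
        using functor_simps(2)[OF F(1,2)] k(3)[OF that] G by simp
      ultimately show "limit_cone (ev r mu \<odot> F \<odot> G) (HO (FO F c) mu) (\<lambda>j. HM (FA F (k j)) mu)"
        using limit_cone_cong[of "ev r mu \<odot> F \<odot> G" "HO (FO F c) mu" "\<lambda>j. FA (ev r mu \<odot> F) (k j)" "\<lambda>j. HM (FA F (k j)) mu"] mu F G G' k by simp
    qed (use G F in "simp_all add: comp_small_diagram")
  qed
  then show ?thesis using F by (simp add: lex_ftr_def)
qed

text \<open>A 2-cell \<open>\<alpha> : \<mu> \<Rightarrow> \<nu>\<close> acts on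
  \<open>\<Gamma>\<close> by an arrow from the value at \<open>\<nu>\<close> to the value at
  \<open>\<mu>\<close>: the structure morphism for \<open>\<nu> 1\<close>, corrected by the inverse
  of \<open>PU\<close>. These arrows, taken at whiskered 2-cells, are the components of
  \<open>codext_ntr\<close>.\<close>

definition "tr Ga al = NC (inv_ntr (PU C (src1 L (tgt2 L al)))) (HO Ga (src2 L al)) \<cdot>[P0 C (src1 L (tgt2 L al))]
    HA Ga (tgt2 L al, id1 L (src1 L (tgt2 L al)), al)"

lemma tr [simp]:
  assumes "codext_obj L C (tgt1 L (tgt2 L al)) Ga" "al \<in> Cell2 L" "p = src1 L (tgt2 L al)"
  shows "tr Ga al \<in> Ar (P0 C p)" "Src (P0 C p) (tr Ga al) = HO Ga (tgt2 L al)" "Tgt (P0 C p) (tr Ga al) = HO Ga (src2 L al)"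
  using assms by (simp_all add: tr_def)

lemma PUi_R:
  assumes "p \<in> Cell0 L" "u \<in> Ar (P0 C p)" "Tgt (P0 C p) u = b"
  shows "NC (inv_ntr (PU C p)) b \<cdot>[P0 C p] FA (P1 C (id1 L p)) u = u \<cdot>[P0 C p] NC (inv_ntr (PU C p)) (Src (P0 C p) u)"
  using PUi_L[of p u] assms by simp

text \<open>With \<open>HA_tr\<close>: structure morphisms absorb the action of 2-cells on either
  side. Both are the composition axiom with an identity 1-cell as one factor, after cancelling
  \<open>PU\<close>.\<close>

lemma tr_HA:
  assumes "codext_obj L C (tgt1 L nu) Ga" "nu \<in> Cell1 L" "rh \<in> Cell1 L" "src1 L nu = tgt1 L rh" "al \<in> Cell2 L" "tgt2 L al = nu \<star>[L] rh"
    "ga \<in> Cell2 L" "tgt2 L ga = src2 L al" "p = src1 L nu"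
  shows "FA (P1 C rh) (tr Ga ga) \<cdot>[P0 C p] HA Ga (nu, rh, al) = HA Ga (nu, rh, al \<bullet>[L] ga)"
  using assms HA_cmp[of nu Ga "id1 L (src1 L rh)" "src2 L al" ga rh al p "src2 L ga"]
  by (simp add: tr_def PC_id)

lemma HA_tr:
  assumes "codext_obj L C (tgt1 L nu) Ga" "nu \<in> Cell1 L" "rh \<in> Cell1 L" "src1 L nu = tgt1 L rh" "al \<in> Cell2 L" "tgt2 L al = nu \<star>[L] rh"
    "be \<in> Cell2 L" "src2 L be = nu" "p = src1 L nu"
  shows "HA Ga (nu, rh, al) \<cdot>[P0 C p] tr Ga be = HA Ga (tgt2 L be, rh, (be \<triangleright>[L] rh) \<bullet>[L] al)"
proof -
  have t: "src1 L (tgt2 L be) = tgt1 L rh" "tgt1 L (tgt2 L be) = tgt1 L nu" "p = tgt1 L rh"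
    using cell21[OF assms(7)] assms(4,8,9) by simp_all
  have "NC (PC C (id1 L p) rh) (HO Ga (src2 L al)) \<cdot>[P0 C p] FA (P1 C (id1 L p)) (HA Ga (nu, rh, al)) \<cdot>[P0 C p] HA Ga (tgt2 L be, id1 L p, be) =
    HA Ga (tgt2 L be, id1 L p \<star>[L] rh, (be \<triangleright>[L] rh) \<bullet>[L] al)"
    by (rule HA_cmp) (use assms(1-8) t in simp_all)
  then show ?thesis using assms(1-8) t by (simp add: tr_def PC_id PUi_L[THEN cmpE])
qed

lemma tr_id:
  assumes "codext_obj L C (tgt1 L mu) Ga" "mu \<in> Cell1 L"
  shows "tr Ga (id2 L mu) = Idn (P0 C (src1 L mu)) (HO Ga mu)"
  using assms by (simp add: tr_def HA_id PU_inv)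

lemma tr_vcmp:
  assumes "codext_obj L C (tgt1 L (tgt2 L be)) Ga" "al \<in> Cell2 L" "be \<in> Cell2 L" "src2 L be = tgt2 L al" "p = src1 L (tgt2 L be)"
  shows "tr Ga al \<cdot>[P0 C p] tr Ga be = tr Ga (be \<bullet>[L] al)"
proof -
  have [simp]: "src1 L (tgt2 L be) = src1 L (tgt2 L al)" "tgt1 L (tgt2 L be) = tgt1 L (tgt2 L al)" using cell21[OF assms(3)] assms(4) by simp_all
  have 1: "HA Ga (tgt2 L al, id1 L (src1 L (tgt2 L al)), al) \<cdot>[P0 C p] tr Ga be = HA Ga (tgt2 L be, id1 L (src1 L (tgt2 L al)), be \<bullet>[L] al)"
    using assms HA_tr[of "tgt2 L al" Ga "id1 L (src1 L (tgt2 L al))" al be p] by simp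
  have "tr Ga al \<cdot>[P0 C p] tr Ga be = NC (inv_ntr (PU C (src1 L (tgt2 L al)))) (HO Ga (src2 L al)) \<cdot>[P0 C p]
    (HA Ga (tgt2 L al, id1 L (src1 L (tgt2 L al)), al) \<cdot>[P0 C p] tr Ga be)"
    using assms by (subst (1) tr_def) simp
  then show ?thesis unfolding 1 using assms by (simp add: tr_def)
qed

lemma HM_tr:
  assumes "codext_mor L C (tgt1 L (tgt2 L al)) th" "al \<in> Cell2 L" "p = src1 L (tgt2 L al)" "HDom th = Ga" "mu = src2 L al"
  shows "HM th mu \<cdot>[P0 C p] tr Ga al = tr (HCod th) al \<cdot>[P0 C p] HM th (tgt2 L al)"
  using assms codext_mor[OF assms(1)] by (simp add: tr_def PUi_L[THEN cmpE] HM_HA)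

end

section \<open>Restriction functors and the pseudofunctor \<open>codext\<close>\<close>

context cod begin

lemma restr [simp]:
  "nu \<in> Cell1 L ==> tgt1 L nu = src1 L mu ==> HO (restr_obj L mu Ga) nu = HO Ga (mu \<star>[L] nu)"
  "nu \<in> Cell1 L ==> tgt1 L nu = src1 L mu ==> rh \<in> Cell1 L ==> tgt1 L rh = src1 L nu ==> al \<in> Cell2 L ==> tgt2 L al = nu \<star>[L] rh ==>
    HA (restr_obj L mu Ga) (nu, rh, al) = HA Ga (mu \<star>[L] nu, rh, mu \<triangleleft>[L] al)"
  by (simp_all add: restr_obj_def into_def decomp_def)

lemma restr_codext_obj [simp]:
  assumes "mu \<in> Cell1 L" "codext_obj L C (tgt1 L mu) Ga" "p = src1 L mu"
  shows "codext_obj L C p (restr_obj L mu Ga)"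
proof (rule codext_objI)
  show "HO (restr_obj L mu Ga) \<in> extensional (into L p)" "HA (restr_obj L mu Ga) \<in> extensional (decomp L p)"
    using assms by (simp_all add: restr_obj_def)
qed (use assms in "simp_all add: HA_id HA_cmp HA_2cell")

lemma codext_ftr_simps [simp]:
  "FDom (codext_ftr L C mu) = E (tgt1 L mu)" "FCod (codext_ftr L C mu) = E (src1 L mu)"
  "codext_obj L C (tgt1 L mu) Ga ==> FO (codext_ftr L C mu) Ga = restr_obj L mu Ga"
  "codext_mor L C (tgt1 L mu) th ==> HDom (FA (codext_ftr L C mu) th) = restr_obj L mu (HDom th)"
  "codext_mor L C (tgt1 L mu) th ==> HCod (FA (codext_ftr L C mu) th) = restr_obj L mu (HCod th)"
  "codext_mor L C (tgt1 L mu) th ==> nu \<in> Cell1 L ==> tgt1 L nu = src1 L mu ==> HM (FA (codext_ftr L C mu) th) nu = HM th (mu \<star>[L] nu)"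
  by (simp_all add: codext_ftr_def Let_def into_def)

lemma codext_ftr_mor [simp]:
  assumes "mu \<in> Cell1 L" "codext_mor L C (tgt1 L mu) th" "p = src1 L mu"
  shows "codext_mor L C p (FA (codext_ftr L C mu) th)"
proof (rule codext_morI)
  show "HM (FA (codext_ftr L C mu) th) \<in> extensional (into L p)"
    using assms by (simp add: codext_ftr_def Let_def)
qed (use assms codext_mor[OF assms(2)] in "simp_all add: HM_HA")

lemma codext_ftr_functor [simp]:
  assumes "mu \<in> Cell1 L" shows "is_functor (codext_ftr L C mu)"
proof (rule functorI)
  show "FO (codext_ftr L C mu) \<in> extensional (Ob (FDom (codext_ftr L C mu)))"
    "FA (codext_ftr L C mu) \<in> extensional (Ar (FDom (codext_ftr L C mu)))" by (simp_all add: codext_ftr_def Let_def)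
next
  fix Ga assume "Ga \<in> Ob (FDom (codext_ftr L C mu))"
  then show "FA (codext_ftr L C mu) (Idn (FDom (codext_ftr L C mu)) Ga) = Idn (FCod (codext_ftr L C mu)) (FO (codext_ftr L C mu) Ga)"
    by - (rule hmor_eqI[of "src1 L mu"]; use assms in "simp add: E_id")
next
  fix u v assume "u \<in> Ar (FDom (codext_ftr L C mu))" "v \<in> Ar (FDom (codext_ftr L C mu))" "Src (FDom (codext_ftr L C mu)) v = Tgt (FDom (codext_ftr L C mu)) u"
  then show "FA (codext_ftr L C mu) (v \<cdot>[FDom (codext_ftr L C mu)] u) = FA (codext_ftr L C mu) v \<cdot>[FCod (codext_ftr L C mu)] FA (codext_ftr L C mu) u"
    by - (rule hmor_eqI[of "src1 L mu"]; use assms in "simp add: E_cmp")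
qed (use assms codext_mor in simp_all)

text \<open>Restriction along \<open>mu\<close> followed by evaluation at \<open>nu\<close> is
  evaluation at the composite, which is lex.\<close>

lemma codext_ftr_lex [simp]:
  assumes "mu \<in> Cell1 L" shows "lex_ftr kp (codext_ftr L C mu)"
proof (rule lex_into_E)
  fix nu assume nu: "nu \<in> Cell1 L" "tgt1 L nu = src1 L mu"
  have "ev (src1 L mu) nu \<odot> codext_ftr L C mu = ev (tgt1 L mu) (mu \<star>[L] nu)"
    by (rule ftr_eqI) (use assms nu in simp_all)
  then show "lex_ftr kp (ev (src1 L mu) nu \<odot> codext_ftr L C mu)" using assms nu by simp
qed (use assms in simp_all)

text \<open>Composition in \<open>L\<close> is strictly associative, so restriction is strictly
  functorial; this is what permits identity coherence cells in \<open>codext\<close>.\<close>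

lemma restr_restr:
  assumes "mu \<in> Cell1 L" "nu \<in> Cell1 L" "tgt1 L nu = src1 L mu" "codext_obj L C (tgt1 L mu) Ga"
  shows "restr_obj L nu (restr_obj L mu Ga) = restr_obj L (mu \<star>[L] nu) Ga"
  by (rule hobj_eqI[of "src1 L nu"]) (use assms in simp_all)

lemma codext_ftr_comp:
  assumes "mu \<in> Cell1 L" "nu \<in> Cell1 L" "tgt1 L nu = src1 L mu"
  shows "codext_ftr L C nu \<odot> codext_ftr L C mu = codext_ftr L C (mu \<star>[L] nu)"
proof (rule ftr_eqI)
  fix th assume "th \<in> Ar (FDom (codext_ftr L C nu \<odot> codext_ftr L C mu))"
  then have g: "codext_mor L C (tgt1 L mu) th" by simp
  show "FA (codext_ftr L C nu \<odot> codext_ftr L C mu) th = FA (codext_ftr L C (mu \<star>[L] nu)) th"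
    by (rule hmor_eqI[of "src1 L nu"]) (use assms g codext_mor[OF g] in "simp_all add: restr_restr")
qed (use assms in "simp_all add: restr_restr")

lemma restr_id: "codext_obj L C p Ga ==> p \<in> Cell0 L ==> restr_obj L (id1 L p) Ga = Ga"
  by (rule hobj_eqI[of p]) simp_all

lemma codext_ftr_id:
  assumes "p \<in> Cell0 L" shows "codext_ftr L C (id1 L p) = id_ftr (E p)"
proof (rule ftr_eqI)
  fix th assume "th \<in> Ar (FDom (codext_ftr L C (id1 L p)))"
  then have g: "codext_mor L C p th" using assms by simp
  show "FA (codext_ftr L C (id1 L p)) th = FA (id_ftr (E p)) th"
    by (rule hmor_eqI[of p]) (use assms g codext_mor[OF g] in "simp_all add: restr_id")
qed (use assms in "simp_all add: restr_id")

lemma codext_ntr_simps [simp]: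
  "NDom (codext_ntr L C be) = codext_ftr L C (tgt2 L be)" "NCod (codext_ntr L C be) = codext_ftr L C (src2 L be)"
  "be \<in> Cell2 L ==> codext_obj L C (tgt1 L (tgt2 L be)) Ga ==> HDom (NC (codext_ntr L C be) Ga) = restr_obj L (tgt2 L be) Ga"
  "be \<in> Cell2 L ==> codext_obj L C (tgt1 L (tgt2 L be)) Ga ==> HCod (NC (codext_ntr L C be) Ga) = restr_obj L (src2 L be) Ga"
  "be \<in> Cell2 L ==> codext_obj L C (tgt1 L (tgt2 L be)) Ga ==> rh \<in> Cell1 L ==> tgt1 L rh = src1 L (tgt2 L be) ==>
    HM (NC (codext_ntr L C be) Ga) rh = tr Ga (be \<triangleright>[L] rh)"
  by (simp_all add: codext_ntr_def Let_def into_def tr_def)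

lemma codext_ntr_mor [simp]:
  assumes b: "be \<in> Cell2 L" and G: "codext_obj L C (tgt1 L (tgt2 L be)) Ga" and p: "p = src1 L (tgt2 L be)"
  shows "codext_mor L C p (NC (codext_ntr L C be) Ga)"
proof (rule codext_morI)
  show "HM (NC (codext_ntr L C be) Ga) \<in> extensional (into L p)"
    using assms by (simp add: codext_ntr_def Let_def)
next
  fix nu rh al assume a: "nu \<in> Cell1 L" "tgt1 L nu = p" "rh \<in> Cell1 L" "src1 L nu = tgt1 L rh" "al \<in> Cell2 L" "tgt2 L al = nu \<star>[L] rh"
  \<comment> \<open>The interchange law identifies the two 2-cells to which \<open>tr_HA\<close> and
    \<open>HA_tr\<close> reduce the two sides.\<close>
  have ic: "((be \<triangleright>[L] nu) \<triangleright>[L] rh) \<bullet>[L] (src2 L be \<triangleleft>[L] al) = (tgt2 L be \<triangleleft>[L] al) \<bullet>[L] (be \<triangleright>[L] src2 L al)"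
    using wh_interchange[of al be] a b p by simp
  show "FA (P1 C rh) (HM (NC (codext_ntr L C be) Ga) (src2 L al)) \<cdot>[P0 C (tgt1 L rh)] HA (HDom (NC (codext_ntr L C be) Ga)) (nu, rh, al) =
     HA (HCod (NC (codext_ntr L C be) Ga)) (nu, rh, al) \<cdot>[P0 C (tgt1 L rh)] HM (NC (codext_ntr L C be) Ga) nu"
    using a b G p by (simp add: tr_HA HA_tr ic)
qed (use assms in simp_all)

lemma codext_ntr_nattrans [simp]:
  assumes "be \<in> Cell2 L" shows "nattrans (codext_ntr L C be)"
proof (rule nattransI)
  show "NC (codext_ntr L C be) \<in> extensional (Ob (FDom (NDom (codext_ntr L C be))))"
    using assms by (simp add: codext_ntr_def Let_def)
next
  fix u assume "u \<in> Ar (FDom (NDom (codext_ntr L C be)))"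
  then have u: "codext_mor L C (tgt1 L (tgt2 L be)) u" by simp
  note u' = codext_mor[OF u]
  have "FA (codext_ftr L C (src2 L be)) u \<cdot>[E (src1 L (tgt2 L be))] NC (codext_ntr L C be) (HDom u) =
    NC (codext_ntr L C be) (HCod u) \<cdot>[E (src1 L (tgt2 L be))] FA (codext_ftr L C (tgt2 L be)) u"
    by (rule hmor_eqI[of "src1 L (tgt2 L be)"]) (use assms u u' in "simp_all add: E_cmp HM_tr")
  then show "FA (NCod (codext_ntr L C be)) u \<cdot>[FCod (NDom (codext_ntr L C be))] NC (codext_ntr L C be) (Src (FDom (NDom (codext_ntr L C be))) u) =
      NC (codext_ntr L C be) (Tgt (FDom (NDom (codext_ntr L C be))) u) \<cdot>[FCod (NDom (codext_ntr L C be))] FA (NDom (codext_ntr L C be)) u" by simp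
qed (use assms in simp_all)

lemma codext_simps:
  "P0 (codext kp L C) = codext_cat L C" "P1 (codext kp L C) = codext_ftr L C" "P2 (codext kp L C) = codext_ntr L C"
  "PC (codext kp L C) g f = id_ntr (codext_ftr L C (f \<star>[L] g))" "PU (codext kp L C) p = id_ntr (codext_ftr L C (id1 L p))"
  by (simp_all add: codext_def strict_pfun_def)

lemma iso_id_ntr: "is_functor F ==> iso_ntr (id_ntr F)"
  using functorD[of F] by (intro iso_ntrI) (auto simp: isom_Idn)

lemma codext_pseudofunctor: "pseudofunctor (coop L) (Lex kp) (codext kp L C)"
proof (rule pseudofunctorI, unfold codext_simps)
  fix f Ga assume a: "f \<in> Cell1 (coop L)" "Ga \<in> Ob (E (src1 (coop L) f))"
  have "NC (codext_ntr L C (id2 L f)) Ga = Idn (E (src1 L f)) (restr_obj L f Ga)"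
    by (rule hmor_eqI[of "src1 L f"]) (use a in "simp_all add: E_id tr_id")
  then show "NC (codext_ntr L C (id2 (coop L) f)) Ga = Idn (E (tgt1 (coop L) f)) (FO (codext_ftr L C f) Ga)" using a by simp
next
  fix al be Ga assume a: "al \<in> Cell2 (coop L)" "be \<in> Cell2 (coop L)" "src2 (coop L) be = tgt2 (coop L) al" "Ga \<in> Ob (E (src1 (coop L) (src2 (coop L) al)))"
  have t: "src1 L (tgt2 L be) = src1 L (tgt2 L al)" "tgt1 L (tgt2 L be) = tgt1 L (tgt2 L al)" using cell21[of al] a(1,3) by simp_all
  have "NC (codext_ntr L C (al \<bullet>[L] be)) Ga = NC (codext_ntr L C be) Ga \<cdot>[E (src1 L (tgt2 L al))] NC (codext_ntr L C al) Ga"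
    by (rule hmor_eqI[of "src1 L (tgt2 L al)"]) (use a t in "simp_all add: E_cmp tr_vcmp")
  then show "NC (codext_ntr L C (be \<bullet>[coop L] al)) Ga = NC (codext_ntr L C be) Ga \<cdot>[E (tgt1 (coop L) (src2 (coop L) al))] NC (codext_ntr L C al) Ga"
    using a by simp
next
  fix f be Ga assume a: "f \<in> Cell1 (coop L)" "be \<in> Cell2 (coop L)" "src1 (coop L) (src2 (coop L) be) = tgt1 (coop L) f" "Ga \<in> Ob (E (src1 (coop L) f))"
  have "NC (codext_ntr L C (f \<triangleleft>[L] be)) Ga = NC (codext_ntr L C be) (restr_obj L f Ga)"
    by (rule hmor_eqI[of "src1 L (tgt2 L be)"]) 
      (use a in "simp_all add: tr_def restr_restr")
  then show "NC (codext_ntr L C (be \<triangleright>[coop L] f)) Ga \<cdot>[E (tgt1 (coop L) (src2 (coop L) be))] NC (id_ntr (codext_ftr L C (f \<star>[L] src2 (coop L) be))) Ga =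
     NC (id_ntr (codext_ftr L C (f \<star>[L] tgt2 (coop L) be))) Ga \<cdot>[E (tgt1 (coop L) (src2 (coop L) be))] NC (codext_ntr L C be) (FO (codext_ftr L C f) Ga)"
    using a by (simp add: restr_restr)
next
  fix g al Ga assume a: "g \<in> Cell1 (coop L)" "al \<in> Cell2 (coop L)" "src1 (coop L) g = tgt1 (coop L) (src2 (coop L) al)" "Ga \<in> Ob (E (src1 (coop L) (src2 (coop L) al)))"
  have "NC (codext_ntr L C (al \<triangleright>[L] g)) Ga = FA (codext_ftr L C g) (NC (codext_ntr L C al) Ga)"
    by (rule hmor_eqI[of "src1 L g"])
      (use a in "simp_all add: restr_restr")
  then show "NC (codext_ntr L C (g \<triangleleft>[coop L] al)) Ga \<cdot>[E (tgt1 (coop L) g)] NC (id_ntr (codext_ftr L C (src2 (coop L) al \<star>[L] g))) Ga =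
     NC (id_ntr (codext_ftr L C (tgt2 (coop L) al \<star>[L] g))) Ga \<cdot>[E (tgt1 (coop L) g)] FA (codext_ftr L C g) (NC (codext_ntr L C al) Ga)"
    using a by (simp add: restr_restr)
qed (use two two_category_coop[OF two] in "simp_all add: codext_ftr_comp iso_id_ntr codext_ftr_id E_id restr_id restr_restr")

end

section \<open>Right adjoints to restriction\<close>

context cod begin

text \<open>The structure morphisms of the right adjoint are described through inverses of
  \<open>PC\<close>, so the axioms of \<open>C\<close> are needed, here and in the following lemmas,
  in inverted form.\<close>

lemma PCi_lwh:
  assumes "g \<in> Cell1 L" "al \<in> Cell2 L" "src1 L g = tgt1 L (tgt2 L al)" "x \<in> Ob (P0 C (src1 L (tgt2 L al)))" "q = tgt1 L g" "f = src2 L al"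
  shows "FA (P1 C g) (NC (P2 C al) x) \<cdot>[P0 C q] NC (inv_ntr (PC C g f)) x =
    NC (inv_ntr (PC C g (tgt2 L al))) x \<cdot>[P0 C q] NC (P2 C (g \<triangleleft>[L] al)) x"
  by (rule inv_square[of _ "NC (PC C g (tgt2 L al)) x" _ _ "NC (PC C g (src2 L al)) x"])
    (use assms P2_lwh[of g al x] in "simp_all add: PC_inv")

lemma PCi_rwh:
  assumes "f \<in> Cell1 L" "be \<in> Cell2 L" "src1 L (tgt2 L be) = tgt1 L f" "x \<in> Ob (P0 C (src1 L f))" "q = tgt1 L (tgt2 L be)" "g = src2 L be" "y = FO (P1 C f) x"
  shows "NC (P2 C be) y \<cdot>[P0 C q] NC (inv_ntr (PC C g f)) x = NC (inv_ntr (PC C (tgt2 L be) f)) x \<cdot>[P0 C q] NC (P2 C (be \<triangleright>[L] f)) x"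
  by (rule inv_square[of _ "NC (PC C (tgt2 L be) f) x" _ _ "NC (PC C (src2 L be) f) x"])
    (use assms P2_rwh[of f be x] in "simp_all add: PC_inv")

lemma PCi_assoc:
  assumes "f \<in> Cell1 L" "g \<in> Cell1 L" "h \<in> Cell1 L" "src1 L g = tgt1 L f" "src1 L h = tgt1 L g" "x \<in> Ob (P0 C (src1 L f))" "q = tgt1 L h" "y = FO (P1 C f) x"
  shows "FA (P1 C h) (NC (PC C g f) x) \<cdot>[P0 C q] NC (inv_ntr (PC C h g)) y =
      NC (inv_ntr (PC C h (g \<star>[L] f))) x \<cdot>[P0 C q] NC (PC C (h \<star>[L] g) f) x"
  by (rule inv_square[of _ "NC (PC C h (g \<star>[L] f)) x" _ _ "NC (PC C h g) (FO (P1 C f) x)"])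
    (use assms PC_assoc[of f g h x] in "simp_all add: PC_inv")

lemma PCi_assoc':
  assumes "f \<in> Cell1 L" "g \<in> Cell1 L" "h \<in> Cell1 L" "src1 L g = tgt1 L f" "src1 L h = tgt1 L g" "x \<in> Ob (P0 C (src1 L f))" "q = tgt1 L h" "y = FO (P1 C f) x"
    "k = g \<star>[L] f"
  shows "NC (PC C h g) y \<cdot>[P0 C q] FA (P1 C h) (NC (inv_ntr (PC C g f)) x) \<cdot>[P0 C q] NC (inv_ntr (PC C h k)) x =
      NC (inv_ntr (PC C (h \<star>[L] g) f)) x"
proof -
  have i: "isom (P0 C q) (NC (PC C (h \<star>[L] g) f) x)" by (rule iso_ntr_isom[OF PC(1)]) (use assms in simp_all)
  have e: "NC (inv_ntr (PC C h (g \<star>[L] f))) x \<cdot>[P0 C q] NC (PC C (h \<star>[L] g) f) x =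
    FA (P1 C h) (NC (PC C g f) x) \<cdot>[P0 C q] NC (inv_ntr (PC C h g)) (FO (P1 C f) x)"
    by (rule PCi_assoc[symmetric]) (use assms in simp_all)
  have e': "FA (P1 C h) (NC (inv_ntr (PC C g f)) x) \<cdot>[P0 C q] FA (P1 C h) (NC (PC C g f) x) = Idn (P0 C q) (FO (P1 C h) (FO (P1 C g) (FO (P1 C f) x)))"
  proof -
    have "NC (inv_ntr (PC C g f)) x \<cdot>[P0 C (tgt1 L g)] NC (PC C g f) x = Idn (P0 C (tgt1 L g)) (FO (P1 C g) (FO (P1 C f) x))"
      by (rule PC_inv(2)) (use assms in simp_all)
    from FA_eq[OF this, of "P1 C h"] show ?thesis using assms(1-7) by simp
  qed
  show ?thesis
    by (rule isom_cancel[OF _ i]) (use assms in "simp_all add: PC_inv e[unfolded assms(7)] e'[unfolded assms(7), THEN cmpE]")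
qed

lemma PCi_id:
  assumes "f \<in> Cell1 L" "x \<in> Ob (P0 C (src1 L f))" "q = tgt1 L f"
  shows "p = src1 L f ==> FA (P1 C f) (NC (inv_ntr (PU C p)) x) \<cdot>[P0 C q] NC (inv_ntr (PC C f (id1 L p))) x = Idn (P0 C q) (FO (P1 C f) x)"
    "NC (inv_ntr (PC C (id1 L q) f)) x = NC (PU C q) (FO (P1 C f) x)"
proof -
  show "p = src1 L f ==> FA (P1 C f) (NC (inv_ntr (PU C p)) x) \<cdot>[P0 C q] NC (inv_ntr (PC C f (id1 L p))) x = Idn (P0 C q) (FO (P1 C f) x)"
  proof -
    assume p: "p = src1 L f"
    have "NC (PC C f (id1 L p)) x \<cdot>[P0 C q] NC (inv_ntr (PC C f (id1 L p))) x = Idn (P0 C q) (FO (P1 C (f \<star>[L] id1 L p)) x)"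
      by (rule PC_inv(1)) (use assms p in simp_all)
    then show ?thesis using assms p by (simp add: PC_id)
  qed
  have i: "isom (P0 C q) (NC (PC C (id1 L q) f) x)" by (rule iso_ntr_isom[OF PC(1)]) (use assms in simp_all)
  show "NC (inv_ntr (PC C (id1 L q) f)) x = NC (PU C q) (FO (P1 C f) x)"
    by (rule isom_cancel_left[OF _ i]) (use assms in "simp_all add: PC_inv PC_unit(2)")
qed

text \<open>The value at \<open>\<nu>\<close> of the right adjoint to restriction along \<open>\<mu>\<close> is the limit of the objects
  \<open>C\<^sub>\<rho> (\<Gamma>\<^sup>\<sigma>)\<close> indexed by the 2-cells \<open>\<alpha> : \<mu> \<sigma> \<Rightarrow> \<nu> \<rho>\<close>, with an arrow for every 2-cell out of \<open>\<rho>\<close>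
  and for every structure morphism of \<open>\<Gamma>\<close>.\<close>

definition "kV mu nu = {(rh, si, al). rh \<in> Cell1 L \<and> si \<in> Cell1 L \<and> al \<in> Cell2 L \<and> tgt1 L rh = src1 L nu \<and> tgt1 L si = src1 L mu \<and>
  src1 L si = src1 L rh \<and> src2 L al = mu \<star>[L] si \<and> tgt2 L al = nu \<star>[L] rh}"

definition "kX Ga = (\<lambda>(rh, si, al). FO (P1 C rh) (HO Ga si))"

text \<open>In the second kind of edge, the structure morphism of \<open>\<Gamma>\<close> at
  \<open>\<gamma> : \<sigma>' \<Rightarrow> \<sigma> \<tau>\<close> leads from the index
  \<open>\<alpha>\<close> to the composite \<open>\<mu> \<sigma>' \<Rightarrow> \<mu> \<sigma>
  \<tau> \<Rightarrow> \<nu> \<rho> \<tau>\<close>.\<close>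

definition "kE mu Ga nu =
  (\<lambda>((rh, si, al), be). ((rh, si, al), (tgt2 L be, si, (nu \<triangleleft>[L] be) \<bullet>[L] al), NC (P2 C be) (HO Ga si))) `
    {((rh, si, al), be). (rh, si, al) \<in> kV mu nu \<and> be \<in> Cell2 L \<and> src2 L be = rh} \<union>
  (\<lambda>((rh, si, al), ta, ga). ((rh, si, al), (rh \<star>[L] ta, src2 L ga, (al \<triangleright>[L] ta) \<bullet>[L] (mu \<triangleleft>[L] ga)),
      NC (PC C rh ta) (HO Ga (src2 L ga)) \<cdot>[P0 C (src1 L nu)] FA (P1 C rh) (HA Ga (si, ta, ga)))) `
    {((rh, si, al), ta, ga). (rh, si, al) \<in> kV mu nu \<and> ta \<in> Cell1 L \<and> tgt1 L ta = src1 L rh \<and> ga \<in> Cell2 L \<and> tgt2 L ga = si \<star>[L] ta}"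

lemma kV_iff: "(rh, si, al) \<in> kV mu nu \<longleftrightarrow> rh \<in> Cell1 L \<and> si \<in> Cell1 L \<and> al \<in> Cell2 L \<and> tgt1 L rh = src1 L nu \<and> tgt1 L si = src1 L mu \<and>
  src1 L si = src1 L rh \<and> src2 L al = mu \<star>[L] si \<and> tgt2 L al = nu \<star>[L] rh"
  by (simp add: kV_def)

lemma kE_a: "(rh, si, al) \<in> kV mu nu ==> be \<in> Cell2 L ==> src2 L be = rh ==>
  ((rh, si, al), (tgt2 L be, si, (nu \<triangleleft>[L] be) \<bullet>[L] al), NC (P2 C be) (HO Ga si)) \<in> kE mu Ga nu"
  unfolding kE_def by (rule UnI1, rule image_eqI[where x = "((rh, si, al), be)"]) simp_all

lemma kE_b: "(rh, si, al) \<in> kV mu nu ==> ta \<in> Cell1 L ==> tgt1 L ta = src1 L rh ==> ga \<in> Cell2 L ==> tgt2 L ga = si \<star>[L] ta ==>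
  ((rh, si, al), (rh \<star>[L] ta, src2 L ga, (al \<triangleright>[L] ta) \<bullet>[L] (mu \<triangleleft>[L] ga)),
      NC (PC C rh ta) (HO Ga (src2 L ga)) \<cdot>[P0 C (src1 L nu)] FA (P1 C rh) (HA Ga (si, ta, ga))) \<in> kE mu Ga nu"
  unfolding kE_def by (rule UnI2, rule image_eqI[where x = "((rh, si, al), ta, ga)"]) simp_all

lemma kE_cases:
  assumes "e \<in> kE mu Ga nu"
  obtains (a) rh si al be where "(rh, si, al) \<in> kV mu nu" "be \<in> Cell2 L" "src2 L be = rh"
      "e = ((rh, si, al), (tgt2 L be, si, (nu \<triangleleft>[L] be) \<bullet>[L] al), NC (P2 C be) (HO Ga si))"
    | (b) rh si al ta ga where "(rh, si, al) \<in> kV mu nu" "ta \<in> Cell1 L" "tgt1 L ta = src1 L rh" "ga \<in> Cell2 L" "tgt2 L ga = si \<star>[L] ta"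
      "e = ((rh, si, al), (rh \<star>[L] ta, src2 L ga, (al \<triangleright>[L] ta) \<bullet>[L] (mu \<triangleleft>[L] ga)),
      NC (PC C rh ta) (HO Ga (src2 L ga)) \<cdot>[P0 C (src1 L nu)] FA (P1 C rh) (HA Ga (si, ta, ga)))"
  using assms unfolding kE_def by fast

lemma kV_a: "(rh, si, al) \<in> kV mu nu ==> mu \<in> Cell1 L ==> nu \<in> Cell1 L ==> be \<in> Cell2 L ==> src2 L be = rh ==>
  (tgt2 L be, si, (nu \<triangleleft>[L] be) \<bullet>[L] al) \<in> kV mu nu"
  using cell21[of be] by (simp add: kV_iff)

lemma kV_b: "(rh, si, al) \<in> kV mu nu ==> mu \<in> Cell1 L ==> nu \<in> Cell1 L ==> ta \<in> Cell1 L ==> tgt1 L ta = src1 L rh ==> ga \<in> Cell2 L ==> tgt2 L ga = si \<star>[L] ta ==>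
  (rh \<star>[L] ta, src2 L ga, (al \<triangleright>[L] ta) \<bullet>[L] (mu \<triangleleft>[L] ga)) \<in> kV mu nu"
  using cell21[of ga] by (simp add: kV_iff)

lemma kan_gdiag:
  assumes "mu \<in> Cell1 L" "nu \<in> Cell1 L" "codext_obj L C (src1 L mu) Ga"
  shows "gdiag (P0 C (src1 L nu)) (kV mu nu) (kX Ga) (kE mu Ga nu)"
  unfolding gdiag_def
proof (intro conjI ballI)
  fix v assume "v \<in> kV mu nu" then show "kX Ga v \<in> Ob (P0 C (src1 L nu))" using assms by (cases v) (auto simp: kV_iff kX_def)
next
  fix e assume "e \<in> kE mu Ga nu"
  then show "case e of (v, w, m) => v \<in> kV mu nu \<and> w \<in> kV mu nu \<and> m \<in> hom (P0 C (src1 L nu)) (kX Ga v) (kX Ga w)"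
  proof (cases rule: kE_cases)
    case (a rh si al be)
    then show ?thesis using assms kV_a[OF a(1) assms(1,2) a(2,3)] cell21[OF a(2)] by (simp add: kX_def kV_iff)
  next
    case (b rh si al ta ga)
    then show ?thesis using assms kV_b[OF b(1) assms(1,2) b(2-5)] cell21[OF b(4)] by (simp add: kX_def kV_iff)
  qed
qed (use assms in simp)

text \<open>An object with legs that can serve as the value at \<open>nu\<close> of the right
  adjoint. It is a relation because the limit is only known to exist, and because the legs are
  needed along with the object.\<close>

definition "kan mu Ga nu c l \<longleftrightarrow> glimit (P0 C (src1 L nu)) (kV mu nu) (kX Ga) (kE mu Ga nu) c (\<lambda>(rh, si, al). l rh si al)"

lemma kanD:
  assumes "kan mu Ga nu c l"
  shows "r = src1 L nu ==> c \<in> Ob (P0 C r)"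
    "(rh, si, al) \<in> kV mu nu ==> r = src1 L nu ==> l rh si al \<in> Ar (P0 C r)"
    "(rh, si, al) \<in> kV mu nu ==> r = src1 L nu ==> Src (P0 C r) (l rh si al) = c"
    "(rh, si, al) \<in> kV mu nu ==> r = src1 L nu ==> Tgt (P0 C r) (l rh si al) = FO (P1 C rh) (HO Ga si)"
    "(rh, si, al) \<in> kV mu nu ==> be \<in> Cell2 L ==> src2 L be = rh ==> r = src1 L nu ==>
      NC (P2 C be) (HO Ga si) \<cdot>[P0 C r] l rh si al = l (tgt2 L be) si ((nu \<triangleleft>[L] be) \<bullet>[L] al)"
    "(rh, si, al) \<in> kV mu nu ==> ta \<in> Cell1 L ==> tgt1 L ta = src1 L rh ==> ga \<in> Cell2 L ==> tgt2 L ga = si \<star>[L] ta ==> r = src1 L nu ==>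
      (NC (PC C rh ta) (HO Ga (src2 L ga)) \<cdot>[P0 C r] FA (P1 C rh) (HA Ga (si, ta, ga))) \<cdot>[P0 C r] l rh si al =
      l (rh \<star>[L] ta) (src2 L ga) ((al \<triangleright>[L] ta) \<bullet>[L] (mu \<triangleleft>[L] ga))"
proof -
  note g = glimitD[OF assms[unfolded kan_def]]
  show "r = src1 L nu ==> c \<in> Ob (P0 C r)" using g(1) by simp
  show "(rh, si, al) \<in> kV mu nu ==> r = src1 L nu ==> l rh si al \<in> Ar (P0 C r)"
    "(rh, si, al) \<in> kV mu nu ==> r = src1 L nu ==> Src (P0 C r) (l rh si al) = c"
    "(rh, si, al) \<in> kV mu nu ==> r = src1 L nu ==> Tgt (P0 C r) (l rh si al) = FO (P1 C rh) (HO Ga si)"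
    using g(2,3,4)[of "(rh, si, al)"] by (simp_all add: kX_def)
  show "(rh, si, al) \<in> kV mu nu ==> be \<in> Cell2 L ==> src2 L be = rh ==> r = src1 L nu ==>
      NC (P2 C be) (HO Ga si) \<cdot>[P0 C r] l rh si al = l (tgt2 L be) si ((nu \<triangleleft>[L] be) \<bullet>[L] al)"
    using g(5)[OF kE_a[of rh si al mu nu be Ga]] by simp
  show "(rh, si, al) \<in> kV mu nu ==> ta \<in> Cell1 L ==> tgt1 L ta = src1 L rh ==> ga \<in> Cell2 L ==> tgt2 L ga = si \<star>[L] ta ==> r = src1 L nu ==>
      (NC (PC C rh ta) (HO Ga (src2 L ga)) \<cdot>[P0 C r] FA (P1 C rh) (HA Ga (si, ta, ga))) \<cdot>[P0 C r] l rh si al =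
      l (rh \<star>[L] ta) (src2 L ga) ((al \<triangleright>[L] ta) \<bullet>[L] (mu \<triangleleft>[L] ga))"
    using g(5)[OF kE_b[of rh si al mu nu ta ga Ga]] by simp
qed

end

lemma small_Un: "Card_order kp ==> cinfinite kp ==> |A| <o kp ==> |B| <o kp ==> |A \<union> B| <o kp"
  using card_of_Un_ordLess_infinite_Field[of kp A B] by (simp add: cinfinite_def)

locale codk = cod kp L C
  for kp :: "'k rel" and L :: "('p, 'f, 'a) twocat" and C :: "('p, 'f, 'a, 'o, 'm) catpfun" +
  assumes card: "Card_order kp" "cinfinite kp" and small: "small_twocat kp L"
begin

text \<open>Vertices and edges are parametrised by tuples of cells of \<open>L\<close>; the arrows
  of \<open>C\<close> on the edges are functions of these tuples, so it is the size of
  \<open>L\<close> that counts.\<close>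

lemma kan_small: "|kV mu nu| <o kp" "|kE mu Ga nu| <o kp"
proof -
  note s = small[unfolded small_twocat_def]
  have V: "|Cell1 L \<times> Cell1 L \<times> Cell2 L| <o kp" using s card by (simp add: small_Times)
  have sub: "kV mu nu \<subseteq> Cell1 L \<times> Cell1 L \<times> Cell2 L" by (auto simp: kV_def)
  show v: "|kV mu nu| <o kp" by (rule small_subset[OF sub V])
  have 1: "|kV mu nu \<times> Cell2 L| <o kp" "|kV mu nu \<times> Cell1 L \<times> Cell2 L| <o kp" using s v card by (simp_all add: small_Times)
  have "|{((rh, si, al), be). (rh, si, al) \<in> kV mu nu \<and> be \<in> Cell2 L \<and> src2 L be = rh}| <o kp"
    by (rule small_subset[OF _ 1(1)]) auto
  moreover have "|{((rh, si, al), ta, ga). (rh, si, al) \<in> kV mu nu \<and> ta \<in> Cell1 L \<and> tgt1 L ta = src1 L rh \<and> ga \<in> Cell2 L \<and> tgt2 L ga = si \<star>[L] ta}| <o kp"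
    by (rule small_subset[OF _ 1(2)]) auto
  ultimately show "|kE mu Ga nu| <o kp" unfolding kE_def by (intro small_Un[OF card] small_image)
qed

lemma kan_exists:
  assumes "mu \<in> Cell1 L" "nu \<in> Cell1 L" "codext_obj L C (src1 L mu) Ga"
  shows "\<exists>c l. kan mu Ga nu c l"
proof -
  from glimit_exists(1)[OF card kan_small kan_gdiag[OF assms]] obtain c l
    where "glimit (P0 C (src1 L nu)) (kV mu nu) (kX Ga) (kE mu Ga nu) c l" using assms(2) by auto
  then have "kan mu Ga nu c (\<lambda>rh si al. l (rh, si, al))" by (simp add: kan_def)
  then show ?thesis by blast
qed

text \<open>The structure morphisms of the right adjoint end in the image of a limit under
  \<open>P1 C ta\<close>. This functor is lex, so that image is again a limit, with mapped legs;
  \<open>kan_image_monic\<close> and \<open>kan_image_lift\<close> exploit this.\<close>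

lemma kan_image:
  assumes "mu \<in> Cell1 L" "nu \<in> Cell1 L" "codext_obj L C (src1 L mu) Ga" "kan mu Ga nu c l" "ta \<in> Cell1 L" "src1 L ta = src1 L nu"
  shows "glimit (P0 C (tgt1 L ta)) (kV mu nu) (\<lambda>v. FO (P1 C ta) (kX Ga v)) ((\<lambda>(v, w, m). (v, w, FA (P1 C ta) m)) ` kE mu Ga nu)
    (FO (P1 C ta) c) (\<lambda>v. FA (P1 C ta) (case v of (rh, si, al) => l rh si al))"
  using glimit_exists(2)[OF card kan_small kan_gdiag[OF assms(1-3)] assms(4)[unfolded kan_def] P1(1)[OF assms(5)]] assms(5,6)
  by simp

lemma kan_image_monic:
  assumes a: "mu \<in> Cell1 L" "nu \<in> Cell1 L" "codext_obj L C (src1 L mu) Ga" "kan mu Ga nu c l" "ta \<in> Cell1 L" "src1 L ta = src1 L nu"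
    and h: "h \<in> hom (P0 C (tgt1 L ta)) x (FO (P1 C ta) c)" "h' \<in> hom (P0 C (tgt1 L ta)) x (FO (P1 C ta) c)"
    and e: "!!rh si al. (rh, si, al) \<in> kV mu nu ==> FA (P1 C ta) (l rh si al) \<cdot>[P0 C (tgt1 L ta)] h = FA (P1 C ta) (l rh si al) \<cdot>[P0 C (tgt1 L ta)] h'"
  shows "h = h'"
proof (rule glimit_joint_monic[OF kan_image[OF a] _ h])
  show "gdiag (P0 C (tgt1 L ta)) (kV mu nu) (\<lambda>v. FO (P1 C ta) (kX Ga v)) ((\<lambda>(v, w, m). (v, w, FA (P1 C ta) m)) ` kE mu Ga nu)"
    using kan_gdiag[OF a(1-3)] a(5,6) unfolding gdiag_def by auto
qed (use e in auto)

lemma kan_image_lift: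
  assumes a: "mu \<in> Cell1 L" "nu \<in> Cell1 L" "codext_obj L C (src1 L mu) Ga" "kan mu Ga nu c l" "ta \<in> Cell1 L" "src1 L ta = src1 L nu"
    and x: "x \<in> Ob (P0 C (tgt1 L ta))"
    and k: "!!rh si al. (rh, si, al) \<in> kV mu nu ==> k rh si al \<in> hom (P0 C (tgt1 L ta)) x (FO (P1 C ta) (FO (P1 C rh) (HO Ga si)))"
    and ka: "!!si al be. (src2 L be, si, al) \<in> kV mu nu ==> be \<in> Cell2 L ==>
      FA (P1 C ta) (NC (P2 C be) (HO Ga si)) \<cdot>[P0 C (tgt1 L ta)] k (src2 L be) si al = k (tgt2 L be) si ((nu \<triangleleft>[L] be) \<bullet>[L] al)"
    and kb: "!!rh si al \<chi> ga. (rh, si, al) \<in> kV mu nu ==> \<chi> \<in> Cell1 L ==> tgt1 L \<chi> = src1 L rh ==> ga \<in> Cell2 L ==> tgt2 L ga = si \<star>[L] \<chi> ==>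
      FA (P1 C ta) (NC (PC C rh \<chi>) (HO Ga (src2 L ga)) \<cdot>[P0 C (src1 L nu)] FA (P1 C rh) (HA Ga (si, \<chi>, ga))) \<cdot>[P0 C (tgt1 L ta)] k rh si al =
      k (rh \<star>[L] \<chi>) (src2 L ga) ((al \<triangleright>[L] \<chi>) \<bullet>[L] (mu \<triangleleft>[L] ga))"
  shows "\<exists>h. h \<in> hom (P0 C (tgt1 L ta)) x (FO (P1 C ta) c) \<and>
    (\<forall>rh si al. (rh, si, al) \<in> kV mu nu \<longrightarrow> FA (P1 C ta) (l rh si al) \<cdot>[P0 C (tgt1 L ta)] h = k rh si al)"
proof -
  let ?k = "\<lambda>(rh, si, al). k rh si al"
  have "FA (P1 C ta) m \<cdot>[P0 C (tgt1 L ta)] ?k v = ?k w" if "(v, w, m) \<in> kE mu Ga nu" for v w m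
    using that by (cases rule: kE_cases) (use ka kb in auto)
  then have "gcone (P0 C (tgt1 L ta)) (kV mu nu) (\<lambda>v. FO (P1 C ta) (kX Ga v)) ((\<lambda>(v, w, m). (v, w, FA (P1 C ta) m)) ` kE mu Ga nu) x ?k"
    unfolding gcone_def using x k by (auto simp: kX_def)
  then obtain h where "h \<in> hom (P0 C (tgt1 L ta)) x (FO (P1 C ta) c)" "\<forall>v \<in> kV mu nu. FA (P1 C ta) (case v of (rh, si, al) => l rh si al) \<cdot>[P0 C (tgt1 L ta)] h = ?k v"
    using kan_image[OF a] unfolding glimit_def by blast
  then show ?thesis by fastforce
qed

text \<open>\<open>P1 C\<close> of an identity 1-cell is only isomorphic to an identity functor, so
  lifting into the limit itself is not literally an instance of
  \<open>kan_image_lift\<close>.\<close>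

lemma kan_lift:
  assumes a: "mu \<in> Cell1 L" "nu \<in> Cell1 L" "codext_obj L C (src1 L mu) Ga" "kan mu Ga nu c l"
    and x: "x \<in> Ob (P0 C (src1 L nu))"
    and k: "!!rh si al. (rh, si, al) \<in> kV mu nu ==> k rh si al \<in> hom (P0 C (src1 L nu)) x (FO (P1 C rh) (HO Ga si))"
    and ka: "!!si al be. (src2 L be, si, al) \<in> kV mu nu ==> be \<in> Cell2 L ==>
      NC (P2 C be) (HO Ga si) \<cdot>[P0 C (src1 L nu)] k (src2 L be) si al = k (tgt2 L be) si ((nu \<triangleleft>[L] be) \<bullet>[L] al)"
    and kb: "!!rh si al \<chi> ga. (rh, si, al) \<in> kV mu nu ==> \<chi> \<in> Cell1 L ==> tgt1 L \<chi> = src1 L rh ==> ga \<in> Cell2 L ==> tgt2 L ga = si \<star>[L] \<chi> ==>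
      (NC (PC C rh \<chi>) (HO Ga (src2 L ga)) \<cdot>[P0 C (src1 L nu)] FA (P1 C rh) (HA Ga (si, \<chi>, ga))) \<cdot>[P0 C (src1 L nu)] k rh si al =
      k (rh \<star>[L] \<chi>) (src2 L ga) ((al \<triangleright>[L] \<chi>) \<bullet>[L] (mu \<triangleleft>[L] ga))"
  shows "\<exists>!h. h \<in> hom (P0 C (src1 L nu)) x c \<and> (\<forall>rh si al. (rh, si, al) \<in> kV mu nu \<longrightarrow> l rh si al \<cdot>[P0 C (src1 L nu)] h = k rh si al)"
proof -
  let ?k = "\<lambda>(rh, si, al). k rh si al"
  have "m \<cdot>[P0 C (src1 L nu)] ?k v = ?k w" if "(v, w, m) \<in> kE mu Ga nu" for v w m
    using that by (cases rule: kE_cases) (use ka kb in auto)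
  then have "gcone (P0 C (src1 L nu)) (kV mu nu) (kX Ga) (kE mu Ga nu) x ?k"
    unfolding gcone_def using x k by (auto simp: kX_def)
  then have "\<exists>!h. h \<in> hom (P0 C (src1 L nu)) x c \<and> (\<forall>v \<in> kV mu nu. (case v of (rh, si, al) => l rh si al) \<cdot>[P0 C (src1 L nu)] h = ?k v)"
    using a(4) unfolding kan_def glimit_def by blast
  moreover have "(\<forall>v \<in> kV mu nu. (case v of (rh, si, al) => l rh si al) \<cdot>[P0 C (src1 L nu)] h = ?k v) \<longleftrightarrow>
    (\<forall>rh si al. (rh, si, al) \<in> kV mu nu \<longrightarrow> l rh si al \<cdot>[P0 C (src1 L nu)] h = k rh si al)" for h by auto
  ultimately show ?thesis by simp
qed

end

context codk begin

text \<open>The last clause prescribes the structure morphism of \<open>R\<close> at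
  \<open>\<alpha>\<close> on the legs: followed by the leg at
  \<open>\<beta> : \<mu> \<sigma> \<Rightarrow> \<lambda> \<rho>\<close>, where
  \<open>\<lambda>\<close> is the source of \<open>\<alpha>\<close>, it is the leg at the pasted
  2-cell \<open>\<mu> \<sigma> \<Rightarrow> \<lambda> \<rho> \<Rightarrow> \<nu> \<tau>
  \<rho>\<close>, up to \<open>PC\<close>.\<close>

definition "ran_spec mu Ga R l \<longleftrightarrow> codext_obj L C (tgt1 L mu) R \<and> (\<forall>nu. nu \<in> Cell1 L \<longrightarrow> tgt1 L nu = tgt1 L mu \<longrightarrow> kan mu Ga nu (HO R nu) (l nu)) \<and>
    (\<forall>nu ta al rh si be. nu \<in> Cell1 L \<longrightarrow> tgt1 L nu = tgt1 L mu \<longrightarrow> ta \<in> Cell1 L \<longrightarrow> src1 L nu = tgt1 L ta \<longrightarrow> al \<in> Cell2 L \<longrightarrow> tgt2 L al = nu \<star>[L] ta \<longrightarrow>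
       (rh, si, be) \<in> kV mu (src2 L al) \<longrightarrow>
       FA (P1 C ta) (l (src2 L al) rh si be) \<cdot>[P0 C (tgt1 L ta)] HA R (nu, ta, al) =
       NC (inv_ntr (PC C ta rh)) (HO Ga si) \<cdot>[P0 C (tgt1 L ta)] l nu (ta \<star>[L] rh) si ((al \<triangleright>[L] rh) \<bullet>[L] be))"

text \<open>The structure morphisms are lifts into images of limits, so the identity, composition
  and 2-cell axioms need only be checked on legs, where they rest on \<open>PCi_id\<close>,
  \<open>PCi_assoc'\<close> and \<open>PCi_rwh\<close>.\<close>

lemma ran_exists:
  assumes mu: "mu \<in> Cell1 L" and Ga: "codext_obj L C (src1 L mu) Ga"
  shows "\<exists>R l. ran_spec mu Ga R l"
proof -
  let ?q = "tgt1 L mu"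
  obtain c l where kan: "!!nu. nu \<in> Cell1 L ==> kan mu Ga nu (c nu) (l nu)"
    using kan_exists[OF mu _ Ga] by metis
  have c: "nu \<in> Cell1 L ==> r = src1 L nu ==> c nu \<in> Ob (P0 C r)" for nu r
    using kanD(1)[OF kan] by blast
  have V: "(ta \<star>[L] rh, si, (al \<triangleright>[L] rh) \<bullet>[L] be) \<in> kV mu nu"
    if "nu \<in> Cell1 L" "ta \<in> Cell1 L" "src1 L nu = tgt1 L ta" "al \<in> Cell2 L" "tgt2 L al = nu \<star>[L] ta" "(rh, si, be) \<in> kV mu (src2 L al)" for nu ta al rh si be
    using that mu by (simp add: kV_iff)
  have l: "l nu rh si al \<in> Ar (P0 C r)" "Src (P0 C r) (l nu rh si al) = c nu" "Tgt (P0 C r) (l nu rh si al) = FO (P1 C rh) (HO Ga si)"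
    if "nu \<in> Cell1 L" "(rh, si, al) \<in> kV mu nu" "r = src1 L nu" for nu rh si al r
    using kanD(2-4)[OF kan[OF that(1)] that(2,3)] by auto
  have la: "NC (P2 C \<delta>) (HO Ga si) \<cdot>[P0 C r] l nu rh si al = l nu (tgt2 L \<delta>) si ((nu \<triangleleft>[L] \<delta>) \<bullet>[L] al)"
    if "nu \<in> Cell1 L" "(rh, si, al) \<in> kV mu nu" "\<delta> \<in> Cell2 L" "src2 L \<delta> = rh" "r = src1 L nu" for nu rh si al \<delta> r
    using kanD(5)[OF kan[OF that(1)] that(2-5)] .
  have lb: "NC (PC C rh ta) (HO Ga si') \<cdot>[P0 C r] FA (P1 C rh) (HA Ga (si, ta, ga)) \<cdot>[P0 C r] l nu rh si al =
      l nu (rh \<star>[L] ta) (src2 L ga) ((al \<triangleright>[L] ta) \<bullet>[L] (mu \<triangleleft>[L] ga))"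
    if "nu \<in> Cell1 L" "(rh, si, al) \<in> kV mu nu" "ta \<in> Cell1 L" "tgt1 L ta = src1 L rh" "ga \<in> Cell2 L" "tgt2 L ga = si \<star>[L] ta" "r = src1 L nu" "src2 L ga = si'"
    for nu rh si al ta ga r si'
    using kanD(6)[OF kan[OF that(1)] that(2-7)] that Ga l[OF that(1,2)] cell21[of ga] cell2(1)[of ga] by (simp add: kV_iff)
  have exA: "\<exists>h. h \<in> hom (P0 C (tgt1 L ta)) (c nu) (FO (P1 C ta) (c (src2 L al))) \<and>
    (\<forall>rh si be. (rh, si, be) \<in> kV mu (src2 L al) \<longrightarrow> FA (P1 C ta) (l (src2 L al) rh si be) \<cdot>[P0 C (tgt1 L ta)] h =
      NC (inv_ntr (PC C ta rh)) (HO Ga si) \<cdot>[P0 C (tgt1 L ta)] l nu (ta \<star>[L] rh) si ((al \<triangleright>[L] rh) \<bullet>[L] be))"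
    if a: "nu \<in> Cell1 L" "tgt1 L nu = ?q" "ta \<in> Cell1 L" "src1 L nu = tgt1 L ta" "al \<in> Cell2 L" "tgt2 L al = nu \<star>[L] ta" for nu ta al
  proof (rule kan_image_lift[OF mu _ Ga kan])
    fix rh si be assume v: "(rh, si, be) \<in> kV mu (src2 L al)"
    note v' = v[unfolded kV_iff] and w = V[OF a(1,3-6) v]
    show "NC (inv_ntr (PC C ta rh)) (HO Ga si) \<cdot>[P0 C (tgt1 L ta)] l nu (ta \<star>[L] rh) si ((al \<triangleright>[L] rh) \<bullet>[L] be)
      \<in> hom (P0 C (tgt1 L ta)) (c nu) (FO (P1 C ta) (FO (P1 C rh) (HO Ga si)))"
      using a v' Ga mu l[OF a(1) w] by simp
    fix \<chi> ga assume g: "\<chi> \<in> Cell1 L" "tgt1 L \<chi> = src1 L rh" "ga \<in> Cell2 L" "tgt2 L ga = si \<star>[L] \<chi>"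
    have g': "src1 L (src2 L ga) = src1 L \<chi>" "tgt1 L (src2 L ga) = src1 L mu" using g v' by simp_all
    show "FA (P1 C ta) (NC (PC C rh \<chi>) (HO Ga (src2 L ga)) \<cdot>[P0 C (src1 L (src2 L al))] FA (P1 C rh) (HA Ga (si, \<chi>, ga))) \<cdot>[P0 C (tgt1 L ta)]
        NC (inv_ntr (PC C ta rh)) (HO Ga si) \<cdot>[P0 C (tgt1 L ta)] l nu (ta \<star>[L] rh) si ((al \<triangleright>[L] rh) \<bullet>[L] be) =
      NC (inv_ntr (PC C ta (rh \<star>[L] \<chi>))) (HO Ga (src2 L ga)) \<cdot>[P0 C (tgt1 L ta)]
        l nu (ta \<star>[L] (rh \<star>[L] \<chi>)) (src2 L ga) ((al \<triangleright>[L] (rh \<star>[L] \<chi>)) \<bullet>[L] ((be \<triangleright>[L] \<chi>) \<bullet>[L] (mu \<triangleleft>[L] ga)))"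
      using a v' g g' Ga mu l[OF a(1) w] lb[OF a(1) w g(1) _ g(3,4)]
      by (simp add: PCi_L[THEN cmpE] PCi_assoc[THEN cmpE])
  next
    fix si be \<delta> assume v: "(src2 L \<delta>, si, be) \<in> kV mu (src2 L al)" and d: "\<delta> \<in> Cell2 L"
    note v' = v[unfolded kV_iff] and w = V[OF a(1,3-6) v]
    \<comment> \<open>Interchange makes the prescribed composites compatible with the edges that
      come from 2-cells out of \<open>\<rho>\<close>.\<close>
    have ic: "((al \<triangleright>[L] tgt2 L \<delta>) \<bullet>[L] (src2 L al \<triangleleft>[L] \<delta>)) = ((nu \<star>[L] ta) \<triangleleft>[L] \<delta>) \<bullet>[L] (al \<triangleright>[L] src2 L \<delta>)"
      using wh_interchange[of \<delta> al] d a v' by simp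
    have "(al \<triangleright>[L] tgt2 L \<delta>) \<bullet>[L] ((src2 L al \<triangleleft>[L] \<delta>) \<bullet>[L] be) = ((al \<triangleright>[L] tgt2 L \<delta>) \<bullet>[L] (src2 L al \<triangleleft>[L] \<delta>)) \<bullet>[L] be"
      using d a v' mu by simp
    also have "\<dots> = (nu \<triangleleft>[L] (ta \<triangleleft>[L] \<delta>)) \<bullet>[L] ((al \<triangleright>[L] src2 L \<delta>) \<bullet>[L] be)"
      unfolding ic using d a v' mu by simp
    finally have ic': "(al \<triangleright>[L] tgt2 L \<delta>) \<bullet>[L] ((src2 L al \<triangleleft>[L] \<delta>) \<bullet>[L] be) = (nu \<triangleleft>[L] (ta \<triangleleft>[L] \<delta>)) \<bullet>[L] ((al \<triangleright>[L] src2 L \<delta>) \<bullet>[L] be)" .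
    show "FA (P1 C ta) (NC (P2 C \<delta>) (HO Ga si)) \<cdot>[P0 C (tgt1 L ta)] 
        NC (inv_ntr (PC C ta (src2 L \<delta>))) (HO Ga si) \<cdot>[P0 C (tgt1 L ta)] l nu (ta \<star>[L] src2 L \<delta>) si ((al \<triangleright>[L] src2 L \<delta>) \<bullet>[L] be) =
      NC (inv_ntr (PC C ta (tgt2 L \<delta>))) (HO Ga si) \<cdot>[P0 C (tgt1 L ta)] l nu (ta \<star>[L] tgt2 L \<delta>) si ((al \<triangleright>[L] tgt2 L \<delta>) \<bullet>[L] ((src2 L al \<triangleleft>[L] \<delta>) \<bullet>[L] be))"
      unfolding ic' using a v' d Ga mu l[OF a(1) w] la[OF a(1) w, of "ta \<triangleleft>[L] \<delta>"]
      by (simp add: PCi_lwh[THEN cmpE])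
  qed (use a mu in "simp_all add: c")
  define A where "A nu ta al = (SOME h. h \<in> hom (P0 C (tgt1 L ta)) (c nu) (FO (P1 C ta) (c (src2 L al))) \<and>
    (\<forall>rh si be. (rh, si, be) \<in> kV mu (src2 L al) \<longrightarrow> FA (P1 C ta) (l (src2 L al) rh si be) \<cdot>[P0 C (tgt1 L ta)] h =
      NC (inv_ntr (PC C ta rh)) (HO Ga si) \<cdot>[P0 C (tgt1 L ta)] l nu (ta \<star>[L] rh) si ((al \<triangleright>[L] rh) \<bullet>[L] be)))" for nu ta al
  have A: "!!nu ta al. nu \<in> Cell1 L ==> tgt1 L nu = ?q ==> ta \<in> Cell1 L ==> src1 L nu = tgt1 L ta ==> al \<in> Cell2 L ==> tgt2 L al = nu \<star>[L] ta ==>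
     A nu ta al \<in> hom (P0 C (tgt1 L ta)) (c nu) (FO (P1 C ta) (c (src2 L al)))"
    "!!nu ta al rh si be. nu \<in> Cell1 L ==> tgt1 L nu = ?q ==> ta \<in> Cell1 L ==> src1 L nu = tgt1 L ta ==> al \<in> Cell2 L ==> tgt2 L al = nu \<star>[L] ta ==>
      (rh, si, be) \<in> kV mu (src2 L al) ==> FA (P1 C ta) (l (src2 L al) rh si be) \<cdot>[P0 C (tgt1 L ta)] A nu ta al =
      NC (inv_ntr (PC C ta rh)) (HO Ga si) \<cdot>[P0 C (tgt1 L ta)] l nu (ta \<star>[L] rh) si ((al \<triangleright>[L] rh) \<bullet>[L] be)"
    using someI_ex[OF exA, folded A_def] by blast+
  have A2: "FA (P1 C ta) (l nu' rh si be) \<cdot>[P0 C r] A nu ta al =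
      NC (inv_ntr (PC C ta rh)) (HO Ga si) \<cdot>[P0 C r] l nu (ta \<star>[L] rh) si ((al \<triangleright>[L] rh) \<bullet>[L] be)"
    if "nu \<in> Cell1 L" "tgt1 L nu = ?q" "ta \<in> Cell1 L" "src1 L nu = tgt1 L ta" "al \<in> Cell2 L" "tgt2 L al = nu \<star>[L] ta"
      "nu' = src2 L al" "(rh, si, be) \<in> kV mu nu'" "r = tgt1 L ta" for nu ta al rh si be nu' r
    using A(2)[OF that(1-6)] that(7-9) by simp
  have At: "A nu rh al \<in> Ar (P0 C p)" "Src (P0 C p) (A nu rh al) = c nu" "Tgt (P0 C p) (A nu rh al) = FO (P1 C rh) (c (src2 L al))"
    if "nu \<in> Cell1 L" "tgt1 L nu = ?q" "rh \<in> Cell1 L" "src1 L nu = tgt1 L rh" "al \<in> Cell2 L" "tgt2 L al = nu \<star>[L] rh" "p = tgt1 L rh" for nu rh al p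
    using A(1)[OF that(1-6)] that(7) by simp_all
  define R where "R = \<lparr>HO = restrict c (into L ?q), HA = (\<lambda>(nu, rh, al) \<in> decomp L ?q. A nu rh al)\<rparr>"
  have RO: "HO R nu = c nu" if "nu \<in> Cell1 L" "tgt1 L nu = ?q" for nu using that by (simp add: R_def into_def)
  have RA: "HA R (nu, rh, al) = A nu rh al" if "nu \<in> Cell1 L" "tgt1 L nu = ?q" "rh \<in> Cell1 L" "src1 L nu = tgt1 L rh" "al \<in> Cell2 L" "tgt2 L al = nu \<star>[L] rh" for nu rh al
    using that by (simp add: R_def into_def decomp_def)
  have "codext_obj L C ?q R"
  proof (rule codext_objI)
    show "HO R \<in> extensional (into L ?q)" "HA R \<in> extensional (decomp L ?q)" by (simp_all add: R_def)
  next
    fix nu assume nu: "nu \<in> Cell1 L" "tgt1 L nu = ?q"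
    have "A nu (id1 L (src1 L nu)) (id2 L nu) = NC (PU C (src1 L nu)) (c nu)"
    proof (rule kan_image_monic[OF mu nu(1) Ga kan[OF nu(1)], of "id1 L (src1 L nu)" _ "c nu"])
      fix rh si al assume v: "(rh, si, al) \<in> kV mu nu"
      note v' = v[unfolded kV_iff]
      show "FA (P1 C (id1 L (src1 L nu))) (l nu rh si al) \<cdot>[P0 C (tgt1 L (id1 L (src1 L nu)))] A nu (id1 L (src1 L nu)) (id2 L nu) =
        FA (P1 C (id1 L (src1 L nu))) (l nu rh si al) \<cdot>[P0 C (tgt1 L (id1 L (src1 L nu)))] NC (PU C (src1 L nu)) (c nu)"
        using v v' nu Ga mu A2[of nu "id1 L (src1 L nu)" "id2 L nu" nu rh si al "src1 L nu"] l[OF nu(1) v] by (simp add: PU_L PCi_id(2))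
    qed (use nu in "simp_all add: c At")
    then show "HA R (nu, id1 L (src1 L nu), id2 L nu) = NC (PU C (src1 L nu)) (HO R nu)" using nu by (simp add: RO RA)
  next
    fix rh al \<pi> si be assume a: "rh \<in> Cell1 L" "\<pi> \<in> Cell1 L" "tgt1 L \<pi> = ?q" "si \<in> Cell1 L" "src1 L \<pi> = tgt1 L si"
      "src1 L si = tgt1 L rh" "be \<in> Cell2 L" "tgt2 L be = \<pi> \<star>[L] si" "al \<in> Cell2 L" "tgt2 L al = src2 L be \<star>[L] rh"
    have s: "src2 L al \<in> Cell1 L" "src2 L be \<in> Cell1 L" using a by simp_all
    have "NC (PC C si rh) (c (src2 L al)) \<cdot>[P0 C (tgt1 L si)] FA (P1 C si) (A (src2 L be) rh al) \<cdot>[P0 C (tgt1 L si)] A \<pi> si be =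
      A \<pi> (si \<star>[L] rh) ((be \<triangleright>[L] rh) \<bullet>[L] al)"
    proof (rule kan_image_monic[OF mu s(1) Ga kan[OF s(1)], of "si \<star>[L] rh" _ "c \<pi>"])
      fix rh' si' ga assume v: "(rh', si', ga) \<in> kV mu (src2 L al)"
      note v' = v[unfolded kV_iff]
      have w: "(rh \<star>[L] rh', si', (al \<triangleright>[L] rh') \<bullet>[L] ga) \<in> kV mu (src2 L be)"
        using V[of "src2 L be" rh al rh' si' ga] a v by simp
      have w': "(si \<star>[L] (rh \<star>[L] rh'), si', (be \<triangleright>[L] (rh \<star>[L] rh')) \<bullet>[L] ((al \<triangleright>[L] rh') \<bullet>[L] ga)) \<in> kV mu \<pi>"
        using V[of \<pi> si be "rh \<star>[L] rh'" si' "(al \<triangleright>[L] rh') \<bullet>[L] ga"] a w by simp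
      have 1: "FA (P1 C rh) (l (src2 L al) rh' si' ga) \<cdot>[P0 C (tgt1 L rh)] A (src2 L be) rh al =
        NC (inv_ntr (PC C rh rh')) (HO Ga si') \<cdot>[P0 C (tgt1 L rh)] l (src2 L be) (rh \<star>[L] rh') si' ((al \<triangleright>[L] rh') \<bullet>[L] ga)"
        by (rule A2) (use a v in simp_all)
      have 2: "FA (P1 C si) (l (src2 L be) (rh \<star>[L] rh') si' ((al \<triangleright>[L] rh') \<bullet>[L] ga)) \<cdot>[P0 C (tgt1 L si)] A \<pi> si be =
        NC (inv_ntr (PC C si (rh \<star>[L] rh'))) (HO Ga si') \<cdot>[P0 C (tgt1 L si)] l \<pi> (si \<star>[L] (rh \<star>[L] rh')) si' ((be \<triangleright>[L] (rh \<star>[L] rh')) \<bullet>[L] ((al \<triangleright>[L] rh') \<bullet>[L] ga))"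
        by (rule A2) (use a w in simp_all)
      have 3: "FA (P1 C (si \<star>[L] rh)) (l (src2 L al) rh' si' ga) \<cdot>[P0 C (tgt1 L si)] A \<pi> (si \<star>[L] rh) ((be \<triangleright>[L] rh) \<bullet>[L] al) =
        NC (inv_ntr (PC C (si \<star>[L] rh) rh')) (HO Ga si') \<cdot>[P0 C (tgt1 L si)] l \<pi> ((si \<star>[L] rh) \<star>[L] rh') si' ((((be \<triangleright>[L] rh) \<bullet>[L] al) \<triangleright>[L] rh') \<bullet>[L] ga)"
        by (rule A2) (use a v in simp_all)
      have 4: "(((be \<triangleright>[L] rh) \<bullet>[L] al) \<triangleright>[L] rh') \<bullet>[L] ga = (be \<triangleright>[L] (rh \<star>[L] rh')) \<bullet>[L] ((al \<triangleright>[L] rh') \<bullet>[L] ga)"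
        using a v' by simp
      have 5: "(si \<star>[L] rh) \<star>[L] rh' = si \<star>[L] (rh \<star>[L] rh')" using a v' by simp
      note ty = l[OF s(1) v] l[OF s(2) w] l[OF a(2) w']
      show "FA (P1 C (si \<star>[L] rh)) (l (src2 L al) rh' si' ga) \<cdot>[P0 C (tgt1 L (si \<star>[L] rh))]
          NC (PC C si rh) (c (src2 L al)) \<cdot>[P0 C (tgt1 L si)] FA (P1 C si) (A (src2 L be) rh al) \<cdot>[P0 C (tgt1 L si)] A \<pi> si be =
        FA (P1 C (si \<star>[L] rh)) (l (src2 L al) rh' si' ga) \<cdot>[P0 C (tgt1 L (si \<star>[L] rh))] A \<pi> (si \<star>[L] rh) ((be \<triangleright>[L] rh) \<bullet>[L] al)"
        using a v' Ga mu ty 3[unfolded 4 5] by (simp add: c At PC_L[THEN cmpE] 1[THEN FA_eq, THEN cmpE] 2 PCi_assoc'[THEN cmpE3])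
    qed (use a in "simp_all add: c At")
    then show "NC (PC C si rh) (HO R (src2 L al)) \<cdot>[P0 C (tgt1 L si)] FA (P1 C si) (HA R (src2 L be, rh, al)) \<cdot>[P0 C (tgt1 L si)] HA R (\<pi>, si, be) =
      HA R (\<pi>, si \<star>[L] rh, (be \<triangleright>[L] rh) \<bullet>[L] al)" using a by (simp add: RO RA)
  next
    fix nu al be assume a: "nu \<in> Cell1 L" "tgt1 L nu = ?q" "src1 L nu = tgt1 L (tgt2 L be)" "al \<in> Cell2 L"
      "be \<in> Cell2 L" "tgt2 L al = nu \<star>[L] src2 L be"
    have s: "src2 L al \<in> Cell1 L" using a by simp
    have "NC (P2 C be) (c (src2 L al)) \<cdot>[P0 C (tgt1 L (tgt2 L be))] A nu (src2 L be) al = A nu (tgt2 L be) ((nu \<triangleleft>[L] be) \<bullet>[L] al)"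
    proof (rule kan_image_monic[OF mu s Ga kan[OF s], of "tgt2 L be" _ "c nu"])
      fix rh' si' ga assume v: "(rh', si', ga) \<in> kV mu (src2 L al)"
      note v' = v[unfolded kV_iff]
      have w: "(src2 L be \<star>[L] rh', si', (al \<triangleright>[L] rh') \<bullet>[L] ga) \<in> kV mu nu"
        using V[of nu "src2 L be" al rh' si' ga] a v by simp
      have 1: "FA (P1 C (src2 L be)) (l (src2 L al) rh' si' ga) \<cdot>[P0 C (tgt1 L (tgt2 L be))] A nu (src2 L be) al =
        NC (inv_ntr (PC C (src2 L be) rh')) (HO Ga si') \<cdot>[P0 C (tgt1 L (tgt2 L be))] l nu (src2 L be \<star>[L] rh') si' ((al \<triangleright>[L] rh') \<bullet>[L] ga)"
        by (rule A2) (use a v in simp_all)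
      have 2: "FA (P1 C (tgt2 L be)) (l (src2 L al) rh' si' ga) \<cdot>[P0 C (tgt1 L (tgt2 L be))] A nu (tgt2 L be) ((nu \<triangleleft>[L] be) \<bullet>[L] al) =
        NC (inv_ntr (PC C (tgt2 L be) rh')) (HO Ga si') \<cdot>[P0 C (tgt1 L (tgt2 L be))] l nu (tgt2 L be \<star>[L] rh') si' ((((nu \<triangleleft>[L] be) \<bullet>[L] al) \<triangleright>[L] rh') \<bullet>[L] ga)"
        by (rule A2) (use a v in simp_all)
      show "FA (P1 C (tgt2 L be)) (l (src2 L al) rh' si' ga) \<cdot>[P0 C (tgt1 L (tgt2 L be))] NC (P2 C be) (c (src2 L al)) \<cdot>[P0 C (tgt1 L (tgt2 L be))] A nu (src2 L be) al =
        FA (P1 C (tgt2 L be)) (l (src2 L al) rh' si' ga) \<cdot>[P0 C (tgt1 L (tgt2 L be))] A nu (tgt2 L be) ((nu \<triangleleft>[L] be) \<bullet>[L] al)"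
        using a v' Ga mu l[OF s v] l[OF a(1) w] la[OF a(1) w, of "be \<triangleright>[L] rh'"] unfolding 2
        by (simp add: c At P2_L[THEN cmpE] 1 PCi_rwh[THEN cmpE])
    qed (use a in "simp_all add: c At")
    then show "NC (P2 C be) (HO R (src2 L al)) \<cdot>[P0 C (tgt1 L (tgt2 L be))] HA R (nu, src2 L be, al) = HA R (nu, tgt2 L be, (nu \<triangleleft>[L] be) \<bullet>[L] al)"
      using a by (simp add: RO RA)
  qed (simp_all add: RO RA c At)
  moreover have "\<forall>nu. nu \<in> Cell1 L \<longrightarrow> tgt1 L nu = ?q \<longrightarrow> kan mu Ga nu (HO R nu) (l nu)"
    using kan by (simp add: RO)
  moreover have "FA (P1 C ta) (l (src2 L al) rh si be) \<cdot>[P0 C (tgt1 L ta)] HA R (nu, ta, al) =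
       NC (inv_ntr (PC C ta rh)) (HO Ga si) \<cdot>[P0 C (tgt1 L ta)] l nu (ta \<star>[L] rh) si ((al \<triangleright>[L] rh) \<bullet>[L] be)"
    if "nu \<in> Cell1 L" "tgt1 L nu = ?q" "ta \<in> Cell1 L" "src1 L nu = tgt1 L ta" "al \<in> Cell2 L" "tgt2 L al = nu \<star>[L] ta" "(rh, si, be) \<in> kV mu (src2 L al)"
    for nu ta al rh si be
    using A(2)[OF that] that by (simp add: RA)
  ultimately show ?thesis unfolding ran_spec_def by blast
qed

text \<open>The universal arrow consists of the legs at identity 2-cells. Conversely every leg is
  obtained from it through a structure morphism (\<open>epl\<close>), which makes factorisations
  unique; they exist because a morphism \<open>f\<close> out of a restriction induces a cone,
  \<open>?k\<close>, over each of the limits.\<close>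

lemma restriction_adjn:
  assumes mu: "mu \<in> Cell1 L"
  shows "\<exists>R \<eta> ep. adjn (codext_ftr L C mu) R \<eta> ep (E (tgt1 L mu)) (E (src1 L mu))"
proof -
  let ?p = "src1 L mu" and ?q = "tgt1 L mu"
  obtain R l where Rl: "!!Ga. codext_obj L C ?p Ga ==> ran_spec mu Ga (R Ga) (l Ga)" using ran_exists[OF mu] by metis
  have R0: "!!Ga. codext_obj L C ?p Ga ==> codext_obj L C ?q (R Ga)"
    and kan: "!!Ga nu. codext_obj L C ?p Ga ==> nu \<in> Cell1 L ==> tgt1 L nu = ?q ==> kan mu Ga nu (HO (R Ga) nu) (l Ga nu)"
    and lR0: "!!Ga nu ta al rh si be. codext_obj L C ?p Ga ==> nu \<in> Cell1 L ==> tgt1 L nu = ?q ==> ta \<in> Cell1 L ==> src1 L nu = tgt1 L ta ==>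
       al \<in> Cell2 L ==> tgt2 L al = nu \<star>[L] ta ==> (rh, si, be) \<in> kV mu (src2 L al) ==>
       FA (P1 C ta) (l Ga (src2 L al) rh si be) \<cdot>[P0 C (tgt1 L ta)] HA (R Ga) (nu, ta, al) =
       NC (inv_ntr (PC C ta rh)) (HO Ga si) \<cdot>[P0 C (tgt1 L ta)] l Ga nu (ta \<star>[L] rh) si ((al \<triangleright>[L] rh) \<bullet>[L] be)"
    using Rl unfolding ran_spec_def by blast+
  have lR: "FA (P1 C ta) (l Ga nu' rh si be) \<cdot>[P0 C r] HA (R Ga) (nu, ta, al) =
       NC (inv_ntr (PC C ta rh)) (HO Ga si) \<cdot>[P0 C r] l Ga nu (ta \<star>[L] rh) si ((al \<triangleright>[L] rh) \<bullet>[L] be)"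
    if "codext_obj L C ?p Ga" "nu \<in> Cell1 L" "tgt1 L nu = ?q" "ta \<in> Cell1 L" "src1 L nu = tgt1 L ta" "al \<in> Cell2 L" "tgt2 L al = nu \<star>[L] ta"
      "nu' = src2 L al" "(rh, si, be) \<in> kV mu nu'" "r = tgt1 L ta" for Ga nu ta al rh si be nu' r
    using lR0[OF that(1-7)] that(8-10) by simp
  have l: "l Ga nu rh si al \<in> Ar (P0 C r)" "Src (P0 C r) (l Ga nu rh si al) = HO (R Ga) nu" "Tgt (P0 C r) (l Ga nu rh si al) = FO (P1 C rh) (HO Ga si)"
    if "codext_obj L C ?p Ga" "nu \<in> Cell1 L" "tgt1 L nu = ?q" "(rh, si, al) \<in> kV mu nu" "r = src1 L nu" for Ga nu rh si al r
    using kanD(2-4)[OF kan[OF that(1-3)] that(4,5)] by auto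
  have V1: "(id1 L (src1 L si), si, id2 L (mu \<star>[L] si)) \<in> kV mu (mu \<star>[L] si)" if "si \<in> Cell1 L" "tgt1 L si = ?p" for si
    using that mu by (simp add: kV_iff)
  have V2: "(ta, src2 L al, mu \<triangleleft>[L] al) \<in> kV mu (mu \<star>[L] si)"
    if "si \<in> Cell1 L" "tgt1 L si = ?p" "ta \<in> Cell1 L" "src1 L si = tgt1 L ta" "al \<in> Cell2 L" "tgt2 L al = si \<star>[L] ta" for si ta al
    using that mu by (simp add: kV_iff)
  \<comment> \<open>At \<open>\<sigma>\<close>, the leg indexed by the identity of
    \<open>\<mu> \<sigma>\<close>, read as a 2-cell into \<open>(\<mu> \<sigma>) 1\<close>, followed
    by the inverse of \<open>PU\<close>.\<close>
  define ep where "ep Ga = \<lparr>HDom = restr_obj L mu (R Ga), HCod = Ga,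
    HM = (\<lambda>si \<in> into L ?p. NC (inv_ntr (PU C (src1 L si))) (HO Ga si) \<cdot>[P0 C (src1 L si)] l Ga (mu \<star>[L] si) (id1 L (src1 L si)) si (id2 L (mu \<star>[L] si)))\<rparr>" for Ga
  have epD: "HDom (ep Ga) = restr_obj L mu (R Ga)" "HCod (ep Ga) = Ga" for Ga by (simp_all add: ep_def)
  have epM: "HM (ep Ga) si = NC (inv_ntr (PU C (src1 L si))) (HO Ga si) \<cdot>[P0 C (src1 L si)] l Ga (mu \<star>[L] si) (id1 L (src1 L si)) si (id2 L (mu \<star>[L] si))"
    if "si \<in> Cell1 L" "tgt1 L si = ?p" for Ga si using that by (simp add: ep_def into_def)
  \<comment> \<open>The 1-cell \<open>\<sigma>\<close> is written as \<open>src2 L al\<close> to fit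
    the compatibility axiom of a morphism; where a plain \<open>\<sigma>\<close> is meant,
    \<open>al\<close> is taken to be its identity 2-cell.\<close>
  have epl: "FA (P1 C ta) (HM (ep Ga) (src2 L al)) \<cdot>[P0 C (tgt1 L ta)] HA (R Ga) (nu, ta, be) = l Ga nu ta (src2 L al) be"
    if a: "codext_obj L C ?p Ga" "nu \<in> Cell1 L" "tgt1 L nu = ?q" "ta \<in> Cell1 L" "src1 L nu = tgt1 L ta"
      and b: "be \<in> Cell2 L" "tgt2 L be = nu \<star>[L] ta" "src2 L be = mu \<star>[L] src2 L al" and s: "src2 L al \<in> Cell1 L" "tgt1 L (src2 L al) = ?p" for Ga nu ta al be
  proof -
    let ?s = "src2 L al"
    have t: "src1 L ?s = src1 L ta" using arg_cong[OF b(3), of "src1 L"] cell21(1)[OF b(1)] b(2) a s mu by simp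
    have w: "(ta, ?s, be) \<in> kV mu nu" using a b s t mu by (simp add: kV_iff)
    have "FA (P1 C ta) (l Ga (mu \<star>[L] ?s) (id1 L (src1 L ?s)) ?s (id2 L (mu \<star>[L] ?s))) \<cdot>[P0 C (tgt1 L ta)] HA (R Ga) (nu, ta, be) =
       NC (inv_ntr (PC C ta (id1 L (src1 L ?s)))) (HO Ga ?s) \<cdot>[P0 C (tgt1 L ta)] l Ga nu (ta \<star>[L] id1 L (src1 L ?s)) ?s ((be \<triangleright>[L] id1 L (src1 L ?s)) \<bullet>[L] id2 L (mu \<star>[L] ?s))"
      by (rule lR) (use a b s t V1[of ?s] in simp_all)
    then have 1: "FA (P1 C ta) (l Ga (mu \<star>[L] ?s) (id1 L (src1 L ta)) ?s (id2 L (mu \<star>[L] ?s))) \<cdot>[P0 C (tgt1 L ta)] HA (R Ga) (nu, ta, be) =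
       NC (inv_ntr (PC C ta (id1 L (src1 L ta)))) (HO Ga ?s) \<cdot>[P0 C (tgt1 L ta)] l Ga nu ta ?s be" using a b t mu s by simp
    show ?thesis using a b s t mu l[OF a(1-3) w] l[OF a(1) _ _ V1[of ?s], of "src1 L ta"] R0[OF a(1)]
      by (simp add: epM 1 PCi_id(1)[THEN cmpE])
  qed
  have ep: "codext_mor L C ?p (ep Ga)" if Ga: "codext_obj L C ?p Ga" for Ga
  proof (rule codext_morI)
    show "HM (ep Ga) \<in> extensional (into L ?p)" by (simp add: ep_def)
  next
    fix si assume s: "si \<in> Cell1 L" "tgt1 L si = ?p"
    show "HM (ep Ga) si \<in> hom (P0 C (src1 L si)) (HO (HDom (ep Ga)) si) (HO (HCod (ep Ga)) si)"
      using l[OF Ga _ _ V1[OF s], of "src1 L si"] s mu Ga by (simp add: epM epD)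
  next
    fix si ta al assume a: "si \<in> Cell1 L" "tgt1 L si = ?p" "ta \<in> Cell1 L" "src1 L si = tgt1 L ta" "al \<in> Cell2 L" "tgt2 L al = si \<star>[L] ta"
    have s: "src2 L al \<in> Cell1 L" "tgt1 L (src2 L al) = ?p" "src1 L (src2 L al) = src1 L ta" using a by simp_all
    have m: "mu \<star>[L] si \<in> Cell1 L" "tgt1 L (mu \<star>[L] si) = ?q" "src1 L (mu \<star>[L] si) = tgt1 L ta" using a mu by simp_all
    have 1: "FA (P1 C ta) (HM (ep Ga) (src2 L al)) \<cdot>[P0 C (tgt1 L ta)] HA (R Ga) (mu \<star>[L] si, ta, mu \<triangleleft>[L] al) = l Ga (mu \<star>[L] si) ta (src2 L al) (mu \<triangleleft>[L] al)"
      by (rule epl) (use a s m mu Ga in simp_all)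
    note ty = l[OF Ga m(1,2) V1[OF a(1,2)], of "tgt1 L ta"] l[OF Ga m(1,2) V2[OF a], of "tgt1 L ta"]
    have "(NC (PC C (id1 L (src1 L si)) ta) (HO Ga (src2 L al)) \<cdot>[P0 C (tgt1 L ta)] FA (P1 C (id1 L (src1 L si))) (HA Ga (si, ta, al))) \<cdot>[P0 C (tgt1 L ta)] l Ga (mu \<star>[L] si) (id1 L (src1 L si)) si (id2 L (mu \<star>[L] si)) =
      l Ga (mu \<star>[L] si) (id1 L (src1 L si) \<star>[L] ta) (src2 L al) ((id2 L (mu \<star>[L] si) \<triangleright>[L] ta) \<bullet>[L] (mu \<triangleleft>[L] al))"
      by (rule kanD(6)[OF kan[OF Ga m(1,2)] V1[OF a(1,2)]]) (use a mu in simp_all)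
    then have 2: "NC (PC C (id1 L (tgt1 L ta)) ta) (HO Ga (src2 L al)) \<cdot>[P0 C (tgt1 L ta)] FA (P1 C (id1 L (tgt1 L ta))) (HA Ga (si, ta, al)) \<cdot>[P0 C (tgt1 L ta)] l Ga (mu \<star>[L] si) (id1 L (tgt1 L ta)) si (id2 L (mu \<star>[L] si)) =
      l Ga (mu \<star>[L] si) ta (src2 L al) (mu \<triangleleft>[L] al)"
      using a mu Ga ty m s by simp
    show "FA (P1 C ta) (HM (ep Ga) (src2 L al)) \<cdot>[P0 C (tgt1 L ta)] HA (HDom (ep Ga)) (si, ta, al) = HA (HCod (ep Ga)) (si, ta, al) \<cdot>[P0 C (tgt1 L ta)] HM (ep Ga) si"
      using a mu Ga ty m s by (simp add: epD 1 2[symmetric], simp add: epM PC_id PUi_L[THEN cmpE])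
  qed (use Ga R0 mu in "simp_all add: epD")
  have univ: "\<exists>!g. g \<in> hom (E ?q) \<Delta> (R Ga) \<and> ep Ga \<cdot>[E ?p] FA (codext_ftr L C mu) g = f"
    if \<Delta>: "codext_obj L C ?q \<Delta>" and Ga: "codext_obj L C ?p Ga" and f: "codext_mor L C ?p f" "HDom f = restr_obj L mu \<Delta>" "HCod f = Ga" for \<Delta> Ga f
  proof -
    \<comment> \<open>The value that the leg at \<open>al\<close> must take on the factorisation:
      the structure morphism of \<open>\<Delta>\<close>, then \<open>f\<close> under
      \<open>P1 C rh\<close>.\<close>
    let ?k = "\<lambda>nu rh si al. FA (P1 C rh) (HM f si) \<cdot>[P0 C (tgt1 L rh)] HA \<Delta> (nu, rh, al)"
    have ex: "\<exists>!h. h \<in> hom (P0 C (src1 L nu)) (HO \<Delta> nu) (HO (R Ga) nu) \<and> (\<forall>rh si al. (rh, si, al) \<in> kV mu nu \<longrightarrow> l Ga nu rh si al \<cdot>[P0 C (src1 L nu)] h = ?k nu rh si al)"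
      if n: "nu \<in> Cell1 L" "tgt1 L nu = ?q" for nu
    proof (rule kan_lift[OF mu n(1) Ga kan[OF Ga n]])
      show "HO \<Delta> nu \<in> Ob (P0 C (src1 L nu))" using \<Delta> n by simp
    next
      fix rh si al assume v: "(rh, si, al) \<in> kV mu nu"
      note v' = v[unfolded kV_iff]
      show "?k nu rh si al \<in> hom (P0 C (src1 L nu)) (HO \<Delta> nu) (FO (P1 C rh) (HO Ga si))" using v' n f \<Delta> mu by simp
      fix \<chi> ga assume g: "\<chi> \<in> Cell1 L" "tgt1 L \<chi> = src1 L rh" "ga \<in> Cell2 L" "tgt2 L ga = si \<star>[L] \<chi>"
      have rn: "tgt1 L rh = src1 L nu" using v' by simp
      have g': "src1 L (src2 L ga) = src1 L \<chi>" "tgt1 L (src2 L ga) = src1 L mu" using g v' by simp_all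
      have 1: "FA (P1 C \<chi>) (HM f (src2 L ga)) \<cdot>[P0 C (src1 L rh)] HA \<Delta> (mu \<star>[L] si, \<chi>, mu \<triangleleft>[L] ga) = HA Ga (si, \<chi>, ga) \<cdot>[P0 C (src1 L rh)] HM f si"
      proof -
        have "FA (P1 C \<chi>) (HM f (src2 L ga)) \<cdot>[P0 C (src1 L rh)] HA (restr_obj L mu \<Delta>) (si, \<chi>, ga) = HA (HCod f) (si, \<chi>, ga) \<cdot>[P0 C (src1 L rh)] HM f si"
          by (rule HM_HA) (use f g v' in simp_all)
        then show ?thesis using f(3) g v' by simp
      qed
      have 2: "FA (P1 C rh) (HA Ga (si, \<chi>, ga)) \<cdot>[P0 C (tgt1 L rh)] FA (P1 C rh) (HM f si) = FA (P1 C rh) (FA (P1 C \<chi>) (HM f (src2 L ga))) \<cdot>[P0 C (tgt1 L rh)] FA (P1 C rh) (HA \<Delta> (mu \<star>[L] si, \<chi>, mu \<triangleleft>[L] ga))"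
        using arg_cong[OF 1, of "FA (P1 C rh)"] f g g' v' mu \<Delta> Ga by simp
      have 3: "NC (PC C rh \<chi>) (HO \<Delta> (mu \<star>[L] src2 L ga)) \<cdot>[P0 C (tgt1 L rh)] FA (P1 C rh) (HA \<Delta> (mu \<star>[L] si, \<chi>, mu \<triangleleft>[L] ga)) \<cdot>[P0 C (tgt1 L rh)] HA \<Delta> (nu, rh, al) =
        HA \<Delta> (nu, rh \<star>[L] \<chi>, (al \<triangleright>[L] \<chi>) \<bullet>[L] (mu \<triangleleft>[L] ga))"
        by (rule HA_cmp) (use f g g' v' mu \<Delta> Ga n in simp_all)
      show "(NC (PC C rh \<chi>) (HO Ga (src2 L ga)) \<cdot>[P0 C (src1 L nu)] FA (P1 C rh) (HA Ga (si, \<chi>, ga))) \<cdot>[P0 C (src1 L nu)] ?k nu rh si al =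
        ?k nu (rh \<star>[L] \<chi>) (src2 L ga) ((al \<triangleright>[L] \<chi>) \<bullet>[L] (mu \<triangleleft>[L] ga))"
        using f g g' v' mu \<Delta> Ga n by (simp add: 2[unfolded rn, THEN cmpE] 3[unfolded rn, symmetric] PC_L[THEN cmpE])
    next
      fix si al be assume v: "(src2 L be, si, al) \<in> kV mu nu" and b: "be \<in> Cell2 L"
      note v' = v[unfolded kV_iff]
      show "NC (P2 C be) (HO Ga si) \<cdot>[P0 C (src1 L nu)] ?k nu (src2 L be) si al = ?k nu (tgt2 L be) si ((nu \<triangleleft>[L] be) \<bullet>[L] al)"
      proof -
        have "NC (P2 C be) (HO \<Delta> (mu \<star>[L] si)) \<cdot>[P0 C (src1 L nu)] HA \<Delta> (nu, src2 L be, al) = HA \<Delta> (nu, tgt2 L be, (nu \<triangleleft>[L] be) \<bullet>[L] al)"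
          by (rule HA_2cell) (use v' b n \<Delta> in simp_all)
        then show ?thesis using v' b n f \<Delta> Ga mu cell21[OF b] by (simp add: P2_R[THEN cmpE])
      qed
    qed
    then obtain h where h: "!!nu. nu \<in> Cell1 L ==> tgt1 L nu = ?q ==> h nu \<in> hom (P0 C (src1 L nu)) (HO \<Delta> nu) (HO (R Ga) nu)"
      "!!nu rh si al. nu \<in> Cell1 L ==> tgt1 L nu = ?q ==> (rh, si, al) \<in> kV mu nu ==> l Ga nu rh si al \<cdot>[P0 C (src1 L nu)] h nu = ?k nu rh si al"
      by metis
    have ht: "h nu \<in> Ar (P0 C r)" "Src (P0 C r) (h nu) = HO \<Delta> nu" "Tgt (P0 C r) (h nu) = HO (R Ga) nu" if "nu \<in> Cell1 L" "tgt1 L nu = ?q" "r = src1 L nu" for nu r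
      using h(1)[OF that(1,2)] that(3) by simp_all
    have hl: "l Ga nu rh si al \<cdot>[P0 C r] h nu = ?k nu rh si al" if "nu \<in> Cell1 L" "tgt1 L nu = ?q" "(rh, si, al) \<in> kV mu nu" "r = src1 L nu" for nu rh si al r
      using h(2)[OF that(1-3)] that(4) by simp
    define g where "g = \<lparr>HDom = \<Delta>, HCod = R Ga, HM = restrict h (into L ?q)\<rparr>"
    have gD: "HDom g = \<Delta>" "HCod g = R Ga" by (simp_all add: g_def)
    have gM: "HM g nu = h nu" if "nu \<in> Cell1 L" "tgt1 L nu = ?q" for nu using that by (simp add: g_def into_def)
    have g: "codext_mor L C ?q g"
    proof (rule codext_morI)
      show "HM g \<in> extensional (into L ?q)" by (simp add: g_def)
    next
      fix nu ta al assume a: "nu \<in> Cell1 L" "tgt1 L nu = ?q" "ta \<in> Cell1 L" "src1 L nu = tgt1 L ta" "al \<in> Cell2 L" "tgt2 L al = nu \<star>[L] ta"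
      have s: "src2 L al \<in> Cell1 L" "tgt1 L (src2 L al) = ?q" "src1 L (src2 L al) = src1 L ta" using a by simp_all
      have "FA (P1 C ta) (h (src2 L al)) \<cdot>[P0 C (tgt1 L ta)] HA \<Delta> (nu, ta, al) = HA (R Ga) (nu, ta, al) \<cdot>[P0 C (tgt1 L ta)] h nu"
      proof (rule kan_image_monic[OF mu s(1) Ga kan[OF Ga s(1,2)] a(3), of _ "HO \<Delta> nu"])
        fix rh si be assume v: "(rh, si, be) \<in> kV mu (src2 L al)"
        note v' = v[unfolded kV_iff]
        have w: "(ta \<star>[L] rh, si, (al \<triangleright>[L] rh) \<bullet>[L] be) \<in> kV mu nu" using a v' mu by (simp add: kV_iff)
        have 1: "FA (P1 C ta) (l Ga (src2 L al) rh si be) \<cdot>[P0 C (tgt1 L ta)] HA (R Ga) (nu, ta, al) =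
          NC (inv_ntr (PC C ta rh)) (HO Ga si) \<cdot>[P0 C (tgt1 L ta)] l Ga nu (ta \<star>[L] rh) si ((al \<triangleright>[L] rh) \<bullet>[L] be)" by (rule lR) (use a v Ga in simp_all)
        have 2: "l Ga nu (ta \<star>[L] rh) si ((al \<triangleright>[L] rh) \<bullet>[L] be) \<cdot>[P0 C (tgt1 L ta)] h nu = FA (P1 C (ta \<star>[L] rh)) (HM f si) \<cdot>[P0 C (tgt1 L ta)] HA \<Delta> (nu, ta \<star>[L] rh, (al \<triangleright>[L] rh) \<bullet>[L] be)"
          using hl[OF a(1,2) w, of "tgt1 L ta"] a v' by simp
        have 3: "NC (PC C ta rh) (HO \<Delta> (mu \<star>[L] si)) \<cdot>[P0 C (tgt1 L ta)] FA (P1 C ta) (HA \<Delta> (src2 L al, rh, be)) \<cdot>[P0 C (tgt1 L ta)] HA \<Delta> (nu, ta, al) =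
          HA \<Delta> (nu, ta \<star>[L] rh, (al \<triangleright>[L] rh) \<bullet>[L] be)"
          by (rule HA_cmp) (use a v' s \<Delta> in simp_all)
        have 4: "FA (P1 C ta) (l Ga (src2 L al) rh si be) \<cdot>[P0 C (tgt1 L ta)] FA (P1 C ta) (h (src2 L al)) = FA (P1 C ta) (FA (P1 C rh) (HM f si)) \<cdot>[P0 C (tgt1 L ta)] FA (P1 C ta) (HA \<Delta> (src2 L al, rh, be))"
          using arg_cong[OF hl[OF s(1,2) v, of "src1 L ta"], of "FA (P1 C ta)"] l[OF Ga s(1,2) v, of "src1 L ta"] a s v' f \<Delta> mu by (simp add: ht)
        note ty = l[OF Ga s(1,2) v, of "src1 L ta"] l[OF Ga a(1,2) w, of "tgt1 L ta"]
        show "FA (P1 C ta) (l Ga (src2 L al) rh si be) \<cdot>[P0 C (tgt1 L ta)] FA (P1 C ta) (h (src2 L al)) \<cdot>[P0 C (tgt1 L ta)] HA \<Delta> (nu, ta, al) =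
          FA (P1 C ta) (l Ga (src2 L al) rh si be) \<cdot>[P0 C (tgt1 L ta)] HA (R Ga) (nu, ta, al) \<cdot>[P0 C (tgt1 L ta)] h nu"
          using ty a s v' f \<Delta> Ga mu R0[OF Ga] by (simp add: ht 1[THEN cmpE] 2 4[THEN cmpE] 3[symmetric] PCi_R[THEN cmpE] PC_inv[THEN cmpE])
      qed (use a s \<Delta> Ga R0 in "simp_all add: ht")
      then show "FA (P1 C ta) (HM g (src2 L al)) \<cdot>[P0 C (tgt1 L ta)] HA (HDom g) (nu, ta, al) = HA (HCod g) (nu, ta, al) \<cdot>[P0 C (tgt1 L ta)] HM g nu"
        using a s by (simp add: gD gM)
    qed (use \<Delta> Ga R0 in "simp_all add: gD gM ht")
    have gf: "ep Ga \<cdot>[E ?p] FA (codext_ftr L C mu) g = f"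
    proof (rule hmor_eqI[of ?p])
      fix si assume s: "si \<in> Cell1 L" "tgt1 L si = ?p"
      have "l Ga (mu \<star>[L] si) (id1 L (src1 L si)) si (id2 L (mu \<star>[L] si)) \<cdot>[P0 C (src1 L si)] h (mu \<star>[L] si) = ?k (mu \<star>[L] si) (id1 L (src1 L si)) si (id2 L (mu \<star>[L] si))"
        by (rule hl[OF _ _ V1[OF s]]) (use s mu in simp_all)
      moreover have "HA \<Delta> (mu \<star>[L] si, id1 L (src1 L si), id2 L (mu \<star>[L] si)) = NC (PU C (src1 L si)) (HO \<Delta> (mu \<star>[L] si))"
        by (rule HA_id) (use s mu \<Delta> in simp_all)
      ultimately show "HM (ep Ga \<cdot>[E ?p] FA (codext_ftr L C mu) g) si = HM f si"
        using s mu g gD \<Delta> Ga f l[OF Ga _ _ V1[OF s], of "src1 L si"]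
        by (simp add: gM ht epM PUi_R[THEN cmpE] PU_inv)
    qed (use g gD mu Ga \<Delta> f R0 epD ep in "simp_all add: E_cmp")
    show ?thesis
    proof (rule ex1I[of _ g])
      show "g \<in> hom (E ?q) \<Delta> (R Ga) \<and> ep Ga \<cdot>[E ?p] FA (codext_ftr L C mu) g = f" using g gD gf by simp
      fix g' assume "g' \<in> hom (E ?q) \<Delta> (R Ga) \<and> ep Ga \<cdot>[E ?p] FA (codext_ftr L C mu) g' = f"
      then have g': "codext_mor L C ?q g'" "HDom g' = \<Delta>" "HCod g' = R Ga" and gf': "ep Ga \<cdot>[E ?p] FA (codext_ftr L C mu) g' = f" by simp_all
      show "g' = g"
      proof (rule hmor_eqI[of ?q])
        fix nu assume n: "nu \<in> Cell1 L" "tgt1 L nu = ?q"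
        \<comment> \<open>By \<open>epl\<close> a leg after \<open>g'\<close> depends only on
          \<open>g'\<close> followed by the universal arrow, so \<open>g'\<close> solves the lifting
          problem that determines \<open>h\<close>.\<close>
        have "l Ga nu rh si al \<cdot>[P0 C (src1 L nu)] HM g' nu = ?k nu rh si al" if v: "(rh, si, al) \<in> kV mu nu" for rh si al
        proof -
          note v' = v[unfolded kV_iff]
          have 1: "HM f si = HM (ep Ga) si \<cdot>[P0 C (src1 L si)] HM g' (mu \<star>[L] si)"
            using arg_cong[OF gf', of "\<lambda>t. HM t si"] v' g' mu by simp
          have 2: "FA (P1 C rh) (HM (ep Ga) si) \<cdot>[P0 C (src1 L nu)] HA (R Ga) (nu, rh, al) = l Ga nu rh si al"
            using epl[of Ga nu rh al "id2 L si"] Ga n v' by simp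
          show ?thesis using 1 v' n g' Ga \<Delta> mu ep[OF Ga] epD[of Ga] R0[OF Ga] by (simp add: HM_HA 2[THEN cmpE])
        qed
        then show "HM g' nu = HM g nu" using ex[OF n] h(1)[OF n] h(2)[OF n] g' n gM[OF n] by (metis (no_types, lifting) HM hom_iff)
      qed (use g g' gD in simp_all)
    qed
  qed
  show ?thesis
  proof (rule universal_arrows_adjn[where r = R and e = ep])
    fix x y f assume "x \<in> Ob (E ?q)" "y \<in> Ob (E ?p)" "f \<in> hom (E ?p) (FO (codext_ftr L C mu) x) y"
    then show "\<exists>!g. g \<in> hom (E ?q) x (R y) \<and> ep y \<cdot>[E ?p] FA (codext_ftr L C mu) g = f"
      using univ[of x y f] mu by simp
  qed (use mu R0 ep epD in simp_all)
qed

lemma codext_adj_pfun: "adj_pfun kp L (codext kp L C)"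
  unfolding adj_pfun_def codext_simps using codext_pseudofunctor restriction_adjn adjn_has_radj codext_ftr_lex by metis

end

section \<open>The canonical transformation\<close>

context codk begin

sublocale H: hctx kp L "codext kp L C" C
  by unfold_locales (use two codext_adj_pfun psf in simp_all)

lemma canon_ftr_ev: "p \<in> Cell0 L ==> canon_ftr L C p = ev p (id1 L p)"
  by (simp add: canon_ftr_def ev_def)

text \<open>The 2-cells of \<open>canon\<close> are written in the shape of \<open>htrf\<close>,
  with the structure morphism at the identity 2-cell \<open>f \<Rightarrow> 1 f\<close> as half
  form. Colaxness thus reduces to \<open>H1\<close>, \<open>H2\<close> and \<open>H3\<close> for
  this half form.\<close>

lemma canon_htrf: "canon kp L C = htrf kp L (codext kp L C) C (\<lambda>p. ev p (id1 L p)) (\<lambda>f Ga. HA Ga (id1 L (tgt1 L f), f, id2 L f))"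
proof -
  have "codext_mor L C (src1 L f) (H.e f Ga)" if "f \<in> Cell1 L" "codext_obj L C (src1 L f) Ga" for f Ga
    using nattrans_simps(1)[OF H.R(8)[OF that(1)], of "P0 (codext kp L C) (src1 L f)" Ga] that by (simp add: codext_simps(1))
  then have 1: "FA (ev p (id1 L p)) (H.e f Ga) = HM (H.e f Ga) (id1 L p)" if "f \<in> Cell1 L" "codext_obj L C p Ga" "p = src1 L f" for f Ga p
    using that by simp
  show ?thesis
    unfolding canon_def htrf_def
    by (auto simp: canon_ftr_ev Let_def codext_simps restrict_def fun_eq_iff 1[unfolded codext_simps])
qed

text \<open>The half-form axioms are instances of the axioms of an object: \<open>H2\<close> of the
  composition axiom, \<open>H3\<close> of the identity axiom. In \<open>H1\<close> both sides equal
  the structure morphism at \<open>(1, f', al)\<close>, reached on one side by \<open>tr_HA\<close>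
  and on the other by \<open>HA_2cell\<close>.\<close>

lemma canon_hcolax: "hcolax kp L (codext kp L C) C (\<lambda>p. ev p (id1 L p)) (\<lambda>f Ga. HA Ga (id1 L (tgt1 L f), f, id2 L f))"
proof unfold_locales
  fix f u assume "f \<in> Cell1 L" "u \<in> Ar (P0 (codext kp L C) (tgt1 L f))"
  then show "FA (P1 C f) (FA (ev (src1 L f) (id1 L (src1 L f))) (FA (P1 (codext kp L C) f) u)) \<cdot>[P0 C (tgt1 L f)]
      HA (Src (P0 (codext kp L C) (tgt1 L f)) u) (id1 L (tgt1 L f), f, id2 L f) =
    HA (Tgt (P0 (codext kp L C) (tgt1 L f)) u) (id1 L (tgt1 L f), f, id2 L f) \<cdot>[P0 C (tgt1 L f)] FA (ev (tgt1 L f) (id1 L (tgt1 L f))) u"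
    by (simp add: codext_simps HM_HA)
next
  fix al Ga f' p q
  assume a: "al \<in> Cell2 L" "Ga \<in> Ob (P0 (codext kp L C) (tgt1 L (tgt2 L al)))" "f' = tgt2 L al" "p = src1 L f'" "q = tgt1 L f'"
  have 1: "FA (P1 C (tgt2 L al)) (tr Ga al) \<cdot>[P0 C (tgt1 L (tgt2 L al))] HA Ga (id1 L (tgt1 L (tgt2 L al)), tgt2 L al, id2 L (tgt2 L al)) =
    HA Ga (id1 L (tgt1 L (tgt2 L al)), tgt2 L al, id2 L (tgt2 L al) \<bullet>[L] al)"
    by (rule tr_HA) (use a in "simp_all add: codext_simps")
  have 2: "NC (P2 C al) (HO Ga (src2 L al)) \<cdot>[P0 C (tgt1 L (tgt2 L al))] HA Ga (id1 L (tgt1 L (tgt2 L al)), src2 L al, id2 L (src2 L al)) =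
    HA Ga (id1 L (tgt1 L (tgt2 L al)), tgt2 L al, (id1 L (tgt1 L (tgt2 L al)) \<triangleleft>[L] al) \<bullet>[L] id2 L (src2 L al))"
    by (rule HA_2cell) (use a in "simp_all add: codext_simps")
  show "FA (P1 C f') (FA (ev p (id1 L p)) (NC (P2 (codext kp L C) al) Ga)) \<cdot>[P0 C q] HA Ga (id1 L (tgt1 L f'), f', id2 L f') =
    NC (P2 C al) (FO (ev p (id1 L p)) (FO (P1 (codext kp L C) (src2 L al)) Ga)) \<cdot>[P0 C q] HA Ga (id1 L (tgt1 L (src2 L al)), src2 L al, id2 L (src2 L al))"
    using a 1 2 by (simp add: codext_simps)
next
  fix f g Ga assume a: "f \<in> Cell1 L" "g \<in> Cell1 L" "src1 L g = tgt1 L f" "Ga \<in> Ob (P0 (codext kp L C) (tgt1 L g))"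
  have "NC (PC C g f) (HO Ga (g \<star>[L] f)) \<cdot>[P0 C (tgt1 L g)] FA (P1 C g) (HA Ga (g, f, id2 L (g \<star>[L] f))) \<cdot>[P0 C (tgt1 L g)] HA Ga (id1 L (tgt1 L g), g, id2 L g) =
    HA Ga (id1 L (tgt1 L g), g \<star>[L] f, (id2 L g \<triangleright>[L] f) \<bullet>[L] id2 L (g \<star>[L] f))"
    by (rule HA_cmp) (use a in "simp_all add: codext_simps")
  then show "HA Ga (id1 L (tgt1 L (g \<star>[L] f)), g \<star>[L] f, id2 L (g \<star>[L] f)) =
    FA (P1 C (g \<star>[L] f)) (FA (ev (src1 L f) (id1 L (src1 L f))) (NC (PC (codext kp L C) f g) Ga)) \<cdot>[P0 C (tgt1 L g)]
      NC (PC C g f) (FO (ev (src1 L f) (id1 L (src1 L f))) (FO (P1 (codext kp L C) f) (FO (P1 (codext kp L C) g) Ga))) \<cdot>[P0 C (tgt1 L g)]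
      FA (P1 C g) (HA (FO (P1 (codext kp L C) g) Ga) (id1 L (tgt1 L f), f, id2 L f)) \<cdot>[P0 C (tgt1 L g)] HA Ga (id1 L (tgt1 L g), g, id2 L g)"
    using a by (simp add: codext_simps E_id restr_restr)
next
  fix p Ga assume "p \<in> Cell0 L" "Ga \<in> Ob (P0 (codext kp L C) p)"
  then show "HA Ga (id1 L (tgt1 L (id1 L p)), id1 L p, id2 L (id1 L p)) =
    FA (P1 C (id1 L p)) (FA (ev p (id1 L p)) (NC (PU (codext kp L C) p) Ga)) \<cdot>[P0 C p] NC (PU C p) (FO (ev p (id1 L p)) Ga)"
    by (simp add: codext_simps E_id restr_id HA_id)
qed (simp_all add: codext_simps)

lemma canon_colax: "colax kp L (canon kp L C)" "TDom (canon kp L C) = U0 kp L (codext kp L C)" "TCod (canon kp L C) = C"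
  "p \<in> Cell0 L ==> T1 (canon kp L C) p = ev p (id1 L p)"
  "f \<in> Cell1 L ==> codext_obj L C (tgt1 L f) Ga ==> hlf kp L (codext kp L C) (canon kp L C) f Ga = HA Ga (id1 L (tgt1 L f), f, id2 L f)"
proof -
  interpret c: hcolax kp L "codext kp L C" C "\<lambda>p. ev p (id1 L p)" "\<lambda>f Ga. HA Ga (id1 L (tgt1 L f), f, id2 L f)" by (rule canon_hcolax)
  show "colax kp L (canon kp L C)" "TDom (canon kp L C) = U0 kp L (codext kp L C)" "TCod (canon kp L C) = C"
    "p \<in> Cell0 L ==> T1 (canon kp L C) p = ev p (id1 L p)"
    using c.htrf_colax by (simp_all add: canon_htrf)
  show "f \<in> Cell1 L ==> codext_obj L C (tgt1 L f) Ga ==> hlf kp L (codext kp L C) (canon kp L C) f Ga = HA Ga (id1 L (tgt1 L f), f, id2 L f)"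
    unfolding canon_htrf using c.hlf_htrf[of f Ga] by (simp add: codext_simps)
qed

end

section \<open>Extending colax transformations to the co-dextrification\<close>

locale extl = codk kp L C + h: hcolax kp L D C T \<phi>
  for kp :: "'k rel" and L :: "('p, 'f, 'a) twocat" and C :: "('p, 'f, 'a, 'o, 'm) catpfun"
    and D :: "('p, 'f, 'a, 'od, 'md) catpfun" and T \<phi>
begin

text \<open>For \<open>\<alpha> : \<mu> \<Rightarrow> \<nu> \<rho>\<close> the structure morphism is
  \<open>\<phi>\<close> at \<open>D^\<nu> d\<close>, followed, under \<open>C_\<rho>\<close> and
  \<open>T\<close>, by the coherence from \<open>D^\<rho> D^\<nu>\<close> to
  \<open>D^(\<nu> \<rho>)\<close> and by \<open>D^\<alpha>\<close>, which leads on to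
  \<open>D^\<mu>\<close> because \<open>D\<close> reverses 2-cells.\<close>

definition "ext_obj q d = \<lparr>HO = (\<lambda>mu \<in> into L q. FO (T (src1 L mu)) (FO (P1 D mu) d)),
  HA = (\<lambda>(nu, rh, al) \<in> decomp L q. FA (P1 C rh) (FA (T (src1 L rh)) (NC (P2 D al) d)) \<cdot>[P0 C (tgt1 L rh)]
     FA (P1 C rh) (FA (T (src1 L rh)) (NC (PC D rh nu) d)) \<cdot>[P0 C (tgt1 L rh)] \<phi> rh (FO (P1 D nu) d))\<rparr>"

lemma ext_obj [simp]:
  "mu \<in> Cell1 L ==> tgt1 L mu = q ==> HO (ext_obj q d) mu = FO (T (src1 L mu)) (FO (P1 D mu) d)"
  "nu \<in> Cell1 L ==> tgt1 L nu = q ==> rh \<in> Cell1 L ==> src1 L nu = tgt1 L rh ==> al \<in> Cell2 L ==> tgt2 L al = nu \<star>[L] rh ==>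
    HA (ext_obj q d) (nu, rh, al) = FA (P1 C rh) (FA (T (src1 L rh)) (NC (P2 D al) d)) \<cdot>[P0 C (tgt1 L rh)]
     FA (P1 C rh) (FA (T (src1 L rh)) (NC (PC D rh nu) d)) \<cdot>[P0 C (tgt1 L rh)] \<phi> rh (FO (P1 D nu) d)"
  by (simp_all add: ext_obj_def into_def decomp_def)

text \<open>The identity, composition and 2-cell axioms of an object come from \<open>H3\<close>,
  \<open>H2\<close> and \<open>H1\<close> respectively, together with the matching axioms of
  \<open>D\<close>.\<close>

lemma ext_codext_obj [simp]:
  assumes d: "d \<in> Ob (P0 D q)"
  shows "codext_obj L C q (ext_obj q d)"
proof (rule codext_objI)
  show "HO (ext_obj q d) \<in> extensional (into L q)" "HA (ext_obj q d) \<in> extensional (decomp L q)" by (simp_all add: ext_obj_def)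
next
  fix mu assume m: "mu \<in> Cell1 L" "tgt1 L mu = q"
  have 1: "NC (PC D (id1 L (src1 L mu)) mu) d \<cdot>[P0 D (src1 L mu)] NC (PU D (src1 L mu)) (FO (P1 D mu) d) = Idn (P0 D (src1 L mu)) (FO (P1 D mu) d)"
    by (rule h.D_unit) (use m d in simp_all)
  show "HA (ext_obj q d) (mu, id1 L (src1 L mu), id2 L mu) = NC (PU C (src1 L mu)) (HO (ext_obj q d) mu)"
    using m d h.D.P2_id[of mu d] by (simp add: h.H3 1[THEN FA_eq, THEN FA_eq, THEN cmpE])
next
  fix rh al \<pi> si be assume a: "rh \<in> Cell1 L" "\<pi> \<in> Cell1 L" "tgt1 L \<pi> = q" "si \<in> Cell1 L" "src1 L \<pi> = tgt1 L si"
      "src1 L si = tgt1 L rh" "be \<in> Cell2 L" "tgt2 L be = \<pi> \<star>[L] si" "al \<in> Cell2 L" "tgt2 L al = src2 L be \<star>[L] rh"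
  show "NC (PC C si rh) (HO (ext_obj q d) (src2 L al)) \<cdot>[P0 C (tgt1 L si)] FA (P1 C si) (HA (ext_obj q d) (src2 L be, rh, al)) \<cdot>[P0 C (tgt1 L si)] HA (ext_obj q d) (\<pi>, si, be) =
      HA (ext_obj q d) (\<pi>, si \<star>[L] rh, (be \<triangleright>[L] rh) \<bullet>[L] al)"
  proof -
    have e1: "NC (P2 D (be \<triangleright>[L] rh)) d \<cdot>[P0 D (src1 L rh)] NC (PC D rh (\<pi> \<star>[L] si)) d = NC (PC D rh (src2 L be)) d \<cdot>[P0 D (src1 L rh)] FA (P1 D rh) (NC (P2 D be) d)"
      by (rule h.D_rwh) (use a d in simp_all)
    have e2: "NC (PC D (si \<star>[L] rh) \<pi>) d \<cdot>[P0 D (src1 L rh)] NC (PC D rh si) (FO (P1 D \<pi>) d) = NC (PC D rh (\<pi> \<star>[L] si)) d \<cdot>[P0 D (src1 L rh)] FA (P1 D rh) (NC (PC D si \<pi>) d)"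
      by (rule h.D_assoc) (use a d in simp_all)
    note H = h.H2[of rh si "FO (P1 D \<pi>) d"]
    show ?thesis using a d
      by (simp add: h.\<phi>_R h.\<phi>_R[THEN FA_eq] h.\<phi>_R[THEN FA_eq, THEN cmpE] PC_R PC_R[THEN cmpE] h.D_vcmp,
          simp add: H e2[THEN FA_eq, THEN FA_eq, THEN cmpE] e1[THEN FA_eq, THEN FA_eq, THEN cmpE])
  qed
next
  fix nu al be assume a: "nu \<in> Cell1 L" "tgt1 L nu = q" "src1 L nu = tgt1 L (tgt2 L be)" "al \<in> Cell2 L"
      "be \<in> Cell2 L" "tgt2 L al = nu \<star>[L] src2 L be"
  show "NC (P2 C be) (HO (ext_obj q d) (src2 L al)) \<cdot>[P0 C (tgt1 L (tgt2 L be))] HA (ext_obj q d) (nu, src2 L be, al) =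
      HA (ext_obj q d) (nu, tgt2 L be, (nu \<triangleleft>[L] be) \<bullet>[L] al)"
  proof -
    have e: "NC (P2 D (nu \<triangleleft>[L] be)) d \<cdot>[P0 D (src1 L (tgt2 L be))] NC (PC D (tgt2 L be) nu) d = NC (PC D (src2 L be) nu) d \<cdot>[P0 D (src1 L (tgt2 L be))] NC (P2 D be) (FO (P1 D nu) d)"
      by (rule h.D_lwh) (use a d in simp_all)
    show ?thesis using a d
      by (simp add: P2_R[THEN cmpE] h.H1[symmetric] h.D_vcmp e[THEN FA_eq, THEN FA_eq, THEN cmpE])
  qed
qed (use d in simp_all)

text \<open>By \<open>H3\<close> the half form at an identity 1-cell consists of \<open>PU C\<close>
  and \<open>PU D\<close>. The former cancels against its inverse in \<open>tr\<close>, the latter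
  against \<open>PC D\<close>, and the action of \<open>D\<close> is left.\<close>

lemma tr_ext:
  assumes "ga \<in> Cell2 L" "tgt1 L (tgt2 L ga) = q" "d \<in> Ob (P0 D q)"
  shows "tr (ext_obj q d) ga = FA (T (src1 L (tgt2 L ga))) (NC (P2 D ga) d)"
proof -
  let ?p = "src1 L (tgt2 L ga)"
  have 1: "NC (PC D (id1 L ?p) (tgt2 L ga)) d \<cdot>[P0 D ?p] NC (PU D ?p) (FO (P1 D (tgt2 L ga)) d) = Idn (P0 D ?p) (FO (P1 D (tgt2 L ga)) d)"
    by (rule h.D_unit) (use assms in simp_all)
  show ?thesis using assms
    by (simp add: tr_def h.H3 1[THEN FA_eq, THEN FA_eq, THEN cmpE] PUi_R PUi_R[THEN cmpE] PU_inv)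
qed

definition "ext_ftr q = \<lparr>FDom = P0 D q, FCod = E q, FO = (\<lambda>d \<in> Ob (P0 D q). ext_obj q d),
  FA = (\<lambda>u \<in> Ar (P0 D q). \<lparr>HDom = ext_obj q (Src (P0 D q) u), HCod = ext_obj q (Tgt (P0 D q) u),
     HM = (\<lambda>mu \<in> into L q. FA (T (src1 L mu)) (FA (P1 D mu) u))\<rparr>)\<rparr>"

lemma ext_ftr_simps [simp]:
  "FDom (ext_ftr q) = P0 D q" "FCod (ext_ftr q) = E q" "d \<in> Ob (P0 D q) ==> FO (ext_ftr q) d = ext_obj q d"
  "u \<in> Ar (P0 D q) ==> HDom (FA (ext_ftr q) u) = ext_obj q (Src (P0 D q) u)"
  "u \<in> Ar (P0 D q) ==> HCod (FA (ext_ftr q) u) = ext_obj q (Tgt (P0 D q) u)"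
  "u \<in> Ar (P0 D q) ==> mu \<in> Cell1 L ==> tgt1 L mu = q ==> HM (FA (ext_ftr q) u) mu = FA (T (src1 L mu)) (FA (P1 D mu) u)"
  by (simp_all add: ext_ftr_def into_def)

lemma ext_ftr_mor [simp]:
  assumes "q \<in> Cell0 L" "u \<in> Ar (P0 D q)"
  shows "codext_mor L C q (FA (ext_ftr q) u)"
proof (rule codext_morI)
  show "HM (FA (ext_ftr q) u) \<in> extensional (into L q)" using assms by (simp add: ext_ftr_def)
next
  fix nu rh al assume a: "nu \<in> Cell1 L" "tgt1 L nu = q" "rh \<in> Cell1 L" "src1 L nu = tgt1 L rh" "al \<in> Cell2 L" "tgt2 L al = nu \<star>[L] rh"
  let ?p = "src1 L rh" and ?a = "Src (P0 D q) u" and ?b = "Tgt (P0 D q) u"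
  have e1: "FA (P1 D (src2 L al)) u \<cdot>[P0 D ?p] NC (P2 D al) ?a = NC (P2 D al) ?b \<cdot>[P0 D ?p] FA (P1 D (nu \<star>[L] rh)) u"
    using naturality[of "P2 D al" u "P0 D q" "P0 D ?p" ?a ?b] a assms by simp
  have e2: "FA (P1 D (nu \<star>[L] rh)) u \<cdot>[P0 D ?p] NC (PC D rh nu) ?a = NC (PC D rh nu) ?b \<cdot>[P0 D ?p] FA (P1 D rh) (FA (P1 D nu) u)"
    using naturality[of "PC D rh nu" u "P0 D q" "P0 D ?p" ?a ?b] a assms by simp
  show "FA (P1 C rh) (HM (FA (ext_ftr q) u) (src2 L al)) \<cdot>[P0 C (tgt1 L rh)] HA (HDom (FA (ext_ftr q) u)) (nu, rh, al) =
    HA (HCod (FA (ext_ftr q) u)) (nu, rh, al) \<cdot>[P0 C (tgt1 L rh)] HM (FA (ext_ftr q) u) nu"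
    using a assms by (simp add: e1[THEN FA_eq, THEN FA_eq, THEN cmpE] e2[THEN FA_eq, THEN FA_eq, THEN cmpE] h.\<phi>_R)
qed (use assms in simp_all)

lemma ext_ftr_functor [simp]:
  assumes q: "q \<in> Cell0 L" shows "is_functor (ext_ftr q)"
proof (rule functorI)
  show "FO (ext_ftr q) \<in> extensional (Ob (FDom (ext_ftr q)))" "FA (ext_ftr q) \<in> extensional (Ar (FDom (ext_ftr q)))"
    by (simp_all add: ext_ftr_def)
next
  fix d assume "d \<in> Ob (FDom (ext_ftr q))"
  then show "FA (ext_ftr q) (Idn (FDom (ext_ftr q)) d) = Idn (FCod (ext_ftr q)) (FO (ext_ftr q) d)"
    by - (rule hmor_eqI[of q]; use q in "simp add: E_id")
next
  fix u v assume "u \<in> Ar (FDom (ext_ftr q))" "v \<in> Ar (FDom (ext_ftr q))" "Src (FDom (ext_ftr q)) v = Tgt (FDom (ext_ftr q)) u"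
  then show "FA (ext_ftr q) (v \<cdot>[FDom (ext_ftr q)] u) = FA (ext_ftr q) v \<cdot>[FCod (ext_ftr q)] FA (ext_ftr q) u"
    by - (rule hmor_eqI[of q]; use q in "simp add: E_cmp")
qed (use q in simp_all)

text \<open>Evaluated at \<open>mu\<close> the extension is \<open>T\<close> after
  \<open>D^mu\<close>, a composite of lex functors.\<close>

lemma ext_ftr_lex [simp]:
  assumes q: "q \<in> Cell0 L" shows "lex_ftr kp (ext_ftr q)"
proof (rule lex_into_E)
  fix mu assume m: "mu \<in> Cell1 L" "tgt1 L mu = q"
  have "ev q mu \<odot> ext_ftr q = T (src1 L mu) \<odot> P1 D mu"
    by (rule ftr_eqI) (use q m in simp_all)
  then show "lex_ftr kp (ev q mu \<odot> ext_ftr q)" using q m by (simp add: lex_comp_ftr)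
qed (use q in simp_all)

text \<open>The 2-cell at \<open>mu\<close> compares the objects with values
  \<open>T (D^nu (D^mu d))\<close> and \<open>T (D^(mu nu) d)\<close> at \<open>nu\<close>. Its
  components are images of coherence isomorphisms of \<open>D\<close>, and therefore
  invertible.\<close>

definition "ext_trf = \<lparr>TDom = D, TCod = codext kp L C, T1 = restrict ext_ftr (Cell0 L),
  T2 = (\<lambda>mu \<in> Cell1 L. \<lparr>NDom = ext_ftr (src1 L mu) \<odot> P1 D mu, NCod = codext_ftr L C mu \<odot> ext_ftr (tgt1 L mu),
     NC = (\<lambda>d \<in> Ob (P0 D (tgt1 L mu)). \<lparr>HDom = ext_obj (src1 L mu) (FO (P1 D mu) d), HCod = restr_obj L mu (ext_obj (tgt1 L mu) d),
        HM = (\<lambda>nu \<in> into L (src1 L mu). FA (T (src1 L nu)) (NC (PC D nu mu) d))\<rparr>)\<rparr>)\<rparr>"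

lemma ext_trf_simps [simp]:
  "TDom ext_trf = D" "TCod ext_trf = codext kp L C" "p \<in> Cell0 L ==> T1 ext_trf p = ext_ftr p"
  "mu \<in> Cell1 L ==> NDom (T2 ext_trf mu) = ext_ftr (src1 L mu) \<odot> P1 D mu"
  "mu \<in> Cell1 L ==> NCod (T2 ext_trf mu) = codext_ftr L C mu \<odot> ext_ftr (tgt1 L mu)"
  "mu \<in> Cell1 L ==> d \<in> Ob (P0 D (tgt1 L mu)) ==> HDom (NC (T2 ext_trf mu) d) = ext_obj (src1 L mu) (FO (P1 D mu) d)"
  "mu \<in> Cell1 L ==> d \<in> Ob (P0 D (tgt1 L mu)) ==> HCod (NC (T2 ext_trf mu) d) = restr_obj L mu (ext_obj (tgt1 L mu) d)"
  "mu \<in> Cell1 L ==> d \<in> Ob (P0 D (tgt1 L mu)) ==> nu \<in> Cell1 L ==> tgt1 L nu = src1 L mu ==>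
    HM (NC (T2 ext_trf mu) d) nu = FA (T (src1 L nu)) (NC (PC D nu mu) d)"
  by (simp_all add: ext_trf_def into_def)

lemma ext_trf_mor [simp]:
  assumes m: "mu \<in> Cell1 L" "d \<in> Ob (P0 D (tgt1 L mu))" "p = src1 L mu"
  shows "codext_mor L C p (NC (T2 ext_trf mu) d)"
proof (rule codext_morI)
  show "HM (NC (T2 ext_trf mu) d) \<in> extensional (into L p)" using m by (simp add: ext_trf_def)
next
  fix nu rh al assume a: "nu \<in> Cell1 L" "tgt1 L nu = p" "rh \<in> Cell1 L" "src1 L nu = tgt1 L rh" "al \<in> Cell2 L" "tgt2 L al = nu \<star>[L] rh"
  let ?p = "src1 L rh"
  have e1: "NC (PC D (src2 L al) mu) d \<cdot>[P0 D ?p] NC (P2 D al) (FO (P1 D mu) d) = NC (P2 D (mu \<triangleleft>[L] al)) d \<cdot>[P0 D ?p] NC (PC D (nu \<star>[L] rh) mu) d"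
    by (rule h.D_lwh[symmetric]) (use a m in simp_all)
  have e2: "NC (PC D (nu \<star>[L] rh) mu) d \<cdot>[P0 D ?p] NC (PC D rh nu) (FO (P1 D mu) d) = NC (PC D rh (mu \<star>[L] nu)) d \<cdot>[P0 D ?p] FA (P1 D rh) (NC (PC D nu mu) d)"
    by (rule h.D_assoc) (use a m in simp_all)
  show "FA (P1 C rh) (HM (NC (T2 ext_trf mu) d) (src2 L al)) \<cdot>[P0 C (tgt1 L rh)] HA (HDom (NC (T2 ext_trf mu) d)) (nu, rh, al) =
    HA (HCod (NC (T2 ext_trf mu) d)) (nu, rh, al) \<cdot>[P0 C (tgt1 L rh)] HM (NC (T2 ext_trf mu) d) nu"
    using a m by (simp add: e1[THEN FA_eq, THEN FA_eq, THEN cmpE] e2[THEN FA_eq, THEN FA_eq, THEN cmpE] h.\<phi>_R)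
qed (use m in simp_all)

text \<open>Compared at each \<open>nu\<close>, the axioms are the images under \<open>T\<close> of
  the whiskering, associativity and unit axioms of \<open>D\<close>.\<close>

lemma ext_trf_colax: "colax kp (coop L) ext_trf"
proof (rule colaxI)
  show "two_category (coop L)" by (rule two_category_coop[OF two])
  show "pseudofunctor (coop L) (Lex kp) (TDom ext_trf)" using h.D.psf by simp
  show "pseudofunctor (coop L) (Lex kp) (TCod ext_trf)" using codext_pseudofunctor by simp
next
  show "T1 ext_trf \<in> extensional (Cell0 (coop L))" "T2 ext_trf \<in> extensional (Cell1 (coop L))" by (simp_all add: ext_trf_def)
next
  fix mu assume "mu \<in> Cell1 (coop L)"
  then have m: "mu \<in> Cell1 L" by simp
  have "nattrans (T2 ext_trf mu)"
  proof (rule nattransI)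
    show "NC (T2 ext_trf mu) \<in> extensional (Ob (FDom (NDom (T2 ext_trf mu))))" using m by (simp add: ext_trf_def)
  next
    fix u assume "u \<in> Ar (FDom (NDom (T2 ext_trf mu)))"
    then have u: "u \<in> Ar (P0 D (tgt1 L mu))" using m by simp
    have "FA (codext_ftr L C mu) (FA (ext_ftr (tgt1 L mu)) u) \<cdot>[E (src1 L mu)] NC (T2 ext_trf mu) (Src (P0 D (tgt1 L mu)) u) =
      NC (T2 ext_trf mu) (Tgt (P0 D (tgt1 L mu)) u) \<cdot>[E (src1 L mu)] FA (ext_ftr (src1 L mu)) (FA (P1 D mu) u)"
    proof (rule hmor_eqI[of "src1 L mu"])
      fix nu assume n: "nu \<in> Cell1 L" "tgt1 L nu = src1 L mu"
      let ?a = "Src (P0 D (tgt1 L mu)) u" and ?b = "Tgt (P0 D (tgt1 L mu)) u"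
      have e2: "FA (P1 D (mu \<star>[L] nu)) u \<cdot>[P0 D (src1 L nu)] NC (PC D nu mu) ?a = NC (PC D nu mu) ?b \<cdot>[P0 D (src1 L nu)] FA (P1 D nu) (FA (P1 D mu) u)"
        using naturality[of "PC D nu mu" u "P0 D (tgt1 L mu)" "P0 D (src1 L nu)" ?a ?b] n m u by simp
      show "HM (FA (codext_ftr L C mu) (FA (ext_ftr (tgt1 L mu)) u) \<cdot>[E (src1 L mu)] NC (T2 ext_trf mu) ?a) nu =
        HM (NC (T2 ext_trf mu) ?b \<cdot>[E (src1 L mu)] FA (ext_ftr (src1 L mu)) (FA (P1 D mu) u)) nu"
        using m n u by (simp add: e2[THEN FA_eq])
    qed (use m u in "simp_all add: E_cmp")
    then show "FA (NCod (T2 ext_trf mu)) u \<cdot>[FCod (NDom (T2 ext_trf mu))] NC (T2 ext_trf mu) (Src (FDom (NDom (T2 ext_trf mu))) u) =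
      NC (T2 ext_trf mu) (Tgt (FDom (NDom (T2 ext_trf mu))) u) \<cdot>[FCod (NDom (T2 ext_trf mu))] FA (NDom (T2 ext_trf mu)) u" using m u by simp
  qed (use m in simp_all)
  then show "T2 ext_trf mu \<in> nats (T1 ext_trf (tgt1 (coop L) mu) \<odot> P1 (TDom ext_trf) mu) (P1 (TCod ext_trf) mu \<odot> T1 ext_trf (src1 (coop L) mu))"
    using m by (simp add: codext_simps)
next
  fix al d assume "al \<in> Cell2 (coop L)" "d \<in> Ob (P0 (TDom ext_trf) (src1 (coop L) (tgt2 (coop L) al)))"
  then have a: "al \<in> Cell2 L" "d \<in> Ob (P0 D (tgt1 L (tgt2 L al)))" by simp_all
  let ?p = "src1 L (tgt2 L al)" and ?q = "tgt1 L (tgt2 L al)"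
  have "NC (T2 ext_trf (src2 L al)) d \<cdot>[E ?p] FA (ext_ftr ?p) (NC (P2 D al) d) = NC (codext_ntr L C al) (ext_obj ?q d) \<cdot>[E ?p] NC (T2 ext_trf (tgt2 L al)) d"
  proof (rule hmor_eqI[of ?p])
    fix nu assume n: "nu \<in> Cell1 L" "tgt1 L nu = ?p"
    have e: "NC (P2 D (al \<triangleright>[L] nu)) d \<cdot>[P0 D (src1 L nu)] NC (PC D nu (tgt2 L al)) d = NC (PC D nu (src2 L al)) d \<cdot>[P0 D (src1 L nu)] FA (P1 D nu) (NC (P2 D al) d)"
      by (rule h.D_rwh) (use a n in simp_all)
    show "HM (NC (T2 ext_trf (src2 L al)) d \<cdot>[E ?p] FA (ext_ftr ?p) (NC (P2 D al) d)) nu = HM (NC (codext_ntr L C al) (ext_obj ?q d) \<cdot>[E ?p] NC (T2 ext_trf (tgt2 L al)) d) nu"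
      using a n by (simp add: tr_ext e[THEN FA_eq])
  qed (use a in "simp_all add: E_cmp")
  then show "NC (T2 ext_trf (tgt2 (coop L) al)) d \<cdot>[P0 (TCod ext_trf) (tgt1 (coop L) (tgt2 (coop L) al))] FA (T1 ext_trf (tgt1 (coop L) (tgt2 (coop L) al))) (NC (P2 (TDom ext_trf) al) d) =
    NC (P2 (TCod ext_trf) al) (FO (T1 ext_trf (src1 (coop L) (tgt2 (coop L) al))) d) \<cdot>[P0 (TCod ext_trf) (tgt1 (coop L) (tgt2 (coop L) al))] NC (T2 ext_trf (src2 (coop L) al)) d"
    using a by (simp add: codext_simps)
next
  fix f g d assume "f \<in> Cell1 (coop L)" "g \<in> Cell1 (coop L)" "src1 (coop L) g = tgt1 (coop L) f" "d \<in> Ob (P0 (TDom ext_trf) (src1 (coop L) f))"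
  then have a: "f \<in> Cell1 L" "g \<in> Cell1 L" "tgt1 L g = src1 L f" "d \<in> Ob (P0 D (tgt1 L f))" by simp_all
  let ?p = "src1 L g" and ?q = "tgt1 L f"
  have "NC (T2 ext_trf (f \<star>[L] g)) d \<cdot>[E ?p] FA (ext_ftr ?p) (NC (PC D g f) d) =
    FA (codext_ftr L C g) (NC (T2 ext_trf f) d) \<cdot>[E ?p] NC (T2 ext_trf g) (FO (P1 D f) d)" (is "?l = ?r")
  proof (rule hmor_eqI[of ?p])
    fix nu assume n: "nu \<in> Cell1 L" "tgt1 L nu = ?p"
    have e: "NC (PC D (g \<star>[L] nu) f) d \<cdot>[P0 D (src1 L nu)] NC (PC D nu g) (FO (P1 D f) d) = NC (PC D nu (f \<star>[L] g)) d \<cdot>[P0 D (src1 L nu)] FA (P1 D nu) (NC (PC D g f) d)"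
      by (rule h.D_assoc) (use a n in simp_all)
    show "HM ?l nu = HM ?r nu" using a n by (simp add: e[THEN FA_eq])
  qed (use a in "simp_all add: E_cmp restr_restr")
  then show "NC (T2 ext_trf (g \<star>[coop L] f)) d \<cdot>[P0 (TCod ext_trf) (tgt1 (coop L) g)] FA (T1 ext_trf (tgt1 (coop L) g)) (NC (PC (TDom ext_trf) g f) d) =
    NC (PC (TCod ext_trf) g f) (FO (T1 ext_trf (src1 (coop L) f)) d) \<cdot>[P0 (TCod ext_trf) (tgt1 (coop L) g)]
      FA (P1 (TCod ext_trf) g) (NC (T2 ext_trf f) d) \<cdot>[P0 (TCod ext_trf) (tgt1 (coop L) g)] NC (T2 ext_trf g) (FO (P1 (TDom ext_trf) f) d)"
    using a by (simp add: codext_simps restr_restr E_cmp)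
next
  fix p d assume "p \<in> Cell0 (coop L)" "d \<in> Ob (P0 (TDom ext_trf) p)"
  then have a: "p \<in> Cell0 L" "d \<in> Ob (P0 D p)" by simp_all
  have "NC (T2 ext_trf (id1 L p)) d \<cdot>[E p] FA (ext_ftr p) (NC (PU D p) d) = Idn (E p) (ext_obj p d)"
  proof (rule hmor_eqI[of p])
    fix nu assume n: "nu \<in> Cell1 L" "tgt1 L nu = p"
    have e: "NC (PC D nu (id1 L p)) d \<cdot>[P0 D (src1 L nu)] FA (P1 D nu) (NC (PU D p) d) = Idn (P0 D (src1 L nu)) (FO (P1 D nu) d)"
      by (rule h.D_unit) (use a n in simp_all)
    show "HM (NC (T2 ext_trf (id1 L p)) d \<cdot>[E p] FA (ext_ftr p) (NC (PU D p) d)) nu = HM (Idn (E p) (ext_obj p d)) nu"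
      using a n by (simp add: e[THEN FA_eq])
  qed (use a in "simp_all add: E_cmp E_id restr_id")
  then show "NC (T2 ext_trf (id1 (coop L) p)) d \<cdot>[P0 (TCod ext_trf) p] FA (T1 ext_trf p) (NC (PU (TDom ext_trf) p) d) = NC (PU (TCod ext_trf) p) (FO (T1 ext_trf p) d)"
    using a by (simp add: codext_simps restr_id)
qed (simp_all add: codext_simps)

lemma ext_trf_adj: "adj_trf kp L ext_trf"
proof -
  have "iso_ntr (T2 ext_trf mu)" if m: "mu \<in> Cell1 L" for mu
  proof (rule iso_ntrI)
    interpret X: clx kp "coop L" ext_trf by unfold_locales (use two_category_coop[OF two] ext_trf_colax in simp_all)
    show "nattrans (T2 ext_trf mu)" using m X.T2(1)[of mu] by simp
    fix d assume "d \<in> Ob (FDom (NDom (T2 ext_trf mu)))"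
    then have d: "d \<in> Ob (P0 D (tgt1 L mu))" using m by simp
    have "isom (E (src1 L mu)) (NC (T2 ext_trf mu) d)"
    proof (rule E_isom)
      fix nu assume n: "nu \<in> Cell1 L" "tgt1 L nu = src1 L mu"
      have "isom (P0 D (src1 L nu)) (NC (PC D nu mu) d)" by (rule iso_ntr_isom[OF h.D.PC(1)]) (use m n d in simp_all)
      then have "isom (P0 C (src1 L nu)) (FA (T (src1 L nu)) (NC (PC D nu mu) d))"
        by - (rule isom_FA[of _ "P0 D (src1 L nu)"]; use m n in simp)
      then show "isom (P0 C (src1 L nu)) (HM (NC (T2 ext_trf mu) d) nu)" using m n d by simp
    qed (use m d in simp)
    then show "isom (FCod (NDom (T2 ext_trf mu))) (NC (T2 ext_trf mu) d)" using m d by simp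
  qed
  then show ?thesis
    unfolding adj_trf_def pseudonatural_def using ext_trf_colax codext_adj_pfun h.adjD by simp
qed

end

section \<open>Transformations into the co-dextrification\<close>

text \<open>An arbitrary 1-cell from \<open>D\<close> to the co-dextrification in
  \<open>Ps_adj\<close>, with its data evaluated down to arrows of the categories
  \<open>P0 C p\<close>.\<close>

locale gct = codk kp L C + dd: adjp kp L D
  for kp :: "'k rel" and L :: "('p, 'f, 'a) twocat" and C :: "('p, 'f, 'a, 'o, 'm) catpfun"
    and D :: "('p, 'f, 'a, 'od, 'md) catpfun" +
  fixes G
  assumes G: "adj_trf kp L G" "TDom G = D" "TCod G = codext kp L C"
begin

abbreviation "t f d nu \<equiv> HM (NC (T2 G f) d) nu"
abbreviation "gm q u nu \<equiv> HM (FA (T1 G q) u) nu"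
abbreviation "go q d \<equiv> FO (T1 G q) d"

lemma g_adjt: "adjt kp L G" by unfold_locales (use two G in simp_all)

lemma g1 [simp]:
  assumes "p \<in> Cell0 L"
  shows "is_functor (T1 G p)" "lex_ftr kp (T1 G p)" "FDom (T1 G p) = P0 D p" "FCod (T1 G p) = E p"
proof -
  interpret W: adjt kp L G by (rule g_adjt)
  show "is_functor (T1 G p)" "lex_ftr kp (T1 G p)" "FDom (T1 G p) = P0 D p" "FCod (T1 G p) = E p"
    using W.G.T1[of p] assms G by (simp_all add: codext_simps)
qed

lemma g1_mor [simp]:
  assumes "p \<in> Cell0 L"
  shows "d \<in> Ob (P0 D p) ==> codext_obj L C p (go p d)" 
    "u \<in> Ar (P0 D p) ==> codext_mor L C p (FA (T1 G p) u)" "u \<in> Ar (P0 D p) ==> HDom (FA (T1 G p) u) = go p (Src (P0 D p) u)"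
    "u \<in> Ar (P0 D p) ==> HCod (FA (T1 G p) u) = go p (Tgt (P0 D p) u)"
  using functor_simps(1-4)[OF g1(1,4)[OF assms]] assms by simp_all

lemma g2 [simp]:
  assumes "f \<in> Cell1 L"
  shows "nattrans (T2 G f)" "iso_ntr (T2 G f)" "NDom (T2 G f) = T1 G (src1 L f) \<odot> P1 D f" "NCod (T2 G f) = codext_ftr L C f \<odot> T1 G (tgt1 L f)"
proof -
  interpret W: adjt kp L G by (rule g_adjt)
  show "nattrans (T2 G f)" "iso_ntr (T2 G f)" "NDom (T2 G f) = T1 G (src1 L f) \<odot> P1 D f" "NCod (T2 G f) = codext_ftr L C f \<odot> T1 G (tgt1 L f)"
    using W.G.T2[of f] assms G by (simp_all add: codext_simps)
qed

lemma g2_mor [simp]: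
  assumes "f \<in> Cell1 L" "d \<in> Ob (P0 D (tgt1 L f))" "p = src1 L f"
  shows "codext_mor L C p (NC (T2 G f) d)" "HDom (NC (T2 G f) d) = go p (FO (P1 D f) d)" "HCod (NC (T2 G f) d) = restr_obj L f (go (tgt1 L f) d)"
    "codext_mor L C p (NC (inv_ntr (T2 G f)) d)" "HCod (NC (inv_ntr (T2 G f)) d) = go p (FO (P1 D f) d)" "HDom (NC (inv_ntr (T2 G f)) d) = restr_obj L f (go (tgt1 L f) d)"
proof -
  have i: "nattrans (inv_ntr (T2 G f))" "NDom (inv_ntr (T2 G f)) = codext_ftr L C f \<odot> T1 G (tgt1 L f)" "NCod (inv_ntr (T2 G f)) = T1 G (src1 L f) \<odot> P1 D f"
    using inv_ntr[OF g2(2)[OF assms(1)]] assms by simp_all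
  show "codext_mor L C p (NC (T2 G f) d)" "HDom (NC (T2 G f) d) = go p (FO (P1 D f) d)" "HCod (NC (T2 G f) d) = restr_obj L f (go (tgt1 L f) d)"
    using nattrans_simps[OF g2(1)[OF assms(1)], of "E p" d] assms by simp_all
  show "codext_mor L C p (NC (inv_ntr (T2 G f)) d)" "HCod (NC (inv_ntr (T2 G f)) d) = go p (FO (P1 D f) d)" "HDom (NC (inv_ntr (T2 G f)) d) = restr_obj L f (go (tgt1 L f) d)"
    using nattrans_simps[OF i(1), of "E p" d] assms i by simp_all
qed

lemma t_nat:
  assumes "f \<in> Cell1 L" "u \<in> Ar (P0 D (tgt1 L f))" "nu \<in> Cell1 L" "tgt1 L nu = src1 L f" "r = src1 L nu" "q = tgt1 L f" "mu = f \<star>[L] nu"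
    "Src (P0 D (tgt1 L f)) u = a"
  shows "gm q u mu \<cdot>[P0 C r] t f a nu = t f (Tgt (P0 D (tgt1 L f)) u) nu \<cdot>[P0 C r] gm (src1 L f) (FA (P1 D f) u) nu"
proof -
  have "FA (NCod (T2 G f)) u \<cdot>[E (src1 L f)] NC (T2 G f) (Src (P0 D (tgt1 L f)) u) = NC (T2 G f) (Tgt (P0 D (tgt1 L f)) u) \<cdot>[E (src1 L f)] FA (NDom (T2 G f)) u"
    by (rule naturality[of "T2 G f" u "P0 D (tgt1 L f)" "E (src1 L f)"]) (use assms in simp_all)
  from arg_cong[OF this, of "\<lambda>x. HM x nu"] show ?thesis using assms by simp
qed

lemma t_cell2:
  assumes "al \<in> Cell2 L" "f = tgt2 L al" "d \<in> Ob (P0 D (tgt1 L f))" "nu \<in> Cell1 L" "tgt1 L nu = src1 L f" "r = src1 L nu" "p = src1 L f"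
  shows "t (src2 L al) d nu \<cdot>[P0 C r] gm p (NC (P2 D al) d) nu = tr (go (tgt1 L f) d) (al \<triangleright>[L] nu) \<cdot>[P0 C r] t f d nu"
proof -
  interpret W: adjt kp L G by (rule g_adjt)
  show ?thesis using arg_cong[OF W.G.T2_cell2[of al d], of "\<lambda>x. HM x nu"] assms G by (simp add: codext_simps)
qed

lemma t_cmp:
  assumes "f \<in> Cell1 L" "g \<in> Cell1 L" "tgt1 L g = src1 L f" "d \<in> Ob (P0 D (tgt1 L f))" "nu \<in> Cell1 L" "tgt1 L nu = src1 L g" "r = src1 L nu" "p = src1 L g"
  shows "t (f \<star>[L] g) d nu \<cdot>[P0 C r] gm p (NC (PC D g f) d) nu = t f d (g \<star>[L] nu) \<cdot>[P0 C r] t g (FO (P1 D f) d) nu"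
proof -
  interpret W: adjt kp L G by (rule g_adjt)
  show ?thesis using arg_cong[OF W.G.T2_cmp[of f g d], of "\<lambda>x. HM x nu"] assms G by (simp add: codext_simps restr_restr)
qed

lemma t_unit:
  assumes "p \<in> Cell0 L" "d \<in> Ob (P0 D p)" "nu \<in> Cell1 L" "tgt1 L nu = p" "r = src1 L nu"
  shows "t (id1 L p) d nu \<cdot>[P0 C r] gm p (NC (PU D p) d) nu = Idn (P0 C r) (HO (go p d) nu)"
proof -
  interpret W: adjt kp L G by (rule g_adjt)
  show ?thesis using arg_cong[OF W.G.T2_unit[of p d], of "\<lambda>x. HM x nu"] assms G by (simp add: codext_simps restr_id)
qed

text \<open>The pseudonaturality isomorphism of \<open>G\<close> at \<open>f\<close>, evaluated at
  an identity 1-cell. It identifies \<open>(G (D^f d))^1\<close> with \<open>(G d)^f\<close>, so the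
  values of \<open>G d\<close> at all 1-cells are known from values at identities.\<close>

definition "k f d = t f d (id1 L (src1 L f))"
definition "ki f d = HM (NC (inv_ntr (T2 G f)) d) (id1 L (src1 L f))"

lemma k [simp]:
  assumes "f \<in> Cell1 L" "d \<in> Ob (P0 D (tgt1 L f))" "p = src1 L f"
  shows "k f d \<in> Ar (P0 C p)" "Src (P0 C p) (k f d) = HO (go p (FO (P1 D f) d)) (id1 L p)" "Tgt (P0 C p) (k f d) = HO (go (tgt1 L f) d) f"
    "ki f d \<in> Ar (P0 C p)" "Tgt (P0 C p) (ki f d) = HO (go p (FO (P1 D f) d)) (id1 L p)" "Src (P0 C p) (ki f d) = HO (go (tgt1 L f) d) f"
  unfolding k_def ki_def using assms by simp_all

lemma k_inv:
  assumes "f \<in> Cell1 L" "d \<in> Ob (P0 D (tgt1 L f))" "p = src1 L f"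
  shows "ki f d \<cdot>[P0 C p] k f d = Idn (P0 C p) (HO (go p (FO (P1 D f) d)) (id1 L p))"
    "k f d \<cdot>[P0 C p] ki f d = Idn (P0 C p) (HO (go (tgt1 L f) d) f)"
proof -
  interpret W: adjt kp L G by (rule g_adjt)
  note i = W.gi_inv[OF assms(1) refl refl, unfolded G(2,3) codext_simps, OF assms(2)]
  have c: "HM (x \<cdot>[E (src1 L f)] y) (id1 L (src1 L f)) = HM x (id1 L (src1 L f)) \<cdot>[P0 C (src1 L f)] HM y (id1 L (src1 L f))" for x y
    using assms(1) by simp
  show "ki f d \<cdot>[P0 C p] k f d = Idn (P0 C p) (HO (go p (FO (P1 D f) d)) (id1 L p))"
    "k f d \<cdot>[P0 C p] ki f d = Idn (P0 C p) (HO (go (tgt1 L f) d) f)"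
    unfolding assms(3) k_def ki_def c[symmetric] i using assms G by simp_all
qed

lemma k_isom: "f \<in> Cell1 L ==> d \<in> Ob (P0 D (tgt1 L f)) ==> p = src1 L f ==> isom (P0 C p) (k f d)"
  by (rule isomI[where g = "ki f d"]) (simp_all add: k_inv)

lemma k_nat:
  assumes "mu \<in> Cell1 L" "q = tgt1 L mu" "u \<in> Ar (P0 D q)" "p = src1 L mu"
  shows "gm q u mu \<cdot>[P0 C p] k mu (Src (P0 D q) u) = k mu (Tgt (P0 D q) u) \<cdot>[P0 C p] gm p (FA (P1 D mu) u) (id1 L p)"
  unfolding k_def assms(2,4) by (rule t_nat) (use assms in simp_all)

text \<open>The composition axiom of \<open>G\<close> at an identity 1-cell; it expresses the
  remaining components of the pseudonaturality 2-cells through \<open>k\<close>.\<close>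

lemma t_k:
  assumes "f \<in> Cell1 L" "g \<in> Cell1 L" "tgt1 L g = src1 L f" "d \<in> Ob (P0 D (tgt1 L f))" "p = src1 L g" "x = FO (P1 D f) d"
  shows "t f d g \<cdot>[P0 C p] k g x = k (f \<star>[L] g) d \<cdot>[P0 C p] gm p (NC (PC D g f) d) (id1 L p)"
  using t_cmp[of f g d "id1 L p" p p] assms by (simp add: k_def)

lemma ki_id:
  assumes "p \<in> Cell0 L" "d \<in> Ob (P0 D p)"
  shows "k (id1 L p) d \<cdot>[P0 C p] gm p (NC (PU D p) d) (id1 L p) = Idn (P0 C p) (HO (go p d) (id1 L p))"
    "ki (id1 L p) d = gm p (NC (PU D p) d) (id1 L p)"
proof -
  show 1: "k (id1 L p) d \<cdot>[P0 C p] gm p (NC (PU D p) d) (id1 L p) = Idn (P0 C p) (HO (go p d) (id1 L p))"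
    using t_unit[of p d "id1 L p" p] assms by (simp add: k_def)
  show "ki (id1 L p) d = gm p (NC (PU D p) d) (id1 L p)"
    by (rule isom_cancel_left[OF _ k_isom[of "id1 L p" d p]]) (use assms 1 in "simp_all add: k_inv")
qed

text \<open>The half form of the transpose of \<open>G\<close> (see \<open>trans_hlf\<close>): the
  structure morphism of \<open>G d\<close> at the identity of \<open>f\<close>, then the inverse of
  \<open>k\<close> to return to a value at an identity 1-cell.\<close>

definition "\<psi> f d = FA (P1 C f) (ki f d) \<cdot>[P0 C (tgt1 L f)] HA (go (tgt1 L f) d) (id1 L (tgt1 L f), f, id2 L f)"

lemma \<psi> [simp]:
  assumes "f \<in> Cell1 L" "d \<in> Ob (P0 D (tgt1 L f))" "q = tgt1 L f"
  shows "\<psi> f d \<in> Ar (P0 C q)" "Src (P0 C q) (\<psi> f d) = HO (go q d) (id1 L q)"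
    "Tgt (P0 C q) (\<psi> f d) = FO (P1 C f) (HO (go (src1 L f) (FO (P1 D f) d)) (id1 L (src1 L f)))"
  using assms by (simp_all add: \<psi>_def)

lemma trans_colax:
  "colax kp L (comp_trf L (canon kp L C) (U1 kp L G))" "TDom (comp_trf L (canon kp L C) (U1 kp L G)) = U0 kp L D"
  "TCod (comp_trf L (canon kp L C) (U1 kp L G)) = C"
  "p \<in> Cell0 L ==> T1 (comp_trf L (canon kp L C) (U1 kp L G)) p = ev p (id1 L p) \<odot> T1 G p"
proof -
  interpret W: adjt kp L G by (rule g_adjt)
  show "colax kp L (comp_trf L (canon kp L C) (U1 kp L G))"
    by (rule comp_trf_colax[OF two W.U1_colax canon_colax(1)]) (simp add: canon_colax G)
  show "TDom (comp_trf L (canon kp L C) (U1 kp L G)) = U0 kp L D"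
    "TCod (comp_trf L (canon kp L C) (U1 kp L G)) = C"
    "p \<in> Cell0 L ==> T1 (comp_trf L (canon kp L C) (U1 kp L G)) p = ev p (id1 L p) \<odot> T1 G p"
    by (simp_all add: canon_colax G)
qed

lemma trans_hlf:
  assumes "f \<in> Cell1 L" "d \<in> Ob (P0 D (tgt1 L f))"
  shows "hlf kp L D (comp_trf L (canon kp L C) (U1 kp L G)) f d = \<psi> f d"
proof -
  interpret W: adjt kp L G by (rule g_adjt)
  show ?thesis
    using W.hlf_comp_U1[OF canon_colax(1) _ assms(1), of d] assms G by (simp add: canon_colax \<psi>_def ki_def)
qed

text \<open>Conjugated by \<open>k\<close>, the structure morphisms of \<open>G d\<close> follow the
  formula of \<open>ext_obj\<close> with \<open>\<psi>\<close> in place of \<open>\<phi>\<close>.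
  They are thus governed by the transpose of \<open>G\<close>, on which fullness depends.\<close>

lemma HA_k:
  assumes a: "nu \<in> Cell1 L" "rh \<in> Cell1 L" "src1 L nu = tgt1 L rh" "al \<in> Cell2 L" "tgt2 L al = nu \<star>[L] rh" and d: "d \<in> Ob (P0 D (tgt1 L nu))"
    and q: "q = tgt1 L nu" "s = tgt1 L rh" "r = src1 L rh"
  shows "HA (go q d) (nu, rh, al) \<cdot>[P0 C s] k nu d =
    FA (P1 C rh) (k (src2 L al) d) \<cdot>[P0 C s] FA (P1 C rh) (gm r (NC (P2 D al) d) (id1 L r)) \<cdot>[P0 C s]
      FA (P1 C rh) (gm r (NC (PC D rh nu) d) (id1 L r)) \<cdot>[P0 C s] \<psi> rh (FO (P1 D nu) d)"
proof -
  \<comment> \<open>Facts 1 and 2 are the 2-cell and composition axioms of \<open>G\<close> at an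
    identity 1-cell, 3 is compatibility of a pseudonaturality 2-cell with structure morphisms, and 4
    merges the action of \<open>al\<close> into the structure morphism.\<close>
  have 1: "k (src2 L al) d \<cdot>[P0 C r] gm r (NC (P2 D al) d) (id1 L r) = tr (go q d) al \<cdot>[P0 C r] k (nu \<star>[L] rh) d"
    using t_cell2[of al "nu \<star>[L] rh" d "id1 L r" r r] a d q by (simp add: k_def)
  have 2: "k (nu \<star>[L] rh) d \<cdot>[P0 C r] gm r (NC (PC D rh nu) d) (id1 L r) = t nu d rh \<cdot>[P0 C r] k rh (FO (P1 D nu) d)"
    using t_cmp[of nu rh d "id1 L r" r r] a d q by (simp add: k_def)
  have 3: "FA (P1 C rh) (t nu d rh) \<cdot>[P0 C s] HA (go s (FO (P1 D nu) d)) (id1 L s, rh, id2 L rh) = HA (go q d) (nu, rh, id2 L (nu \<star>[L] rh)) \<cdot>[P0 C s] k nu d"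
  proof -
    have "FA (P1 C rh) (t nu d rh) \<cdot>[P0 C s] HA (go s (FO (P1 D nu) d)) (id1 L s, rh, id2 L rh) =
      HA (HCod (NC (T2 G nu) d)) (id1 L s, rh, id2 L rh) \<cdot>[P0 C s] t nu d (id1 L s)"
      by (rule HM_HA) (use a d q in simp_all)
    then show ?thesis using a d q by (simp add: k_def)
  qed
  have 4: "FA (P1 C rh) (tr (go q d) al) \<cdot>[P0 C s] HA (go q d) (nu, rh, id2 L (nu \<star>[L] rh)) = HA (go q d) (nu, rh, id2 L (nu \<star>[L] rh) \<bullet>[L] al)"
    by (rule tr_HA) (use a d q in simp_all)
  have t: "t nu d rh \<in> Ar (P0 C r)" "Src (P0 C r) (t nu d rh) = HO (go s (FO (P1 D nu) d)) rh" "Tgt (P0 C r) (t nu d rh) = HO (go q d) (nu \<star>[L] rh)"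
    using a d q by simp_all
  show ?thesis
    using a d q t 4 k_inv(2)[of rh "FO (P1 D nu) d" r]
    by (simp add: \<psi>_def 1[unfolded q, THEN FA_eq, THEN cmpE] 2[unfolded q, THEN FA_eq, THEN cmpE] k_inv(2)[THEN FA_eq, THEN cmpE] 3[unfolded q] 4[unfolded q, THEN cmpE])
qed

end

locale gct2 = A: gct kp L C D G + B: gct kp L C D G'
  for kp :: "'k rel" and L :: "('p, 'f, 'a) twocat" and C :: "('p, 'f, 'a, 'o, 'm) catpfun"
    and D :: "('p, 'f, 'a, 'od, 'md) catpfun" and G G'
begin

abbreviation "tra m \<equiv> lwh_mdf L (canon kp L C) (U2 kp L m)"

lemma mdf_component:
  assumes m: "adj_mdf kp L m" "MDom m = G" "MCod m = G'"
  shows "q \<in> Cell0 L ==> d \<in> Ob (P0 D q) ==> codext_mor L C q (NC (MC m q) d)"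
    "q \<in> Cell0 L ==> d \<in> Ob (P0 D q) ==> HDom (NC (MC m q) d) = A.go q d"
    "q \<in> Cell0 L ==> d \<in> Ob (P0 D q) ==> HCod (NC (MC m q) d) = B.go q d"
    "f \<in> Cell1 L ==> d \<in> Ob (P0 D (tgt1 L f)) ==> 
      HM (NC (MC m (tgt1 L f)) d) f \<cdot>[P0 C (src1 L f)] A.k f d = B.k f d \<cdot>[P0 C (src1 L f)] HM (NC (MC m (src1 L f)) (FO (P1 D f) d)) (id1 L (src1 L f))"
proof -
  note M = adj_mdfD[OF m(1) A.two, unfolded m(2,3)]
  show 1: "codext_mor L C q (NC (MC m q) d)" "HDom (NC (MC m q) d) = A.go q d" "HCod (NC (MC m q) d) = B.go q d" if "q \<in> Cell0 L" "d \<in> Ob (P0 D q)" for q d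
  proof -
    have D: "FCod (NDom (MC m q)) = A.E q" "d \<in> Ob (FDom (NDom (MC m q)))" using that M(8)[OF that(1)] by simp_all
    note x = nattrans_simps[OF M(7)[OF that(1)] D, unfolded A.E_simps M(8,9)[OF that(1)]]
    show "codext_mor L C q (NC (MC m q) d)" "HDom (NC (MC m q) d) = A.go q d" "HCod (NC (MC m q) d) = B.go q d" by (rule x)+
  qed
  assume f: "f \<in> Cell1 L" "d \<in> Ob (P0 D (tgt1 L f))"
  have "FA (codext_ftr L C f) (NC (MC m (tgt1 L f)) d) \<cdot>[A.E (src1 L f)] NC (T2 G f) d = NC (T2 G' f) d \<cdot>[A.E (src1 L f)] NC (MC m (src1 L f)) (FO (P1 D f) d)"
    using modificationD(9)[OF M(3) two_category_coop[OF A.two], of f d] f m(2,3) A.G B.G by (simp add: A.codext_simps)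
  from arg_cong[OF this, of "\<lambda>x. HM x (id1 L (src1 L f))"]
  show "HM (NC (MC m (tgt1 L f)) d) f \<cdot>[P0 C (src1 L f)] A.k f d = B.k f d \<cdot>[P0 C (src1 L f)] HM (NC (MC m (src1 L f)) (FO (P1 D f) d)) (id1 L (src1 L f))"
    using f 1[of "tgt1 L f" d] by (simp add: A.k_def B.k_def)
qed

lemma tra_component:
  assumes m: "adj_mdf kp L m" "MDom m = G" "MCod m = G'" and "p \<in> Cell0 L" "d \<in> Ob (P0 D p)"
  shows "NC (MC (tra m) p) d = HM (NC (MC m p) d) (id1 L p)"
proof -
  note M = adj_mdfD[OF m(1) A.two, unfolded m(2,3)]
  show ?thesis using assms M mdf_component[OF m] by (simp add: A.canon_colax)
qed

text \<open>Compatibility of \<open>m\<close> with the pseudonaturality isomorphisms, solved for the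
  component at \<open>f\<close> because \<open>k\<close> is invertible. Faithfulness of
  transposition (\<open>tra_inj\<close>) follows at once.\<close>

lemma component_determined:
  assumes m: "adj_mdf kp L m" "MDom m = G" "MCod m = G'" and f: "f \<in> Cell1 L" "d \<in> Ob (P0 D (tgt1 L f))"
  shows "HM (NC (MC m (tgt1 L f)) d) f = B.k f d \<cdot>[P0 C (src1 L f)] HM (NC (MC m (src1 L f)) (FO (P1 D f) d)) (id1 L (src1 L f)) \<cdot>[P0 C (src1 L f)] A.ki f d"
proof -
  note c = mdf_component[OF m]
  have ty: "HM (NC (MC m (tgt1 L f)) d) f \<in> Ar (P0 C (src1 L f))" "Src (P0 C (src1 L f)) (HM (NC (MC m (tgt1 L f)) d) f) = HO (A.go (tgt1 L f) d) f"
     "HM (NC (MC m (src1 L f)) (FO (P1 D f) d)) (id1 L (src1 L f)) \<in> Ar (P0 C (src1 L f))"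
     "Src (P0 C (src1 L f)) (HM (NC (MC m (src1 L f)) (FO (P1 D f) d)) (id1 L (src1 L f))) = HO (A.go (src1 L f) (FO (P1 D f) d)) (id1 L (src1 L f))"
     "Tgt (P0 C (src1 L f)) (HM (NC (MC m (src1 L f)) (FO (P1 D f) d)) (id1 L (src1 L f))) = HO (B.go (src1 L f) (FO (P1 D f) d)) (id1 L (src1 L f))"
    using c(1-3)[of "tgt1 L f" d] c(1-3)[of "src1 L f" "FO (P1 D f) d"] f by simp_all
  have "(HM (NC (MC m (tgt1 L f)) d) f \<cdot>[P0 C (src1 L f)] A.k f d) \<cdot>[P0 C (src1 L f)] A.ki f d = HM (NC (MC m (tgt1 L f)) d) f"
    using f ty A.k_inv(2)[OF f refl] by simp
  then show ?thesis unfolding c(4)[OF f] using f ty by simp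
qed

lemma tra_inj:
  assumes m: "adj_mdf kp L m" "MDom m = G" "MCod m = G'" and n: "adj_mdf kp L n" "MDom n = G" "MCod n = G'"
    and e: "!!p d. p \<in> Cell0 L ==> d \<in> Ob (P0 D p) ==> HM (NC (MC m p) d) (id1 L p) = HM (NC (MC n p) d) (id1 L p)"
  shows "m = n"
proof (rule mdf_eqI[of _ _ L])
  note M = adj_mdfD[OF m(1) A.two, unfolded m(2,3)] and N = adj_mdfD[OF n(1) A.two, unfolded n(2,3)]
  show "MC m \<in> extensional (Cell0 L)" "MC n \<in> extensional (Cell0 L)" using M N by simp_all
  fix q assume q: "q \<in> Cell0 L"
  show "MC m q = MC n q"
  proof (rule ntr_eqI)
    fix d assume "d \<in> Ob (FDom (NDom (MC m q)))"
    then have d: "d \<in> Ob (P0 D q)" using M(8)[OF q] q by simp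
    show "NC (MC m q) d = NC (MC n q) d"
    proof (rule A.hmor_eqI[of q])
      fix f assume f: "f \<in> Cell1 L" "tgt1 L f = q"
      show "HM (NC (MC m q) d) f = HM (NC (MC n q) d) f"
        using component_determined[OF m f(1), of d] component_determined[OF n f(1), of d] e[of "src1 L f" "FO (P1 D f) d"] f d by simp
    qed (use q d mdf_component(1-3)[OF m q d] mdf_component(1-3)[OF n q d] in simp_all)
  qed (use q M N in simp_all)
qed (use m n in simp_all)

text \<open>The formula of \<open>component_determined\<close>, fed with the components of
  \<open>w\<close>, is taken as the definition of the 2-cell. Once the isomorphisms \<open>k\<close>
  have been moved out of the way, its conditions reduce to naturality of \<open>w\<close> and to the
  modification axiom of \<open>w\<close> on half forms.\<close>

lemma tra_full:
  assumes w: "modification kp L w" and wd: "MDom w = comp_trf L (canon kp L C) (U1 kp L G)" "MCod w = comp_trf L (canon kp L C) (U1 kp L G')"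
  shows "\<exists>m. adj_mdf kp L m \<and> MDom m = G \<and> MCod m = G' \<and> tra m = w"
proof -
  interpret hctx kp L D C by unfold_locales
  note W = modificationD[OF w A.two]
  define M where "M p d = NC (MC w p) d" for p d
  have Wd: "NDom (MC w p) = A.ev p (id1 L p) \<odot> T1 G p" "NCod (MC w p) = A.ev p (id1 L p) \<odot> T1 G' p" "nattrans (MC w p)" if "p \<in> Cell0 L" for p
    using W(6-8)[OF that] that by (simp_all only: wd A.trans_colax B.trans_colax)
  have Mt: "M p d \<in> Ar (P0 C p)" "Src (P0 C p) (M p d) = HO (A.go p d) (id1 L p)" "Tgt (P0 C p) (M p d) = HO (B.go p d) (id1 L p)"
    if "p \<in> Cell0 L" "d \<in> Ob (P0 D p)" for p d
    using nattrans_simps[OF Wd(3)[OF that(1)], of "P0 C p" d] that Wd[OF that(1)] by (simp_all add: M_def)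
  have M_nat: "M p b \<cdot>[P0 C p] A.gm p u i = B.gm p u i \<cdot>[P0 C p] M p (Src (P0 D p) u)"
    if "p \<in> Cell0 L" "u \<in> Ar (P0 D p)" "Tgt (P0 D p) u = b" "i = id1 L p" for p u b i
    using naturality[OF Wd(3)[OF that(1)], of u "P0 D p" "P0 C p" "Src (P0 D p) u" b] that Wd[OF that(1)] by (simp add: M_def)
  have mod: "\<forall>f \<in> Cell1 L. \<forall>d \<in> Ob (P0 D (tgt1 L f)).
     FA (P1 C f) (NC (MC w (src1 L f)) (FO (P1 D f) d)) \<cdot>[P0 C (tgt1 L f)] hlf kp L D (MDom w) f d =
     hlf kp L D (MCod w) f d \<cdot>[P0 C (tgt1 L f)] NC (MC w (tgt1 L f)) d"
    using modification_hlf[of w] W A.trans_colax B.trans_colax w by (simp only: wd) (simp add: Wd)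
  have M_\<psi>: "FA (P1 C f) (M p x) \<cdot>[P0 C q] A.\<psi> f d = B.\<psi> f d \<cdot>[P0 C q] M q d"
    if "f \<in> Cell1 L" "q = tgt1 L f" "d \<in> Ob (P0 D q)" "p = src1 L f" "x = FO (P1 D f) d" for f d p q x
    using mod[rule_format, of f d] that A.trans_hlf[of f d] B.trans_hlf[of f d] by (simp only: wd M_def)
  define mm where "mm q d = \<lparr>HDom = A.go q d, HCod = B.go q d,
    HM = (\<lambda>mu \<in> into L q. B.k mu d \<cdot>[P0 C (src1 L mu)] M (src1 L mu) (FO (P1 D mu) d) \<cdot>[P0 C (src1 L mu)] A.ki mu d)\<rparr>" for q d
  have mmd: "HDom (mm q d) = A.go q d" "HCod (mm q d) = B.go q d" for q d by (simp_all add: mm_def)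
  have mmM: "HM (mm q d) mu = B.k mu d \<cdot>[P0 C (src1 L mu)] M (src1 L mu) (FO (P1 D mu) d) \<cdot>[P0 C (src1 L mu)] A.ki mu d"
    if "mu \<in> Cell1 L" "tgt1 L mu = q" for q d mu using that by (simp add: mm_def into_def)
  have mm: "codext_mor L C q (mm q d)" if q: "q \<in> Cell0 L" and d: "d \<in> Ob (P0 D q)" for q d
  proof (rule A.codext_morI)
    show "HM (mm q d) \<in> extensional (into L q)" by (simp add: mm_def)
  next
    fix mu assume "mu \<in> Cell1 L" "tgt1 L mu = q"
    then show "HM (mm q d) mu \<in> hom (P0 C (src1 L mu)) (HO (HDom (mm q d)) mu) (HO (HCod (mm q d)) mu)"
      using q d by (simp add: mmM mmd Mt)
  next
    fix nu rh al assume a: "nu \<in> Cell1 L" "tgt1 L nu = q" "rh \<in> Cell1 L" "src1 L nu = tgt1 L rh" "al \<in> Cell2 L" "tgt2 L al = nu \<star>[L] rh"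
    have m: "src2 L al \<in> Cell1 L" "tgt1 L (src2 L al) = q" "src1 L (src2 L al) = src1 L rh" using a by simp_all
    \<comment> \<open>Precomposition with \<open>k\<close> brings both sides into the form of
      \<open>HA_k\<close>, for \<open>G\<close> on one side and \<open>G'\<close> on the other;
      \<open>M_\<psi>\<close> then exchanges the two half forms.\<close>
    have i: "isom (P0 C (tgt1 L rh)) (A.k nu d)" by (rule A.k_isom) (use a d in simp_all)
    show "FA (P1 C rh) (HM (mm q d) (src2 L al)) \<cdot>[P0 C (tgt1 L rh)] HA (HDom (mm q d)) (nu, rh, al) = HA (HCod (mm q d)) (nu, rh, al) \<cdot>[P0 C (tgt1 L rh)] HM (mm q d) nu"
      by (rule isom_cancel[OF _ i])
        (use a m q d in "simp_all add: mmM mmd Mt A.HA_k B.HA_k[THEN cmpE] A.k_inv(1) A.k_inv(1)[THEN FA_eq, THEN cmpE]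
          M_nat[THEN FA_eq, THEN cmpE] M_\<psi>")
  qed (use q d in "simp_all add: mmd")
  define m where "m = \<lparr>MDom = G, MCod = G', MC = (\<lambda>q \<in> Cell0 L. \<lparr>NDom = T1 G q, NCod = T1 G' q, NC = (\<lambda>d \<in> Ob (P0 D q). mm q d)\<rparr>)\<rparr>"
  have md: "MDom m = G" "MCod m = G'" by (simp_all add: m_def)
  have mC: "NC (MC m q) d = mm q d" if "q \<in> Cell0 L" "d \<in> Ob (P0 D q)" for q d using that by (simp add: m_def)
  have mD: "NDom (MC m q) = T1 G q" "NCod (MC m q) = T1 G' q" if "q \<in> Cell0 L" for q using that by (simp_all add: m_def)
  have "modification kp (coop L) m"
  proof (rule modificationI)
    show "two_category (coop L)" by (rule two_category_coop[OF A.two])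
    show "colax kp (coop L) (MDom m)" "colax kp (coop L) (MCod m)" using A.G(1) B.G(1) by (auto simp: md adj_trf_def pseudonatural_def)
    show "MC m \<in> extensional (Cell0 (coop L))" by (simp add: m_def)
  next
    fix q assume "q \<in> Cell0 (coop L)"
    then have q: "q \<in> Cell0 L" by simp
    have "nattrans (MC m q)"
    proof (rule nattransI)
      show "NC (MC m q) \<in> extensional (Ob (FDom (NDom (MC m q))))" using q by (simp add: m_def)
    next
      fix u assume "u \<in> Ar (FDom (NDom (MC m q)))"
      then have u: "u \<in> Ar (P0 D q)" using q by (simp add: mD)
      have "FA (T1 G' q) u \<cdot>[A.E q] mm q (Src (P0 D q) u) = mm q (Tgt (P0 D q) u) \<cdot>[A.E q] FA (T1 G q) u"
      proof (rule A.hmor_eqI[of q])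
        fix mu assume n: "mu \<in> Cell1 L" "tgt1 L mu = q"
        let ?p = "src1 L mu" and ?a = "Src (P0 D q) u" and ?b = "Tgt (P0 D q) u"
        have e: "B.gm q u mu \<cdot>[P0 C ?p] B.k mu ?a = B.k mu ?b \<cdot>[P0 C ?p] B.gm ?p (FA (P1 D mu) u) (id1 L ?p)"
          by (rule B.k_nat) (use n u in simp_all)
        have e0: "A.k mu ?b \<cdot>[P0 C ?p] A.gm ?p (FA (P1 D mu) u) (id1 L ?p) = A.gm q u mu \<cdot>[P0 C ?p] A.k mu ?a"
          by (rule A.k_nat[symmetric]) (use n u in simp_all)
        have e': "A.gm ?p (FA (P1 D mu) u) (id1 L ?p) \<cdot>[P0 C ?p] A.ki mu ?a = A.ki mu ?b \<cdot>[P0 C ?p] A.gm q u mu"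
          by (rule inv_square[OF _ e0]) (use n u q in "simp_all add: A.k_inv")
        show "HM (FA (T1 G' q) u \<cdot>[A.E q] mm q ?a) mu = HM (mm q ?b \<cdot>[A.E q] FA (T1 G q) u) mu"
          using n u q by (simp add: mmM Mt e[THEN cmpE] e'[symmetric] M_nat[THEN cmpE])
      qed (use q u in "simp_all add: A.E_cmp mm mmd")
      then show "FA (NCod (MC m q)) u \<cdot>[FCod (NDom (MC m q))] NC (MC m q) (Src (FDom (NDom (MC m q))) u) =
        NC (MC m q) (Tgt (FDom (NDom (MC m q))) u) \<cdot>[FCod (NDom (MC m q))] FA (NDom (MC m q)) u" using q u by (simp add: mD mC)
    qed (use q in "simp_all add: mD mC mm mmd")
    then show "MC m q \<in> nats (T1 (MDom m) q) (T1 (MCod m) q)" using q by (simp add: md mD)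
  next
    fix f d assume "f \<in> Cell1 (coop L)" "d \<in> Ob (P0 (TDom (MDom m)) (src1 (coop L) f))"
    then have f: "f \<in> Cell1 L" "d \<in> Ob (P0 D (tgt1 L f))" by (simp_all add: md A.G)
    let ?p = "src1 L f" and ?q = "tgt1 L f"
    have "FA (codext_ftr L C f) (mm ?q d) \<cdot>[A.E ?p] NC (T2 G f) d = NC (T2 G' f) d \<cdot>[A.E ?p] mm ?p (FO (P1 D f) d)"
    proof (rule A.hmor_eqI[of ?p])
      fix nu assume n: "nu \<in> Cell1 L" "tgt1 L nu = ?p"
      have i: "isom (P0 C (src1 L nu)) (A.k nu (FO (P1 D f) d))" by (rule A.k_isom) (use f n in simp_all)
      show "HM (FA (codext_ftr L C f) (mm ?q d) \<cdot>[A.E ?p] NC (T2 G f) d) nu = HM (NC (T2 G' f) d \<cdot>[A.E ?p] mm ?p (FO (P1 D f) d)) nu"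
        by (rule isom_cancel[OF _ i])
          (use n f in "simp_all add: mm mmM mmd Mt A.t_k B.t_k[THEN cmpE] A.k_inv(1) A.k_inv(1)[THEN cmpE] M_nat")
    qed (use f in "simp_all add: A.E_cmp mm mmd")
    then show "FA (P1 (TCod (MDom m)) f) (NC (MC m (src1 (coop L) f)) d) \<cdot>[P0 (TCod (MDom m)) (tgt1 (coop L) f)] NC (T2 (MDom m) f) d =
      NC (T2 (MCod m) f) d \<cdot>[P0 (TCod (MDom m)) (tgt1 (coop L) f)] NC (MC m (tgt1 (coop L) f)) (FO (P1 (TDom (MDom m)) f) d)"
      using f by (simp add: md mC A.G A.codext_simps)
  qed (simp_all add: md A.G B.G)
  then have m: "adj_mdf kp L m" using A.G(1) B.G(1) by (simp add: adj_mdf_def md)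
  have "tra m = w"
  proof (rule mdf_eqI[of _ _ L])
    fix p assume p: "p \<in> Cell0 L"
    note t = lwh_mdf_modification[OF A.two U2_modification[OF A.two m] A.canon_colax(1)]
    show "MC (tra m) p = MC w p"
    proof (rule ntr_eqI)
      fix d assume "d \<in> Ob (FDom (NDom (MC (tra m) p)))"
      then have d: "d \<in> Ob (P0 D p)" using p by (simp add: A.canon_colax mD)
      \<comment> \<open>At an identity 1-cell the conjugating isomorphisms are inverse to images of
        \<open>PU D\<close> (\<open>ki_id\<close>), and they cancel by naturality of
        \<open>M\<close>.\<close>
      show "NC (MC (tra m) p) d = NC (MC w p) d"
        using p d Mt[OF p d] unfolding tra_component[OF m md p d] by (simp add: mC mmM A.ki_id(2) M_nat B.ki_id(1)[THEN cmpE], simp add: M_def)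
    qed (use p Wd[OF p] modificationD(6)[OF U2_modification[OF A.two m] A.two p] in "simp_all add: A.canon_colax mD")
  qed (use W(5) in "simp_all add: md wd")
  with m md show ?thesis by blast
qed

end

text \<open>The componentwise inverses satisfy the modification axiom by
  \<open>inv_square\<close>.\<close>

lemma mdf_isom:
  assumes two: "two_category K" and m: "modification kp K m" and i: "!!p. p \<in> Cell0 K ==> iso_ntr (MC m p)"
    and CD: "TDom (MDom m) = C" "TCod (MDom m) = D"
  shows "isom (colax_hom kp K C D) m"
proof -
  interpret twocat K by unfold_locales fact
  note M = modificationD[OF m two]
  interpret F: clx kp K "MDom m" using two M by unfold_locales
  interpret G: clx kp K "MCod m" using two M by unfold_locales
  define n where "n = \<lparr>MDom = MCod m, MCod = MDom m, MC = (\<lambda>p \<in> Cell0 K. inv_ntr (MC m p))\<rparr>"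
  have nd: "MDom n = MCod m" "MCod n = MDom m" "!!p. p \<in> Cell0 K ==> MC n p = inv_ntr (MC m p)" by (simp_all add: n_def)
  note ty = M(3,4,7,8)
  have inv: "NC (inv_ntr (MC m p)) x \<cdot>[P0 (TCod (MDom m)) p] NC (MC m p) x = Idn (P0 (TCod (MDom m)) p) (FO (T1 (MDom m) p) x)"
    "NC (MC m p) x \<cdot>[P0 (TCod (MDom m)) p] NC (inv_ntr (MC m p)) x = Idn (P0 (TCod (MDom m)) p) (FO (T1 (MCod m) p) x)"
    if "p \<in> Cell0 K" "x \<in> Ob (P0 (TDom (MDom m)) p)" for p x
    using inv_ntr(5,6)[OF i[OF that(1)], of x "P0 (TCod (MDom m)) p"] that by (simp_all add: ty)
  have n: "modification kp K n"
  proof (rule modificationI)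
    show "MC n \<in> extensional (Cell0 K)" by (simp add: n_def)
  next
    fix f x assume a: "f \<in> Cell1 K" and "x \<in> Ob (P0 (TDom (MDom n)) (src1 K f))"
    then have x: "x \<in> Ob (P0 (TDom (MDom m)) (src1 K f))" by (simp add: nd ty)
    have "NC (T2 (MDom m) f) x \<cdot>[P0 (TCod (MDom m)) (tgt1 K f)] NC (inv_ntr (MC m (tgt1 K f))) (FO (P1 (TDom (MDom m)) f) x) =
      FA (P1 (TCod (MDom m)) f) (NC (inv_ntr (MC m (src1 K f))) x) \<cdot>[P0 (TCod (MDom m)) (tgt1 K f)] NC (T2 (MCod m) f) x"
      by (rule inv_square[OF _ M(9)[OF a x]]) (use a x i in "simp_all add: inv ty inv[THEN FA_eq]")
    then show "FA (P1 (TCod (MDom n)) f) (NC (MC n (src1 K f)) x) \<cdot>[P0 (TCod (MDom n)) (tgt1 K f)] NC (T2 (MDom n) f) x =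
      NC (T2 (MCod n) f) x \<cdot>[P0 (TCod (MDom n)) (tgt1 K f)] NC (MC n (tgt1 K f)) (FO (P1 (TDom (MDom n)) f) x)"
      using a by (simp add: nd ty)
  qed (use two M i in "simp_all add: nd")
  show ?thesis
  proof (rule isomI[where g = n])
    show "n \<cdot>[colax_hom kp K C D] m = Idn (colax_hom kp K C D) (Src (colax_hom kp K C D) m)"
      unfolding colax_hom_simps
    proof (rule mdf_eqI[of _ _ K])
      fix p assume p: "p \<in> Cell0 K"
      show "MC (vcomp_mdf K n m) p = MC (id_mdf K (MDom m)) p"
        by (rule ntr_eqI) (use p i in "simp_all add: nd ty inv")
    qed (simp_all add: nd)
    show "m \<cdot>[colax_hom kp K C D] n = Idn (colax_hom kp K C D) (Src (colax_hom kp K C D) n)"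
      unfolding colax_hom_simps
    proof (rule mdf_eqI[of _ _ K])
      fix p assume p: "p \<in> Cell0 K"
      show "MC (vcomp_mdf K m n) p = MC (id_mdf K (MDom n)) p"
        by (rule ntr_eqI) (use p i in "simp_all add: nd ty inv")
    qed (simp_all add: nd)
  qed (use m n M CD in "simp_all add: nd")
qed

lemma (in adjp) D_PC_id:
  assumes "f \<in> Cell1 L" "x \<in> Ob (P0 D (tgt1 L f))" "p = src1 L f" "q = tgt1 L f"
  shows "NC (PC D f (id1 L q)) x = FA (P1 D f) (NC (inv_ntr (PU D q)) x)"
    "NC (PC D (id1 L p) f) x = NC (inv_ntr (PU D p)) (FO (P1 D f) x)"
  using D.PC_id(1)[of f x p q] D.PC_id(2)[of f x p] assms by simp_all

context extl begin

lemma ext_gct: "gct kp L C D ext_trf"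
  by unfold_locales (simp_all add: ext_trf_adj)

abbreviation "tre \<equiv> comp_trf L (canon kp L C) (U1 kp L ext_trf)"

text \<open>For the extension, \<open>k\<close> is the image of \<open>PC D\<close> with an identity
  factor, that is, of an inverse of \<open>PU D\<close>. This is where the unit constraints of
  \<open>D\<close> enter the transpose.\<close>

lemma tre_hlf:
  assumes f: "f \<in> Cell1 L" "d \<in> Ob (P0 D (tgt1 L f))" and q: "q = tgt1 L f"
  shows "hlf kp L D tre f d = FA (P1 C f) (FA (T (src1 L f)) (NC (PU D (src1 L f)) (FO (P1 D f) d))) \<cdot>[P0 C q]
    FA (P1 C f) (FA (T (src1 L f)) (FA (P1 D f) (NC (inv_ntr (PU D q)) d))) \<cdot>[P0 C q] \<phi> f (FO (P1 D (id1 L q)) d)"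
proof -
  interpret x: gct kp L C D ext_trf by (rule ext_gct)
  let ?p = "src1 L f"
  have k: "x.k f d = FA (T ?p) (NC (inv_ntr (PU D ?p)) (FO (P1 D f) d))"
    using f by (simp add: x.k_def h.D_PC_id)
  have e: "NC (inv_ntr (PU D ?p)) (FO (P1 D f) d) \<cdot>[P0 D ?p] NC (PU D ?p) (FO (P1 D f) d) = Idn (P0 D ?p) (FO (P1 D f) d)"
    by (rule h.D.PU_inv) (use f in simp_all)
  have ki: "x.ki f d = FA (T ?p) (NC (PU D ?p) (FO (P1 D f) d))"
  proof (rule isom_cancel_left[OF _ x.k_isom[OF f refl]])
    show "x.k f d \<cdot>[P0 C ?p] x.ki f d = x.k f d \<cdot>[P0 C ?p] FA (T ?p) (NC (PU D ?p) (FO (P1 D f) d))"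
      unfolding x.k_inv(2)[OF f refl] unfolding k using f by (simp add: e[THEN FA_eq])
  qed (use f in simp_all)
  show ?thesis
    unfolding x.trans_hlf[OF f] x.\<psi>_def using f q h.D.P2_id[of f d] by (simp add: ki h.D_PC_id)
qed

text \<open>The transpose has components \<open>T (D^1 d)\<close> instead of \<open>T d\<close>.
  Images of the inverses of \<open>PU D\<close> mediate between the two, and the extra factors in
  \<open>tre_hlf\<close> are those that make them a modification.\<close>

lemma tre_iso:
  assumes F: "colax kp L F" "TDom F = U0 kp L D" "TCod F = C" and T: "!!p. p \<in> Cell0 L ==> T1 F p = T p"
    and \<phi>: "!!f d. f \<in> Cell1 L ==> d \<in> Ob (P0 D (tgt1 L f)) ==> hlf kp L D F f d = \<phi> f d"
  shows "\<exists>i \<in> hom (colax_hom kp L (U0 kp L D) C) tre F. isom (colax_hom kp L (U0 kp L D) C) i"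
proof -
  interpret x: gct kp L C D ext_trf by (rule ext_gct)
  define m where "m = \<lparr>MDom = tre, MCod = F, MC = (\<lambda>p \<in> Cell0 L. \<lparr>NDom = ev p (id1 L p) \<odot> ext_ftr p, NCod = T p,
    NC = (\<lambda>d \<in> Ob (P0 D p). FA (T p) (NC (inv_ntr (PU D p)) d))\<rparr>)\<rparr>"
  have md: "MDom m = tre" "MCod m = F" "MC m \<in> extensional (Cell0 L)" by (simp_all add: m_def)
  have mC: "NDom (MC m p) = ev p (id1 L p) \<odot> ext_ftr p" "NCod (MC m p) = T p"
    "d \<in> Ob (P0 D p) ==> NC (MC m p) d = FA (T p) (NC (inv_ntr (PU D p)) d)" if "p \<in> Cell0 L" for p d
    using that by (simp_all add: m_def)
  have mn: "nattrans (MC m p)" if p: "p \<in> Cell0 L" for p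
  proof (rule nattransI)
    show "NC (MC m p) \<in> extensional (Ob (FDom (NDom (MC m p))))" using p by (simp add: m_def)
  next
    fix u assume "u \<in> Ar (FDom (NDom (MC m p)))"
    then have u: "u \<in> Ar (P0 D p)" using p by (simp add: mC)
    have e: "u \<cdot>[P0 D p] NC (inv_ntr (PU D p)) (Src (P0 D p) u) = NC (inv_ntr (PU D p)) (Tgt (P0 D p) u) \<cdot>[P0 D p] FA (P1 D (id1 L p)) u"
      using h.D.PUi_L[of p u] p u by simp
    show "FA (NCod (MC m p)) u \<cdot>[FCod (NDom (MC m p))] NC (MC m p) (Src (FDom (NDom (MC m p))) u) =
      NC (MC m p) (Tgt (FDom (NDom (MC m p))) u) \<cdot>[FCod (NDom (MC m p))] FA (NDom (MC m p)) u"
      using p u by (simp add: mC e[THEN FA_eq])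
  qed (use p in "simp_all add: mC")
  have iso: "iso_ntr (MC m p)" if p: "p \<in> Cell0 L" for p
  proof (rule iso_ntrI[OF mn[OF p]])
    fix d assume "d \<in> Ob (FDom (NDom (MC m p)))"
    then have d: "d \<in> Ob (P0 D p)" using p by (simp add: mC)
    have "isom (P0 D p) (NC (inv_ntr (PU D p)) d)"
      by (rule iso_ntr_isom[OF inv_ntr_iso[OF h.D.PU(1)]]) (use p d in simp_all)
    then have "isom (P0 C p) (FA (T p) (NC (inv_ntr (PU D p)) d))" by - (rule isom_FA[of _ "P0 D p"]; use p in simp)
    then show "isom (FCod (NDom (MC m p))) (NC (MC m p) d)" using p d by (simp add: mC)
  qed
  have "modification kp L m"
  proof (subst h.modification_hlf)
    show "\<forall>f\<in>Cell1 L. \<forall>d\<in>Ob (P0 D (tgt1 L f)). FA (P1 C f) (NC (MC m (src1 L f)) (FO (P1 D f) d)) \<cdot>[P0 C (tgt1 L f)] hlf kp L D (MDom m) f d =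
       hlf kp L D (MCod m) f d \<cdot>[P0 C (tgt1 L f)] NC (MC m (tgt1 L f)) d"
    proof (intro ballI)
      fix f d assume f: "f \<in> Cell1 L" "d \<in> Ob (P0 D (tgt1 L f))"
      let ?p = "src1 L f"
      have e: "NC (inv_ntr (PU D ?p)) (FO (P1 D f) d) \<cdot>[P0 D ?p] NC (PU D ?p) (FO (P1 D f) d) = Idn (P0 D ?p) (FO (P1 D f) d)"
        by (rule h.D.PU_inv) (use f in simp_all)
      show "FA (P1 C f) (NC (MC m (src1 L f)) (FO (P1 D f) d)) \<cdot>[P0 C (tgt1 L f)] hlf kp L D (MDom m) f d =
       hlf kp L D (MCod m) f d \<cdot>[P0 C (tgt1 L f)] NC (MC m (tgt1 L f)) d"
        unfolding md \<phi>[OF f] tre_hlf[OF f refl] using f by (simp add: mC e[THEN FA_eq, THEN FA_eq, THEN cmpE] h.\<phi>_R)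
    qed
  qed (use F T mn in "simp_all add: md mC x.trans_colax del: comp_trf_simps")
  moreover from this have "isom (colax_hom kp L (U0 kp L D) C) m"
    by (rule mdf_isom[OF two]) (use iso x.trans_colax in "simp_all add: md del: comp_trf_simps")
  ultimately show ?thesis by (intro bexI[of _ m]) (use x.trans_colax in "simp_all add: md del: comp_trf_simps")
qed

end

text \<open>Faithful by \<open>tra_inj\<close>, full by \<open>tra_full\<close>, and essentially
  surjective because the extension built from the half form of \<open>F\<close> transposes to
  \<open>F\<close> up to isomorphism (\<open>tre_iso\<close>).\<close>

theorem (in codk) canon_equivalence:
  fixes D :: "('p, 'f, 'a, 'od, 'md) catpfun"
  assumes D: "adj_pfun kp L D"
  shows "equivalence (transpose_U kp L (canon kp L C) D (codext kp L C) C)"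
proof (rule equivalenceI)
  interpret dd: adjp kp L D by unfold_locales (use two D in simp_all)
  show "is_functor (transpose_U kp L (canon kp L C) D (codext kp L C) C)"
    by (rule transpose_U_functor[OF two]) (simp add: canon_colax)
  show "FDom (transpose_U kp L (canon kp L C) D (codext kp L C) C) = adj_hom kp L D (codext kp L C)"
    "FCod (transpose_U kp L (canon kp L C) D (codext kp L C) C) = colax_hom kp L (U0 kp L D) C" by simp_all
  fix u v
  assume u: "u \<in> Ar (adj_hom kp L D (codext kp L C))" and v: "v \<in> Ar (adj_hom kp L D (codext kp L C))"
    and uv: "Src (adj_hom kp L D (codext kp L C)) u = Src (adj_hom kp L D (codext kp L C)) v"
      "Tgt (adj_hom kp L D (codext kp L C)) u = Tgt (adj_hom kp L D (codext kp L C)) v"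
    and e: "FA (transpose_U kp L (canon kp L C) D (codext kp L C) C) u = FA (transpose_U kp L (canon kp L C) D (codext kp L C) C) v"
  have u': "adj_mdf kp L u" "TDom (MDom u) = D" "TCod (MDom u) = codext kp L C" using u by simp_all
  have v': "adj_mdf kp L v" "MDom v = MDom u" "MCod v = MCod u" using v uv by simp_all
  note M = adj_mdfD[OF u'(1) two]
  interpret gct2 kp L C D "MDom u" "MCod u" by unfold_locales (use M u' in simp_all)
  have "tra u = tra v" using e u' v' by simp
  then show "u = v"
    by (intro tra_inj[OF u'(1) refl refl v']) (simp add: tra_component[OF u'(1) refl refl, symmetric] tra_component[OF v', symmetric])
next
  interpret dd: adjp kp L D by unfold_locales (use two D in simp_all)
  fix a b w
  assume a: "a \<in> Ob (adj_hom kp L D (codext kp L C))" and b: "b \<in> Ob (adj_hom kp L D (codext kp L C))"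
    and w: "w \<in> hom (colax_hom kp L (U0 kp L D) C) (FO (transpose_U kp L (canon kp L C) D (codext kp L C) C) a) (FO (transpose_U kp L (canon kp L C) D (codext kp L C) C) b)"
  interpret gct2 kp L C D a b by unfold_locales (use a b in simp_all)
  have w': "modification kp L w" "MDom w = comp_trf L (canon kp L C) (U1 kp L a)" "MCod w = comp_trf L (canon kp L C) (U1 kp L b)"
    using w a b by simp_all
  from tra_full[OF this] obtain m where "adj_mdf kp L m" "MDom m = a" "MCod m = b" "tra m = w" by blast
  then show "\<exists>u\<in>hom (adj_hom kp L D (codext kp L C)) a b. FA (transpose_U kp L (canon kp L C) D (codext kp L C) C) u = w"
    using a by (intro bexI[of _ m]) simp_all
next
  interpret dd: hctx kp L D C by unfold_locales (use two D psf in simp_all)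
  fix F assume "F \<in> Ob (colax_hom kp L (U0 kp L D) C)"
  then have F: "colax kp L F" "TDom F = U0 kp L D" "TCod F = C" by simp_all
  interpret h: hcolax kp L D C "T1 F" "hlf kp L D F" by (rule dd.hlf_hcolax[OF F])
  interpret extl kp L C D "T1 F" "hlf kp L D F" by unfold_locales
  obtain i where "i \<in> hom (colax_hom kp L (U0 kp L D) C) tre F" "isom (colax_hom kp L (U0 kp L D) C) i"
    using tre_iso[OF F] by auto
  then show "\<exists>x\<in>Ob (adj_hom kp L D (codext kp L C)). \<exists>i\<in>hom (colax_hom kp L (U0 kp L D) C) (FO (transpose_U kp L (canon kp L C) D (codext kp L C) C) x) F. isom (colax_hom kp L (U0 kp L D) C) i"
    using ext_trf_adj by (intro bexI[of _ ext_trf]) auto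
qed

section \<open>The co-dextrification as a right biadjoint\<close>

lemma lwh_id_mdf:
  assumes "two_category K" "colax kp K F" "colax kp K G" "TDom G = TCod F"
  shows "lwh_mdf K G (id_mdf K F) = id_mdf K (comp_trf K G F)" "rwh_mdf K (id_mdf K G) F = id_mdf K (comp_trf K G F)"
proof -
  interpret F: clx kp K F using assms by unfold_locales
  interpret G: clx kp K G using assms by unfold_locales
  show "lwh_mdf K G (id_mdf K F) = id_mdf K (comp_trf K G F)" "rwh_mdf K (id_mdf K G) F = id_mdf K (comp_trf K G F)"
    by (rule mdf_eqI[of _ _ K]; use assms in "simp add: lwh_id_ntr")+
qed

lemma adj_mdf_closure:
  assumes two: "two_category L"
  shows "adj_trf kp L F ==> adj_mdf kp L (id_mdf L F)"
    "adj_mdf kp L m ==> adj_mdf kp L n ==> MDom n = MCod m ==> adj_mdf kp L (vcomp_mdf L n m)"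
    "adj_mdf kp L m ==> adj_trf kp L G ==> TDom G = TCod (MDom m) ==> adj_mdf kp L (lwh_mdf (coop L) G m)"
    "adj_mdf kp L m ==> adj_trf kp L F ==> TDom (MDom m) = TCod F ==> adj_mdf kp L (rwh_mdf (coop L) m F)"
proof -
  note two' = two_category_coop[OF two]
  have c: "colax kp (coop L) X" if "adj_trf kp L X" for X :: "('a, 'b, 'c, 'x, 'y, 'x', 'y') trf"
    using that by (simp add: adj_trf_def pseudonatural_def)
  show "adj_trf kp L F ==> adj_mdf kp L (id_mdf L F)"
    by (simp add: adj_mdf_def c id_mdf_modification[OF two', simplified])
  show "adj_mdf kp L m ==> adj_mdf kp L n ==> MDom n = MCod m ==> adj_mdf kp L (vcomp_mdf L n m)"
    by (simp add: adj_mdf_def vcomp_mdf_modification[OF two', simplified])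
  assume m: "adj_mdf kp L m"
  note M = adj_mdfD(1-5)[OF m two]
  show "adj_mdf kp L (lwh_mdf (coop L) G m)" if "adj_trf kp L G" "TDom G = TCod (MDom m)"
    using that M by (simp add: adj_mdf_def adj_trf_comp[OF two] c lwh_mdf_modification[OF two'])
  show "adj_mdf kp L (rwh_mdf (coop L) m F)" if "adj_trf kp L F" "TDom (MDom m) = TCod F"
    using that M by (simp add: adj_mdf_def adj_trf_comp[OF two] c rwh_mdf_modification[OF two'])
qed

text \<open>For \<open>D = codext kp L C'\<close> the cells \<open>PU D\<close> have identity
  components, since restriction along an identity 1-cell is an identity functor. The isomorphism of
  \<open>tre_iso\<close> thereby becomes an equality, which \<open>trf_eqI\<close> checks on half
  forms.\<close>

lemma (in codk) strict_extension:
  fixes C' :: "('p, 'f, 'a, 'o2, 'm2) catpfun"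
  assumes C': "codk kp L C'" and X: "colax kp L X" "TDom X = U0 kp L (codext kp L C')" "TCod X = C"
  shows "\<exists>G. adj_trf kp L G \<and> TDom G = codext kp L C' \<and> TCod G = codext kp L C \<and> comp_trf L (canon kp L C) (U1 kp L G) = X"
proof -
  interpret S: codk kp L C' by fact
  interpret dd: hctx kp L "codext kp L C'" C by unfold_locales (use two S.codext_adj_pfun psf in simp_all)
  interpret h: hcolax kp L "codext kp L C'" C "T1 X" "hlf kp L (codext kp L C') X" by (rule dd.hlf_hcolax[OF X])
  interpret extl kp L C "codext kp L C'" "T1 X" "hlf kp L (codext kp L C') X" by unfold_locales
  interpret x: gct kp L C "codext kp L C'" ext_trf by (rule ext_gct)
  have id: "P1 (codext kp L C') (id1 L p) = id_ftr (S.E p)" if "p \<in> Cell0 L" for p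
    using S.codext_ftr_id[OF that] by (simp add: S.codext_simps)
  have P0': "P0 (codext kp L C') p = S.E p" for p by (simp add: S.codext_simps)
  have pu: "NC (PU (codext kp L C') p) Ga = Idn (S.E p) Ga" "NC (inv_ntr (PU (codext kp L C') p)) Ga = Idn (S.E p) Ga"
    if "p \<in> Cell0 L" "codext_obj L C' p Ga" for p Ga
  proof -
    show 1: "NC (PU (codext kp L C') p) Ga = Idn (S.E p) Ga"
      using that S.codext_ftr_id[OF that(1)] by (simp add: S.codext_simps)
    have "NC (inv_ntr (PU (codext kp L C') p)) Ga = NC (PU (codext kp L C') p) Ga"
      by (rule inv_ntr_comp[of _ _ _ "S.E p"]) (use that S.H.D.PU[of p] 1 S.E_id in "simp_all add: P0' id")
    then show "NC (inv_ntr (PU (codext kp L C') p)) Ga = Idn (S.E p) Ga" using 1 by simp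
  qed
  have "tre = X"
  proof (rule dd.trf_eqI)
    fix p assume p: "p \<in> Cell0 L"
    show "T1 tre p = T1 X p"
      unfolding x.trans_colax(4)[OF p] by (rule ftr_eqI) (use p in "simp_all add: id P0'")
  next
    fix f Ga assume f: "f \<in> Cell1 L" "Ga \<in> Ob (P0 (codext kp L C') (tgt1 L f))"
    then have g: "codext_obj L C' (tgt1 L f) Ga" by (simp add: P0')
    have g': "codext_obj L C' (src1 L f) (FO (P1 (codext kp L C') f) Ga)" using f g by (simp add: S.codext_simps)
    show "hlf kp L (codext kp L C') tre f Ga = hlf kp L (codext kp L C') X f Ga"
      unfolding tre_hlf[OF f refl] using f g g' h.T_simps[of "src1 L f"] S.H.D.P1[of f]
      by (simp add: pu id P0')
  qed (use X x.trans_colax in simp_all)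
  then show ?thesis using ext_trf_adj by (intro exI[of _ ext_trf]) simp
qed

text \<open>What transposition retains of a 2-cell into a co-dextrification (compare
  \<open>tra_component\<close>).\<close>

definition "cn L n p d = HM (NC (MC n p) d) (id1 L p)"

text \<open>Inverse to transposition on 2-cells: for a modification \<open>w\<close> between the
  transposes of \<open>G\<close> and \<open>G'\<close> the lift exists by fullness and is unique by
  faithfulness.\<close>

definition "lift kp L C G G' w = (SOME n. adj_mdf kp L n \<and> MDom n = G \<and> MCod n = G' \<and> lwh_mdf L (canon kp L C) (U2 kp L n) = w)"

text \<open>Supplied by \<open>strict_extension\<close>. The choice is immaterial: only the four
  properties listed are used afterwards.\<close>

definition "H1 kp L F = (SOME G. adj_trf kp L G \<and> TDom G = codext kp L (TDom F) \<and> TCod G = codext kp L (TCod F) \<and>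
  comp_trf L (canon kp L (TCod F)) (U1 kp L G) = comp_trf L F (canon kp L (TDom F)))"

text \<open>The transpose is prescribed to be \<open>m\<close> whiskered with the canonical map.
  This is well typed because \<open>H1\<close> extends on the nose.\<close>

definition "H2 kp L m = lift kp L (TCod (MDom m)) (H1 kp L (MDom m)) (H1 kp L (MCod m)) (rwh_mdf L m (canon kp L (TDom (MDom m))))"

text \<open>Source and target have equal transposes, so the comparison is the lift of an identity;
  likewise for \<open>HU\<close>.\<close>

definition "HC kp L G F = lift kp L (TCod G) (comp_trf (coop L) (H1 kp L G) (H1 kp L F)) (H1 kp L (comp_trf L G F))
  (id_mdf L (comp_trf L (comp_trf L G F) (canon kp L (TDom F))))"

definition "HU kp L C = lift kp L C (id_trf (coop L) (codext kp L C)) (H1 kp L (id_trf L C)) (id_mdf L (canon kp L C))"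

definition "Hp kp L = \<lparr>P0 = codext kp L, P1 = H1 kp L, P2 = H2 kp L, PC = HC kp L, PU = HU kp L\<rparr>"

locale biadj = twocat L for kp :: "'k rel" and L :: "('p, 'f, 'a) twocat" +
  assumes card: "Card_order kp" "cinfinite kp" and small: "small_twocat kp L"
begin

lemma codk: "pseudofunctor L (Lex kp) C ==> codk kp L C"
  by unfold_locales (use two card small in simp_all)

lemma colaxD:
  assumes "colax kp L F" shows "pseudofunctor L (Lex kp) (TDom F)" "pseudofunctor L (Lex kp) (TCod F)"
proof -
  interpret F: clx kp L F using two assms by unfold_locales
  show "pseudofunctor L (Lex kp) (TDom F)" "pseudofunctor L (Lex kp) (TCod F)" by (rule F.S.psf F.T.psf)+
qed

lemma gct2I:
  assumes C: "pseudofunctor L (Lex kp) C" and G: "adj_trf kp L G" "TCod G = codext kp L C"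
    and G': "adj_trf kp L G'" "TDom G' = TDom G" "TCod G' = codext kp L C"
  shows "gct2 kp L C (TDom G) G G'"
proof -
  interpret codk kp L C by (rule codk[OF C])
  interpret G: adjt kp L G using two G by unfold_locales
  show ?thesis by unfold_locales (use G G' in simp_all)
qed

lemma lift:
  assumes C: "pseudofunctor L (Lex kp) C" and G: "adj_trf kp L G" "TCod G = codext kp L C"
    and G': "adj_trf kp L G'" "TDom G' = TDom G" "TCod G' = codext kp L C"
    and w: "modification kp L w" "MDom w = comp_trf L (canon kp L C) (U1 kp L G)" "MCod w = comp_trf L (canon kp L C) (U1 kp L G')"
  shows "adj_mdf kp L (lift kp L C G G' w)" "MDom (lift kp L C G G' w) = G" "MCod (lift kp L C G G' w) = G'"
    "lwh_mdf L (canon kp L C) (U2 kp L (lift kp L C G G' w)) = w"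
    "p \<in> Cell0 L ==> d \<in> Ob (P0 (TDom G) p) ==> cn L (lift kp L C G G' w) p d = NC (MC w p) d"
proof -
  interpret gct2 kp L C "TDom G" G G' by (rule gct2I) (use assms in simp_all)
  show 1: "adj_mdf kp L (lift kp L C G G' w)" "MDom (lift kp L C G G' w) = G" "MCod (lift kp L C G G' w) = G'"
    "lwh_mdf L (canon kp L C) (U2 kp L (lift kp L C G G' w)) = w"
    using someI_ex[OF tra_full[OF w]] unfolding lift_def by blast+
  show "p \<in> Cell0 L ==> d \<in> Ob (P0 (TDom G) p) ==> cn L (lift kp L C G G' w) p d = NC (MC w p) d"
    using tra_component[OF 1(1-3)] 1(4) by (simp add: cn_def)
qed

lemma cn:
  assumes "pseudofunctor L (Lex kp) C" "adj_mdf kp L m" "TCod (MDom m) = codext kp L C" "p \<in> Cell0 L" "d \<in> Ob (P0 (TDom (MDom m)) p)"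
  shows "codext_mor L C p (NC (MC m p) d)" "HDom (NC (MC m p) d) = FO (T1 (MDom m) p) d" "HCod (NC (MC m p) d) = FO (T1 (MCod m) p) d"
    "cn L m p d \<in> Ar (P0 C p)" "Src (P0 C p) (cn L m p d) = HO (FO (T1 (MDom m) p) d) (id1 L p)"
    "Tgt (P0 C p) (cn L m p d) = HO (FO (T1 (MCod m) p) d) (id1 L p)"
proof -
  note M = adj_mdfD[OF assms(2) two]
  interpret gct2 kp L C "TDom (MDom m)" "MDom m" "MCod m" by (rule gct2I) (use assms M in simp_all)
  show 1: "codext_mor L C p (NC (MC m p) d)" "HDom (NC (MC m p) d) = FO (T1 (MDom m) p) d" "HCod (NC (MC m p) d) = FO (T1 (MCod m) p) d"
    using mdf_component(1-3)[OF assms(2) refl refl assms(4,5)] by simp_all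
  show "cn L m p d \<in> Ar (P0 C p)" "Src (P0 C p) (cn L m p d) = HO (FO (T1 (MDom m) p) d) (id1 L p)"
    "Tgt (P0 C p) (cn L m p d) = HO (FO (T1 (MCod m) p) d) (id1 L p)"
    using 1 assms(4) by (simp_all add: cn_def A.HM)
qed

text \<open>Faithfulness of transposition, in the form used for all laws of \<open>H\<close>:
  2-cells into a co-dextrification are compared on \<open>cn\<close>.\<close>

lemma cn_eqI:
  assumes "pseudofunctor L (Lex kp) C" "adj_mdf kp L m" "adj_mdf kp L n" "TCod (MDom m) = codext kp L C" "MDom m = MDom n" "MCod m = MCod n"
    "!!p d. p \<in> Cell0 L ==> d \<in> Ob (P0 (TDom (MDom m)) p) ==> cn L m p d = cn L n p d"
  shows "m = n"
proof -
  note M = adj_mdfD[OF assms(2) two]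
  interpret gct2 kp L C "TDom (MDom m)" "MDom m" "MCod m" by (rule gct2I) (use assms M in simp_all)
  show ?thesis by (rule tra_inj[OF assms(2) refl refl assms(3)]) (use assms(5-7) in "simp_all add: cn_def")
qed

lemma cn_id:
  assumes "pseudofunctor L (Lex kp) C" "adj_trf kp L G" "TCod G = codext kp L C" "p \<in> Cell0 L" "d \<in> Ob (P0 (TDom G) p)"
  shows "cn L (id_mdf L G) p d = Idn (P0 C p) (HO (FO (T1 G p) d) (id1 L p))"
proof -
  interpret gct2 kp L C "TDom G" G G by (rule gct2I) (use assms in simp_all)
  show ?thesis using assms by (simp add: cn_def)
qed

lemma cn_vcomp:
  assumes "pseudofunctor L (Lex kp) C" "adj_mdf kp L m" "adj_mdf kp L n" "TCod (MDom m) = codext kp L C" "MDom n = MCod m"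
    "p \<in> Cell0 L" "d \<in> Ob (P0 (TDom (MDom m)) p)"
  shows "cn L (vcomp_mdf L n m) p d = cn L n p d \<cdot>[P0 C p] cn L m p d"
proof -
  note M = adj_mdfD[OF assms(2) two]
  interpret gct2 kp L C "TDom (MDom m)" "MDom m" "MCod m" by (rule gct2I) (use assms M in simp_all)
  show ?thesis using assms M by (simp add: cn_def)
qed

lemma cn_rwh:
  assumes "adj_mdf kp L m" "adj_trf kp L F" "TDom (MDom m) = TCod F" "p \<in> Cell0 L" "d \<in> Ob (P0 (TDom F) p)"
  shows "cn L (rwh_mdf (coop L) m F) p d = cn L m p (FO (T1 F p) d)"
proof -
  interpret F: adjt kp L F using two assms by unfold_locales
  show ?thesis using assms adj_mdfD[OF assms(1) two] F.G.T1[of p] by (simp add: cn_def)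
qed

lemma H1:
  assumes F: "colax kp L F"
  shows "adj_trf kp L (H1 kp L F)" "TDom (H1 kp L F) = codext kp L (TDom F)" "TCod (H1 kp L F) = codext kp L (TCod F)"
    "comp_trf L (canon kp L (TCod F)) (U1 kp L (H1 kp L F)) = comp_trf L F (canon kp L (TDom F))"
proof -
  interpret S: codk kp L "TDom F" by (rule codk[OF colaxD(1)[OF F]])
  interpret T: codk kp L "TCod F" by (rule codk[OF colaxD(2)[OF F]])
  have "\<exists>G. adj_trf kp L G \<and> TDom G = codext kp L (TDom F) \<and> TCod G = codext kp L (TCod F) \<and>
      comp_trf L (canon kp L (TCod F)) (U1 kp L G) = comp_trf L F (canon kp L (TDom F))"
    by (rule T.strict_extension[OF codk[OF colaxD(1)[OF F]]]) (use F comp_trf_colax[OF two S.canon_colax(1) F] in "simp_all add: S.canon_colax")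
  from someI_ex[OF this] show "adj_trf kp L (H1 kp L F)" "TDom (H1 kp L F) = codext kp L (TDom F)" "TCod (H1 kp L F) = codext kp L (TCod F)"
    "comp_trf L (canon kp L (TCod F)) (U1 kp L (H1 kp L F)) = comp_trf L F (canon kp L (TDom F))"
    unfolding H1_def by blast+
qed

text \<open>The defining equation of \<open>H1\<close>, read on components. It lets
  \<open>cn\<close> pass through \<open>H1 kp L F\<close>, where it becomes an application of
  \<open>F\<close> (see \<open>cn_lwh\<close>).\<close>

lemma H1_canon:
  assumes F: "colax kp L F" and p: "p \<in> Cell0 L"
  shows "codext_obj L (TDom F) p Ga ==> codext_obj L (TCod F) p (FO (T1 (H1 kp L F) p) Ga)"
    "codext_obj L (TDom F) p Ga ==> HO (FO (T1 (H1 kp L F) p) Ga) (id1 L p) = FO (T1 F p) (HO Ga (id1 L p))"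
    "codext_mor L (TDom F) p u ==> HM (FA (T1 (H1 kp L F) p) u) (id1 L p) = FA (T1 F p) (HM u (id1 L p))"
proof -
  interpret S: codk kp L "TDom F" by (rule codk[OF colaxD(1)[OF F]])
  interpret T: codk kp L "TCod F" by (rule codk[OF colaxD(2)[OF F]])
  interpret F: clx kp L F using two F by unfold_locales
  interpret dd: adjp kp L "codext kp L (TDom F)" by unfold_locales (use two S.codext_adj_pfun in simp_all)
  interpret g: gct kp L "TCod F" "codext kp L (TDom F)" "H1 kp L F" by unfold_locales (use H1[OF F] in simp_all)
  have P0': "P0 (codext kp L (TDom F)) p = S.E p" by (simp add: S.codext_simps)
  have e: "T.ev p (id1 L p) \<odot> T1 (H1 kp L F) p = T1 F p \<odot> S.ev p (id1 L p)"
    using arg_cong[OF H1(4)[OF F], of "\<lambda>X. T1 X p"] p by (simp add: S.canon_colax T.canon_colax U1_def)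
  show "codext_obj L (TDom F) p Ga ==> codext_obj L (TCod F) p (FO (T1 (H1 kp L F) p) Ga)"
    using g.g1_mor(1)[OF p, of Ga] by (simp add: P0')
  show "codext_obj L (TDom F) p Ga ==> HO (FO (T1 (H1 kp L F) p) Ga) (id1 L p) = FO (T1 F p) (HO Ga (id1 L p))"
    using arg_cong[OF e, of "\<lambda>X. FO X Ga"] p by (simp add: P0')
  show "codext_mor L (TDom F) p u ==> HM (FA (T1 (H1 kp L F) p) u) (id1 L p) = FA (T1 F p) (HM u (id1 L p))"
    using arg_cong[OF e, of "\<lambda>X. FA X u"] p by (simp add: P0')
qed

lemma cn_lwh:
  assumes F: "colax kp L F" and m: "adj_mdf kp L m" "TCod (MDom m) = codext kp L (TDom F)" and p: "p \<in> Cell0 L" "d \<in> Ob (P0 (TDom (MDom m)) p)"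
  shows "cn L (lwh_mdf (coop L) (H1 kp L F) m) p d = FA (T1 F p) (cn L m p d)"
proof -
  note M = adj_mdfD[OF m(1) two]
  interpret G: adjt kp L "MDom m" using two M by unfold_locales
  show ?thesis
    using cn(1)[OF colaxD(1)[OF F] m p] H1_canon(3)[OF F p(1)] p M G.G.T1[of p] by (simp add: cn_def)
qed

lemma H2:
  assumes m: "modification kp L m"
  shows "adj_mdf kp L (H2 kp L m)" "MDom (H2 kp L m) = H1 kp L (MDom m)" "MCod (H2 kp L m) = H1 kp L (MCod m)"
    "lwh_mdf L (canon kp L (TCod (MDom m))) (U2 kp L (H2 kp L m)) = rwh_mdf L m (canon kp L (TDom (MDom m)))"
    "p \<in> Cell0 L ==> codext_obj L (TDom (MDom m)) p Ga ==> cn L (H2 kp L m) p Ga = NC (MC m p) (HO Ga (id1 L p))"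
proof -
  note M = modificationD[OF m two]
  interpret S: codk kp L "TDom (MDom m)" by (rule codk[OF colaxD(1)[OF M(1)]])
  note h = H1[OF M(1)] H1[OF M(2), unfolded M(3,4)]
  note l = lift[OF colaxD(2)[OF M(1)] h(1,3,5) _ h(7), of "rwh_mdf L m (canon kp L (TDom (MDom m)))", folded H2_def]
  have w: "modification kp L (rwh_mdf L m (canon kp L (TDom (MDom m))))"
    by (rule rwh_mdf_modification[OF two m]) (simp_all add: S.canon_colax)
  show "adj_mdf kp L (H2 kp L m)" "MDom (H2 kp L m) = H1 kp L (MDom m)" "MCod (H2 kp L m) = H1 kp L (MCod m)"
    "lwh_mdf L (canon kp L (TCod (MDom m))) (U2 kp L (H2 kp L m)) = rwh_mdf L m (canon kp L (TDom (MDom m)))"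
    by (rule l; simp add: h w)+
  assume p: "p \<in> Cell0 L" "codext_obj L (TDom (MDom m)) p Ga"
  have "cn L (H2 kp L m) p Ga = NC (MC (rwh_mdf L m (canon kp L (TDom (MDom m)))) p) Ga"
    by (rule l) (use p in "simp_all add: h w S.codext_simps")
  then show "cn L (H2 kp L m) p Ga = NC (MC m p) (HO Ga (id1 L p))" using p by (simp add: S.canon_colax)
qed

text \<open>The inverse is the lift of the same identity in the opposite direction; both composites
  have identities as values of \<open>cn\<close>.\<close>

lemma HU:
  assumes C: "pseudofunctor L (Lex kp) C"
  shows "adj_mdf kp L (HU kp L C)" "MDom (HU kp L C) = id_trf (coop L) (codext kp L C)" "MCod (HU kp L C) = H1 kp L (id_trf L C)"
    "lwh_mdf L (canon kp L C) (U2 kp L (HU kp L C)) = id_mdf L (canon kp L C)"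
    "p \<in> Cell0 L ==> codext_obj L C p Ga ==> cn L (HU kp L C) p Ga = Idn (P0 C p) (HO Ga (id1 L p))"
    "invertible2 (Ps_adj kp L) (HU kp L C)"
proof -
  interpret S: codk kp L C by (rule codk[OF C])
  have i: "colax kp L (id_trf L C)" by (rule id_trf_colax[OF two C])
  note h = H1[OF i, unfolded id_trf_simps]
  have a: "adj_trf kp L (id_trf (coop L) (codext kp L C))" by (rule adj_trf_id[OF two S.codext_adj_pfun])
  have t: "comp_trf L (canon kp L C) (U1 kp L (id_trf (coop L) (codext kp L C))) = canon kp L C"
    "comp_trf L (id_trf L C) (canon kp L C) = canon kp L C"
    using comp_trf_id[OF two S.canon_colax(1)] by (simp_all add: U1_id[OF two S.codext_adj_pfun] S.canon_colax)
  have w: "modification kp L (id_mdf L (canon kp L C))" by (rule id_mdf_modification[OF two S.canon_colax(1)])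
  note l = lift[OF C a _ h(1), of "id_mdf L (canon kp L C)", folded HU_def]
  show 1: "adj_mdf kp L (HU kp L C)" "MDom (HU kp L C) = id_trf (coop L) (codext kp L C)" "MCod (HU kp L C) = H1 kp L (id_trf L C)"
    "lwh_mdf L (canon kp L C) (U2 kp L (HU kp L C)) = id_mdf L (canon kp L C)"
    by (rule l; simp add: h w t)+
  show 2: "cn L (HU kp L C) p Ga = Idn (P0 C p) (HO Ga (id1 L p))" if p: "p \<in> Cell0 L" "codext_obj L C p Ga" for p Ga
  proof -
    have "cn L (HU kp L C) p Ga = NC (MC (id_mdf L (canon kp L C)) p) Ga"
      by (rule l) (use p in "simp_all add: h w t S.codext_simps")
    then show ?thesis using p by (simp add: S.canon_colax)
  qed
  let ?n = "lift kp L C (H1 kp L (id_trf L C)) (id_trf (coop L) (codext kp L C)) (id_mdf L (canon kp L C))"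
  note l' = lift[OF C h(1) h(3) a, of "id_mdf L (canon kp L C)"]
  have 3: "adj_mdf kp L ?n" "MDom ?n = H1 kp L (id_trf L C)" "MCod ?n = id_trf (coop L) (codext kp L C)" by (rule l'; simp add: h w t)+
  have 4: "cn L ?n p Ga = Idn (P0 C p) (HO Ga (id1 L p))" if p: "p \<in> Cell0 L" "codext_obj L C p Ga" for p Ga
  proof -
    have "cn L ?n p Ga = NC (MC (id_mdf L (canon kp L C)) p) Ga"
      by (rule l') (use p in "simp_all add: h w t S.codext_simps")
    then show ?thesis using p by (simp add: S.canon_colax)
  qed
  have P0': "P0 (codext kp L C) p = S.E p" for p by (simp add: S.codext_simps)
  have "vcomp_mdf L ?n (HU kp L C) = id_mdf L (id_trf (coop L) (codext kp L C))"
    by (rule cn_eqI[OF C adj_mdf_closure(2)[OF two] adj_mdf_closure(1)[OF two]])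
      (use 1 3 a in "simp_all add: cn_vcomp[OF C] cn_id[OF C] 2 4 P0'")
  moreover have "vcomp_mdf L (HU kp L C) ?n = id_mdf L (H1 kp L (id_trf L C))"
    by (rule cn_eqI[OF C adj_mdf_closure(2)[OF two] adj_mdf_closure(1)[OF two]])
      (use 1 3 h H1_canon(2)[OF i] in "simp_all add: cn_vcomp[OF C] cn_id[OF C] 2 4 P0'")
  ultimately show "invertible2 (Ps_adj kp L) (HU kp L C)"
    unfolding invertible2_def using 1 3 by (auto intro!: bexI[of _ ?n])
qed

text \<open>Equality of the transposes of source and target (\<open>t\<close>) follows from strict
  associativity and the defining equation of \<open>H1\<close>, used once for \<open>G\<close> and
  once for \<open>F\<close>. Invertibility is proved as in \<open>HU\<close>.\<close>

lemma HC:
  assumes F: "colax kp L F" and G: "colax kp L G" and eq: "TDom G = TCod F"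
  shows "adj_mdf kp L (HC kp L G F)" "MDom (HC kp L G F) = comp_trf (coop L) (H1 kp L G) (H1 kp L F)" "MCod (HC kp L G F) = H1 kp L (comp_trf L G F)"
    "lwh_mdf L (canon kp L (TCod G)) (U2 kp L (HC kp L G F)) = id_mdf L (comp_trf L (comp_trf L G F) (canon kp L (TDom F)))"
    "p \<in> Cell0 L ==> codext_obj L (TDom F) p Ga ==> cn L (HC kp L G F) p Ga = Idn (P0 (TCod G) p) (FO (T1 G p) (FO (T1 F p) (HO Ga (id1 L p))))"
    "invertible2 (Ps_adj kp L) (HC kp L G F)"
proof -
  interpret F: clx kp L F using two F by unfold_locales
  interpret G: clx kp L G using two G by unfold_locales
  interpret S: codk kp L "TDom F" by (rule codk[OF colaxD(1)[OF F]])
  interpret T: codk kp L "TCod F" by (rule codk[OF colaxD(2)[OF F]])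
  interpret V: codk kp L "TCod G" by (rule codk[OF colaxD(2)[OF G]])
  note C = colaxD(2)[OF G]
  let ?K = "comp_trf L G F" and ?A = "comp_trf (coop L) (H1 kp L G) (H1 kp L F)" and ?c = "canon kp L (TDom F)"
  have K: "colax kp L ?K" by (rule comp_trf_colax[OF two F G eq])
  note hF = H1[OF F] and hG = H1[OF G, unfolded eq] and h = H1[OF K, unfolded comp_trf_simps]
  have a: "adj_trf kp L ?A" by (rule adj_trf_comp[OF two hF(1) hG(1)]) (simp add: hF hG)
  note uF = U1_colax[OF two hF(1), unfolded hF] and uG = U1_colax[OF two hG(1), unfolded hG]
  have t: "comp_trf L (canon kp L (TCod G)) (U1 kp L ?A) = comp_trf L ?K ?c"
  proof -
    have "comp_trf L (canon kp L (TCod G)) (U1 kp L ?A) = comp_trf L (canon kp L (TCod G)) (comp_trf L (U1 kp L (H1 kp L G)) (U1 kp L (H1 kp L F)))"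
      by (subst U1_comp[OF two hF(1) hG(1)]) (simp_all add: hF hG)
    also have "\<dots> = comp_trf L (comp_trf L (canon kp L (TCod G)) (U1 kp L (H1 kp L G))) (U1 kp L (H1 kp L F))"
      by (rule comp_trf_assoc[OF two uF(1) uG(1) V.canon_colax(1), symmetric]) (simp_all add: uF uG V.canon_colax)
    also have "\<dots> = comp_trf L (comp_trf L G (canon kp L (TCod F))) (U1 kp L (H1 kp L F))" by (simp only: hG)
    also have "\<dots> = comp_trf L G (comp_trf L (canon kp L (TCod F)) (U1 kp L (H1 kp L F)))"
      by (rule comp_trf_assoc[OF two uF(1) T.canon_colax(1) G]) (simp_all add: uF eq T.canon_colax)
    also have "\<dots> = comp_trf L G (comp_trf L F ?c)" by (simp only: hF)
    also have "\<dots> = comp_trf L ?K ?c"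
      by (rule comp_trf_assoc[OF two S.canon_colax(1) F G, symmetric]) (simp_all add: eq S.canon_colax)
    finally show ?thesis .
  qed
  let ?w = "id_mdf L (comp_trf L ?K ?c)"
  have w: "modification kp L ?w"
    by (rule id_mdf_modification[OF two comp_trf_colax[OF two S.canon_colax(1) K]]) (simp add: S.canon_colax)
  have wp: "NC (MC ?w p) Ga = Idn (P0 (TCod G) p) (FO (T1 G p) (FO (T1 F p) (HO Ga (id1 L p))))" if "p \<in> Cell0 L" "codext_obj L (TDom F) p Ga" for p Ga
    using that eq by (simp add: S.canon_colax)
  note l = lift[OF C a _ h(1), of ?w, folded HC_def]
  show 1: "adj_mdf kp L (HC kp L G F)" "MDom (HC kp L G F) = ?A" "MCod (HC kp L G F) = H1 kp L ?K"
    "lwh_mdf L (canon kp L (TCod G)) (U2 kp L (HC kp L G F)) = ?w"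
    by (rule l; simp add: h hF hG w t del: U1_comp)+
  show 2: "cn L (HC kp L G F) p Ga = Idn (P0 (TCod G) p) (FO (T1 G p) (FO (T1 F p) (HO Ga (id1 L p))))" if p: "p \<in> Cell0 L" "codext_obj L (TDom F) p Ga" for p Ga
  proof -
    have "cn L (HC kp L G F) p Ga = NC (MC ?w p) Ga"
      by (rule l) (use p in "simp_all add: h hF hG w t S.codext_simps")
    then show ?thesis using wp[OF p] by simp
  qed
  let ?n = "lift kp L (TCod G) (H1 kp L ?K) ?A ?w"
  note l' = lift[OF C h(1) h(3) a, of ?w]
  have 3: "adj_mdf kp L ?n" "MDom ?n = H1 kp L ?K" "MCod ?n = ?A" by (rule l'; simp add: h hF hG w t)+
  have 4: "cn L ?n p Ga = Idn (P0 (TCod G) p) (FO (T1 G p) (FO (T1 F p) (HO Ga (id1 L p))))" if p: "p \<in> Cell0 L" "codext_obj L (TDom F) p Ga" for p Ga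
  proof -
    have "cn L ?n p Ga = NC (MC ?w p) Ga"
      by (rule l') (use p in "simp_all add: h hF hG w t S.codext_simps")
    then show ?thesis using wp[OF p] by simp
  qed
  have P0': "P0 (codext kp L (TDom F)) p = S.E p" for p by (simp add: S.codext_simps)
  have T1A: "FO (T1 ?A p) Ga = FO (T1 (H1 kp L G) p) (FO (T1 (H1 kp L F) p) Ga)" if "p \<in> Cell0 L" "codext_obj L (TDom F) p Ga" for p Ga
  proof -
    interpret f: adjt kp L "H1 kp L F" using two hF(1) by unfold_locales
    show ?thesis using that f.G.T1[of p] by (simp add: hF P0')
  qed
  note hc = H1_canon[OF F] H1_canon[OF G, unfolded eq] H1_canon(2)[OF K, unfolded comp_trf_simps]
  have "vcomp_mdf L ?n (HC kp L G F) = id_mdf L ?A"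
    by (rule cn_eqI[OF C adj_mdf_closure(2)[OF two] adj_mdf_closure(1)[OF two]])
      (use 1 3 a in "simp_all add: cn_vcomp[OF C] cn_id[OF C] 2 4 P0' hF hG T1A hc eq del: comp_trf_simps(3)")
  moreover have "vcomp_mdf L (HC kp L G F) ?n = id_mdf L (H1 kp L ?K)"
    by (rule cn_eqI[OF C adj_mdf_closure(2)[OF two] adj_mdf_closure(1)[OF two]])
      (use 1 3 h in "simp_all add: cn_vcomp[OF C] cn_id[OF C] 2 4 P0' hc eq")
  ultimately show "invertible2 (Ps_adj kp L) (HC kp L G F)"
    unfolding invertible2_def using 1 3 by (auto intro!: bexI[of _ ?n])
qed

end

lemma codext_P0 [simp]: "P0 (codext kp L C) p = codext_cat L C p"
  by (simp add: codext_def strict_pfun_def)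

lemma in_codext_cat [simp]: "Ga \<in> Ob (codext_cat L C p) \<longleftrightarrow> codext_obj L C p Ga"
  by (simp add: codext_cat_def)

context biadj begin

lemma HO_id1 [simp]: "pseudofunctor L (Lex kp) C ==> p \<in> Cell0 L ==> codext_obj L C p Ga ==> HO Ga (id1 L p) \<in> Ob (P0 C p)"
  using codk.axioms(1)[OF codk, THEN cod.HO, of C "id1 L p" Ga p] by simp

lemma H1_comp_FO:
  assumes F: "colax kp L F" and p: "p \<in> Cell0 L" "codext_obj L (TDom F) p Ga"
  shows "FO (T1 (comp_trf (coop L) G (H1 kp L F)) p) Ga = FO (T1 G p) (FO (T1 (H1 kp L F) p) Ga)"
proof -
  interpret f: adjt kp L "H1 kp L F" using two H1(1)[OF F] by unfold_locales
  show ?thesis using p f.G.T1[of p] by (simp add: H1[OF F])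
qed

text \<open>On \<open>cn\<close> the cells \<open>HC\<close> become identities, and both sides
  reduce to the component of \<open>m\<close> at an image under \<open>F\<close>.\<close>

lemma H_rwh:
  fixes F :: "('p, 'f, 'a, 'o, 'm, 'o, 'm) trf" and m :: "('p, 'f, 'a, 'o, 'm, 'o, 'm) mdf"
  assumes F: "colax kp L F" and m: "modification kp L m" and eq: "TDom (MDom m) = TCod F"
  shows "vcomp_mdf L (H2 kp L (rwh_mdf L m F)) (HC kp L (MDom m) F) = vcomp_mdf L (HC kp L (MCod m) F) (rwh_mdf (coop L) (H2 kp L m) (H1 kp L F))"
proof -
  note M = modificationD[OF m two, unfolded eq]
  interpret F: clx kp L F using two F by unfold_locales
  interpret A: clx kp L "MDom m" using two M by unfold_locales
  note C = colaxD(2)[OF M(1)]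
  have r: "modification kp L (rwh_mdf L m F)" by (rule rwh_mdf_modification[OF two m F eq])
  note f = H1[OF F] H1_canon[OF F] and hm = H2[OF m, unfolded eq] and hr = H2[OF r, simplified] and c = HC[OF F M(1) eq] HC[OF F M(2) M(3), unfolded M(4)]
  have a: "adj_mdf kp L (rwh_mdf (coop L) (H2 kp L m) (H1 kp L F))"
    by (rule adj_mdf_closure(4)[OF two]) (simp_all add: hm f H1[OF M(1)] eq)
  show ?thesis
    by (rule cn_eqI[OF C adj_mdf_closure(2)[OF two] adj_mdf_closure(2)[OF two]])
      (use M F.T1 A.T1 in "simp_all add: f hm hr c a H1[OF M(1)] eq cn_vcomp[OF C] cn_rwh colaxD[OF F]")
qed

lemma H_lwh:
  fixes G :: "('p, 'f, 'a, 'o, 'm, 'o, 'm) trf" and m :: "('p, 'f, 'a, 'o, 'm, 'o, 'm) mdf"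
  assumes G: "colax kp L G" and m: "modification kp L m" and eq: "TDom G = TCod (MDom m)"
  shows "vcomp_mdf L (H2 kp L (lwh_mdf L G m)) (HC kp L G (MDom m)) = vcomp_mdf L (HC kp L G (MCod m)) (lwh_mdf (coop L) (H1 kp L G) (H2 kp L m))"
proof -
  note M = modificationD[OF m two]
  interpret G: clx kp L G using two G by unfold_locales
  interpret A: clx kp L "MDom m" using two M by unfold_locales
  interpret B: clx kp L "MCod m" using two M by unfold_locales
  note C = colaxD(2)[OF G]
  have r: "modification kp L (lwh_mdf L G m)" by (rule lwh_mdf_modification[OF two m G eq])
  note f = H1[OF G] and hm = H2[OF m] and hr = H2[OF r, simplified] and c = HC[OF M(1) G eq] HC[OF M(2) G eq[folded M(4)], unfolded M(3)]
  have a: "adj_mdf kp L (lwh_mdf (coop L) (H1 kp L G) (H2 kp L m))"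
    by (rule adj_mdf_closure(3)[OF two]) (simp_all add: hm f H1[OF M(1)] eq)
  show ?thesis
    by (rule cn_eqI[OF C adj_mdf_closure(2)[OF two] adj_mdf_closure(2)[OF two]])
      (use M G.T1 A.T1 B.T1 colaxD(1)[OF M(1)] in "simp_all add: f hm hr c a H1[OF M(1)] eq cn_vcomp[OF C] cn_lwh[OF G] eq")
qed

text \<open>All four cells have identities as values of \<open>cn\<close>. What has to be supplied
  is that the two composites are parallel, and this is strict associativity over
  \<open>coop L\<close> and over \<open>L\<close>.\<close>

lemma H_assoc:
  fixes F G K :: "('p, 'f, 'a, 'o, 'm, 'o, 'm) trf"
  assumes F: "colax kp L F" and G: "colax kp L G" and K: "colax kp L K" and eq: "TDom G = TCod F" "TDom K = TCod G"
  shows "vcomp_mdf L (HC kp L (comp_trf L K G) F) (rwh_mdf (coop L) (HC kp L K G) (H1 kp L F)) =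
    vcomp_mdf L (HC kp L K (comp_trf L G F)) (lwh_mdf (coop L) (H1 kp L K) (HC kp L G F))"
proof -
  interpret F: clx kp L F using two F by unfold_locales
  interpret G: clx kp L G using two G by unfold_locales
  interpret K: clx kp L K using two K by unfold_locales
  note C = colaxD(2)[OF K]
  have KG: "colax kp L (comp_trf L K G)" and GF: "colax kp L (comp_trf L G F)" using comp_trf_colax[OF two] assms by auto
  note h = H1[OF F] H1[OF G, unfolded eq] H1[OF K, unfolded eq] H1[OF KG, unfolded comp_trf_simps eq] H1[OF GF, unfolded comp_trf_simps eq]
  have cc: "colax kp (coop L) (H1 kp L F)" "colax kp (coop L) (H1 kp L G)" "colax kp (coop L) (H1 kp L K)"
    using h by (simp_all add: adj_trf_def pseudonatural_def)
  have as: "comp_trf (coop L) (comp_trf (coop L) (H1 kp L K) (H1 kp L G)) (H1 kp L F) = comp_trf (coop L) (H1 kp L K) (comp_trf (coop L) (H1 kp L G) (H1 kp L F))"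
    by (rule comp_trf_assoc[OF two_category_coop[OF two] cc]) (simp_all add: h)
  have as': "comp_trf L (comp_trf L K G) F = comp_trf L K (comp_trf L G F)" by (rule comp_trf_assoc[OF two F G K eq])
  note c = HC[OF F G eq(1)] HC[OF G K eq(2), unfolded eq] HC[OF F KG, simplified, OF eq(1)] HC[OF GF K, simplified, OF eq(2)]
  have a: "adj_mdf kp L (rwh_mdf (coop L) (HC kp L K G) (H1 kp L F))" "adj_mdf kp L (lwh_mdf (coop L) (H1 kp L K) (HC kp L G F))"
    by (rule adj_mdf_closure(4)[OF two], simp_all add: c h) (rule adj_mdf_closure(3)[OF two], simp_all add: c h)
  show ?thesis
    by (rule cn_eqI[OF C adj_mdf_closure(2)[OF two] adj_mdf_closure(2)[OF two]])
      (use F.T1 G.T1 K.T1 colaxD[OF F] in "simp_all add: h c a as as' cn_vcomp[OF C] cn_rwh cn_lwh[OF K] H1_canon[OF F] eq")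
qed

lemma H_unit:
  fixes F :: "('p, 'f, 'a, 'o, 'm, 'o, 'm) trf"
  assumes F: "colax kp L F"
  shows "vcomp_mdf L (HC kp L F (id_trf L (TDom F))) (lwh_mdf (coop L) (H1 kp L F) (HU kp L (TDom F))) = id_mdf L (H1 kp L F)"
    "vcomp_mdf L (HC kp L (id_trf L (TCod F)) F) (rwh_mdf (coop L) (HU kp L (TCod F)) (H1 kp L F)) = id_mdf L (H1 kp L F)"
proof -
  interpret F: clx kp L F using two F by unfold_locales
  note C = colaxD[OF F]
  have i: "colax kp L (id_trf L (TDom F))" "colax kp L (id_trf L (TCod F))" using id_trf_colax[OF two] C by auto
  note h = H1[OF F] H1[OF i(1), unfolded id_trf_simps] H1[OF i(2), unfolded id_trf_simps]
  have cc: "colax kp (coop L) (H1 kp L F)" using h by (simp add: adj_trf_def pseudonatural_def)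
  note ci = comp_trf_id[OF two_category_coop[OF two] cc] comp_trf_id[OF two F]
  note u = HU[OF C(1)] HU[OF C(2)] and c = HC[OF i(1) F, simplified] HC[OF F i(2), simplified]
  have a: "adj_mdf kp L (lwh_mdf (coop L) (H1 kp L F) (HU kp L (TDom F)))" "adj_mdf kp L (rwh_mdf (coop L) (HU kp L (TCod F)) (H1 kp L F))"
    by (rule adj_mdf_closure(3)[OF two], simp_all add: u h) (rule adj_mdf_closure(4)[OF two], simp_all add: u h)
  show "vcomp_mdf L (HC kp L F (id_trf L (TDom F))) (lwh_mdf (coop L) (H1 kp L F) (HU kp L (TDom F))) = id_mdf L (H1 kp L F)"
    by (rule cn_eqI[OF C(2) adj_mdf_closure(2)[OF two] adj_mdf_closure(1)[OF two]])
      (use F.T1 C in "simp_all add: h u c a ci cn_vcomp[OF C(2)] cn_lwh[OF F] cn_id[OF C(2)] H1_canon[OF F]")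
  show "vcomp_mdf L (HC kp L (id_trf L (TCod F)) F) (rwh_mdf (coop L) (HU kp L (TCod F)) (H1 kp L F)) = id_mdf L (H1 kp L F)"
    by (rule cn_eqI[OF C(2) adj_mdf_closure(2)[OF two] adj_mdf_closure(1)[OF two]])
      (use F.T1 C in "simp_all add: h u c a ci cn_vcomp[OF C(2)] cn_rwh cn_id[OF C(2)] H1_canon[OF F]")
qed

lemma H_id:
  fixes F :: "('p, 'f, 'a, 'o, 'm, 'o, 'm) trf"
  assumes F: "colax kp L F"
  shows "H2 kp L (id_mdf L F) = id_mdf L (H1 kp L F)"
proof -
  interpret F: clx kp L F using two F by unfold_locales
  note C = colaxD[OF F] and h = H1[OF F] and m = H2[OF id_mdf_modification[OF two F], simplified]
  show ?thesis
    by (rule cn_eqI[OF C(2) _ adj_mdf_closure(1)[OF two]]) (use F.T1 C in "simp_all add: h m cn_id[OF C(2)] H1_canon[OF F]")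
qed

lemma H_vcomp:
  fixes m n :: "('p, 'f, 'a, 'o, 'm, 'o, 'm) mdf"
  assumes m: "modification kp L m" "modification kp L n" "MDom n = MCod m"
  shows "H2 kp L (vcomp_mdf L n m) = vcomp_mdf L (H2 kp L n) (H2 kp L m)"
proof -
  note M = modificationD[OF m(1) two] and N = modificationD[OF m(2) two, unfolded m(3)]
  interpret F: clx kp L "MDom m" using two M by unfold_locales
  note C = colaxD[OF M(1)] and h = H1[OF M(1)] 
  note k = H2[OF m(1)] H2[OF m(2), unfolded m(3) M(3,4)] H2[OF vcomp_mdf_modification[OF two m], simplified]
  show ?thesis
    by (rule cn_eqI[OF C(2) _ adj_mdf_closure(2)[OF two]]) (use F.T1 C M N m in "simp_all add: h k cn_vcomp[OF C(2)]")
qed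

lemma H_pseudofunctor:
  "pseudofunctor (Ps_colax kp L) (Ps_adj kp L) (Hp kp L :: (('p, 'f, 'a, 'o, 'm) catpfun, ('p, 'f, 'a, 'o, 'm, 'o, 'm) trf, ('p, 'f, 'a, 'o, 'm, 'o, 'm) mdf, _, _, _) pfun)"
proof -
  have s: "P0 (Hp kp L) = codext kp L" "P1 (Hp kp L) = H1 kp L" "P2 (Hp kp L) = H2 kp L" "PC (Hp kp L) = HC kp L" "PU (Hp kp L) = HU kp L"
    by (simp_all add: Hp_def)
  have 0: "adj_pfun kp L (codext kp L C)" if "pseudofunctor L (Lex kp) C" for C :: "('p, 'f, 'a, 'o, 'm) catpfun"
    by (rule codk.codext_adj_pfun[OF codk[OF that]])
  show ?thesis
    unfolding pseudofunctor_def s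
    by (simp add: 0 H1 H2 HU HC H_id H_vcomp H_rwh H_lwh H_assoc H_unit)
qed

text \<open>With identities as the 2-cells \<open>e1\<close>, the conditions on them come down to
  the equations that prescribe the transposes of \<open>H2\<close>, \<open>HC\<close> and
  \<open>HU\<close>; strict associativity and unit laws match the remaining domains.\<close>

lemma H_right_biadjoint:
  "right_biadjoint_U TYPE('od \<times> 'md) kp L
     (Hp kp L :: (('p, 'f, 'a, 'o, 'm) catpfun, ('p, 'f, 'a, 'o, 'm, 'o, 'm) trf, ('p, 'f, 'a, 'o, 'm, 'o, 'm) mdf, _, _, _) pfun)
     (canon kp L) (\<lambda>F. id_mdf L (comp_trf L F (canon kp L (TDom F))))"
proof -
  have s: "P0 (Hp kp L) = codext kp L" "P1 (Hp kp L) = H1 kp L" "P2 (Hp kp L) = H2 kp L" "PC (Hp kp L) = HC kp L" "PU (Hp kp L) = HU kp L"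
    by (simp_all add: Hp_def)
  let ?c = "canon kp L :: ('p, 'f, 'a, 'o, 'm) catpfun => _"
  have c: "colax kp L (?c C)" "TDom (?c C) = U0 kp L (codext kp L C)" "TCod (?c C) = C" if "pseudofunctor L (Lex kp) C" for C
    using codk.canon_colax(1-3)[OF codk[OF that]] by simp_all
  have Fc: "colax kp L (comp_trf L F (?c (TDom F)))" if "colax kp L F" for F :: "('p, 'f, 'a, 'o, 'm, 'o, 'm) trf"
    by (rule comp_trf_colax[OF two c(1) that]) (use colaxD(1)[OF that] c in simp_all)
  have idid: "vcomp_mdf L (id_mdf L F) (id_mdf L F) = id_mdf L F" if "colax kp L F" for F :: "('p, 'f, 'a, 'x, 'y, 'o, 'm) trf"
    using modification_vcomp_id(1)[OF two id_mdf_modification[OF two that]] by simp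
  have 1: "vcomp_mdf L (id_mdf L (comp_trf L (MCod m) (?c (TDom (MCod m))))) (lwh_mdf L (?c (TCod (MDom m))) (U2 kp L (H2 kp L m))) =
      vcomp_mdf L (rwh_mdf L m (?c (TDom (MDom m)))) (id_mdf L (comp_trf L (MDom m) (?c (TDom (MDom m)))))"
    if m: "modification kp L m" for m :: "('p, 'f, 'a, 'o, 'm, 'o, 'm) mdf"
  proof -
    note M = modificationD[OF m two]
    have r: "modification kp L (rwh_mdf L m (?c (TDom (MDom m))))"
      by (rule rwh_mdf_modification[OF two m]) (use colaxD(1)[OF M(1)] c in simp_all)
    show ?thesis unfolding H2(4)[OF m] M(3) using modification_vcomp_id[OF two r] by simp
  qed
  have 2: "vcomp_mdf L (id_mdf L (comp_trf L (comp_trf L G F) (?c (TDom F)))) (lwh_mdf L (?c (TCod G)) (U2 kp L (HC kp L G F))) =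
      vcomp_mdf L (lwh_mdf L G (id_mdf L (comp_trf L F (?c (TDom F))))) (rwh_mdf L (id_mdf L (comp_trf L G (?c (TDom G)))) (U1 kp L (H1 kp L F)))"
    if F: "colax kp L F" and G: "colax kp L G" and eq: "TDom G = TCod F" for F G :: "('p, 'f, 'a, 'o, 'm, 'o, 'm) trf"
  proof -
    note C = colaxD[OF F] and K = comp_trf_colax[OF two F G eq] and u = U1_colax[OF two H1(1)[OF F], unfolded H1(2,3)[OF F]]
    have a: "lwh_mdf L G (id_mdf L (comp_trf L F (?c (TDom F)))) = id_mdf L (comp_trf L G (comp_trf L F (?c (TDom F))))"
      by (rule lwh_id_mdf(1)[OF two Fc[OF F] G]) (simp add: eq)
    have b: "rwh_mdf L (id_mdf L (comp_trf L G (?c (TDom G)))) (U1 kp L (H1 kp L F)) = id_mdf L (comp_trf L (comp_trf L G (?c (TDom G))) (U1 kp L (H1 kp L F)))"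
      by (rule lwh_id_mdf(2)[OF two u(1) Fc[OF G]]) (simp add: eq u c C)
    have d: "comp_trf L (comp_trf L G (?c (TCod F))) (U1 kp L (H1 kp L F)) = comp_trf L G (comp_trf L (?c (TCod F)) (U1 kp L (H1 kp L F)))"
      by (rule comp_trf_assoc[OF two u(1) c(1) G]) (simp_all add: eq u c C)
    have e: "comp_trf L (comp_trf L G F) (?c (TDom F)) = comp_trf L G (comp_trf L F (?c (TDom F)))"
      by (rule comp_trf_assoc[OF two c(1) F G]) (simp_all add: eq c C)
    have K': "colax kp L (comp_trf L G (comp_trf L F (?c (TDom F))))" by (rule comp_trf_colax[OF two Fc[OF F] G]) (simp add: eq)
    show ?thesis unfolding HC(4)[OF F G eq] a b unfolding eq d H1(4)[OF F] e by (rule refl)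
  qed
  have 3: "vcomp_mdf L (id_mdf L (comp_trf L (id_trf L C) (?c C))) (lwh_mdf L (?c C) (U2 kp L (HU kp L C))) = id_mdf L (?c C)"
    if C: "pseudofunctor L (Lex kp) C" for C :: "('p, 'f, 'a, 'o, 'm) catpfun"
    unfolding HU(4)[OF C] comp_trf_id(2)[OF two c(1)[OF C] c(3)[OF C]] by (rule idid[OF c(1)[OF C]])
  have 4: "equivalence (transpose_U kp L (?c C) D (codext kp L C) C)" if "pseudofunctor L (Lex kp) C" "adj_pfun kp L D"
    for C and D :: "('p, 'f, 'a, 'od, 'md) catpfun"
    by (rule codk.canon_equivalence[OF codk[OF that(1)] that(2)])
  let ?X = "\<lambda>F. colax_hom kp L (U0 kp L (codext kp L (TDom F))) (TCod F)"
  let ?s = "\<lambda>F. comp_trf L (?c (TCod F)) (U1 kp L (H1 kp L F))" and ?t = "\<lambda>F. comp_trf L F (?c (TDom F))"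
  have 5: "id_mdf L (?t F) \<in> hom (?X F) (?s F) (?t F)"
    "\<exists>n \<in> hom (?X F) (?t F) (?s F). n \<cdot>[?X F] id_mdf L (?t F) = Idn (?X F) (?s F) \<and> id_mdf L (?t F) \<cdot>[?X F] n = Idn (?X F) (?t F)"
    if F: "colax kp L F" for F
  proof -
    have h: "id_mdf L (?t F) \<in> hom (?X F) (?t F) (?t F)"
      using id_mdf_modification[OF two Fc[OF F]] c[OF colaxD(1)[OF F]] by simp
    then show "id_mdf L (?t F) \<in> hom (?X F) (?s F) (?t F)" unfolding H1(4)[OF F] .
    show "\<exists>n \<in> hom (?X F) (?t F) (?s F). n \<cdot>[?X F] id_mdf L (?t F) = Idn (?X F) (?s F) \<and> id_mdf L (?t F) \<cdot>[?X F] n = Idn (?X F) (?t F)"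
      unfolding H1(4)[OF F] by (rule bexI[OF _ h]) (simp add: idid[OF Fc[OF F]])
  qed
  show ?thesis
    unfolding right_biadjoint_U_def Let_def s comp_trf_simps(1) id_trf_simps(1)
    by (intro conjI ballI impI;
        (rule U_pseudofunctor[OF two] H_pseudofunctor | (rule 1 2 3 4 5; simp; fail) | (simp add: c; fail)))
qed

end

theorem theoremA2:
  fixes \<kappa> :: "'k rel" and L :: "('p, 'f, 'a) twocat"
  assumes "Card_order \<kappa>" and "cinfinite \<kappa>" and "regularCard \<kappa>"
    and "two_category L" and "small_twocat \<kappa> L"
  shows
    "(\<forall>C :: ('p, 'f, 'a, 'o, 'm) catpfun \<in> Cell0 (Ps_colax \<kappa> L).
        codext \<kappa> L C \<in> Cell0 (Ps_adj \<kappa> L) \<and>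
        canon \<kappa> L C \<in> Ob (colax_hom \<kappa> L (U0 \<kappa> L (codext \<kappa> L C)) C) \<and>
        (\<forall>D :: ('p, 'f, 'a, 'od, 'md) catpfun \<in> Cell0 (Ps_adj \<kappa> L).
           equivalence (transpose_U \<kappa> L (canon \<kappa> L C) D (codext \<kappa> L C) C))) \<and>
     (\<exists>H e1. (\<forall>C :: ('p, 'f, 'a, 'o, 'm) catpfun \<in> Cell0 (Ps_colax \<kappa> L). P0 H C = codext \<kappa> L C) \<and>
        right_biadjoint_U TYPE('od \<times> 'md) \<kappa> L H (canon \<kappa> L) e1)"
proof -
  interpret biadj \<kappa> L by unfold_locales (use assms in simp_all)
  note c = codk
  have "\<forall>C :: ('p, 'f, 'a, 'o, 'm) catpfun \<in> Cell0 (Ps_colax \<kappa> L).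
        codext \<kappa> L C \<in> Cell0 (Ps_adj \<kappa> L) \<and>
        canon \<kappa> L C \<in> Ob (colax_hom \<kappa> L (U0 \<kappa> L (codext \<kappa> L C)) C) \<and>
        (\<forall>D :: ('p, 'f, 'a, 'od, 'md) catpfun \<in> Cell0 (Ps_adj \<kappa> L).
           equivalence (transpose_U \<kappa> L (canon \<kappa> L C) D (codext \<kappa> L C) C))"
    by (simp add: codk.codext_adj_pfun[OF c] codk.canon_colax(1-3)[OF c] codk.canon_equivalence[OF c])
  moreover have "\<forall>C. P0 (Hp \<kappa> L) C = codext \<kappa> L C" by (simp add: Hp_def)
  ultimately show ?thesis using H_right_biadjoint by blast
qed

end
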